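(* The functor $\mathfrak{C}: Set_{\Delta}\to Cat_{\Delta}$ is naturally isomorphic to the composition of functors $$Set_{\Delta}\xrightarrow{\ \mathfrak{C}_{\square_c}\ }Cat_{\square_c}\xrightarrow{\ \mathfrak{T}\ }Cat_{\Delta}.$$
   Context: $Set_\Delta$ is the category of simplicial sets and $Cat_\Delta$ the category of small categories enriched over simplicial sets (cartesian product). Category $\square_c$: let $\mathbf 1$ be the category with objects $0,1$ and one non-identity morphism $0\to1$; $\mathbf 1^n$ is its $n$-fold product ($\mathbf 1^0$ is the terminal category). $\square_c$ is the subcategory of small categories with objects $\mathbf 1^n$, $n\ge0$, and morphisms generated by the functors: co-faces $\delta^\epsilon_{j,n}:\mathbf 1^n\to\mathbf 1^{n+1}$ ($1\le j\le n+1$, $\epsilon\in\{0,1\}$) inserting $\epsilon$ in position $j$; co-degeneracies $\varepsilon_{j,n}:\mathbf 1^n\to\mathbf 1^{n-1}$ ($1\le j\le n$) deleting the $j$-th coordinate; co-connections $\gamma_{j,n}:\mathbf 1^n\to\mathbf 1^{n-1}$ ($1\le j\le n-1$) replacing $(s_j,s_{j+1})$ by $\max(s_j,s_{j+1})$. $Set_{\square_c}$ is the category of presheaves of sets on $\square_c$ (cubical sets with connections), $\square_c^n$ the presheaf represented by $\mathbf 1^n$, with (non-symmetric) monoidal structure $K\otimes K'=\mathrm{colim}_{\square^n_c\to K,\,\square^m_c\to K'}\square_c^{n+m}$. $Cat_{\square_c}$ is the category of small categories enriched over $(Set_{\square_c},\otimes)$. Necklaces: a necklace is a simplicial set $T=\Delta^{n_1}\vee\dots\vee\Delta^{n_k}$,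 where the final vertex of each bead $\Delta^{n_i}$ is glued to the initial vertex of $\Delta^{n_{i+1}}$; it is in preferred form if $k=0$ (so $T=\Delta^0$) or all $n_i\ge1$. $V_T$ is its set of vertices, totally ordered by $a\preceq b$ if there is a directed path from $a$ to $b$; $\alpha_T,\omega_T$ are the first and last vertices; $J_T\subseteq V_T$ is the set of joints, i.e. initial or final vertices of beads (for $T=\Delta^0$ the unique vertex). $Nec$ is the category of necklaces in preferred form and simplicial maps preserving first and last vertices. $P(T)$ is the poset, regarded as a category, of subsets $X$ with $J_T\subseteq X\subseteq V_T$, and $P(f)(X)=f(X)$. Writing $V_T-J_T=\{y_1\prec\dots\prec y_N\}$, let $\phi_T:P(T)\cong\mathbf 1^N$ be the isomorphism whose $i$-th coordinate at $X$ is $1$ if $y_i\in X$ and $0$ otherwise; set $P_{\mathbf 1}(T)=\mathbf 1^N$ and $P_{\mathbf 1}(f)=\phi_{T'}\circ P(f)\circ\phi_T^{-1}$ for $f:T\to T'$. This takes values in $\square_c$, and $C_{\square_c}:Nec\to Set_{\square_c}$ is $P_{\mathbf 1}$ followed by the Yoneda embedding; thus $C_{\square_c}(T)=\square_c^{|V_T-J_T|}$. Functor $\mathfrak C_{\square_c}$: the objects of $\mathfrak C_{\square_c}(S)$ are the vertices of $S$, and $\mathfrak C_{\square_c}(S)(x,y)=\mathrm{colim}_{T\to S\in(Nec\downarrow S)_{x,y}}C_{\square_c}(T)$, where $(Nec\downarrow S)_{x,y}$ is the category of maps $f:T\to S$ with $T\in Nec$, $f(\alpha_T)=x$, $f(\omega_T)=y$.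 Composition $\mathfrak C_{\square_c}(S)(x,y)\otimes\mathfrak C_{\square_c}(S)(y,z)\to\mathfrak C_{\square_c}(S)(x,z)$ is induced on colimits by the identifications $C_{\square_c}(T)\otimes C_{\square_c}(U)\cong C_{\square_c}(T\vee U)$. Functor $\mathfrak T$: the triangulation $|\cdot|:Set_{\square_c}\to Set_\Delta$ is $|K|=\mathrm{colim}_{\square_c^n\to K}N(\mathbf 1^n)$, with $N$ the nerve, $N(\mathbf 1^n)\cong(\Delta^1)^{\times n}$; there is a natural isomorphism $|K\otimes K'|\cong|K|\times|K'|$. $\mathfrak T(\mathcal K)$ has the objects of $\mathcal K$, mapping spaces $|\mathcal K(x,y)|$, and the induced composition. Functor $\mathfrak C$ (Lurie): for $0\le i\le j$ let $P_{i,j}$ be the poset of subsets of $\{i,\dots,j\}$ containing $i$ and $j$. $\mathfrak C(\Delta^n)$ has objects $0,\dots,n$, with $\mathfrak C(\Delta^n)(i,j)=N(P_{i,j})$ if $i\le j$ and $\emptyset$ otherwise, composition induced by union of sets $P_{j,l}\times P_{i,j}\to P_{i,l}$; this is functorial in $[n]$, and $\mathfrak C(S)=\mathrm{colim}_{\Delta^n\to S}\mathfrak C(\Delta^n)$ in $Cat_\Delta$. *)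

theory Defs
  imports Main "HOL-Library.FuncSet"
begin

section \<open>Categories and functors\<close>

record ('o, 'm) cat =
  Ob :: "'o set"
  Ar :: "'m set"
  Dom :: "'m \<Rightarrow> 'o"
  Cod :: "'m \<Rightarrow> 'o"
  Idn :: "'o \<Rightarrow> 'm"
  Comp :: "'m \<Rightarrow> 'm \<Rightarrow> 'm"  \<comment> \<open>\<open>Comp C g f\<close> is \<open>g\<close> after \<open>f\<close>\<close>

definition is_category :: "('o, 'm) cat \<Rightarrow> bool" where
  "is_category C \<longleftrightarrow>
     (\<forall>f\<in>Ar C. Dom C f \<in> Ob C \<and> Cod C f \<in> Ob C) \<and>
     (\<forall>a\<in>Ob C. Idn C a \<in> Ar C \<and> Dom C (Idn C a) = a \<and> Cod C (Idn C a) = a) \<and>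
     (\<forall>f\<in>Ar C. \<forall>g\<in>Ar C. Dom C g = Cod C f \<longrightarrow>
        Comp C g f \<in> Ar C \<and> Dom C (Comp C g f) = Dom C f \<and> Cod C (Comp C g f) = Cod C g) \<and>
     (\<forall>f\<in>Ar C. Comp C f (Idn C (Dom C f)) = f \<and> Comp C (Idn C (Cod C f)) f = f) \<and>
     (\<forall>f\<in>Ar C. \<forall>g\<in>Ar C. \<forall>h\<in>Ar C. Dom C g = Cod C f \<longrightarrow> Dom C h = Cod C g \<longrightarrow>
        Comp C h (Comp C g f) = Comp C (Comp C h g) f)"

record ('o, 'm, 'p, 'q) func =
  fob :: "'o \<Rightarrow> 'p"
  far :: "'m \<Rightarrow> 'q"

definition is_functor :: "('o, 'm) cat \<Rightarrow> ('p, 'q) cat \<Rightarrow> ('o, 'm, 'p, 'q) func \<Rightarrow> bool" where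
  "is_functor C D F \<longleftrightarrow> is_category C \<and> is_category D \<and>
     (\<forall>a\<in>Ob C. fob F a \<in> Ob D \<and> far F (Idn C a) = Idn D (fob F a)) \<and>
     (\<forall>f\<in>Ar C. far F f \<in> Ar D \<and> Dom D (far F f) = fob F (Dom C f)
        \<and> Cod D (far F f) = fob F (Cod C f)) \<and>
     (\<forall>f\<in>Ar C. \<forall>g\<in>Ar C. Dom C g = Cod C f \<longrightarrow>
        far F (Comp C g f) = Comp D (far F g) (far F f))"

definition fcompose ::
  "('p, 'q, 'r, 's) func \<Rightarrow> ('o, 'm, 'p, 'q) func \<Rightarrow> ('o, 'm, 'r, 's) func" (infixr "\<circ>\<^sub>F" 55)
where
  "G \<circ>\<^sub>F F = \<lparr>fob = fob G \<circ> fob F, far = far G \<circ> far F\<rparr>"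

definition prod_cat :: "('o, 'm) cat \<Rightarrow> ('p, 'q) cat \<Rightarrow> ('o \<times> 'p, 'm \<times> 'q) cat" where
  "prod_cat C D =
     \<lparr>Ob = Ob C \<times> Ob D, Ar = Ar C \<times> Ar D,
      Dom = map_prod (Dom C) (Dom D), Cod = map_prod (Cod C) (Cod D),
      Idn = map_prod (Idn C) (Idn D),
      Comp = (\<lambda>(g, g') (f, f'). (Comp C g f, Comp D g' f'))\<rparr>"


section \<open>Colimits of sets\<close>

definition eqcl :: "('a \<times> 'a) set \<Rightarrow> ('a \<times> 'a) set" where
  "eqcl R = (R \<union> R\<inverse>)\<^sup>*"

text \<open>The colimit of \<open>F : J \<rightarrow> Set\<close>, where \<open>F\<close> has values \<open>Fo j\<close> and transition maps \<open>Fm u\<close>,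
  is the quotient of the disjoint union of the \<open>Fo j\<close> by the equivalence relation generated
  by \<open>(j, x) \<sim> (j', Fm u x)\<close> for \<open>u : j \<rightarrow> j'\<close>.\<close>

definition colim_rel ::
  "('j, 'k) cat \<Rightarrow> ('j \<Rightarrow> 'a set) \<Rightarrow> ('k \<Rightarrow> 'a \<Rightarrow> 'a) \<Rightarrow> (('j \<times> 'a) \<times> ('j \<times> 'a)) set"
where
  "colim_rel J Fo Fm = eqcl {((Dom J u, x), (Cod J u, Fm u x)) | u x. u \<in> Ar J \<and> x \<in> Fo (Dom J u)}"

definition colim_set ::
  "('j, 'k) cat \<Rightarrow> ('j \<Rightarrow> 'a set) \<Rightarrow> ('k \<Rightarrow> 'a \<Rightarrow> 'a) \<Rightarrow> ('j \<times> 'a) set set"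
where
  "colim_set J Fo Fm = (SIGMA j : Ob J. Fo j) // colim_rel J Fo Fm"


section \<open>Presheaves\<close>

text \<open>The base categories used below have the natural numbers as objects, so presheaves are
  indexed by \<open>nat\<close>.  A map of presheaves is a family of functions that are \<open>undefined\<close> outside
  the relevant sets, so that equality of maps is equality in HOL.\<close>

record ('m, 'a) psh =
  cells :: "nat \<Rightarrow> 'a set"
  act :: "'m \<Rightarrow> 'a \<Rightarrow> 'a"

definition is_presheaf :: "(nat, 'm) cat \<Rightarrow> ('m, 'a) psh \<Rightarrow> bool" where
  "is_presheaf C P \<longleftrightarrow>
     (\<forall>u\<in>Ar C. \<forall>x\<in>cells P (Cod C u). act P u x \<in> cells P (Dom C u)) \<and>
     (\<forall>n. \<forall>x\<in>cells P n. act P (Idn C n) x = x) \<and>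
     (\<forall>u\<in>Ar C. \<forall>v\<in>Ar C. Dom C v = Cod C u \<longrightarrow>
        (\<forall>x\<in>cells P (Cod C v). act P (Comp C v u) x = act P u (act P v x)))"

definition psh_hom ::
  "(nat, 'm) cat \<Rightarrow> ('m, 'a) psh \<Rightarrow> ('m, 'b) psh \<Rightarrow> (nat \<Rightarrow> 'a \<Rightarrow> 'b) set"
where
  "psh_hom C P Q = {t. (\<forall>n. t n \<in> cells P n \<rightarrow>\<^sub>E cells Q n) \<and>
     (\<forall>u\<in>Ar C. \<forall>x\<in>cells P (Cod C u). t (Dom C u) (act P u x) = act Q u (t (Cod C u) x))}"

definition psh_id :: "('m, 'a) psh \<Rightarrow> nat \<Rightarrow> 'a \<Rightarrow> 'a" where
  "psh_id P = (\<lambda>n. \<lambda>x\<in>cells P n. x)"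

definition psh_comp ::
  "('m, 'a) psh \<Rightarrow> (nat \<Rightarrow> 'b \<Rightarrow> 'c) \<Rightarrow> (nat \<Rightarrow> 'a \<Rightarrow> 'b) \<Rightarrow> nat \<Rightarrow> 'a \<Rightarrow> 'c"
where
  "psh_comp P t s = (\<lambda>n. \<lambda>x\<in>cells P n. t n (s n x))"

text \<open>The category of presheaves on \<open>C\<close> with values in subsets of the type \<open>'a\<close>.\<close>

type_synonym ('m, 'a) psh_arr = "('m, 'a) psh \<times> (nat \<Rightarrow> 'a \<Rightarrow> 'a) \<times> ('m, 'a) psh"

definition psh_cat :: "(nat, 'm) cat \<Rightarrow> (('m, 'a) psh, ('m, 'a) psh_arr) cat" where
  "psh_cat C =
     \<lparr>Ob = {P. is_presheaf C P},
      Ar = {(P, t, Q). is_presheaf C P \<and> is_presheaf C Q \<and> t \<in> psh_hom C P Q},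
      Dom = (\<lambda>(P, t, Q). P), Cod = (\<lambda>(P, t, Q). Q),
      Idn = (\<lambda>P. (P, psh_id P, P)),
      Comp = (\<lambda>(_, t, R) (P, s, _). (P, psh_comp P t s, R))\<rparr>"

definition yoneda :: "(nat, 'm) cat \<Rightarrow> (nat, 'm, ('m, 'm) psh, nat \<Rightarrow> 'm \<Rightarrow> 'm) func" where
  "yoneda C =
     \<lparr>fob = (\<lambda>n. \<lparr>cells = (\<lambda>d. {u \<in> Ar C. Dom C u = d \<and> Cod C u = n}),
                   act = (\<lambda>v u. Comp C u v)\<rparr>),
      far = (\<lambda>w d. \<lambda>u\<in>{u \<in> Ar C. Dom C u = d \<and> Cod C u = Dom C w}. Comp C w u)\<rparr>"

text \<open>The category of elements: its objects are the pairs \<open>(n, x)\<close> with \<open>x \<in> P(n)\<close>, which by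
  the Yoneda lemma are the maps from representable presheaves to \<open>P\<close>.\<close>

definition elements ::
  "(nat, 'm) cat \<Rightarrow> ('m, 'a) psh \<Rightarrow> (nat \<times> 'a, (nat \<times> 'a) \<times> 'm \<times> (nat \<times> 'a)) cat"
where
  "elements C P =
     \<lparr>Ob = {(n, x). x \<in> cells P n},
      Ar = {((m, x), u, (n, y)). u \<in> Ar C \<and> Dom C u = m \<and> Cod C u = n
              \<and> y \<in> cells P n \<and> x = act P u y},
      Dom = (\<lambda>(a, u, b). a), Cod = (\<lambda>(a, u, b). b),
      Idn = (\<lambda>(n, x). ((n, x), Idn C n, (n, x))),
      Comp = (\<lambda>(_, v, c) (a, u, _). (a, Comp C v u, c))\<rparr>"

definition elements_proj :: "(nat \<times> 'a, (nat \<times> 'a) \<times> 'm \<times> (nat \<times> 'a), nat, 'm) func" where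
  "elements_proj = \<lparr>fob = (\<lambda>(n, x). n), far = (\<lambda>(a, u, b). u)\<rparr>"

text \<open>Colimits of presheaves, computed objectwise.  Whenever a map out of a quotient is given
  by a formula on representatives, we write it as the saturation of the set of all
  values of the formula; no representatives have to be chosen.\<close>

definition psh_colim_rel ::
  "('j, 'k) cat \<Rightarrow> ('j, 'k, ('m, 'a) psh, nat \<Rightarrow> 'a \<Rightarrow> 'a) func \<Rightarrow> nat
     \<Rightarrow> (('j \<times> 'a) \<times> ('j \<times> 'a)) set"
where
  "psh_colim_rel J F n = colim_rel J (\<lambda>j. cells (fob F j) n) (\<lambda>k. far F k n)"

definition psh_colim ::
  "(nat, 'm) cat \<Rightarrow> ('j, 'k) cat \<Rightarrow> ('j, 'k, ('m, 'a) psh, nat \<Rightarrow> 'a \<Rightarrow> 'a) func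
     \<Rightarrow> ('m, ('j \<times> 'a) set) psh"
where
  "psh_colim C J F =
     \<lparr>cells = (\<lambda>n. colim_set J (\<lambda>j. cells (fob F j) n) (\<lambda>k. far F k n)),
      act = (\<lambda>u X. psh_colim_rel J F (Dom C u) `` ((\<lambda>(j, x). (j, act (fob F j) u x)) ` X))\<rparr>"


section \<open>Simplicial sets\<close>

text \<open>A monotone map \<open>[m] \<rightarrow> [n]\<close> is a triple \<open>(m, n, f)\<close> with \<open>f\<close> extensional on \<open>{..m}\<close>.\<close>

type_synonym simp_arr = "nat \<times> nat \<times> (nat \<Rightarrow> nat)"
type_synonym 'a sset = "(simp_arr, 'a) psh"

definition simplex_cat :: "(nat, simp_arr) cat" where
  "simplex_cat =
     \<lparr>Ob = UNIV,
      Ar = {(m, n, f). f \<in> {..m} \<rightarrow>\<^sub>E {..n} \<and> mono_on {..m} f},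
      Dom = (\<lambda>(m, n, f). m), Cod = (\<lambda>(m, n, f). n),
      Idn = (\<lambda>n. (n, n, \<lambda>i\<in>{..n}. i)),
      Comp = (\<lambda>(_, p, g) (m, _, f). (m, p, \<lambda>i\<in>{..m}. g (f i)))\<rparr>"

abbreviation SSet :: "('a sset, (simp_arr, 'a) psh_arr) cat" where
  "SSet \<equiv> psh_cat simplex_cat"

text \<open>The nerve of the poset \<open>(A, le)\<close>.\<close>

definition nerve :: "'a set \<Rightarrow> ('a \<Rightarrow> 'a \<Rightarrow> bool) \<Rightarrow> (nat \<Rightarrow> 'a) sset" where
  "nerve A le =
     \<lparr>cells = (\<lambda>k. {c \<in> {..k} \<rightarrow>\<^sub>E A. \<forall>i j. i \<le> j \<and> j \<le> k \<longrightarrow> le (c i) (c j)}),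
      act = (\<lambda>(m, n, f) c. \<lambda>i\<in>{..m}. c (f i))\<rparr>"

definition nerve_map ::
  "'a set \<Rightarrow> ('a \<Rightarrow> 'a \<Rightarrow> bool) \<Rightarrow> ('a \<Rightarrow> 'b) \<Rightarrow> nat \<Rightarrow> (nat \<Rightarrow> 'a) \<Rightarrow> (nat \<Rightarrow> 'b)"
where
  "nerve_map A le f = (\<lambda>k. \<lambda>c\<in>cells (nerve A le) k. \<lambda>i\<in>{..k}. f (c i))"

definition std_simplex :: "nat \<Rightarrow> (nat \<Rightarrow> nat) sset" where
  "std_simplex n = nerve {..n} (\<le>)"

definition prod_psh :: "('m, 'a) psh \<Rightarrow> ('m, 'b) psh \<Rightarrow> ('m, 'a \<times> 'b) psh" where
  "prod_psh P Q = \<lparr>cells = (\<lambda>n. cells P n \<times> cells Q n), act = (\<lambda>u. map_prod (act P u) (act Q u))\<rparr>"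


section \<open>Cubical sets with connections\<close>

definition cube :: "nat \<Rightarrow> bool list set" where
  "cube n = {s. length s = n}"

abbreviation cube_le :: "bool list \<Rightarrow> bool list \<Rightarrow> bool" where
  "cube_le \<equiv> list_all2 (\<le>)"

text \<open>A functor \<open>\<one>\<^sup>m \<rightarrow> \<one>\<^sup>n\<close> is determined by its values on objects; it is a triple
  \<open>(m, n, f)\<close> with \<open>f\<close> extensional on \<open>cube m\<close>.  Positions \<open>j\<close> are counted from 1.\<close>

type_synonym box_arr = "nat \<times> nat \<times> (bool list \<Rightarrow> bool list)"
type_synonym 'a cset = "(box_arr, 'a) psh"

definition box_id :: "nat \<Rightarrow> box_arr" where
  "box_id n = (n, n, \<lambda>s\<in>cube n. s)"

definition box_comp :: "box_arr \<Rightarrow> box_arr \<Rightarrow> box_arr" where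
  "box_comp = (\<lambda>(_, p, g) (m, _, f). (m, p, \<lambda>s\<in>cube m. g (f s)))"

definition coface :: "bool \<Rightarrow> nat \<Rightarrow> nat \<Rightarrow> box_arr" where
  "coface e j n = (n, n + 1, \<lambda>s\<in>cube n. take (j - 1) s @ [e] @ drop (j - 1) s)"

definition codegeneracy :: "nat \<Rightarrow> nat \<Rightarrow> box_arr" where
  "codegeneracy j n = (n, n - 1, \<lambda>s\<in>cube n. take (j - 1) s @ drop j s)"

definition coconnection :: "nat \<Rightarrow> nat \<Rightarrow> box_arr" where
  "coconnection j n =
     (n, n - 1, \<lambda>s\<in>cube n. take (j - 1) s @ [max (s ! (j - 1)) (s ! j)] @ drop (j + 1) s)"

inductive_set box_arrows :: "box_arr set" where
  "box_id n \<in> box_arrows"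
| "1 \<le> j \<Longrightarrow> j \<le> n + 1 \<Longrightarrow> coface e j n \<in> box_arrows"
| "1 \<le> j \<Longrightarrow> j \<le> n \<Longrightarrow> codegeneracy j n \<in> box_arrows"
| "1 \<le> j \<Longrightarrow> j \<le> n - 1 \<Longrightarrow> coconnection j n \<in> box_arrows"
| "u \<in> box_arrows \<Longrightarrow> v \<in> box_arrows \<Longrightarrow> fst v = fst (snd u) \<Longrightarrow> box_comp v u \<in> box_arrows"

definition box_cat :: "(nat, box_arr) cat" where
  "box_cat =
     \<lparr>Ob = UNIV, Ar = box_arrows,
      Dom = (\<lambda>(m, n, f). m), Cod = (\<lambda>(m, n, f). n), Idn = box_id, Comp = box_comp\<rparr>"

text \<open>The monoidal product \<open>K \<otimes> L\<close> is the colimit of the representables of dimension \<open>n + m\<close>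
  over all pairs of an \<open>n\<close>-cube of \<open>K\<close> and an \<open>m\<close>-cube of \<open>L\<close>; on arrows of the indexing category
  the diagram is given by the product of functors \<open>\<one>\<^sup>n \<times> \<one>\<^sup>m = \<one>\<^sup>n\<^sup>+\<^sup>m\<close>.\<close>

definition box_plus :: "box_arr \<Rightarrow> box_arr \<Rightarrow> box_arr" where
  "box_plus = (\<lambda>(m, n, f) (m', n', f').
     (m + m', n + n', \<lambda>s\<in>cube (m + m'). f (take m s) @ f' (drop m s)))"

definition box_plus_functor :: "(nat \<times> nat, box_arr \<times> box_arr, nat, box_arr) func" where
  "box_plus_functor = \<lparr>fob = (\<lambda>(n, m). n + m), far = (\<lambda>(u, v). box_plus u v)\<rparr>"

definition prod_functor ::
  "('o, 'm, 'p, 'q) func \<Rightarrow> ('o', 'm', 'p', 'q') func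
     \<Rightarrow> ('o \<times> 'o', 'm \<times> 'm', 'p \<times> 'p', 'q \<times> 'q') func"
where
  "prod_functor F G = \<lparr>fob = map_prod (fob F) (fob G), far = map_prod (far F) (far G)\<rparr>"

type_synonym 'a element = "nat \<times> 'a"
type_synonym 'a element_arr = "'a element \<times> box_arr \<times> 'a element"
type_synonym ('a, 'b) tensor_cell = "(('a element \<times> 'b element) \<times> box_arr) set"

definition tensor_index ::
  "'a cset \<Rightarrow> 'b cset \<Rightarrow> ('a element \<times> 'b element, 'a element_arr \<times> 'b element_arr) cat"
where
  "tensor_index K L = prod_cat (elements box_cat K) (elements box_cat L)"

definition tensor_diagram ::
  "('a element \<times> 'b element, 'a element_arr \<times> 'b element_arr,
    box_arr cset, nat \<Rightarrow> box_arr \<Rightarrow> box_arr) func"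
where
  "tensor_diagram = yoneda box_cat \<circ>\<^sub>F box_plus_functor \<circ>\<^sub>F prod_functor elements_proj elements_proj"

definition tensor :: "'a cset \<Rightarrow> 'b cset \<Rightarrow> ('a, 'b) tensor_cell cset" where
  "tensor K L = psh_colim box_cat (tensor_index K L) tensor_diagram"

definition tensor_rel ::
  "'a cset \<Rightarrow> 'b cset \<Rightarrow> nat
     \<Rightarrow> ((('a element \<times> 'b element) \<times> box_arr) \<times> (('a element \<times> 'b element) \<times> box_arr)) set"
where
  "tensor_rel K L = psh_colim_rel (tensor_index K L) tensor_diagram"

definition tensor_map ::
  "'c cset \<Rightarrow> 'd cset \<Rightarrow> (nat \<Rightarrow> 'a \<Rightarrow> 'c) \<Rightarrow> (nat \<Rightarrow> 'b \<Rightarrow> 'd) \<Rightarrow> nat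
     \<Rightarrow> ('a, 'b) tensor_cell \<Rightarrow> ('c, 'd) tensor_cell"
where
  "tensor_map K' L' s t k X =
     tensor_rel K' L' k `` ((\<lambda>(((n, x), (m, y)), w). (((n, s n x), (m, t m y)), w)) ` X)"

text \<open>The \<open>(n+m)\<close>-cube \<open>x \<otimes> y\<close> of \<open>K \<otimes> L\<close> for an \<open>n\<close>-cube \<open>x\<close> and an \<open>m\<close>-cube \<open>y\<close>.\<close>

definition tensor_cube ::
  "'a cset \<Rightarrow> 'b cset \<Rightarrow> nat \<Rightarrow> 'a \<Rightarrow> nat \<Rightarrow> 'b \<Rightarrow> ('a, 'b) tensor_cell"
where
  "tensor_cube K L n x m y = tensor_rel K L (n + m) `` {(((n, x), (m, y)), box_id (n + m))}"


section \<open>Enriched categories\<close>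

text \<open>Common data of categories enriched in simplicial or cubical sets.  Composition
  \<open>Cmp A x y z\<close> is a map \<open>Hom(x,y) \<otimes> Hom(y,z) \<rightarrow> Hom(x,z)\<close>, in this order, whose domain has cells
  of type \<open>'t\<close>; the map from the unit object (which is the presheaf represented by \<open>0\<close>) to
  \<open>Hom(x,x)\<close> is given as a 0-cell.\<close>

record ('o, 'm, 'a, 't) ecat =
  Obj :: "'o set"
  Hom :: "'o \<Rightarrow> 'o \<Rightarrow> ('m, 'a) psh"
  Unit :: "'o \<Rightarrow> 'a"
  Cmp :: "'o \<Rightarrow> 'o \<Rightarrow> 'o \<Rightarrow> nat \<Rightarrow> 't \<Rightarrow> 'a"

record ('A, 'o, 'a, 'p, 'b, 'B) efun =
  Src :: 'A
  Tgt :: 'B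
  Omap :: "'o \<Rightarrow> 'p"
  Hmap :: "'o \<Rightarrow> 'o \<Rightarrow> nat \<Rightarrow> 'a \<Rightarrow> 'b"

definition efun_id ::
  "('o, 'm, 'a, 't) ecat \<Rightarrow> (('o, 'm, 'a, 't) ecat, 'o, 'a, 'o, 'a, ('o, 'm, 'a, 't) ecat) efun"
where
  "efun_id A = \<lparr>Src = A, Tgt = A, Omap = (\<lambda>x\<in>Obj A. x),
     Hmap = (\<lambda>x\<in>Obj A. \<lambda>y\<in>Obj A. psh_id (Hom A x y))\<rparr>"

definition efun_comp ::
  "('B', 'p, 'b, 'q, 'c, 'C) efun \<Rightarrow> (('o, 'm, 'a, 't) ecat, 'o, 'a, 'p, 'b, 'B) efun
     \<Rightarrow> (('o, 'm, 'a, 't) ecat, 'o, 'a, 'q, 'c, 'C) efun"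
where
  "efun_comp G F = \<lparr>Src = Src F, Tgt = Tgt G,
     Omap = (\<lambda>x\<in>Obj (Src F). Omap G (Omap F x)),
     Hmap = (\<lambda>x\<in>Obj (Src F). \<lambda>y\<in>Obj (Src F).
       psh_comp (Hom (Src F) x y) (Hmap G (Omap F x) (Omap F y)) (Hmap F x y))\<rparr>"

text \<open>Simplicial categories: enrichment in simplicial sets with the cartesian product.\<close>

type_synonym ('o, 'a) scat = "('o, simp_arr, 'a, 'a \<times> 'a) ecat"
type_synonym ('o, 'a, 'p, 'b) sfun = "(('o, 'a) scat, 'o, 'a, 'p, 'b, ('p, 'b) scat) efun"

text \<open>The \<open>n\<close>-simplex of \<open>Hom(x,x)\<close> obtained from the identity by degeneracies.\<close>

definition unit_simplex :: "('o, 'a) scat \<Rightarrow> 'o \<Rightarrow> nat \<Rightarrow> 'a" where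
  "unit_simplex A x n = act (Hom A x x) (n, 0, \<lambda>i\<in>{..n}. 0) (Unit A x)"

definition is_scat :: "('o, 'a) scat \<Rightarrow> bool" where
  "is_scat A \<longleftrightarrow>
     (\<forall>x\<in>Obj A. \<forall>y\<in>Obj A. is_presheaf simplex_cat (Hom A x y)) \<and>
     (\<forall>x\<in>Obj A. Unit A x \<in> cells (Hom A x x) 0) \<and>
     (\<forall>x\<in>Obj A. \<forall>y\<in>Obj A. \<forall>z\<in>Obj A.
        Cmp A x y z \<in> psh_hom simplex_cat (prod_psh (Hom A x y) (Hom A y z)) (Hom A x z)) \<and>
     (\<forall>x\<in>Obj A. \<forall>y\<in>Obj A. \<forall>n. \<forall>a\<in>cells (Hom A x y) n.
        Cmp A x x y n (unit_simplex A x n, a) = a \<and> Cmp A x y y n (a, unit_simplex A y n) = a) \<and>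
     (\<forall>w\<in>Obj A. \<forall>x\<in>Obj A. \<forall>y\<in>Obj A. \<forall>z\<in>Obj A. \<forall>n.
        \<forall>a\<in>cells (Hom A w x) n. \<forall>b\<in>cells (Hom A x y) n. \<forall>c\<in>cells (Hom A y z) n.
        Cmp A w y z n (Cmp A w x y n (a, b), c) = Cmp A w x z n (a, Cmp A x y z n (b, c)))"

definition is_sfun :: "('o, 'a, 'p, 'b) sfun \<Rightarrow> bool" where
  "is_sfun F \<longleftrightarrow> is_scat (Src F) \<and> is_scat (Tgt F) \<and>
     Omap F \<in> Obj (Src F) \<rightarrow>\<^sub>E Obj (Tgt F) \<and>
     Hmap F \<in> (\<Pi>\<^sub>E x\<in>Obj (Src F). \<Pi>\<^sub>E y\<in>Obj (Src F).
       psh_hom simplex_cat (Hom (Src F) x y) (Hom (Tgt F) (Omap F x) (Omap F y))) \<and>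
     (\<forall>x\<in>Obj (Src F). Hmap F x x 0 (Unit (Src F) x) = Unit (Tgt F) (Omap F x)) \<and>
     (\<forall>x\<in>Obj (Src F). \<forall>y\<in>Obj (Src F). \<forall>z\<in>Obj (Src F). \<forall>n.
        \<forall>a\<in>cells (Hom (Src F) x y) n. \<forall>b\<in>cells (Hom (Src F) y z) n.
        Hmap F x z n (Cmp (Src F) x y z n (a, b))
          = Cmp (Tgt F) (Omap F x) (Omap F y) (Omap F z) n (Hmap F x y n a, Hmap F y z n b))"

definition SCat :: "(('o, 'a) scat, ('o, 'a, 'o, 'a) sfun) cat" where
  "SCat = \<lparr>Ob = {A. is_scat A}, Ar = {F. is_sfun F}, Dom = Src, Cod = Tgt,
     Idn = efun_id, Comp = efun_comp\<rparr>"

text \<open>Categories enriched in cubical sets with connections.  A cube of \<open>K \<otimes> L\<close> is of the form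
  \<open>w\<^sup>*(a \<otimes> b)\<close>, and likewise for threefold products; so the associativity and unit diagrams
  are stated on the cubes \<open>a \<otimes> b \<otimes> c\<close>, \<open>1 \<otimes> a\<close> and \<open>a \<otimes> 1\<close>.\<close>

type_synonym ('o, 'a) ccat = "('o, box_arr, 'a, ('a, 'a) tensor_cell) ecat"
type_synonym ('o, 'a, 'p, 'b) cfun = "(('o, 'a) ccat, 'o, 'a, 'p, 'b, ('p, 'b) ccat) efun"

definition cube_cmp :: "('o, 'a) ccat \<Rightarrow> 'o \<Rightarrow> 'o \<Rightarrow> 'o \<Rightarrow> nat \<Rightarrow> 'a \<Rightarrow> nat \<Rightarrow> 'a \<Rightarrow> 'a" where
  "cube_cmp A x y z n a m b =
     Cmp A x y z (n + m) (tensor_cube (Hom A x y) (Hom A y z) n a m b)"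

definition is_ccat :: "('o, 'a) ccat \<Rightarrow> bool" where
  "is_ccat A \<longleftrightarrow>
     (\<forall>x\<in>Obj A. \<forall>y\<in>Obj A. is_presheaf box_cat (Hom A x y)) \<and>
     (\<forall>x\<in>Obj A. Unit A x \<in> cells (Hom A x x) 0) \<and>
     (\<forall>x\<in>Obj A. \<forall>y\<in>Obj A. \<forall>z\<in>Obj A.
        Cmp A x y z \<in> psh_hom box_cat (tensor (Hom A x y) (Hom A y z)) (Hom A x z)) \<and>
     (\<forall>x\<in>Obj A. \<forall>y\<in>Obj A. \<forall>n. \<forall>a\<in>cells (Hom A x y) n.
        cube_cmp A x x y 0 (Unit A x) n a = a \<and> cube_cmp A x y y n a 0 (Unit A y) = a) \<and>
     (\<forall>w\<in>Obj A. \<forall>x\<in>Obj A. \<forall>y\<in>Obj A. \<forall>z\<in>Obj A. \<forall>n m k.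
        \<forall>a\<in>cells (Hom A w x) n. \<forall>b\<in>cells (Hom A x y) m. \<forall>c\<in>cells (Hom A y z) k.
        cube_cmp A w y z (n + m) (cube_cmp A w x y n a m b) k c
          = cube_cmp A w x z n a (m + k) (cube_cmp A x y z m b k c))"

definition is_cfun :: "('o, 'a, 'p, 'b) cfun \<Rightarrow> bool" where
  "is_cfun F \<longleftrightarrow> is_ccat (Src F) \<and> is_ccat (Tgt F) \<and>
     Omap F \<in> Obj (Src F) \<rightarrow>\<^sub>E Obj (Tgt F) \<and>
     Hmap F \<in> (\<Pi>\<^sub>E x\<in>Obj (Src F). \<Pi>\<^sub>E y\<in>Obj (Src F).
       psh_hom box_cat (Hom (Src F) x y) (Hom (Tgt F) (Omap F x) (Omap F y))) \<and>
     (\<forall>x\<in>Obj (Src F). Hmap F x x 0 (Unit (Src F) x) = Unit (Tgt F) (Omap F x)) \<and>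
     (\<forall>x\<in>Obj (Src F). \<forall>y\<in>Obj (Src F). \<forall>z\<in>Obj (Src F). \<forall>n.
        \<forall>t\<in>cells (tensor (Hom (Src F) x y) (Hom (Src F) y z)) n.
        Hmap F x z n (Cmp (Src F) x y z n t)
          = Cmp (Tgt F) (Omap F x) (Omap F y) (Omap F z) n
              (tensor_map (Hom (Tgt F) (Omap F x) (Omap F y)) (Hom (Tgt F) (Omap F y) (Omap F z))
                 (Hmap F x y) (Hmap F y z) n t))"

definition CCat :: "(('o, 'a) ccat, ('o, 'a, 'o, 'a) cfun) cat" where
  "CCat = \<lparr>Ob = {A. is_ccat A}, Ar = {F. is_cfun F}, Dom = Src, Cod = Tgt,
     Idn = efun_id, Comp = efun_comp\<rparr>"


section \<open>Triangulation\<close>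

definition cube_nerve ::
  "(nat, box_arr, (nat \<Rightarrow> bool list) sset, nat \<Rightarrow> (nat \<Rightarrow> bool list) \<Rightarrow> (nat \<Rightarrow> bool list)) func"
where
  "cube_nerve = \<lparr>fob = (\<lambda>n. nerve (cube n) cube_le),
     far = (\<lambda>(m, n, f). nerve_map (cube m) cube_le f)\<rparr>"

type_synonym 'a tri_cell = "('a element \<times> (nat \<Rightarrow> bool list)) set"

definition tri :: "'a cset \<Rightarrow> 'a tri_cell sset" where
  "tri K = psh_colim simplex_cat (elements box_cat K) (cube_nerve \<circ>\<^sub>F elements_proj)"

definition tri_rel ::
  "'a cset \<Rightarrow> nat
     \<Rightarrow> (('a element \<times> (nat \<Rightarrow> bool list)) \<times> ('a element \<times> (nat \<Rightarrow> bool list))) set"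
where
  "tri_rel K = psh_colim_rel (elements box_cat K) (cube_nerve \<circ>\<^sub>F elements_proj)"

definition tri_map ::
  "'a cset \<Rightarrow> 'b cset \<Rightarrow> (nat \<Rightarrow> 'a \<Rightarrow> 'b) \<Rightarrow> nat \<Rightarrow> 'a tri_cell \<Rightarrow> 'b tri_cell"
where
  "tri_map K L t = (\<lambda>k. \<lambda>X\<in>cells (tri K) k.
     tri_rel L k `` ((\<lambda>((n, x), c). ((n, t n x), c)) ` X))"

text \<open>The natural isomorphism \<open>|K| \<times> |L| \<cong> |K \<otimes> L|\<close>: on the simplices of the cubes \<open>x\<close> and \<open>y\<close> it is
  the isomorphism \<open>N(\<one>\<^sup>n) \<times> N(\<one>\<^sup>m) \<cong> N(\<one>\<^sup>n\<^sup>+\<^sup>m)\<close> followed by the map belonging to \<open>x \<otimes> y\<close>.\<close>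

definition tri_mult ::
  "'a cset \<Rightarrow> 'b cset \<Rightarrow> nat \<Rightarrow> 'a tri_cell \<times> 'b tri_cell \<Rightarrow> ('a, 'b) tensor_cell tri_cell"
where
  "tri_mult K L = (\<lambda>k. \<lambda>(X, Y)\<in>cells (prod_psh (tri K) (tri L)) k.
     tri_rel (tensor K L) k ``
       {((n + m, tensor_cube K L n x m y), \<lambda>i\<in>{..k}. c i @ d i) | n x c m y d.
          ((n, x), c) \<in> X \<and> ((m, y), d) \<in> Y})"

definition T_ob :: "('o, 'a) ccat \<Rightarrow> ('o, 'a tri_cell) scat" where
  "T_ob A =
     \<lparr>Obj = Obj A,
      Hom = (\<lambda>x y. tri (Hom A x y)),
      Unit = (\<lambda>x. tri_rel (Hom A x x) 0 `` {((0, Unit A x), \<lambda>i\<in>{..0}. [])}),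
      Cmp = (\<lambda>x y z. psh_comp (prod_psh (tri (Hom A x y)) (tri (Hom A y z)))
        (tri_map (tensor (Hom A x y) (Hom A y z)) (Hom A x z) (Cmp A x y z))
        (tri_mult (Hom A x y) (Hom A y z)))\<rparr>"

definition T_ar :: "('o, 'a, 'p, 'b) cfun \<Rightarrow> ('o, 'a tri_cell, 'p, 'b tri_cell) sfun" where
  "T_ar F =
     \<lparr>Src = T_ob (Src F), Tgt = T_ob (Tgt F), Omap = Omap F,
      Hmap = (\<lambda>x\<in>Obj (Src F). \<lambda>y\<in>Obj (Src F).
        tri_map (Hom (Src F) x y) (Hom (Tgt F) (Omap F x) (Omap F y)) (Hmap F x y))\<rparr>"

definition T_functor ::
  "(('o, 'a) ccat, ('o, 'a, 'o, 'a) cfun,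
    ('o, 'a tri_cell) scat, ('o, 'a tri_cell, 'o, 'a tri_cell) sfun) func"
where
  "T_functor = \<lparr>fob = T_ob, far = T_ar\<rparr>"


section \<open>Necklaces\<close>

text \<open>A necklace in preferred form is given by the list of the dimensions of its beads.  The
  necklace \<open>\<Delta>\<^bsup>n\<^sub>1\<^esup> \<or> \<dots> \<or> \<Delta>\<^bsup>n\<^sub>k\<^esup>\<close> is modelled as the subcomplex of the standard simplex of dimension
  \<open>n\<^sub>1 + \<dots> + n\<^sub>k\<close> consisting of the simplices whose vertices belong to one bead, the \<open>i\<close>-th
  bead having the vertices \<open>n\<^sub>1 + \<dots> + n\<^sub>i\<^sub>-\<^sub>1, \<dots>, n\<^sub>1 + \<dots> + n\<^sub>i\<close>.\<close>

definition necklace :: "nat list \<Rightarrow> (nat \<Rightarrow> nat) sset" where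
  "necklace T = (std_simplex (sum_list T))
     \<lparr>cells := (\<lambda>m. {c \<in> cells (std_simplex (sum_list T)) m. T = [] \<or>
        (\<exists>i<length T. c ` {..m} \<subseteq> {sum_list (take i T) .. sum_list (take (Suc i) T)})})\<rparr>"

definition vtx :: "nat \<Rightarrow> nat \<Rightarrow> nat" where
  "vtx v = (\<lambda>i\<in>{..0}. v)"

definition vertices :: "nat list \<Rightarrow> nat set" where
  "vertices T = {v. vtx v \<in> cells (necklace T) 0}"

definition joints :: "nat list \<Rightarrow> nat set" where
  "joints T = {sum_list (take i T) | i. i \<le> length T}"

abbreviation (input) first_vertex :: "nat list \<Rightarrow> nat" where "first_vertex T \<equiv> 0"
abbreviation (input) last_vertex :: "nat list \<Rightarrow> nat" where "last_vertex T \<equiv> sum_list T"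

text \<open>The order of the vertices given by directed paths is the usual order of natural numbers
  (see \<open>vertex_order\<close> below), so it is used in the form of \<open>sorted_list_of_set\<close> in \<open>phi\<close>.\<close>

definition edge_rel :: "nat list \<Rightarrow> (nat \<times> nat) set" where
  "edge_rel T = {(e 0, e 1) | e. e \<in> cells (necklace T) 1}"

type_synonym necklace_map = "nat \<Rightarrow> (nat \<Rightarrow> nat) \<Rightarrow> (nat \<Rightarrow> nat)"
type_synonym necklace_arr = "nat list \<times> necklace_map \<times> nat list"

definition Nec :: "(nat list, necklace_arr) cat" where
  "Nec =
     \<lparr>Ob = {T. \<forall>n\<in>set T. 1 \<le> n},
      Ar = {(T, g, U). (\<forall>n\<in>set T. 1 \<le> n) \<and> (\<forall>n\<in>set U. 1 \<le> n) \<and>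
              g \<in> psh_hom simplex_cat (necklace T) (necklace U) \<and>
              g 0 (vtx (first_vertex T)) = vtx (first_vertex U) \<and>
              g 0 (vtx (last_vertex T)) = vtx (last_vertex U)},
      Dom = (\<lambda>(T, g, U). T), Cod = (\<lambda>(T, g, U). U),
      Idn = (\<lambda>T. (T, psh_id (necklace T), T)),
      Comp = (\<lambda>(_, h, V) (T, g, _). (T, psh_comp (necklace T) h g, V))\<rparr>"

lemma std_simplex_cells:
  "cells (std_simplex n) m = {c \<in> {..m} \<rightarrow>\<^sub>E {..n}. mono_on {..m} c}"
  unfolding std_simplex_def nerve_def mono_on_def by (auto; metis atMost_iff le_trans)

lemma sum_take_le: "sum_list (take i T) \<le> sum_list (T :: nat list)"
  by (metis append_take_drop_id le_add1 sum_list_append)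

lemma necklace_edge_vertex_cells:
  assumes "i < length T" "c \<in> {..m} \<rightarrow>\<^sub>E {sum_list (take i T) .. sum_list (take (Suc i) T)}" "mono_on {..m} c"
  shows "c \<in> cells (necklace T) m"
proof -
  have "c \<in> {..m} \<rightarrow>\<^sub>E {..sum_list T}"
    using assms(2) sum_take_le[of "Suc i" T] by (auto simp: PiE_iff Ball_def intro: le_trans)
  then show ?thesis
    using assms unfolding necklace_def std_simplex_cells by (auto simp: PiE_iff)
qed

lemma bead_containing:
  assumes "v < sum_list (T :: nat list)"
  shows "\<exists>i<length T. sum_list (take i T) \<le> v \<and> v < sum_list (take (Suc i) T)"
  using assms
proof (induction T rule: rev_induct)
  case (snoc n T)
  show ?case
  proof (cases "v < sum_list T")
    case True
    then obtain i where "i < length T" "sum_list (take i T) \<le> v" "v < sum_list (take (Suc i) T)"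
      using snoc.IH by blast
    then show ?thesis by (intro exI[of _ i]) auto
  next
    case False
    then show ?thesis using snoc.prems by (intro exI[of _ "length T"]) auto
  qed
qed simp

lemma vertices_eq:
  assumes "T \<in> Ob Nec" shows "vertices T = {..sum_list T}"
proof
  show "vertices T \<subseteq> {..sum_list T}"
    by (auto simp: vertices_def necklace_def std_simplex_cells vtx_def PiE_iff)
  show "{..sum_list T} \<subseteq> vertices T"
  proof
    fix v assume v: "v \<in> {..sum_list T}"
    show "v \<in> vertices T"
    proof (cases "T = []")
      case True
      then show ?thesis using v
        by (auto simp: vertices_def necklace_def std_simplex_cells vtx_def mono_on_def)
    next
      case False
      then have pos: "last T \<ge> 1" "T = butlast T @ [last T]" using assms by (auto simp: Nec_def)
      have "\<exists>i<length T. sum_list (take i T) \<le> v \<and> v \<le> sum_list (take (Suc i) T)"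
      proof (cases "v < sum_list T")
        case True then show ?thesis using bead_containing[OF True] by force
      next
        case False
        then have "v = sum_list T" using v by simp
        then show ?thesis using \<open>T \<noteq> []\<close> sum_take_le[of "length T - 1" T]
          by (intro exI[of _ "length T - 1"]) auto
      qed
      then obtain i where i: "i < length T" "sum_list (take i T) \<le> v" "v \<le> sum_list (take (Suc i) T)" by blast
      show ?thesis unfolding vertices_def
        by (rule CollectI, rule necklace_edge_vertex_cells[OF i(1)])
          (use i in \<open>auto simp: vtx_def mono_on_def\<close>)
    qed
  qed
qed

lemma vertex_order:
  assumes "T \<in> Ob Nec" "a \<in> vertices T" "b \<in> vertices T"
  shows "(a, b) \<in> (edge_rel T)\<^sup>* \<longleftrightarrow> a \<le> b"
proof
  assume "(a, b) \<in> (edge_rel T)\<^sup>*"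
  then show "a \<le> b"
    by (induction rule: rtrancl_induct)
      (auto simp: edge_rel_def necklace_def std_simplex_cells mono_on_def intro: le_trans)
next
  assume "a \<le> b"
  have b: "b \<le> sum_list T" using assms vertices_eq by auto
  from \<open>a \<le> b\<close> show "(a, b) \<in> (edge_rel T)\<^sup>*" using b
  proof (induction b rule: dec_induct)
    case (step v)
    from step.prems have "v < sum_list T" by simp
    then obtain i where i: "i < length T" "sum_list (take i T) \<le> v" "v < sum_list (take (Suc i) T)"
      using bead_containing by blast
    define e where "e = (\<lambda>k\<in>{..1::nat}. v + k)"
    have "e \<in> cells (necklace T) 1"
      by (rule necklace_edge_vertex_cells[OF i(1)]) (use i in \<open>auto simp: e_def mono_on_def\<close>)
    moreover have "e 0 = v" "e 1 = Suc v" by (auto simp: e_def)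
    ultimately have "(v, Suc v) \<in> edge_rel T" unfolding edge_rel_def by force
    then show ?case using step by (meson Suc_leD rtrancl.rtrancl_into_rtrancl)
  qed simp
qed

lemma const_in_necklace:
  assumes "T \<in> Ob Nec" "v \<le> sum_list T"
  shows "(\<lambda>i\<in>{..m}. v) \<in> cells (necklace T) m"
proof (cases "T = []")
  case True
  then show ?thesis using assms by (auto simp: necklace_def std_simplex_cells mono_on_def)
next
  case False
  from assms have "vtx v \<in> cells (necklace T) 0" using vertices_eq vertices_def by blast
  then obtain i where "i < length T" "sum_list (take i T) \<le> v" "v \<le> sum_list (take (Suc i) T)"
    using False by (auto simp: necklace_def vtx_def)
  then show ?thesis by (intro necklace_edge_vertex_cells[of i]) (auto simp: mono_on_def)
qed

text \<open>The simplices of \<open>necklace (T @ U)\<close> are those of \<open>necklace T\<close> and the shifted simplices of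
  \<open>necklace U\<close>, glued at the last vertex of the former and the first vertex of the latter.\<close>

lemma necklace_append_left:
  assumes "T \<in> Ob Nec" "U \<in> Ob Nec"
  shows "cells (necklace T) m \<subseteq> cells (necklace (T @ U)) m"
proof
  fix c assume c: "c \<in> cells (necklace T) m"
  show "c \<in> cells (necklace (T @ U)) m"
  proof (cases "T = []")
    case True
    then have "c = (\<lambda>i\<in>{..m}. 0)" using c
      by (auto simp: necklace_def std_simplex_cells PiE_iff extensional_def fun_eq_iff)
    then show ?thesis using const_in_necklace[OF assms(2), of 0] True by simp
  next
    case False
    then obtain i where i: "i < length T" "c ` {..m} \<subseteq> {sum_list (take i T)..sum_list (take (Suc i) T)}"
      and "c \<in> {..m} \<rightarrow>\<^sub>E {..sum_list T}" "mono_on {..m} c"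
      using c by (auto simp: necklace_def std_simplex_cells)
    then show ?thesis by (intro necklace_edge_vertex_cells[of i]) (auto simp: PiE_iff)
  qed
qed

lemma necklace_append_right:
  assumes "T \<in> Ob Nec" "U \<in> Ob Nec" "c \<in> cells (necklace U) m"
  shows "(\<lambda>i\<in>{..m}. sum_list T + c i) \<in> cells (necklace (T @ U)) m"
proof (cases "U = []")
  case True
  then have "(\<lambda>i\<in>{..m}. sum_list T + c i) = (\<lambda>i\<in>{..m}. sum_list T)" using assms(3)
    by (auto simp: necklace_def std_simplex_cells PiE_iff fun_eq_iff)
  then show ?thesis using const_in_necklace[OF assms(1) order_refl, of m] True by simp
next
  case False
  then obtain i where i: "i < length U" "c ` {..m} \<subseteq> {sum_list (take i U)..sum_list (take (Suc i) U)}"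
    and "c \<in> {..m} \<rightarrow>\<^sub>E {..sum_list U}" "mono_on {..m} c"
    using assms(3) by (auto simp: necklace_def std_simplex_cells)
  then show ?thesis
    by (intro necklace_edge_vertex_cells[of "length T + i"]) (auto simp: PiE_iff mono_on_def)
qed

lemma necklace_append:
  assumes "T \<in> Ob Nec" "U \<in> Ob Nec"
  shows "cells (necklace (T @ U)) m =
     cells (necklace T) m \<union> (\<lambda>c. \<lambda>i\<in>{..m}. sum_list T + c i) ` cells (necklace U) m"
    (is "?L = ?A \<union> ?B")
proof
  show "?A \<union> ?B \<subseteq> ?L"
    using necklace_append_left[OF assms] necklace_append_right[OF assms] by blast
  show "?L \<subseteq> ?A \<union> ?B"
  proof
    fix c assume c: "c \<in> ?L"
    then have ce: "c \<in> extensional {..m}" and cm: "mono_on {..m} c"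
      by (auto simp: necklace_def std_simplex_cells PiE_iff)
    show "c \<in> ?A \<union> ?B"
    proof (cases "T @ U = []")
      case True
      then show ?thesis using c by auto
    next
      case False
      then obtain i where i: "i < length (T @ U)"
        "\<forall>k\<le>m. sum_list (take i (T @ U)) \<le> c k \<and> c k \<le> sum_list (take (Suc i) (T @ U))"
        using c unfolding necklace_def by (simp add: image_subset_iff) blast
      show ?thesis
      proof (cases "i < length T")
        case True
        then show ?thesis using i ce cm
          by (intro UnI1 necklace_edge_vertex_cells[of i]) (auto simp: PiE_iff)
      next
        case F: False
        define j where "j = i - length T"
        have j: "i = length T + j" "j < length U" using F i(1) by (auto simp: j_def)
        have ge: "\<forall>k\<le>m. sum_list T + sum_list (take j U) \<le> c k
            \<and> c k \<le> sum_list T + sum_list (take (Suc j) U)"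
          using i(2) j(1) by simp
        have "(\<lambda>k\<in>{..m}. c k - sum_list T) \<in> cells (necklace U) m"
          using ge cm j(2) by (intro necklace_edge_vertex_cells[of j]) (force simp: mono_on_def)+
        moreover have "c = (\<lambda>k\<in>{..m}. sum_list T + (\<lambda>k\<in>{..m}. c k - sum_list T) k)"
        proof
          fix k show "c k = (\<lambda>k\<in>{..m}. sum_list T + (\<lambda>k\<in>{..m}. c k - sum_list T) k) k"
            using ge[rule_format, of k] ce by (cases "k \<le> m") (auto simp: extensional_def)
        qed
        ultimately show ?thesis by blast
      qed
    qed
  qed
qed

lemma necklace_append_Int:
  assumes "T \<in> Ob Nec" "U \<in> Ob Nec"
  shows "cells (necklace T) m \<inter> (\<lambda>c. \<lambda>i\<in>{..m}. sum_list T + c i) ` cells (necklace U) m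
    = {\<lambda>i\<in>{..m}. sum_list T}"
proof -
  have "(\<lambda>i\<in>{..m}. sum_list T) = (\<lambda>i\<in>{..m}. sum_list T + (\<lambda>i\<in>{..m}. 0) i)" by auto
  then have "(\<lambda>i\<in>{..m}. sum_list T) \<in> (\<lambda>c. \<lambda>i\<in>{..m}. sum_list T + c i) ` cells (necklace U) m"
    using const_in_necklace[OF assms(2), of 0] by blast
  moreover have "(\<lambda>i\<in>{..m}. sum_list T) \<in> cells (necklace T) m"
    using const_in_necklace[OF assms(1)] by simp
  moreover have "c = (\<lambda>i\<in>{..m}. sum_list T)"
    if "c \<in> cells (necklace T) m" "c = (\<lambda>i\<in>{..m}. sum_list T + d i)" for c d
  proof
    fix i
    have "i \<le> m \<Longrightarrow> c i \<le> sum_list T" using that(1)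
      by (auto simp: necklace_def std_simplex_cells PiE_iff)
    then show "c i = (\<lambda>i\<in>{..m}. sum_list T) i" using that(2) by auto
  qed
  ultimately show ?thesis by blast
qed

definition vertex_map :: "necklace_map \<Rightarrow> nat \<Rightarrow> nat" where
  "vertex_map g v = g 0 (vtx v) 0"

definition P_ob :: "nat list \<Rightarrow> nat set set" where
  "P_ob T = {X. joints T \<subseteq> X \<and> X \<subseteq> vertices T}"

definition phi :: "nat list \<Rightarrow> nat set \<Rightarrow> bool list" where
  "phi T X = map (\<lambda>y. y \<in> X) (sorted_list_of_set (vertices T - joints T))"

definition P1 :: "(nat list, necklace_arr, nat, box_arr) func" where
  "P1 =
     \<lparr>fob = (\<lambda>T. card (vertices T - joints T)),
      far = (\<lambda>(T, g, U). (card (vertices T - joints T), card (vertices U - joints U),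
        \<lambda>s\<in>cube (card (vertices T - joints T)).
          phi U (vertex_map g ` inv_into (P_ob T) (phi T) s)))\<rparr>"

definition C_nec ::
  "(nat list, necklace_arr, box_arr cset, nat \<Rightarrow> box_arr \<Rightarrow> box_arr) func"
where
  "C_nec = yoneda box_cat \<circ>\<^sub>F P1"


section \<open>The cubical rigidification functor\<close>

type_synonym 'a nec_over = "nat list \<times> (nat \<Rightarrow> (nat \<Rightarrow> nat) \<Rightarrow> 'a)"
type_synonym 'a nec_over_arr = "'a nec_over \<times> necklace_arr \<times> 'a nec_over"
type_synonym 'a rig_cube = "('a nec_over \<times> box_arr) set"

text \<open>The category of necklaces over \<open>S\<close> from \<open>x\<close> to \<open>y\<close>.\<close>

definition nec_over :: "'a sset \<Rightarrow> 'a \<Rightarrow> 'a \<Rightarrow> ('a nec_over, 'a nec_over_arr) cat" where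
  "nec_over S x y = (let
     Os = {(T, f). T \<in> Ob Nec \<and> f \<in> psh_hom simplex_cat (necklace T) S \<and>
            f 0 (vtx (first_vertex T)) = x \<and> f 0 (vtx (last_vertex T)) = y}
   in \<lparr>Ob = Os,
       Ar = {((T, f), u, (U, h)) | T f u U h. (T, f) \<in> Os \<and> (U, h) \<in> Os \<and> u \<in> Ar Nec \<and>
               Dom Nec u = T \<and> Cod Nec u = U \<and> f = psh_comp (necklace T) h (fst (snd u))},
       Dom = (\<lambda>(a, u, b). a), Cod = (\<lambda>(a, u, b). b),
       Idn = (\<lambda>(T, f). ((T, f), Idn Nec T, (T, f))),
       Comp = (\<lambda>(_, v, c) (a, u, _). (a, Comp Nec v u, c))\<rparr>)"

definition nec_over_proj ::
  "('a nec_over, 'a nec_over_arr, nat list, necklace_arr) func"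
where
  "nec_over_proj = \<lparr>fob = (\<lambda>(T, f). T), far = (\<lambda>(a, u, b). u)\<rparr>"

definition rig_hom :: "'a sset \<Rightarrow> 'a \<Rightarrow> 'a \<Rightarrow> 'a rig_cube cset" where
  "rig_hom S x y = psh_colim box_cat (nec_over S x y) (C_nec \<circ>\<^sub>F nec_over_proj)"

definition rig_rel ::
  "'a sset \<Rightarrow> 'a \<Rightarrow> 'a \<Rightarrow> nat \<Rightarrow> (('a nec_over \<times> box_arr) \<times> ('a nec_over \<times> box_arr)) set"
where
  "rig_rel S x y = psh_colim_rel (nec_over S x y) (C_nec \<circ>\<^sub>F nec_over_proj)"

text \<open>The necklace \<open>T \<or> U\<close> is the list \<open>T @ U\<close>; this is the map on it given by \<open>f\<close> and \<open>g\<close>.\<close>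

definition glue ::
  "nat list \<Rightarrow> nat list \<Rightarrow> (nat \<Rightarrow> (nat \<Rightarrow> nat) \<Rightarrow> 'a) \<Rightarrow> (nat \<Rightarrow> (nat \<Rightarrow> nat) \<Rightarrow> 'a)
     \<Rightarrow> nat \<Rightarrow> (nat \<Rightarrow> nat) \<Rightarrow> 'a"
where
  "glue T U f g = (\<lambda>m. \<lambda>c\<in>cells (necklace (T @ U)) m.
     if c \<in> cells (necklace T) m then f m c else g m (\<lambda>i\<in>{..m}. c i - last_vertex T))"

text \<open>In composition, \<open>C(T) \<otimes> C(U) \<cong> C(T \<or> U)\<close> is the identification of \<open>\<one>\<^sup>N \<times> \<one>\<^sup>M\<close> with \<open>\<one>\<^sup>N\<^sup>+\<^sup>M\<close>.\<close>

definition Cbox_ob :: "'a sset \<Rightarrow> ('a, 'a rig_cube) ccat" where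
  "Cbox_ob S =
     \<lparr>Obj = cells S 0,
      Hom = rig_hom S,
      Unit = (\<lambda>x. rig_rel S x x 0 ``
        {(([], \<lambda>m. \<lambda>c\<in>cells (necklace []) m. act S (m, 0, \<lambda>i\<in>{..m}. 0) x), box_id 0)}),
      Cmp = (\<lambda>x y z k. \<lambda>X\<in>cells (tensor (rig_hom S x y) (rig_hom S y z)) k.
        rig_rel S x z k ``
          {((T @ U, glue T U f g), box_comp (box_plus u v) w) | n a m b w T f u U g v.
             (((n, a), (m, b)), w) \<in> X \<and> ((T, f), u) \<in> a \<and> ((U, g), v) \<in> b})\<rparr>"

definition Cbox_ar ::
  "(simp_arr, 'a) psh_arr \<Rightarrow> ('a, 'a rig_cube, 'a, 'a rig_cube) cfun"
where
  "Cbox_ar = (\<lambda>(S, p, S').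
     \<lparr>Src = Cbox_ob S, Tgt = Cbox_ob S', Omap = p 0,
      Hmap = (\<lambda>x\<in>cells S 0. \<lambda>y\<in>cells S 0. \<lambda>n. \<lambda>X\<in>cells (rig_hom S x y) n.
        rig_rel S' (p 0 x) (p 0 y) n ``
          ((\<lambda>((T, f), u). ((T, psh_comp (necklace T) p f), u)) ` X))\<rparr>)"

definition Cbox ::
  "('a sset, (simp_arr, 'a) psh_arr,
    ('a, 'a rig_cube) ccat, ('a, 'a rig_cube, 'a, 'a rig_cube) cfun) func"
where
  "Cbox = \<lparr>fob = Cbox_ob, far = Cbox_ar\<rparr>"


section \<open>Colimits of simplicial categories\<close>

text \<open>The objects of the colimit are the colimit of the sets of objects.  In simplicial degree \<open>n\<close>
  the morphisms are equivalence classes of paths of composable letters.  A letter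
  \<open>(j, x, y, a)\<close> is an \<open>n\<close>-simplex \<open>a\<close> of \<open>Hom(x,y)\<close> in the \<open>j\<close>-th category of the diagram, and the
  relations identify composites and identities with those in the categories of the
  diagram and each letter with its images under the functors of the diagram.\<close>

type_synonym ('j, 'o) col_ob = "('j \<times> 'o) set"
type_synonym ('j, 'o, 'a) letter = "'j \<times> 'o \<times> 'o \<times> 'a"

definition col_ob_rel ::
  "('j, 'k) cat \<Rightarrow> ('j, 'k, ('o, 'a) scat, ('o, 'a, 'o, 'a) sfun) func
     \<Rightarrow> (('j \<times> 'o) \<times> ('j \<times> 'o)) set"
where
  "col_ob_rel J D = colim_rel J (\<lambda>j. Obj (fob D j)) (\<lambda>k. Omap (far D k))"

fun is_path ::
  "('j, 'k) cat \<Rightarrow> ('j, 'k, ('o, 'a) scat, ('o, 'a, 'o, 'a) sfun) func \<Rightarrow> nat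
     \<Rightarrow> ('j, 'o) col_ob \<Rightarrow> ('j, 'o, 'a) letter list \<Rightarrow> ('j, 'o) col_ob \<Rightarrow> bool"
where
  "is_path J D n X [] Y \<longleftrightarrow> X = Y"
| "is_path J D n X ((j, x, y, a) # w) Y \<longleftrightarrow>
     j \<in> Ob J \<and> x \<in> Obj (fob D j) \<and> y \<in> Obj (fob D j) \<and> a \<in> cells (Hom (fob D j) x y) n \<and>
     X = col_ob_rel J D `` {(j, x)} \<and> is_path J D n (col_ob_rel J D `` {(j, y)}) w Y"

inductive path_step ::
  "('j, 'k) cat \<Rightarrow> ('j, 'k, ('o, 'a) scat, ('o, 'a, 'o, 'a) sfun) func \<Rightarrow> nat
     \<Rightarrow> ('j, 'o, 'a) letter list \<Rightarrow> ('j, 'o, 'a) letter list \<Rightarrow> bool"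
for J D n where
  "path_step J D n (v @ [(j, x, y, a), (j, y, z, b)] @ w)
     (v @ [(j, x, z, Cmp (fob D j) x y z n (a, b))] @ w)"
| "path_step J D n (v @ [(j, x, x, unit_simplex (fob D j) x n)] @ w) (v @ w)"
| "u \<in> Ar J \<Longrightarrow>
   path_step J D n (v @ [(Dom J u, x, y, a)] @ w)
     (v @ [(Cod J u, Omap (far D u) x, Omap (far D u) y, Hmap (far D u) x y n a)] @ w)"

definition path_rel ::
  "('j, 'k) cat \<Rightarrow> ('j, 'k, ('o, 'a) scat, ('o, 'a, 'o, 'a) sfun) func
     \<Rightarrow> ('j, 'o) col_ob \<Rightarrow> ('j, 'o) col_ob \<Rightarrow> nat
     \<Rightarrow> (('j, 'o, 'a) letter list \<times> ('j, 'o, 'a) letter list) set"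
where
  "path_rel J D X Y n =
     eqcl {(v, w). is_path J D n X v Y \<and> is_path J D n X w Y \<and> path_step J D n v w}"

definition scat_colim ::
  "('j, 'k) cat \<Rightarrow> ('j, 'k, ('o, 'a) scat, ('o, 'a, 'o, 'a) sfun) func
     \<Rightarrow> (('j, 'o) col_ob, ('j, 'o, 'a) letter list set) scat"
where
  "scat_colim J D =
     \<lparr>Obj = colim_set J (\<lambda>j. Obj (fob D j)) (\<lambda>k. Omap (far D k)),
      Hom = (\<lambda>X Y.
        \<lparr>cells = (\<lambda>n. {w. is_path J D n X w Y} // path_rel J D X Y n),
         act = (\<lambda>u W. path_rel J D X Y (Dom simplex_cat u) ``
           (map (\<lambda>(j, x, y, a). (j, x, y, act (Hom (fob D j) x y) u a)) ` W))\<rparr>),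
      Unit = (\<lambda>X. path_rel J D X X 0 `` {[]}),
      Cmp = (\<lambda>X Y Z n.
        \<lambda>(V, W)\<in>({v. is_path J D n X v Y} // path_rel J D X Y n)
               \<times> ({w. is_path J D n Y w Z} // path_rel J D Y Z n).
          path_rel J D X Z n `` {v @ w | v w. v \<in> V \<and> w \<in> W})\<rparr>"


lemma eqcl_refl [simp]: "(a, a) \<in> eqcl R"
  by (simp add: eqcl_def)

lemma eqcl_sym: "(a, b) \<in> eqcl R \<Longrightarrow> (b, a) \<in> eqcl R"
  unfolding eqcl_def by (metis converse_Un converse_converse rtrancl_converseI sup_commute)

lemma eqcl_trans: "(a, b) \<in> eqcl R \<Longrightarrow> (b, c) \<in> eqcl R \<Longrightarrow> (a, c) \<in> eqcl R"
  unfolding eqcl_def by (rule rtrancl_trans)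

lemma eqcl_base: "(a, b) \<in> R \<Longrightarrow> (a, b) \<in> eqcl R"
  unfolding eqcl_def by blast

lemma eqcl_class_eq: "(a, b) \<in> eqcl R \<Longrightarrow> eqcl R `` {a} = eqcl R `` {b}"
  using eqcl_sym eqcl_trans by fast

lemma eqcl_map:
  assumes "(a, b) \<in> eqcl R" "\<And>x y. (x, y) \<in> R \<Longrightarrow> (h x, h y) \<in> eqcl R'"
  shows "(h a, h b) \<in> eqcl R'"
  using assms(1) unfolding eqcl_def[of R]
proof (induction rule: rtrancl_induct)
  case (step y z)
  from step.hyps(2) have "(h y, h z) \<in> eqcl R'"
    by (auto dest: assms(2) intro: eqcl_sym)
  with step.IH show ?case by (rule eqcl_trans)
qed simp

lemma eqcl_saturate:
  assumes "\<And>x y. (x, y) \<in> R \<Longrightarrow> (h x, h y) \<in> eqcl R'"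
  shows "eqcl R' `` (h ` (eqcl R `` {a})) = eqcl R' `` {h a}"
proof -
  have "(h a, h b) \<in> eqcl R'" if "(a, b) \<in> eqcl R" for b
    using eqcl_map[OF that assms] .
  then have "h ` (eqcl R `` {a}) \<subseteq> eqcl R' `` {h a}" by blast
  moreover have "h a \<in> h ` (eqcl R `` {a})" by simp
  ultimately show ?thesis using eqcl_trans by fast
qed

lemma eqcl_invariant:
  assumes "(a, b) \<in> eqcl R" "\<And>x y. (x, y) \<in> R \<Longrightarrow> f x = f y"
  shows "f a = f b"
  using assms(1) unfolding eqcl_def
  by (induction rule: rtrancl_induct) (use assms(2) in auto)

definition quot_lift :: "('a \<Rightarrow> 'b) \<Rightarrow> 'a set \<Rightarrow> 'b" where
  "quot_lift f A = f (SOME a. a \<in> A)"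

lemma quot_lift_class:
  assumes "\<And>x y. (x, y) \<in> R \<Longrightarrow> f x = f y"
  shows "quot_lift f (eqcl R `` {a}) = f a"
proof -
  have "(SOME b. b \<in> eqcl R `` {a}) \<in> eqcl R `` {a}" by (rule someI[of _ a]) simp
  then have "(a, SOME b. b \<in> eqcl R `` {a}) \<in> eqcl R" by simp
  from eqcl_invariant[OF this, of f, OF assms] show ?thesis unfolding quot_lift_def by simp
qed

lemma simplex_cat_category: "is_category simplex_cat"
  unfolding is_category_def
  by (auto simp: simplex_cat_def fun_eq_iff PiE_iff mono_on_def extensional_def)

lemma simplex_const:
  assumes "u \<in> Ar simplex_cat"
  shows "Comp simplex_cat (Cod simplex_cat u, 0, \<lambda>i\<in>{..Cod simplex_cat u}. 0) u
    = (Dom simplex_cat u, 0, \<lambda>i\<in>{..Dom simplex_cat u}. 0)"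
  using assms by (auto simp: simplex_cat_def fun_eq_iff PiE_iff)

lemma simplex_const_arr:
  "(n, 0, \<lambda>i\<in>{..n}. 0) \<in> Ar simplex_cat"
  "Dom simplex_cat (n, 0, f) = n" "Cod simplex_cat (n, k, f) = k"
  by (auto simp: simplex_cat_def mono_on_def)

lemma scat_psh:
  assumes "is_scat A" "x \<in> Obj A" "y \<in> Obj A"
  shows "is_presheaf simplex_cat (Hom A x y)"
  using assms by (simp add: is_scat_def)

lemma psh_act_cells:
  assumes "is_presheaf C P" "u \<in> Ar C" "x \<in> cells P (Cod C u)"
  shows "act P u x \<in> cells P (Dom C u)"
  using assms by (simp add: is_presheaf_def)

lemma scat_unit_cell:
  assumes "is_scat A" "x \<in> Obj A" shows "unit_simplex A x n \<in> cells (Hom A x x) n"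
  using assms psh_act_cells[OF scat_psh[OF assms(1,2,2)] simplex_const_arr(1), of "Unit A x" n]
  unfolding unit_simplex_def simplex_const_arr by (simp add: is_scat_def)

lemma scat_unit_act:
  assumes "is_scat A" "x \<in> Obj A" "u \<in> Ar simplex_cat"
  shows "act (Hom A x x) u (unit_simplex A x (Cod simplex_cat u)) = unit_simplex A x (Dom simplex_cat u)"
proof -
  let ?n = "Cod simplex_cat u"
  have "Unit A x \<in> cells (Hom A x x) 0" using assms by (simp add: is_scat_def)
  then have "act (Hom A x x) (Comp simplex_cat (?n, 0, \<lambda>i\<in>{..?n}. 0) u) (Unit A x)
     = act (Hom A x x) u (act (Hom A x x) (?n, 0, \<lambda>i\<in>{..?n}. 0) (Unit A x))"
    using scat_psh[OF assms(1,2,2)] assms(3) simplex_const_arr(1)[of ?n]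
    unfolding is_presheaf_def by (simp add: simplex_const_arr)
  then show ?thesis unfolding simplex_const[OF assms(3)] unit_simplex_def by simp
qed

lemma scat_cmp_cell:
  assumes "is_scat A" "x \<in> Obj A" "y \<in> Obj A" "z \<in> Obj A"
    "a \<in> cells (Hom A x y) n" "b \<in> cells (Hom A y z) n"
  shows "Cmp A x y z n (a, b) \<in> cells (Hom A x z) n"
proof -
  have "Cmp A x y z n \<in> cells (prod_psh (Hom A x y) (Hom A y z)) n \<rightarrow>\<^sub>E cells (Hom A x z) n"
    using assms by (simp add: is_scat_def psh_hom_def)
  then show ?thesis using assms by (auto simp: prod_psh_def)
qed

lemma scat_cmp_act:
  assumes "is_scat A" "x \<in> Obj A" "y \<in> Obj A" "z \<in> Obj A" "u \<in> Ar simplex_cat"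
    "a \<in> cells (Hom A x y) (Cod simplex_cat u)" "b \<in> cells (Hom A y z) (Cod simplex_cat u)"
  shows "act (Hom A x z) u (Cmp A x y z (Cod simplex_cat u) (a, b)) =
     Cmp A x y z (Dom simplex_cat u) (act (Hom A x y) u a, act (Hom A y z) u b)"
proof -
  have "Cmp A x y z \<in> psh_hom simplex_cat (prod_psh (Hom A x y) (Hom A y z)) (Hom A x z)"
    using assms by (simp add: is_scat_def)
  then show ?thesis using assms unfolding psh_hom_def by (auto simp: prod_psh_def)
qed

lemma scat_cmp_unit:
  assumes "is_scat A" "x \<in> Obj A" "y \<in> Obj A" "a \<in> cells (Hom A x y) n"
  shows "Cmp A x x y n (unit_simplex A x n, a) = a" "Cmp A x y y n (a, unit_simplex A y n) = a"
  using assms by (simp_all add: is_scat_def)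

lemma scat_cmp_assoc:
  assumes "is_scat A" "w \<in> Obj A" "x \<in> Obj A" "y \<in> Obj A" "z \<in> Obj A"
    "a \<in> cells (Hom A w x) n" "b \<in> cells (Hom A x y) n" "c \<in> cells (Hom A y z) n"
  shows "Cmp A w y z n (Cmp A w x y n (a, b), c) = Cmp A w x z n (a, Cmp A x y z n (b, c))"
  using assms by (simp add: is_scat_def)

lemma sfun_ob: "is_sfun F \<Longrightarrow> x \<in> Obj (Src F) \<Longrightarrow> Omap F x \<in> Obj (Tgt F)"
  by (auto simp: is_sfun_def)

lemma sfun_hom:
  assumes "is_sfun F" "x \<in> Obj (Src F)" "y \<in> Obj (Src F)"
  shows "Hmap F x y \<in> psh_hom simplex_cat (Hom (Src F) x y) (Hom (Tgt F) (Omap F x) (Omap F y))"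
proof -
  have "Hmap F \<in> (\<Pi>\<^sub>E x\<in>Obj (Src F). \<Pi>\<^sub>E y\<in>Obj (Src F).
       psh_hom simplex_cat (Hom (Src F) x y) (Hom (Tgt F) (Omap F x) (Omap F y)))"
    using assms by (simp add: is_sfun_def)
  from PiE_mem[OF PiE_mem[OF this assms(2)] assms(3)] show ?thesis .
qed

lemma sfun_cell:
  assumes "is_sfun F" "x \<in> Obj (Src F)" "y \<in> Obj (Src F)" "a \<in> cells (Hom (Src F) x y) n"
  shows "Hmap F x y n a \<in> cells (Hom (Tgt F) (Omap F x) (Omap F y)) n"
  using sfun_hom[OF assms(1-3)] assms(4) unfolding psh_hom_def by auto

lemma sfun_act:
  assumes "is_sfun F" "x \<in> Obj (Src F)" "y \<in> Obj (Src F)" "u \<in> Ar simplex_cat"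
    "a \<in> cells (Hom (Src F) x y) (Cod simplex_cat u)"
  shows "Hmap F x y (Dom simplex_cat u) (act (Hom (Src F) x y) u a)
    = act (Hom (Tgt F) (Omap F x) (Omap F y)) u (Hmap F x y (Cod simplex_cat u) a)"
  using sfun_hom[OF assms(1-3)] assms(4,5) unfolding psh_hom_def by auto

lemma sfun_unit:
  assumes "is_sfun F" "x \<in> Obj (Src F)"
  shows "Hmap F x x n (unit_simplex (Src F) x n) = unit_simplex (Tgt F) (Omap F x) n"
  using sfun_act[OF assms(1,2,2) simplex_const_arr(1), of "Unit (Src F) x" n] assms
  unfolding unit_simplex_def simplex_const_arr by (simp add: is_sfun_def is_scat_def)

lemma sfun_cmp:
  assumes "is_sfun F" "x \<in> Obj (Src F)" "y \<in> Obj (Src F)" "z \<in> Obj (Src F)"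
    "a \<in> cells (Hom (Src F) x y) n" "b \<in> cells (Hom (Src F) y z) n"
  shows "Hmap F x z n (Cmp (Src F) x y z n (a, b))
     = Cmp (Tgt F) (Omap F x) (Omap F y) (Omap F z) n (Hmap F x y n a, Hmap F y z n b)"
  using assms by (simp add: is_sfun_def)

lemma psh_hom_ext:
  assumes "s \<in> psh_hom C P Q" "t \<in> psh_hom C P Q'" "\<And>n x. x \<in> cells P n \<Longrightarrow> s n x = t n x"
  shows "s = t"
proof
  fix n show "s n = t n"
    using assms unfolding psh_hom_def
    by (intro PiE_ext[of _ "cells P n" "\<lambda>_. cells Q n \<union> cells Q' n"]) (auto simp: PiE_iff)
qed

lemma sfun_eqI:
  assumes F: "is_sfun F" and G: "is_sfun G" and st: "Src F = Src G" "Tgt F = Tgt G"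
    and o: "\<And>x. x \<in> Obj (Src F) \<Longrightarrow> Omap F x = Omap G x"
    and h: "\<And>x y n a. x \<in> Obj (Src F) \<Longrightarrow> y \<in> Obj (Src F) \<Longrightarrow> a \<in> cells (Hom (Src F) x y) n
      \<Longrightarrow> Hmap F x y n a = Hmap G x y n a"
  shows "F = G"
proof -
  have oF: "Omap F \<in> extensional (Obj (Src F))" "Omap G \<in> extensional (Obj (Src F))"
    using F G st by (simp_all add: is_sfun_def PiE_iff)
  have oe: "Omap F = Omap G" by (rule extensionalityI[OF oF o])
  have hF: "Hmap F \<in> extensional (Obj (Src F))" "Hmap G \<in> extensional (Obj (Src F))"
    using F G st by (simp_all add: is_sfun_def PiE_iff)
  have hFx: "Hmap F x \<in> extensional (Obj (Src F))" "Hmap G x \<in> extensional (Obj (Src F))"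
    if "x \<in> Obj (Src F)" for x
    using F G st that by (simp_all add: is_sfun_def PiE_iff)
  have "Hmap F x y = Hmap G x y" if "x \<in> Obj (Src F)" "y \<in> Obj (Src F)" for x y
  proof (rule psh_hom_ext)
    show "Hmap F x y \<in> psh_hom simplex_cat (Hom (Src F) x y) (Hom (Tgt F) (Omap F x) (Omap F y))"
      using sfun_hom[OF F] that .
    show "Hmap G x y \<in> psh_hom simplex_cat (Hom (Src F) x y) (Hom (Tgt G) (Omap G x) (Omap G y))"
      using sfun_hom[OF G] that st by simp
  qed (rule h[OF that])
  then have "Hmap F x = Hmap G x" if "x \<in> Obj (Src F)" for x
    using extensionalityI[OF hFx[OF that]] that by blast
  then have "Hmap F = Hmap G" using extensionalityI[OF hF] by blast
  then show ?thesis using oe st by (simp add: efun.equality)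
qed

lemma sfun_comp:
  assumes F: "is_sfun F" and G: "is_sfun G" and FG: "Tgt F = Src G"
  shows "is_sfun (efun_comp G F)"
proof -
  let ?H = "efun_comp G F"
  note ob = sfun_ob[OF F, unfolded FG]
  have o: "Omap ?H x = Omap G (Omap F x)" if "x \<in> Obj (Src F)" for x
    using that by (simp add: efun_comp_def)
  have h: "Hmap ?H x y n a = Hmap G (Omap F x) (Omap F y) n (Hmap F x y n a)"
    if "x \<in> Obj (Src F)" "y \<in> Obj (Src F)" "a \<in> cells (Hom (Src F) x y) n" for x y n a
    using that by (simp add: efun_comp_def psh_comp_def)
  have st: "Src ?H = Src F" "Tgt ?H = Tgt G" by (simp_all add: efun_comp_def)
  have A: "is_scat (Src F)" "is_scat (Tgt G)" using F G by (simp_all add: is_sfun_def)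
  have c: "Hmap F x y n a \<in> cells (Hom (Src G) (Omap F x) (Omap F y)) n"
    if "x \<in> Obj (Src F)" "y \<in> Obj (Src F)" "a \<in> cells (Hom (Src F) x y) n" for x y n a
    using sfun_cell[OF F that] FG by simp
  have H: "Hmap ?H x y \<in> psh_hom simplex_cat (Hom (Src F) x y) (Hom (Tgt G) (Omap ?H x) (Omap ?H y))"
    if xy: "x \<in> Obj (Src F)" "y \<in> Obj (Src F)" for x y
    unfolding psh_hom_def
  proof (intro CollectI conjI allI ballI)
    fix n
    have "Hmap ?H x y n \<in> extensional (cells (Hom (Src F) x y) n)"
      using xy by (simp add: efun_comp_def psh_comp_def)
    then show "Hmap ?H x y n \<in> cells (Hom (Src F) x y) n \<rightarrow>\<^sub>E cells (Hom (Tgt G) (Omap ?H x) (Omap ?H y)) n"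
      using h[OF xy] o xy sfun_cell[OF G ob[OF xy(1)] ob[OF xy(2)] c[OF xy]] by (auto simp: PiE_iff)
  next
    fix u a assume u: "u \<in> Ar simplex_cat" and a: "a \<in> cells (Hom (Src F) x y) (Cod simplex_cat u)"
    have a': "act (Hom (Src F) x y) u a \<in> cells (Hom (Src F) x y) (Dom simplex_cat u)"
      using psh_act_cells[OF scat_psh[OF A(1) xy] u a] .
    show "Hmap ?H x y (Dom simplex_cat u) (act (Hom (Src F) x y) u a)
      = act (Hom (Tgt G) (Omap ?H x) (Omap ?H y)) u (Hmap ?H x y (Cod simplex_cat u) a)"
      using sfun_act[OF F xy u a] sfun_act[OF G ob[OF xy(1)] ob[OF xy(2)] u c[OF xy a]] FG
      by (simp add: h[OF xy a] h[OF xy a'] o xy)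
  qed
  have "Hmap ?H \<in> (\<Pi>\<^sub>E x\<in>Obj (Src F). \<Pi>\<^sub>E y\<in>Obj (Src F).
       psh_hom simplex_cat (Hom (Src F) x y) (Hom (Tgt G) (Omap ?H x) (Omap ?H y)))"
    by (intro PiE_I H) (simp_all add: efun_comp_def)
  moreover have "Omap ?H \<in> Obj (Src F) \<rightarrow>\<^sub>E Obj (Tgt G)"
    using sfun_ob[OF G] ob by (auto simp: efun_comp_def)
  moreover have "Hmap ?H x x 0 (Unit (Src F) x) = Unit (Tgt G) (Omap ?H x)" if x: "x \<in> Obj (Src F)" for x
  proof -
    have "Unit (Src F) x \<in> cells (Hom (Src F) x x) 0" using A x by (simp add: is_scat_def)
    moreover have "Hmap F x x 0 (Unit (Src F) x) = Unit (Src G) (Omap F x)"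
      using F x FG by (simp add: is_sfun_def)
    moreover have "Hmap G (Omap F x) (Omap F x) 0 (Unit (Src G) (Omap F x)) = Unit (Tgt G) (Omap G (Omap F x))"
      using G ob[OF x] by (simp add: is_sfun_def)
    ultimately show ?thesis using h[OF x x] o[OF x] by simp
  qed
  moreover have "Hmap ?H x z n (Cmp (Src F) x y z n (a, b))
          = Cmp (Tgt G) (Omap ?H x) (Omap ?H y) (Omap ?H z) n (Hmap ?H x y n a, Hmap ?H y z n b)"
    if *: "x \<in> Obj (Src F)" "y \<in> Obj (Src F)" "z \<in> Obj (Src F)"
      "a \<in> cells (Hom (Src F) x y) n" "b \<in> cells (Hom (Src F) y z) n" for x y z n a b
    using sfun_cmp[OF F *] sfun_cmp[OF G ob[OF *(1)] ob[OF *(2)] ob[OF *(3)] c[OF *(1,2,4)] c[OF *(2,3,5)]] FG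
      scat_cmp_cell[OF A(1) *]
    by (simp add: h * o)
  ultimately show ?thesis unfolding is_sfun_def st using A by simp
qed


locale scat_diagram =
  fixes J :: "('j, 'k) cat" and D :: "('j, 'k, ('o, 'a) scat, ('o, 'a, 'o, 'a) sfun) func"
  assumes functor_D: "is_functor J SCat D"
begin

lemma D_ob: "j \<in> Ob J \<Longrightarrow> is_scat (fob D j)"
  using functor_D by (simp add: is_functor_def SCat_def)

lemma D_ar:
  assumes "u \<in> Ar J"
  shows "is_sfun (far D u)" "Src (far D u) = fob D (Dom J u)" "Tgt (far D u) = fob D (Cod J u)"
    "Dom J u \<in> Ob J" "Cod J u \<in> Ob J"
  using functor_D assms by (simp_all add: is_functor_def SCat_def is_category_def)

abbreviation "path \<equiv> is_path J D"
definition "q j x = col_ob_rel J D `` {(j, x)}"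
definition "cl X Y n w = path_rel J D X Y n `` {w}"

lemma path_Cons [simp]:
  "path n X ((j, x, y, a) # w) Y \<longleftrightarrow>
     j \<in> Ob J \<and> x \<in> Obj (fob D j) \<and> y \<in> Obj (fob D j) \<and> a \<in> cells (Hom (fob D j) x y) n \<and>
     X = q j x \<and> path n (q j y) w Y"
  by (simp add: q_def)

declare is_path.simps(2) [simp del]
abbreviation "L \<equiv> scat_colim J D"

lemma Obj_L: "Obj L = {q j x | j x. j \<in> Ob J \<and> x \<in> Obj (fob D j)}"
  unfolding scat_colim_def colim_set_def quotient_def col_ob_rel_def q_def by auto

lemma q_in_L: "j \<in> Ob J \<Longrightarrow> x \<in> Obj (fob D j) \<Longrightarrow> q j x \<in> Obj L"
  using Obj_L by auto

lemma q_arr: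
  assumes "u \<in> Ar J" "x \<in> Obj (fob D (Dom J u))"
  shows "q (Cod J u) (Omap (far D u) x) = q (Dom J u) x"
  unfolding col_ob_rel_def colim_rel_def q_def
  by (rule eqcl_class_eq[symmetric], rule eqcl_base) (use assms in blast)

lemma cells_L: "cells (Hom L X Y) n = {cl X Y n w | w. path n X w Y}"
  unfolding scat_colim_def quotient_def cl_def by auto

lemma cells_L_E:
  assumes "W \<in> cells (Hom L X Y) n" obtains w where "path n X w Y" "W = cl X Y n w"
  using assms by (auto simp: cells_L)

lemma cl_in_L: "path n X w Y \<Longrightarrow> cl X Y n w \<in> cells (Hom L X Y) n"
  using cells_L by auto

lemma cl_step:
  assumes "path_step J D n v w" "path n X v Y" "path n X w Y"
  shows "cl X Y n v = cl X Y n w"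
  unfolding path_rel_def cl_def by (rule eqcl_class_eq, rule eqcl_base) (use assms in blast)

lemma path_append: "path n X (v @ w) Z \<longleftrightarrow> (\<exists>Y. path n X v Y \<and> path n Y w Z)"
proof (induction v arbitrary: X)
  case (Cons l v)
  then show ?case by (cases l) auto
qed simp

definition lact :: "simp_arr \<Rightarrow> ('j, 'o, 'a) letter \<Rightarrow> ('j, 'o, 'a) letter" where
  "lact u = (\<lambda>(j, x, y, a). (j, x, y, act (Hom (fob D j) x y) u a))"

lemma path_lact:
  assumes "u \<in> Ar simplex_cat"
  shows "path (Cod simplex_cat u) X w Y \<Longrightarrow> path (Dom simplex_cat u) X (map (lact u) w) Y"
proof (induction w arbitrary: X)
  case (Cons l w)
  then show ?case using psh_act_cells[OF scat_psh[OF D_ob] assms] by (cases l) (auto simp: lact_def)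
qed simp

lemma step_lact:
  assumes u: "u \<in> Ar simplex_cat" and "path_step J D (Cod simplex_cat u) v w"
    and "path (Cod simplex_cat u) X v Y"
  shows "path_step J D (Dom simplex_cat u) (map (lact u) v) (map (lact u) w)"
  using assms(2,3)
proof (induction rule: path_step.cases)
  case (1 v j x y a z b w)
  then have "j \<in> Ob J" "x \<in> Obj (fob D j)" "y \<in> Obj (fob D j)" "z \<in> Obj (fob D j)"
    "a \<in> cells (Hom (fob D j) x y) (Cod simplex_cat u)" "b \<in> cells (Hom (fob D j) y z) (Cod simplex_cat u)"
    by (auto simp: path_append)
  then show ?case
    using path_step.intros(1)[of J D "Dom simplex_cat u" "map (lact u) v" j x y
        "act (Hom (fob D j) x y) u a" z "act (Hom (fob D j) y z) u b" "map (lact u) w"]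
    by (simp add: 1 lact_def scat_cmp_act[OF D_ob _ _ _ u])
next
  case (2 v j x w)
  then have "j \<in> Ob J" "x \<in> Obj (fob D j)" by (auto simp: path_append)
  then show ?case
    using path_step.intros(2)[of J D "Dom simplex_cat u" "map (lact u) v" j x "map (lact u) w"]
    by (simp add: 2 lact_def scat_unit_act[OF D_ob _ u])
next
  case (3 k v x y a w)
  note D = D_ar[OF \<open>k \<in> Ar J\<close>]
  from 3 have "x \<in> Obj (fob D (Dom J k))" "y \<in> Obj (fob D (Dom J k))"
    "a \<in> cells (Hom (fob D (Dom J k)) x y) (Cod simplex_cat u)"
    by (auto simp: path_append)
  then show ?case
    using path_step.intros(3)[OF \<open>k \<in> Ar J\<close>, of D "Dom simplex_cat u" "map (lact u) v" x y
       "act (Hom (fob D (Dom J k)) x y) u a" "map (lact u) w"]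
      sfun_act[OF D(1) _ _ u, unfolded D, of x y a]
    by (simp add: 3 lact_def)
qed

lemma act_cl:
  assumes u: "u \<in> Ar simplex_cat"
  shows "act (Hom L X Y) u (cl X Y (Cod simplex_cat u) w) = cl X Y (Dom simplex_cat u) (map (lact u) w)"
proof -
  have "act (Hom L X Y) u (cl X Y (Cod simplex_cat u) w)
     = path_rel J D X Y (Dom simplex_cat u) `` (map (lact u) ` cl X Y (Cod simplex_cat u) w)"
    by (simp add: scat_colim_def lact_def[abs_def])
  also have "\<dots> = cl X Y (Dom simplex_cat u) (map (lact u) w)"
    unfolding path_rel_def cl_def
  proof (rule eqcl_saturate, rule eqcl_base)
    fix v w
    assume "(v, w) \<in> {(v, w). path (Cod simplex_cat u) X v Y \<and> path (Cod simplex_cat u) X w Y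
        \<and> path_step J D (Cod simplex_cat u) v w}"
    then show "(map (lact u) v, map (lact u) w) \<in> {(v, w). path (Dom simplex_cat u) X v Y
        \<and> path (Dom simplex_cat u) X w Y \<and> path_step J D (Dom simplex_cat u) v w}"
      by (auto intro: step_lact[OF u] path_lact[OF u])
  qed
  finally show ?thesis .
qed

lemma step_ctxt:
  assumes "path_step J D n v w" shows "path_step J D n (p @ v @ r) (p @ w @ r)"
  using assms
proof (induction rule: path_step.cases)
  case (1 v j x y a z b w)
  show ?case using path_step.intros(1)[of J D n "p @ v" j x y a z b "w @ r"] by (simp add: 1)
next
  case (2 v j x w)
  show ?case using path_step.intros(2)[of J D n "p @ v" j x "w @ r"] by (simp add: 2)
next
  case (3 k v x y a w)
  show ?case using path_step.intros(3)[OF \<open>k \<in> Ar J\<close>, of D n "p @ v" x y a "w @ r"] by (simp add: 3)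
qed

lemma Cmp_cl:
  assumes "path n X v Y" "path n Y w Z"
  shows "Cmp L X Y Z n (cl X Y n v, cl Y Z n w) = cl X Z n (v @ w)"
proof -
  have l: "(v @ w, v' @ w) \<in> path_rel J D X Z n"
    if vv: "(v, v') \<in> path_rel J D X Y n" and w: "path n Y w Z" for v v' w
    unfolding path_rel_def
  proof (rule eqcl_map[OF vv[unfolded path_rel_def], of "\<lambda>v. v @ w"], rule eqcl_base)
    fix v v' assume "(v, v') \<in> {(v, w). path n X v Y \<and> path n X w Y \<and> path_step J D n v w}"
    then show "(v @ w, v' @ w) \<in> {(v, w). path n X v Z \<and> path n X w Z \<and> path_step J D n v w}"
      using w step_ctxt[of n v v' "[]" w] path_append by auto
  qed
  have r: "(v @ w, v @ w') \<in> path_rel J D X Z n"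
    if ww: "(w, w') \<in> path_rel J D Y Z n" and v: "path n X v Y" for v w w'
    unfolding path_rel_def
  proof (rule eqcl_map[OF ww[unfolded path_rel_def], of "\<lambda>w. v @ w"], rule eqcl_base)
    fix w w' assume "(w, w') \<in> {(v, w). path n Y v Z \<and> path n Y w Z \<and> path_step J D n v w}"
    then show "(v @ w, v @ w') \<in> {(v, w). path n X v Z \<and> path n X w Z \<and> path_step J D n v w}"
      using v step_ctxt[of n w w' v "[]"] path_append by auto
  qed
  have p: "path n Y w' Z" if "(w, w') \<in> path_rel J D Y Z n" for w'
  proof -
    have "path n Y w Z = path n Y w' Z"
      by (rule eqcl_invariant[OF that[unfolded path_rel_def], of "\<lambda>w. path n Y w Z"]) simp
    then show ?thesis using assms(2) by simp
  qed
  let ?A = "{v' @ w' | v' w'. v' \<in> cl X Y n v \<and> w' \<in> cl Y Z n w}"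
  have tr: "(a, c) \<in> path_rel J D X Z n"
    if "(a, b) \<in> path_rel J D X Z n" "(b, c) \<in> path_rel J D X Z n" for a b c
    using that unfolding path_rel_def by (rule eqcl_trans)
  have sub: "(v @ w, a) \<in> path_rel J D X Z n" if "a \<in> ?A" for a
    using that l p r assms(1) tr unfolding cl_def by blast
  have "v @ w \<in> ?A" unfolding path_rel_def cl_def by force
  then have "path_rel J D X Z n `` ?A = cl X Z n (v @ w)"
    using sub tr unfolding cl_def by blast
  moreover have "(cl X Y n v, cl Y Z n w) \<in>
      ({v. path n X v Y} // path_rel J D X Y n) \<times> ({w. path n Y w Z} // path_rel J D Y Z n)"
    using assms unfolding cl_def by (auto intro: quotientI)
  ultimately show ?thesis by (simp add: scat_colim_def)
qed

lemma Unit_cl: "Unit L X = cl X X 0 []"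
  by (simp add: scat_colim_def cl_def)

lemma unit_simplex_cl: "unit_simplex L X n = cl X X n []"
  using act_cl[OF simplex_const_arr(1), of X X n "[]"]
  unfolding unit_simplex_def simplex_const_arr Unit_cl by simp

lemma lact_id:
  assumes "path n X w Y" shows "map (lact (Idn simplex_cat n)) w = w"
  using assms
proof (induction w arbitrary: X)
  case (Cons l w)
  then show ?case using scat_psh[OF D_ob]
    by (cases l) (auto simp: lact_def is_presheaf_def)
qed simp

lemma lact_comp:
  assumes "path (Cod simplex_cat v) X w Y" "u \<in> Ar simplex_cat" "v \<in> Ar simplex_cat"
    "Dom simplex_cat v = Cod simplex_cat u"
  shows "map (lact (Comp simplex_cat v u)) w = map (lact u) (map (lact v) w)"
  using assms(1)
proof (induction w arbitrary: X)
  case (Cons l w)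
  then show ?case using scat_psh[OF D_ob] assms(2-4)
    by (cases l) (auto simp: lact_def is_presheaf_def simp del: map_map)
qed simp

lemma psh_L: "is_presheaf simplex_cat (Hom L X Y)"
proof -
  have c: "Dom simplex_cat (Comp simplex_cat v u) = Dom simplex_cat u"
    "Cod simplex_cat (Comp simplex_cat v u) = Cod simplex_cat v"
    "Comp simplex_cat v u \<in> Ar simplex_cat"
    if "u \<in> Ar simplex_cat" "v \<in> Ar simplex_cat" "Dom simplex_cat v = Cod simplex_cat u" for u v
    using simplex_cat_category that unfolding is_category_def by blast+
  have i: "Idn simplex_cat n \<in> Ar simplex_cat \<and> Dom simplex_cat (Idn simplex_cat n) = n
      \<and> Cod simplex_cat (Idn simplex_cat n) = n" for n
    using simplex_cat_category unfolding is_category_def by (auto simp: simplex_cat_def)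
  show ?thesis unfolding is_presheaf_def
  proof (intro conjI ballI allI impI)
    fix u W assume "u \<in> Ar simplex_cat" "W \<in> cells (Hom L X Y) (Cod simplex_cat u)"
    then show "act (Hom L X Y) u W \<in> cells (Hom L X Y) (Dom simplex_cat u)"
      by (metis act_cl path_lact cl_in_L cells_L_E)
  next
    fix n W assume "W \<in> cells (Hom L X Y) n"
    then show "act (Hom L X Y) (Idn simplex_cat n) W = W"
      by (metis act_cl i lact_id cells_L_E)
  next
    fix u v W assume uv: "u \<in> Ar simplex_cat" "v \<in> Ar simplex_cat" "Dom simplex_cat v = Cod simplex_cat u"
      and W: "W \<in> cells (Hom L X Y) (Cod simplex_cat v)"
    from W obtain w where w: "path (Cod simplex_cat v) X w Y" "W = cl X Y (Cod simplex_cat v) w"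
      by (auto simp: cells_L)
    show "act (Hom L X Y) (Comp simplex_cat v u) W = act (Hom L X Y) u (act (Hom L X Y) v W)"
      using act_cl[OF c(3)[OF uv], of X Y w] act_cl[OF uv(2), of X Y w]
        act_cl[OF uv(1), of X Y "map (lact v) w"] lact_comp[OF w(1) uv] w(2)
      by (simp add: c[OF uv] uv(3))
  qed
qed

lemma Cmp_L_ext: "Cmp L X Y Z n \<in> extensional (cells (Hom L X Y) n \<times> cells (Hom L Y Z) n)"
  by (simp add: scat_colim_def)

lemma scat_L: "is_scat L"
  unfolding is_scat_def
proof (intro conjI ballI allI)
  fix X Y Z
  show "Cmp L X Y Z \<in> psh_hom simplex_cat (prod_psh (Hom L X Y) (Hom L Y Z)) (Hom L X Z)"
    unfolding psh_hom_def
  proof (intro CollectI conjI allI ballI)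
    fix n
    show "Cmp L X Y Z n \<in> cells (prod_psh (Hom L X Y) (Hom L Y Z)) n \<rightarrow>\<^sub>E cells (Hom L X Z) n"
    proof (rule PiE_I)
      fix p assume "p \<in> cells (prod_psh (Hom L X Y) (Hom L Y Z)) n"
      then obtain v w where "path n X v Y" "path n Y w Z" "p = (cl X Y n v, cl Y Z n w)"
        by (auto simp: prod_psh_def cells_L)
      then show "Cmp L X Y Z n p \<in> cells (Hom L X Z) n"
        using Cmp_cl cl_in_L path_append by metis
    next
      fix p assume "p \<notin> cells (prod_psh (Hom L X Y) (Hom L Y Z)) n"
      then show "Cmp L X Y Z n p = undefined"
        using Cmp_L_ext[of X Y Z n] by (cases p) (simp add: prod_psh_def extensional_def)
    qed
  next
    fix u p assume u: "u \<in> Ar simplex_cat"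
      and "p \<in> cells (prod_psh (Hom L X Y) (Hom L Y Z)) (Cod simplex_cat u)"
    then obtain v w where vw: "path (Cod simplex_cat u) X v Y" "path (Cod simplex_cat u) Y w Z"
      "p = (cl X Y (Cod simplex_cat u) v, cl Y Z (Cod simplex_cat u) w)"
      by (auto simp: prod_psh_def cells_L)
    then show "Cmp L X Y Z (Dom simplex_cat u) (act (prod_psh (Hom L X Y) (Hom L Y Z)) u p)
       = act (Hom L X Z) u (Cmp L X Y Z (Cod simplex_cat u) p)"
      by (simp add: prod_psh_def act_cl[OF u] Cmp_cl path_lact[OF u])
  qed
next
  fix X Y n A assume "A \<in> cells (Hom L X Y) n"
  then obtain w where w: "path n X w Y" "A = cl X Y n w" by (rule cells_L_E)
  show "Cmp L X X Y n (unit_simplex L X n, A) = A" "Cmp L X Y Y n (A, unit_simplex L Y n) = A"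
    using w by (simp_all add: unit_simplex_cl Cmp_cl)
next
  fix X Y Z W n a b c
  assume "a \<in> cells (Hom L W X) n" "b \<in> cells (Hom L X Y) n" "c \<in> cells (Hom L Y Z) n"
  then obtain a' b' c' where *: "path n W a' X" "a = cl W X n a'" "path n X b' Y" "b = cl X Y n b'"
    "path n Y c' Z" "c = cl Y Z n c'" by (elim cells_L_E)
  have "path n W (a' @ b') Y" "path n X (b' @ c') Z" using * path_append by blast+
  then show "Cmp L W Y Z n (Cmp L W X Y n (a, b), c) = Cmp L W X Z n (a, Cmp L X Y Z n (b, c))"
    using * by (simp add: Cmp_cl)
qed (use psh_L cl_in_L[of 0 _ "[]"] in \<open>auto simp: Unit_cl\<close>)

definition incl :: "'j \<Rightarrow> ('o, 'a, ('j, 'o) col_ob, ('j, 'o, 'a) letter list set) sfun" where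
  "incl j = \<lparr>Src = fob D j, Tgt = scat_colim J D,
     Omap = (\<lambda>x\<in>Obj (fob D j). q j x),
     Hmap = (\<lambda>x\<in>Obj (fob D j). \<lambda>y\<in>Obj (fob D j). \<lambda>n. \<lambda>a\<in>cells (Hom (fob D j) x y) n.
       cl (q j x) (q j y) n [(j, x, y, a)])\<rparr>"

lemma sfun_incl:
  assumes j: "j \<in> Ob J" shows "is_sfun (incl j)"
proof -
  have st: "Src (incl j) = fob D j" "Tgt (incl j) = L" by (simp_all add: incl_def)
  have o: "Omap (incl j) x = q j x" if "x \<in> Obj (fob D j)" for x
    using that by (simp add: incl_def)
  have h: "Hmap (incl j) x y n = (\<lambda>a\<in>cells (Hom (fob D j) x y) n. cl (q j x) (q j y) n [(j, x, y, a)])"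
    if "x \<in> Obj (fob D j)" "y \<in> Obj (fob D j)" for x y n
    using that by (simp add: incl_def)
  have hom: "Hmap (incl j) x y
      \<in> psh_hom simplex_cat (Hom (fob D j) x y) (Hom L (Omap (incl j) x) (Omap (incl j) y))"
    if xy: "x \<in> Obj (fob D j)" "y \<in> Obj (fob D j)" for x y
    unfolding psh_hom_def o[OF xy(1)] o[OF xy(2)] h[OF xy]
    using xy j psh_act_cells[OF scat_psh[OF D_ob[OF j] xy]]
    by (auto simp: act_cl lact_def intro!: cl_in_L)
  show ?thesis
    unfolding is_sfun_def st
  proof (intro conjI ballI allI)
    show "Omap (incl j) \<in> Obj (fob D j) \<rightarrow>\<^sub>E Obj L"
      using q_in_L[OF j] by (auto simp: incl_def)
    show "Hmap (incl j) \<in> (\<Pi>\<^sub>E x\<in>Obj (fob D j). \<Pi>\<^sub>E y\<in>Obj (fob D j).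
       psh_hom simplex_cat (Hom (fob D j) x y) (Hom L (Omap (incl j) x) (Omap (incl j) y)))"
      by (intro PiE_I hom) (simp_all add: incl_def)
  next
    fix x assume x: "x \<in> Obj (fob D j)"
    have u: "Unit (fob D j) x \<in> cells (Hom (fob D j) x x) 0"
      using D_ob[OF j] x by (simp add: is_scat_def)
    have "(0, 0, \<lambda>i\<in>{..0}. 0) = Idn simplex_cat 0" by (auto simp: simplex_cat_def fun_eq_iff)
    then have "unit_simplex (fob D j) x 0 = Unit (fob D j) x"
      using scat_psh[OF D_ob[OF j] x x] u by (simp add: unit_simplex_def is_presheaf_def)
    then have "path_step J D 0 [(j, x, x, Unit (fob D j) x)] []"
      using path_step.intros(2)[of J D 0 "[]" j x "[]"] by simp
    then have "cl (q j x) (q j x) 0 [(j, x, x, Unit (fob D j) x)] = cl (q j x) (q j x) 0 []"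
      by (rule cl_step) (use u x j in auto)
    then show "Hmap (incl j) x x 0 (Unit (fob D j) x) = Unit L (Omap (incl j) x)"
      unfolding Unit_cl by (simp add: h[OF x x] o[OF x] u)
  next
    fix x y z n a b
    assume xyz: "x \<in> Obj (fob D j)" "y \<in> Obj (fob D j)" "z \<in> Obj (fob D j)"
      "a \<in> cells (Hom (fob D j) x y) n" "b \<in> cells (Hom (fob D j) y z) n"
    note c = scat_cmp_cell[OF D_ob[OF j] xyz]
    have "cl (q j x) (q j z) n [(j, x, y, a), (j, y, z, b)]
        = cl (q j x) (q j z) n [(j, x, z, Cmp (fob D j) x y z n (a, b))]"
      using path_step.intros(1)[of J D n "[]" j x y a z b "[]"] xyz c j by (intro cl_step) simp_all
    then show "Hmap (incl j) x z n (Cmp (fob D j) x y z n (a, b))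
       = Cmp L (Omap (incl j) x) (Omap (incl j) y) (Omap (incl j) z) n
           (Hmap (incl j) x y n a, Hmap (incl j) y z n b)"
      using xyz c j by (simp add: h o Cmp_cl)
  qed (rule D_ob[OF j] scat_L)+
qed

lemma incl_arr:
  assumes "u \<in> Ar J"
  shows "efun_comp (incl (Cod J u)) (far D u) = incl (Dom J u)"
proof (rule sfun_eqI)
  note D = D_ar[OF assms]
  show "is_sfun (efun_comp (incl (Cod J u)) (far D u))"
    by (rule sfun_comp) (use D sfun_incl in \<open>auto simp: incl_def\<close>)
  show "is_sfun (incl (Dom J u))" using D sfun_incl by simp
  show "Src (efun_comp (incl (Cod J u)) (far D u)) = Src (incl (Dom J u))"
    "Tgt (efun_comp (incl (Cod J u)) (far D u)) = Tgt (incl (Dom J u))"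
    using D by (simp_all add: efun_comp_def incl_def)
  have o: "Omap (far D u) x \<in> Obj (fob D (Cod J u))" if "x \<in> Obj (fob D (Dom J u))" for x
    using sfun_ob[OF D(1)] that D by simp
  fix x assume "x \<in> Obj (Src (efun_comp (incl (Cod J u)) (far D u)))"
  then have x: "x \<in> Obj (fob D (Dom J u))" using D by (simp add: efun_comp_def)
  show "Omap (efun_comp (incl (Cod J u)) (far D u)) x = Omap (incl (Dom J u)) x"
    using x D o q_arr[OF assms] by (simp add: efun_comp_def incl_def)
  fix y n a assume "y \<in> Obj (Src (efun_comp (incl (Cod J u)) (far D u)))"
    and "a \<in> cells (Hom (Src (efun_comp (incl (Cod J u)) (far D u))) x y) n"
  then have y: "y \<in> Obj (fob D (Dom J u))" and a: "a \<in> cells (Hom (fob D (Dom J u)) x y) n"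
    using D by (simp_all add: efun_comp_def)
  have h: "Hmap (far D u) x y n a \<in> cells (Hom (fob D (Cod J u)) (Omap (far D u) x) (Omap (far D u) y)) n"
    using sfun_cell[OF D(1), of x y a n] x y a D by simp
  have "cl (q (Dom J u) x) (q (Dom J u) y) n [(Dom J u, x, y, a)] =
      cl (q (Dom J u) x) (q (Dom J u) y) n
       [(Cod J u, Omap (far D u) x, Omap (far D u) y, Hmap (far D u) x y n a)]"
    using path_step.intros(3)[OF assms, of D n "[]" x y a "[]"]
    by (intro cl_step) (use x y a D h o q_arr[OF assms] in simp_all)
  then show "Hmap (efun_comp (incl (Cod J u)) (far D u)) x y n a = Hmap (incl (Dom J u)) x y n a"
    using x y a D o h q_arr[OF assms] by (simp add: efun_comp_def psh_comp_def incl_def)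
qed


fun ev :: "('p, 'b) scat \<Rightarrow> ('j \<Rightarrow> ('o, 'a, 'p, 'b) sfun) \<Rightarrow> nat \<Rightarrow> ('j, 'o, 'a) letter list \<Rightarrow> 'p \<Rightarrow> 'b"
where
  "ev B G n [] r = unit_simplex B r n"
| "ev B G n ((j, x, y, a) # w) r =
     Cmp B (Omap (G j) x) (Omap (G j) y) r n (Hmap (G j) x y n a, ev B G n w r)"

text \<open>\<open>scat_colim J D\<close> with the functors \<open>incl j\<close> is a colimit of \<open>D\<close>; the target \<open>B\<close> may be
  a simplicial category of any HOL type.\<close>

theorem scat_colim_universal:
  fixes B :: "('p, 'b) scat" and G :: "'j \<Rightarrow> ('o, 'a, 'p, 'b) sfun"
  assumes G: "\<And>j. j \<in> Ob J \<Longrightarrow> is_sfun (G j) \<and> Src (G j) = fob D j \<and> Tgt (G j) = B"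
    and B: "is_scat B"
    and cocone: "\<And>u. u \<in> Ar J \<Longrightarrow> efun_comp (G (Cod J u)) (far D u) = G (Dom J u)"
  shows "\<exists>!H. is_sfun H \<and> Src H = scat_colim J D \<and> Tgt H = B
    \<and> (\<forall>j\<in>Ob J. efun_comp H (incl j) = G j)"
proof -
  define obmap where "obmap = (\<lambda>(j, x). Omap (G j) x)"
  define O' where "O' = quot_lift obmap"
  have o_arr: "Omap (G (Cod J u)) (Omap (far D u) x) = Omap (G (Dom J u)) x"
    if "u \<in> Ar J" "x \<in> Obj (fob D (Dom J u))" for u x
    using arg_cong[OF cocone[OF that(1)], of Omap] that D_ar[OF that(1)]
    by (auto simp: efun_comp_def dest: fun_cong[of _ _ x])
  have h_arr: "Hmap (G (Cod J u)) (Omap (far D u) x) (Omap (far D u) y) n (Hmap (far D u) x y n a)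
      = Hmap (G (Dom J u)) x y n a"
    if "u \<in> Ar J" "x \<in> Obj (fob D (Dom J u))" "y \<in> Obj (fob D (Dom J u))"
      "a \<in> cells (Hom (fob D (Dom J u)) x y) n" for u x y n a
  proof -
    have "Hmap (efun_comp (G (Cod J u)) (far D u)) x y n a = Hmap (G (Dom J u)) x y n a"
      using cocone[OF that(1)] by simp
    then show ?thesis using that D_ar[OF that(1)] by (simp add: efun_comp_def psh_comp_def)
  qed
  have O'_q: "O' (q j x) = Omap (G j) x" for j x
  proof -
    have "O' (q j x) = obmap (j, x)"
      unfolding O'_def q_def col_ob_rel_def colim_rel_def
      by (rule quot_lift_class) (auto simp: obmap_def o_arr)
    then show ?thesis by (simp add: obmap_def)
  qed
  have GO: "Omap (G j) x \<in> Obj B" if "j \<in> Ob J" "x \<in> Obj (fob D j)" for j x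
    using sfun_ob[of "G j" x] G[OF that(1)] that by simp
  have GH: "Hmap (G j) x y n a \<in> cells (Hom B (Omap (G j) x) (Omap (G j) y)) n"
    if "j \<in> Ob J" "x \<in> Obj (fob D j)" "y \<in> Obj (fob D j)" "a \<in> cells (Hom (fob D j) x y) n" for j x y n a
    using sfun_cell[of "G j" x y a n] G[OF that(1)] that by simp
  have O'_ob: "O' X \<in> Obj B" if "X \<in> Obj L" for X
    using that GO by (auto simp: Obj_L O'_q)
  have path_ob: "O' X \<in> Obj B" if "path n X w Y" "O' Y \<in> Obj B" for n X w Y
    using that
  proof (cases w)
    case (Cons l w')
    then show ?thesis using that by (cases l) (auto simp: O'_q GO)
  qed simp
  have ev_cell: "ev B G n w (O' Y) \<in> cells (Hom B (O' X) (O' Y)) n"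
    if "path n X w Y" "O' Y \<in> Obj B" for n X w Y
    using that
  proof (induction w arbitrary: X)
    case Nil
    then show ?case using scat_unit_cell[OF B] by simp
  next
    case (Cons l w)
    obtain j x y a where l: "l = (j, x, y, a)" by (cases l)
    then show ?case using Cons scat_cmp_cell[OF B GO GO Cons.prems(2) GH]
      by (simp add: O'_q) (metis O'_q)
  qed
  have ev_app: "ev B G n (v @ w) (O' Z) = Cmp B (O' X) (O' Y) (O' Z) n (ev B G n v (O' Y), ev B G n w (O' Z))"
    if "path n X v Y" "path n Y w Z" "O' Z \<in> Obj B" for n X v Y w Z
    using that(1)
  proof (induction v arbitrary: X)
    case Nil
    then show ?case using scat_cmp_unit(1)[OF B path_ob[OF that(2,3)] that(3) ev_cell[OF that(2,3)]] by simp
  next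
    case (Cons l v)
    obtain j x y a where l: "l = (j, x, y, a)" by (cases l)
    have Y: "O' Y \<in> Obj B" using path_ob that by blast
    from Cons.prems l have *: "j \<in> Ob J" "x \<in> Obj (fob D j)" "y \<in> Obj (fob D j)"
      "a \<in> cells (Hom (fob D j) x y) n" "X = q j x" "path n (q j y) v Y" by auto
    show ?case
      using scat_cmp_assoc[OF B GO[OF *(1,2)] GO[OF *(1,3)] Y that(3) GH[OF *(1-4)]
          ev_cell[OF *(6) Y, unfolded O'_q] ev_cell[OF that(2,3)]] Cons.IH[OF *(6)] *
      by (simp add: l O'_q)
  qed
  have ev_single: "ev B G n [(j, x, y, a)] (O' (q j y)) = Hmap (G j) x y n a"
    if "j \<in> Ob J" "x \<in> Obj (fob D j)" "y \<in> Obj (fob D j)" "a \<in> cells (Hom (fob D j) x y) n" for j x y n a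
    using scat_cmp_unit(2)[OF B GO[OF that(1,2)] GO[OF that(1,3)] GH[OF that]] by (simp add: O'_q)
  have ev_ctxt: "ev B G n (p @ v @ r) (O' Y) = ev B G n (p @ w @ r) (O' Y)"
    if "path n X (p @ v @ r) Y" "path n X (p @ w @ r) Y" "O' Y \<in> Obj B"
      "\<And>X1 Y1. path n X1 v Y1 \<Longrightarrow> path n X1 w Y1 \<Longrightarrow> O' Y1 \<in> Obj B \<Longrightarrow> ev B G n v (O' Y1) = ev B G n w (O' Y1)"
      "\<And>X1 Y1. path n X1 v Y1 \<Longrightarrow> path n X1 w Y1"
    for n X p v w r Y
  proof -
    from that(1) obtain X1 Y1 where 1: "path n X p X1" "path n X1 v Y1" "path n Y1 r Y"
      by (auto simp: path_append)
    have 2: "path n X1 w Y1" using that(5) 1 by blast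
    have Y1: "O' Y1 \<in> Obj B" using path_ob[OF 1(3) that(3)] .
    have pv: "path n X1 (v @ r) Y" "path n X1 (w @ r) Y" using 1 2 path_append by blast+
    show ?thesis
      using ev_app[OF 1(1) pv(1) that(3)] ev_app[OF 1(1) pv(2) that(3)]
        ev_app[OF 1(2) 1(3) that(3)] ev_app[OF 2 1(3) that(3)] that(4)[OF 1(2) 2 Y1] by simp
  qed
  have ev_step: "ev B G n v (O' Y) = ev B G n w (O' Y)"
    if "path_step J D n v w" "path n X v Y" "path n X w Y" "O' Y \<in> Obj B" for n v w X Y
    using that
  proof (induction rule: path_step.cases)
    case (1 v' j x y a z b w')
    show ?case unfolding 1
    proof (rule ev_ctxt)
      show "path n X (v' @ [(j, x, y, a), (j, y, z, b)] @ w') Y"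
        "path n X (v' @ [(j, x, z, Cmp (fob D j) x y z n (a, b))] @ w') Y"
        using 1 by simp_all
      fix X1 Y1 assume *: "path n X1 [(j, x, y, a), (j, y, z, b)] Y1"
      then show "path n X1 [(j, x, z, Cmp (fob D j) x y z n (a, b))] Y1"
        using scat_cmp_cell[OF D_ob] by auto
      assume "O' Y1 \<in> Obj B"
      have j: "j \<in> Ob J" and o: "x \<in> Obj (fob D j)" "y \<in> Obj (fob D j)" "z \<in> Obj (fob D j)"
        and ab: "a \<in> cells (Hom (fob D j) x y) n" "b \<in> cells (Hom (fob D j) y z) n"
        and Y1: "Y1 = q j z" using * by auto
      have Gj: "is_sfun (G j)" "Src (G j) = fob D j" "Tgt (G j) = B" using G[OF j] by auto
      have "ev B G n [(j, x, z, Cmp (fob D j) x y z n (a, b))] (O' Y1)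
          = Hmap (G j) x z n (Cmp (fob D j) x y z n (a, b))"
        using ev_single[OF j o(1,3) scat_cmp_cell[OF D_ob[OF j] o ab]] Y1 by simp
      also have "\<dots> = Cmp B (Omap (G j) x) (Omap (G j) y) (Omap (G j) z) n
          (Hmap (G j) x y n a, Hmap (G j) y z n b)"
        using sfun_cmp[OF Gj(1), unfolded Gj, OF o ab] .
      also have "\<dots> = ev B G n [(j, x, y, a), (j, y, z, b)] (O' Y1)"
        using ev_single[OF j o(2,3) ab(2)] Y1 by (simp add: O'_q)
      finally show "ev B G n [(j, x, y, a), (j, y, z, b)] (O' Y1)
          = ev B G n [(j, x, z, Cmp (fob D j) x y z n (a, b))] (O' Y1)" by simp
    qed (use 1 in simp)
  next
    case (2 v' j x w')
    have "ev B G n (v' @ [(j, x, x, unit_simplex (fob D j) x n)] @ w') (O' Y) = ev B G n (v' @ [] @ w') (O' Y)"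
    proof (rule ev_ctxt)
      show "path n X (v' @ [(j, x, x, unit_simplex (fob D j) x n)] @ w') Y" "path n X (v' @ [] @ w') Y"
        using 2 by simp_all
      fix X1 Y1 assume *: "path n X1 [(j, x, x, unit_simplex (fob D j) x n)] Y1"
      then show "path n X1 [] Y1" by auto
      have j: "j \<in> Ob J" and x: "x \<in> Obj (fob D j)" and Y1: "Y1 = q j x" using * by auto
      have Gj: "is_sfun (G j)" "Src (G j) = fob D j" "Tgt (G j) = B" using G[OF j] by auto
      show "ev B G n [(j, x, x, unit_simplex (fob D j) x n)] (O' Y1) = ev B G n [] (O' Y1)"
        using ev_single[OF j x x scat_unit_cell[OF D_ob[OF j] x]] Y1
          sfun_unit[OF Gj(1), unfolded Gj, OF x] by (simp add: O'_q)
    qed (use 2 in simp)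
    then show ?case using 2 by simp
  next
    case (3 u v' x y a w')
    note D = D_ar[OF \<open>u \<in> Ar J\<close>]
    let ?l = "(Cod J u, Omap (far D u) x, Omap (far D u) y, Hmap (far D u) x y n a)"
    have "ev B G n (v' @ [(Dom J u, x, y, a)] @ w') (O' Y) = ev B G n (v' @ [?l] @ w') (O' Y)"
    proof (rule ev_ctxt)
      show "path n X (v' @ [(Dom J u, x, y, a)] @ w') Y" "path n X (v' @ [?l] @ w') Y"
        using 3 by simp_all
      fix X1 Y1 assume *: "path n X1 [(Dom J u, x, y, a)] Y1"
      have o: "x \<in> Obj (fob D (Dom J u))" "y \<in> Obj (fob D (Dom J u))"
        and a: "a \<in> cells (Hom (fob D (Dom J u)) x y) n" and Y1: "X1 = q (Dom J u) x" "Y1 = q (Dom J u) y"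
        using * by auto
      have o': "Omap (far D u) x \<in> Obj (fob D (Cod J u))" "Omap (far D u) y \<in> Obj (fob D (Cod J u))"
        using sfun_ob[OF D(1), unfolded D] o by auto
      have a': "Hmap (far D u) x y n a
          \<in> cells (Hom (fob D (Cod J u)) (Omap (far D u) x) (Omap (far D u) y)) n"
        using sfun_cell[OF D(1), unfolded D, OF o a] .
      show "path n X1 [?l] Y1" using o o' a' Y1 D q_arr[OF \<open>u \<in> Ar J\<close>] by simp
      have Y1': "Y1 = q (Cod J u) (Omap (far D u) y)" using Y1 q_arr[OF \<open>u \<in> Ar J\<close> o(2)] by simp
      have "ev B G n [(Dom J u, x, y, a)] (O' Y1) = Hmap (G (Dom J u)) x y n a"
        using ev_single[OF D(4) o a] Y1 by simp
      moreover have "ev B G n [?l] (O' Y1) = Hmap (G (Dom J u)) x y n a"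
        using ev_single[OF D(5) o' a'] h_arr[OF \<open>u \<in> Ar J\<close> o a] Y1' by (simp del: ev.simps)
      ultimately show "ev B G n [(Dom J u, x, y, a)] (O' Y1) = ev B G n [?l] (O' Y1)" by simp
    qed (use 3 in simp)
    then show ?case using 3 by simp
  qed
  define H where "H = \<lparr>Src = L, Tgt = B, Omap = (\<lambda>X\<in>Obj L. O' X),
    Hmap = (\<lambda>X\<in>Obj L. \<lambda>Y\<in>Obj L. \<lambda>n. \<lambda>W\<in>cells (Hom L X Y) n.
      quot_lift (\<lambda>w. ev B G n w (O' Y)) W)\<rparr>"
  have H_cl: "Hmap H X Y n (cl X Y n w) = ev B G n w (O' Y)"
    if "X \<in> Obj L" "Y \<in> Obj L" "path n X w Y" for X Y n w
  proof -
    have "quot_lift (\<lambda>w. ev B G n w (O' Y)) (cl X Y n w) = ev B G n w (O' Y)"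
      unfolding cl_def path_rel_def
      by (rule quot_lift_class) (use ev_step[of n _ _ X Y] O'_ob[OF that(2)] in auto)
    then show ?thesis using that cl_in_L by (simp add: H_def)
  qed
  have HO: "Omap H X = O' X" if "X \<in> Obj L" for X using that by (simp add: H_def)
  have st: "Src H = L" "Tgt H = B" by (simp_all add: H_def)
  have lact_ev: "ev B G (Dom simplex_cat u) (map (lact u) w) (O' Y)
      = act (Hom B (O' X) (O' Y)) u (ev B G (Cod simplex_cat u) w (O' Y))"
    if u: "u \<in> Ar simplex_cat" and "path (Cod simplex_cat u) X w Y" and Y: "O' Y \<in> Obj B" for u X w Y
    using that(2)
  proof (induction w arbitrary: X)
    case Nil
    then show ?case using scat_unit_act[OF B Y u] by simp
  next
    case (Cons l w)
    obtain j x y a where l: "l = (j, x, y, a)" by (cases l)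
    then have *: "j \<in> Ob J" "x \<in> Obj (fob D j)" "y \<in> Obj (fob D j)"
      "a \<in> cells (Hom (fob D j) x y) (Cod simplex_cat u)" "X = q j x" "path (Cod simplex_cat u) (q j y) w Y"
      using Cons.prems by auto
    have Gj: "is_sfun (G j)" "Src (G j) = fob D j" "Tgt (G j) = B" using G[OF *(1)] by auto
    show ?case
      using scat_cmp_act[OF B GO[OF *(1,2)] GO[OF *(1,3)] Y u GH[OF *(1-4)] ev_cell[OF *(6) Y, unfolded O'_q]]
        Cons.IH[OF *(6)] sfun_act[OF Gj(1), unfolded Gj, OF *(2,3) u *(4)] *(5)
      by (simp add: l lact_def O'_q)
  qed
  have Hs: "is_sfun H"
    unfolding is_sfun_def st
  proof (intro conjI ballI allI)
    show "is_scat L" by (rule scat_L)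
    show "is_scat B" by (rule B)
    show "Omap H \<in> Obj L \<rightarrow>\<^sub>E Obj B" using O'_ob by (auto simp: H_def)
    show "Hmap H \<in> (\<Pi>\<^sub>E X\<in>Obj L. \<Pi>\<^sub>E Y\<in>Obj L. psh_hom simplex_cat (Hom L X Y) (Hom B (Omap H X) (Omap H Y)))"
    proof (intro PiE_I)
      fix X Y assume X: "X \<in> Obj L" and Y: "Y \<in> Obj L"
      show "Hmap H X Y \<in> psh_hom simplex_cat (Hom L X Y) (Hom B (Omap H X) (Omap H Y))"
        unfolding psh_hom_def
      proof (intro CollectI conjI allI ballI)
        fix n
        show "Hmap H X Y n \<in> cells (Hom L X Y) n \<rightarrow>\<^sub>E cells (Hom B (Omap H X) (Omap H Y)) n"
        proof (rule PiE_I)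
          fix W assume "W \<in> cells (Hom L X Y) n"
          then obtain w where w: "path n X w Y" "W = cl X Y n w" by (rule cells_L_E)
          then show "Hmap H X Y n W \<in> cells (Hom B (Omap H X) (Omap H Y)) n"
            using H_cl[OF X Y] ev_cell O'_ob[OF Y] HO X Y by simp
        qed (simp add: H_def X Y)
      next
        fix u W assume u: "u \<in> Ar simplex_cat" and "W \<in> cells (Hom L X Y) (Cod simplex_cat u)"
        then obtain w where w: "path (Cod simplex_cat u) X w Y" "W = cl X Y (Cod simplex_cat u) w"
          by (elim cells_L_E)
        show "Hmap H X Y (Dom simplex_cat u) (act (Hom L X Y) u W)
            = act (Hom B (Omap H X) (Omap H Y)) u (Hmap H X Y (Cod simplex_cat u) W)"
          using w(1) lact_ev[OF u w(1) O'_ob[OF Y]]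
          by (simp add: w(2) act_cl[OF u] H_cl X Y path_lact[OF u] HO)
      qed
    qed (simp_all add: H_def)
    fix X assume X: "X \<in> Obj L"
    have "(0, 0, \<lambda>i\<in>{..0}. 0) = Idn simplex_cat 0" by (auto simp: simplex_cat_def fun_eq_iff)
    then have "unit_simplex B (O' X) 0 = Unit B (O' X)"
      using B scat_psh[OF B O'_ob[OF X] O'_ob[OF X]] O'_ob[OF X]
      by (simp add: unit_simplex_def is_presheaf_def is_scat_def)
    then show "Hmap H X X 0 (Unit L X) = Unit B (Omap H X)"
      using X by (simp add: Unit_cl H_cl HO)
  next
    fix X Y Z n a b assume XYZ: "X \<in> Obj L" "Y \<in> Obj L" "Z \<in> Obj L"
      and "a \<in> cells (Hom L X Y) n" "b \<in> cells (Hom L Y Z) n"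
    then obtain v w where vw: "path n X v Y" "a = cl X Y n v" "path n Y w Z" "b = cl Y Z n w"
      by (elim cells_L_E)
    then have "path n X (v @ w) Z" using path_append by blast
    then show "Hmap H X Z n (Cmp L X Y Z n (a, b))
       = Cmp B (Omap H X) (Omap H Y) (Omap H Z) n (Hmap H X Y n a, Hmap H Y Z n b)"
      using vw XYZ ev_app[OF vw(1,3) O'_ob[OF XYZ(3)]] by (simp add: Cmp_cl H_cl HO)
  qed
  have Hi: "efun_comp H (incl j) = G j" if j: "j \<in> Ob J" for j
  proof (rule sfun_eqI)
    show "is_sfun (efun_comp H (incl j))"
      by (rule sfun_comp[OF sfun_incl[OF j] Hs]) (simp add: incl_def st)
    show "is_sfun (G j)" using G[OF j] by simp
    show "Src (efun_comp H (incl j)) = Src (G j)" "Tgt (efun_comp H (incl j)) = Tgt (G j)"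
      using G[OF j] by (simp_all add: efun_comp_def incl_def st)
    fix x assume "x \<in> Obj (Src (efun_comp H (incl j)))"
    then have x: "x \<in> Obj (fob D j)" by (simp add: efun_comp_def incl_def)
    show "Omap (efun_comp H (incl j)) x = Omap (G j) x"
      using x q_in_L[OF j x] by (simp add: efun_comp_def incl_def HO O'_q)
    fix y n a assume "y \<in> Obj (Src (efun_comp H (incl j)))"
      "a \<in> cells (Hom (Src (efun_comp H (incl j))) x y) n"
    then have y: "y \<in> Obj (fob D j)" and a: "a \<in> cells (Hom (fob D j) x y) n"
      by (simp_all add: efun_comp_def incl_def)
    show "Hmap (efun_comp H (incl j)) x y n a = Hmap (G j) x y n a"
      using x y a j H_cl[OF q_in_L[OF j x] q_in_L[OF j y], of n "[(j, x, y, a)]"] ev_single[OF j x y a]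
      by (simp add: efun_comp_def psh_comp_def incl_def del: ev.simps)
  qed
  show ?thesis
  proof (rule ex1I[of _ H])
    show "is_sfun H \<and> Src H = scat_colim J D \<and> Tgt H = B \<and> (\<forall>j\<in>Ob J. efun_comp H (incl j) = G j)"
      using Hs st Hi by simp
    fix K assume K: "is_sfun K \<and> Src K = scat_colim J D \<and> Tgt K = B \<and> (\<forall>j\<in>Ob J. efun_comp K (incl j) = G j)"
    then have Ks: "is_sfun K" "Src K = L" "Tgt K = B" by auto
    have KO: "Omap K (q j x) = Omap (G j) x" if "j \<in> Ob J" "x \<in> Obj (fob D j)" for j x
    proof -
      have "Omap (efun_comp K (incl j)) x = Omap (G j) x" using K that by simp
      then show ?thesis using that by (simp add: efun_comp_def incl_def)
    qed
    then have KO': "Omap K X = O' X" if "X \<in> Obj L" for X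
      using that by (auto simp: Obj_L O'_q)
    have KH: "Hmap K (q j x) (q j y) n (cl (q j x) (q j y) n [(j, x, y, a)]) = Hmap (G j) x y n a"
      if "j \<in> Ob J" "x \<in> Obj (fob D j)" "y \<in> Obj (fob D j)" "a \<in> cells (Hom (fob D j) x y) n" for j x y n a
    proof -
      have "Hmap (efun_comp K (incl j)) x y n a = Hmap (G j) x y n a" using K that by simp
      then show ?thesis using that by (simp add: efun_comp_def psh_comp_def incl_def)
    qed
    have Kev: "Hmap K X Y n (cl X Y n w) = ev B G n w (O' Y)"
      if "path n X w Y" "X \<in> Obj L" "Y \<in> Obj L" for X Y n w
      using that(1,2)
    proof (induction w arbitrary: X)
      case Nil
      then show ?case using sfun_unit[OF Ks(1), unfolded Ks, OF that(3), of n] KO'[OF that(3)]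
        by (simp add: unit_simplex_cl)
    next
      case (Cons l w)
      obtain j x y a where l: "l = (j, x, y, a)" by (cases l)
      then have *: "j \<in> Ob J" "x \<in> Obj (fob D j)" "y \<in> Obj (fob D j)"
        "a \<in> cells (Hom (fob D j) x y) n" "X = q j x" "path n (q j y) w Y" using Cons.prems by auto
      have p: "path n (q j x) [(j, x, y, a)] (q j y)" using * by simp
      have "Hmap K X Y n (cl X Y n (l # w))
          = Hmap K X Y n (Cmp L X (q j y) Y n (cl X (q j y) n [(j, x, y, a)], cl (q j y) Y n w))"
        using Cmp_cl[OF p *(6)] *(5) l by simp
      also have "\<dots> = Cmp B (O' X) (O' (q j y)) (O' Y) n
          (Hmap K X (q j y) n (cl X (q j y) n [(j, x, y, a)]), Hmap K (q j y) Y n (cl (q j y) Y n w))"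
        using sfun_cmp[OF Ks(1), unfolded Ks, OF Cons.prems(2) q_in_L[OF *(1,3)] that(3)]
          cl_in_L[OF p] cl_in_L[OF *(6)] KO' Cons.prems(2) q_in_L[OF *(1,3)] that(3) *(5) by simp
      also have "\<dots> = ev B G n (l # w) (O' Y)"
        using KH[OF *(1-4)] Cons.IH[OF *(6) q_in_L[OF *(1,3)]] *(5) l by (simp add: O'_q)
      finally show ?case .
    qed
    show "K = H"
    proof (rule sfun_eqI[OF Ks(1) Hs])
      fix X assume "X \<in> Obj (Src K)"
      then show "Omap K X = Omap H X" using KO' HO Ks by simp
    next
      fix X Y n W assume *: "X \<in> Obj (Src K)" "Y \<in> Obj (Src K)" "W \<in> cells (Hom (Src K) X Y) n"
      then obtain w where "path n X w Y" "W = cl X Y n w" using cells_L_E Ks by metis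
      then show "Hmap K X Y n W = Hmap H X Y n W" using Kev H_cl * Ks by simp
    qed (simp_all add: Ks st)
  qed
qed

end


section \<open>The rigidification functor\<close>

definition path_poset :: "nat \<Rightarrow> nat \<Rightarrow> nat set set" where
  "path_poset i j = (if i \<le> j then {X. X \<subseteq> {i..j} \<and> i \<in> X \<and> j \<in> X} else {})"

text \<open>Note that the nerve of the empty poset is the empty simplicial set.\<close>

definition C_simplex :: "nat \<Rightarrow> (nat, nat \<Rightarrow> nat set) scat" where
  "C_simplex n =
     \<lparr>Obj = {..n},
      Hom = (\<lambda>i j. nerve (path_poset i j) (\<subseteq>)),
      Unit = (\<lambda>i. \<lambda>t\<in>{..0}. {i}),
      Cmp = (\<lambda>i j l k.
        \<lambda>(c, d)\<in>cells (prod_psh (nerve (path_poset i j) (\<subseteq>)) (nerve (path_poset j l) (\<subseteq>))) k.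
          \<lambda>t\<in>{..k}. c t \<union> d t)\<rparr>"

definition C_simplex_functor ::
  "(nat, simp_arr, (nat, nat \<Rightarrow> nat set) scat, (nat, nat \<Rightarrow> nat set, nat, nat \<Rightarrow> nat set) sfun) func"
where
  "C_simplex_functor =
     \<lparr>fob = C_simplex,
      far = (\<lambda>(m, n, f).
        \<lparr>Src = C_simplex m, Tgt = C_simplex n, Omap = f,
         Hmap = (\<lambda>i\<in>{..m}. \<lambda>j\<in>{..m}. nerve_map (path_poset i j) (\<subseteq>) (\<lambda>X. f ` X))\<rparr>)\<rparr>"

type_synonym 'a simp_element_arr = "'a element \<times> simp_arr \<times> 'a element"
type_synonym 'a C_ob = "('a element, nat) col_ob"
type_synonym 'a C_cell = "('a element, nat, nat \<Rightarrow> nat set) letter list set"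

definition C_diagram ::
  "('a element, 'a simp_element_arr,
    (nat, nat \<Rightarrow> nat set) scat, (nat, nat \<Rightarrow> nat set, nat, nat \<Rightarrow> nat set) sfun) func"
where
  "C_diagram = C_simplex_functor \<circ>\<^sub>F elements_proj"

lemma psh_id_hom:
  assumes "is_presheaf C P" shows "psh_id P \<in> psh_hom C P P"
  using assms unfolding psh_id_def psh_hom_def is_presheaf_def by auto

lemma efun_id_sfun: 
  assumes "is_scat A" shows "is_sfun (efun_id A)"
proof -
  have "Hmap (efun_id A) \<in> (\<Pi>\<^sub>E x\<in>Obj A. \<Pi>\<^sub>E y\<in>Obj A.
      psh_hom simplex_cat (Hom A x y) (Hom A (Omap (efun_id A) x) (Omap (efun_id A) y)))"
    using psh_id_hom[OF scat_psh[OF assms]] by (intro PiE_I) (simp_all add: efun_id_def)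
  moreover have "\<forall>x\<in>Obj A. Unit A x \<in> cells (Hom A x x) 0" using assms by (simp add: is_scat_def)
  ultimately show ?thesis using assms scat_cmp_cell[OF assms]
    unfolding is_sfun_def by (simp add: efun_id_def psh_id_def)
qed

lemma SCat_category: "is_category (SCat :: (('o, 'a) scat, ('o, 'a, 'o, 'a) sfun) cat)"
proof -
  have l: "efun_comp F (efun_id (Src F)) = F" if F: "is_sfun F" for F :: "('o, 'a, 'o, 'a) sfun"
  proof (rule sfun_eqI)
    have A: "is_scat (Src F)" using F by (simp add: is_sfun_def)
    show "is_sfun (efun_comp F (efun_id (Src F)))"
      using sfun_comp[OF efun_id_sfun[OF A] F] by (simp add: efun_id_def)
  qed (use F in \<open>auto simp: efun_comp_def efun_id_def psh_comp_def psh_id_def\<close>)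
  have r: "efun_comp (efun_id (Tgt F)) F = F" if F: "is_sfun F" for F :: "('o, 'a, 'o, 'a) sfun"
  proof (rule sfun_eqI)
    have A: "is_scat (Tgt F)" using F by (simp add: is_sfun_def)
    show "is_sfun (efun_comp (efun_id (Tgt F)) F)"
      using sfun_comp[OF F efun_id_sfun[OF A]] by (simp add: efun_id_def)
  qed (use F sfun_ob[OF F] sfun_cell[OF F] in
        \<open>auto simp: efun_comp_def efun_id_def psh_comp_def psh_id_def\<close>)
  have a: "efun_comp K (efun_comp G F) = efun_comp (efun_comp K G) F"
    if F: "is_sfun F" and G: "is_sfun G" and K: "is_sfun K" and "Src G = Tgt F" "Src K = Tgt G"
    for F G K :: "('o, 'a, 'o, 'a) sfun"
  proof (rule sfun_eqI)
    have s: "Src (efun_comp G F) = Src F" "Tgt (efun_comp G F) = Tgt G"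
      "Src (efun_comp K G) = Src G" "Tgt (efun_comp K G) = Tgt K" by (simp_all add: efun_comp_def)
    have GF: "is_sfun (efun_comp G F)" and KG: "is_sfun (efun_comp K G)"
      using that sfun_comp by metis+
    show "is_sfun (efun_comp K (efun_comp G F))" "is_sfun (efun_comp (efun_comp K G) F)"
      using sfun_comp[OF GF K] sfun_comp[OF F KG] s that by simp_all
  qed (use that sfun_ob[OF F] sfun_cell[OF F] in \<open>simp_all add: efun_comp_def psh_comp_def\<close>)
  have s: "Src (efun_id A) = A" "Tgt (efun_id A) = A" for A :: "('o, 'a) scat"
    by (simp_all add: efun_id_def)
  have t: "Src (efun_comp G F) = Src F" "Tgt (efun_comp G F) = Tgt G" for F G :: "('o, 'a, 'o, 'a) sfun"
    by (simp_all add: efun_comp_def)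
  have m: "is_scat (Src F) \<and> is_scat (Tgt F)" if "is_sfun F" for F :: "('o, 'a, 'o, 'a) sfun"
    using that by (simp add: is_sfun_def)
  show ?thesis
    unfolding is_category_def SCat_def
    by (simp add: s t m l r a efun_id_sfun sfun_comp)
qed

lemma nerve_psh: "is_presheaf simplex_cat (nerve A le)"
  unfolding is_presheaf_def nerve_def simplex_cat_def
  by (auto simp: PiE_iff mono_on_def fun_eq_iff extensional_def)

lemma nerve_map_hom:
  assumes "\<And>x. x \<in> A \<Longrightarrow> f x \<in> B"
    and "\<And>x y. x \<in> A \<Longrightarrow> y \<in> A \<Longrightarrow> le x y \<Longrightarrow> le' (f x) (f y)"
  shows "nerve_map A le f \<in> psh_hom simplex_cat (nerve A le) (nerve B le')"
proof -
  have "nerve_map A le f n \<in> cells (nerve A le) n \<rightarrow>\<^sub>E cells (nerve B le') n" for n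
    using assms by (auto simp: nerve_map_def nerve_def PiE_iff)
  moreover have "nerve_map A le f (Dom simplex_cat u) (act (nerve A le) u c)
      = act (nerve B le') u (nerve_map A le f (Cod simplex_cat u) c)"
    if "u \<in> Ar simplex_cat" "c \<in> cells (nerve A le) (Cod simplex_cat u)" for u c
  proof -
    have "act (nerve A le) u c \<in> cells (nerve A le) (Dom simplex_cat u)"
      using nerve_psh[of A le] that unfolding is_presheaf_def by blast
    then show ?thesis using that
      by (auto simp: nerve_map_def nerve_def simplex_cat_def PiE_iff fun_eq_iff)
  qed
  ultimately show ?thesis by (simp add: psh_hom_def)
qed

lemma C_simplex_sel [simp]:
  "Obj (C_simplex n) = {..n}" "Hom (C_simplex n) i j = nerve (path_poset i j) (\<subseteq>)"
  "Unit (C_simplex n) i = (\<lambda>t\<in>{..0}. {i})"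
  by (simp_all add: C_simplex_def)

lemma C_simplex_unit: "unit_simplex (C_simplex n) i k = (\<lambda>t\<in>{..k}. {i})"
  by (auto simp: unit_simplex_def nerve_def fun_eq_iff)

lemma C_simplex_Cmp:
  "c \<in> cells (nerve (path_poset i j) (\<subseteq>)) k \<Longrightarrow> d \<in> cells (nerve (path_poset j l) (\<subseteq>)) k \<Longrightarrow>
   Cmp (C_simplex n) i j l k (c, d) = (\<lambda>t\<in>{..k}. c t \<union> d t)"
  by (simp add: C_simplex_def prod_psh_def)

lemma path_poset_Un:
  "X \<in> path_poset i j \<Longrightarrow> Y \<in> path_poset j l \<Longrightarrow> X \<union> Y \<in> path_poset i l"
  by (auto simp: path_poset_def split: if_splits)

lemma path_nerve_cell:
  "c \<in> cells (nerve (path_poset i j) (\<subseteq>)) k \<longleftrightarrow> c \<in> extensional {..k} \<and> (\<forall>t\<le>k. c t \<in> path_poset i j)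
     \<and> (\<forall>s t. s \<le> t \<and> t \<le> k \<longrightarrow> c s \<subseteq> c t)"
  by (auto simp: nerve_def PiE_iff)

lemma path_cell_subset:
  assumes "c \<in> cells (nerve (path_poset i j) (\<subseteq>)) k" "t \<le> k" "j \<le> m"
  shows "c t \<subseteq> {..m}"
proof -
  have "c t \<in> path_poset i j" using assms unfolding path_nerve_cell by blast
  then have "c t \<subseteq> {i..j}" by (simp add: path_poset_def split: if_splits)
  then show ?thesis using assms(3) by auto
qed

lemma C_simplex_Cmp_cell:
  assumes "c \<in> cells (nerve (path_poset i j) (\<subseteq>)) k" "d \<in> cells (nerve (path_poset j l) (\<subseteq>)) k"
  shows "(\<lambda>t\<in>{..k}. c t \<union> d t) \<in> cells (nerve (path_poset i l) (\<subseteq>)) k"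
proof -
  have "c s \<union> d s \<subseteq> c t \<union> d t" if "s \<le> t" "t \<le> k" for s t
    using assms that unfolding path_nerve_cell by (intro Un_mono) blast+
  moreover have "c t \<union> d t \<in> path_poset i l" if "t \<le> k" for t
    by (rule path_poset_Un) (use assms that in \<open>auto simp: path_nerve_cell\<close>)
  ultimately show ?thesis unfolding path_nerve_cell by simp
qed

lemma C_simplex_unit_cell: "(\<lambda>t\<in>{..k}. {i}) \<in> cells (nerve (path_poset i i) (\<subseteq>)) k"
  unfolding path_nerve_cell by (simp add: path_poset_def)

lemma C_simplex_scat: "is_scat (C_simplex n)"
  unfolding is_scat_def C_simplex_unit C_simplex_sel
proof (intro conjI ballI allI)
  fix i show "(\<lambda>t\<in>{..0}. {i}) \<in> cells (nerve (path_poset i i) (\<subseteq>)) 0"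
    by (rule C_simplex_unit_cell)
next
  fix i j l
  let ?P = "prod_psh (nerve (path_poset i j) (\<subseteq>)) (nerve (path_poset j l) (\<subseteq>))"
  show "Cmp (C_simplex n) i j l \<in> psh_hom simplex_cat ?P (nerve (path_poset i l) (\<subseteq>))"
    unfolding psh_hom_def
  proof (intro CollectI conjI allI ballI)
    fix k
    show "Cmp (C_simplex n) i j l k \<in> cells ?P k \<rightarrow>\<^sub>E cells (nerve (path_poset i l) (\<subseteq>)) k"
    proof (rule PiE_I)
      fix p assume "p \<in> cells ?P k"
      then show "Cmp (C_simplex n) i j l k p \<in> cells (nerve (path_poset i l) (\<subseteq>)) k"
        by (cases p) (simp add: prod_psh_def C_simplex_Cmp C_simplex_Cmp_cell[of _ i j])
    qed (simp add: C_simplex_def)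
  next
    fix u p assume u: "u \<in> Ar simplex_cat" and "p \<in> cells ?P (Cod simplex_cat u)"
    then obtain c d where p: "p = (c, d)"
      and c: "c \<in> cells (nerve (path_poset i j) (\<subseteq>)) (Cod simplex_cat u)"
      and d: "d \<in> cells (nerve (path_poset j l) (\<subseteq>)) (Cod simplex_cat u)"
      by (cases p) (simp add: prod_psh_def)
    obtain m k f where uf: "u = (m, k, f)" by (cases u)
    have f: "t \<le> m \<Longrightarrow> f t \<le> k" for t using u uf by (auto simp: simplex_cat_def)
    have "act (nerve (path_poset i l) (\<subseteq>)) u (\<lambda>t\<in>{..k}. c t \<union> d t) = (\<lambda>t\<in>{..m}. c (f t) \<union> d (f t))"
      using f by (auto simp: nerve_def uf fun_eq_iff)
    moreover have "Cmp (C_simplex n) i j l m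
        (act (nerve (path_poset i j) (\<subseteq>)) u c, act (nerve (path_poset j l) (\<subseteq>)) u d)
        = (\<lambda>t\<in>{..m}. c (f t) \<union> d (f t))"
      using C_simplex_Cmp[OF psh_act_cells[OF nerve_psh u c] psh_act_cells[OF nerve_psh u d]]
      by (auto simp: uf simplex_cat_def nerve_def fun_eq_iff)
    ultimately show "Cmp (C_simplex n) i j l (Dom simplex_cat u) (act ?P u p)
        = act (nerve (path_poset i l) (\<subseteq>)) u (Cmp (C_simplex n) i j l (Cod simplex_cat u) p)"
      using C_simplex_Cmp[OF c d] by (simp add: p uf prod_psh_def simplex_cat_def)
  qed
next
  fix i j k c assume c: "c \<in> cells (nerve (path_poset i j) (\<subseteq>)) k"
  note u = C_simplex_unit_cell
  have "i \<in> c t \<and> j \<in> c t" if "t \<le> k" for t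
  proof -
    have "c t \<in> path_poset i j" using c that unfolding path_nerve_cell by blast
    then show ?thesis by (simp add: path_poset_def split: if_splits)
  qed
  moreover have "c \<in> extensional {..k}" using c by (simp add: path_nerve_cell)
  ultimately have "(\<lambda>t\<in>{..k}. {i} \<union> c t) = c" "(\<lambda>t\<in>{..k}. c t \<union> {j}) = c"
    by (auto simp: fun_eq_iff extensional_def insert_absorb)
  then show "Cmp (C_simplex n) i i j k (\<lambda>t\<in>{..k}. {i}, c) = c"
    "Cmp (C_simplex n) i j j k (c, \<lambda>t\<in>{..k}. {j}) = c"
    unfolding C_simplex_Cmp[OF u c] C_simplex_Cmp[OF c u] by (simp_all cong: restrict_cong)
next
  fix h i j l k a b c
  assume a: "a \<in> cells (nerve (path_poset h i) (\<subseteq>)) k" and b: "b \<in> cells (nerve (path_poset i j) (\<subseteq>)) k"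
    and c: "c \<in> cells (nerve (path_poset j l) (\<subseteq>)) k"
  show "Cmp (C_simplex n) h j l k (Cmp (C_simplex n) h i j k (a, b), c)
      = Cmp (C_simplex n) h i l k (a, Cmp (C_simplex n) i j l k (b, c))"
    unfolding C_simplex_Cmp[OF a b] C_simplex_Cmp[OF b c]
      C_simplex_Cmp[OF C_simplex_Cmp_cell[OF a b] c] C_simplex_Cmp[OF a C_simplex_Cmp_cell[OF b c]]
    by (auto simp: fun_eq_iff)
qed (rule nerve_psh)

lemma C_simplex_functor_sfun:
  assumes "u \<in> Ar simplex_cat" shows "is_sfun (far C_simplex_functor u)"
proof -
  obtain m n f where u: "u = (m, n, f)" by (cases u)
  have f: "f \<in> {..m} \<rightarrow>\<^sub>E {..n}" "mono_on {..m} f" using assms u by (auto simp: simplex_cat_def)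
  have P: "f ` X \<in> path_poset (f i) (f j)" if "X \<in> path_poset i j" "j \<le> m" for X i j
  proof -
    have "i \<le> j" "X \<subseteq> {i..j}" "i \<in> X" "j \<in> X" using that by (auto simp: path_poset_def split: if_splits)
    moreover have "f i \<le> f x \<and> f x \<le> f j" if "x \<in> {i..j}" for x
      using mono_onD[OF f(2), of i x] mono_onD[OF f(2), of x j] that \<open>j \<le> m\<close> by simp
    ultimately show ?thesis unfolding path_poset_def by fastforce
  qed
  let ?N = "\<lambda>i j. nerve_map (path_poset i j) (\<subseteq>) (\<lambda>X. f ` X)"
  have hom: "?N i j \<in> psh_hom simplex_cat (nerve (path_poset i j) (\<subseteq>)) (nerve (path_poset (f i) (f j)) (\<subseteq>))"
    if "j \<le> m" for i j
    by (rule nerve_map_hom) (use P that in auto)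
  have cell: "?N i j k c \<in> cells (nerve (path_poset (f i) (f j)) (\<subseteq>)) k"
    if "j \<le> m" "c \<in> cells (nerve (path_poset i j) (\<subseteq>)) k" for i j k c
    using hom[OF that(1)] that(2) unfolding psh_hom_def by auto
  have "(\<lambda>i\<in>{..m}. \<lambda>j\<in>{..m}. ?N i j) \<in> (\<Pi>\<^sub>E i\<in>{..m}. \<Pi>\<^sub>E j\<in>{..m}.
      psh_hom simplex_cat (nerve (path_poset i j) (\<subseteq>)) (nerve (path_poset (f i) (f j)) (\<subseteq>)))"
    by (intro PiE_I) (simp_all add: hom)
  moreover have "?N i i 0 (\<lambda>t\<in>{..0}. {i}) = (\<lambda>t\<in>{..0}. {f i})" for i
  proof -
    show ?thesis using C_simplex_unit_cell[where k=0 and i=i] by (auto simp: nerve_map_def fun_eq_iff)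
  qed
  moreover have "?N i l k (Cmp (C_simplex m) i j l k (a, b))
      = Cmp (C_simplex n) (f i) (f j) (f l) k (?N i j k a, ?N j l k b)"
    if "j \<le> m" "l \<le> m" and a: "a \<in> cells (nerve (path_poset i j) (\<subseteq>)) k"
      and b: "b \<in> cells (nerve (path_poset j l) (\<subseteq>)) k" for i j l k a b
    unfolding C_simplex_Cmp[OF a b] C_simplex_Cmp[OF cell[OF that(1) a] cell[OF that(2) b]]
    using C_simplex_Cmp_cell[OF a b] a b by (auto simp: nerve_map_def fun_eq_iff image_Un)
  ultimately show ?thesis
    unfolding is_sfun_def using f(1) C_simplex_scat by (simp add: C_simplex_functor_def u)
qed

lemma C_simplex_functor: "is_functor simplex_cat SCat C_simplex_functor"
proof -
  note S = simplex_cat_category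
  have I: "far C_simplex_functor (Idn simplex_cat n) = efun_id (C_simplex n)" for n
  proof (rule sfun_eqI)
    have "Idn simplex_cat n \<in> Ar simplex_cat" using S by (simp add: is_category_def simplex_cat_def mono_on_def)
    then show "is_sfun (far C_simplex_functor (Idn simplex_cat n))" by (rule C_simplex_functor_sfun)
    show "is_sfun (efun_id (C_simplex n))" using C_simplex_scat by (rule efun_id_sfun)
    fix i j k a assume "i \<in> Obj (Src (far C_simplex_functor (Idn simplex_cat n)))"
      "j \<in> Obj (Src (far C_simplex_functor (Idn simplex_cat n)))"
      and "a \<in> cells (Hom (Src (far C_simplex_functor (Idn simplex_cat n))) i j) k"
    then have ij: "i \<le> n" "j \<le> n" and a: "a \<in> cells (nerve (path_poset i j) (\<subseteq>)) k"
      by (simp_all add: C_simplex_functor_def simplex_cat_def)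
    have "(\<lambda>i\<in>{..n}. i) ` a t = a t" if "t \<le> k" for t
    proof -
      have "a t \<subseteq> {..n}" using path_cell_subset[OF a that ij(2)] .
      then show ?thesis by force
    qed
    then have "(\<lambda>t\<in>{..k}. (\<lambda>i\<in>{..n}. i) ` a t) = (\<lambda>t\<in>{..k}. a t)" by (intro restrict_ext) simp
    also have "\<dots> = a" using a by (simp add: path_nerve_cell extensional_restrict)
    finally show "Hmap (far C_simplex_functor (Idn simplex_cat n)) i j k a = Hmap (efun_id (C_simplex n)) i j k a"
      using ij a by (simp add: C_simplex_functor_def simplex_cat_def efun_id_def psh_id_def nerve_map_def)
  qed (simp_all add: C_simplex_functor_def simplex_cat_def efun_id_def)
  have C: "far C_simplex_functor (Comp simplex_cat v u) = efun_comp (far C_simplex_functor v) (far C_simplex_functor u)"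
    if u: "u \<in> Ar simplex_cat" and v: "v \<in> Ar simplex_cat" and uv: "Dom simplex_cat v = Cod simplex_cat u" for u v
  proof (rule sfun_eqI)
    have "Comp simplex_cat v u \<in> Ar simplex_cat" using S u v uv by (simp add: is_category_def)
    then show "is_sfun (far C_simplex_functor (Comp simplex_cat v u))" by (rule C_simplex_functor_sfun)
    obtain m n f p g where uf: "u = (m, n, f)" "v = (n, p, g)" using uv
      by (cases u, cases v) (simp add: simplex_cat_def)
    have f: "f \<in> {..m} \<rightarrow>\<^sub>E {..n}" using u uf by (simp add: simplex_cat_def)
    have st: "Src (far C_simplex_functor u) = C_simplex m" "Tgt (far C_simplex_functor u) = C_simplex n"
      "Src (far C_simplex_functor v) = C_simplex n" "Tgt (far C_simplex_functor v) = C_simplex p"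
      "Src (far C_simplex_functor (Comp simplex_cat v u)) = C_simplex m"
      "Tgt (far C_simplex_functor (Comp simplex_cat v u)) = C_simplex p"
      by (simp_all add: C_simplex_functor_def uf simplex_cat_def)
    show "is_sfun (efun_comp (far C_simplex_functor v) (far C_simplex_functor u))"
      by (rule sfun_comp[OF C_simplex_functor_sfun[OF u] C_simplex_functor_sfun[OF v]]) (simp add: st)
    show "Src (far C_simplex_functor (Comp simplex_cat v u)) = Src (efun_comp (far C_simplex_functor v) (far C_simplex_functor u))"
      "Tgt (far C_simplex_functor (Comp simplex_cat v u)) = Tgt (efun_comp (far C_simplex_functor v) (far C_simplex_functor u))"
      by (simp_all add: st) (simp_all add: efun_comp_def st)
    fix i assume "i \<in> Obj (Src (far C_simplex_functor (Comp simplex_cat v u)))"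
    then have i: "i \<le> m" by (simp add: st)
    show "Omap (far C_simplex_functor (Comp simplex_cat v u)) i
        = Omap (efun_comp (far C_simplex_functor v) (far C_simplex_functor u)) i"
      using i by (simp add: efun_comp_def st) (simp add: C_simplex_functor_def uf simplex_cat_def)
    fix j k a assume "j \<in> Obj (Src (far C_simplex_functor (Comp simplex_cat v u)))"
      "a \<in> cells (Hom (Src (far C_simplex_functor (Comp simplex_cat v u))) i j) k"
    then have j: "j \<le> m" and a: "a \<in> cells (nerve (path_poset i j) (\<subseteq>)) k" by (simp_all add: st)
    have H: "Hmap (far C_simplex_functor (m', n', h)) i' j' = nerve_map (path_poset i' j') (\<subseteq>) (\<lambda>X. h ` X)"
      if "i' \<le> m'" "j' \<le> m'" for m' n' h i' j'
      using that by (simp add: C_simplex_functor_def)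
    have fij: "f i \<le> n" "f j \<le> n" using f i j by auto
    have fa: "nerve_map (path_poset i j) (\<subseteq>) (\<lambda>X. f ` X) k a \<in> cells (nerve (path_poset (f i) (f j)) (\<subseteq>)) k"
      using sfun_cell[OF C_simplex_functor_sfun[OF u], unfolded st, of i j a k] i j a
      by (simp add: st uf(1) H) (simp add: C_simplex_functor_def)
    have sub: "(\<lambda>i\<in>{..m}. g (f i)) ` a t = g ` f ` a t" if "t \<le> k" for t
      unfolding image_image by (rule image_cong) (use path_cell_subset[OF a that j] in auto)
    have o: "Omap (far C_simplex_functor (m, n, f)) = f" by (simp add: C_simplex_functor_def)
    have "Hmap (far C_simplex_functor (Comp simplex_cat v u)) i j k a
       = nerve_map (path_poset i j) (\<subseteq>) (\<lambda>X. (\<lambda>i\<in>{..m}. g (f i)) ` X) k a"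
      using i j by (simp add: uf simplex_cat_def H)
    also have "\<dots> = (\<lambda>t\<in>{..k}. g ` f ` a t)"
      using a sub by (simp add: nerve_map_def cong: restrict_cong)
    also have "\<dots> = Hmap (efun_comp (far C_simplex_functor v) (far C_simplex_functor u)) i j k a"
      using i j a fa fij st by (simp add: efun_comp_def psh_comp_def uf H o) (simp add: nerve_map_def cong: restrict_cong)
    finally show "Hmap (far C_simplex_functor (Comp simplex_cat v u)) i j k a
       = Hmap (efun_comp (far C_simplex_functor v) (far C_simplex_functor u)) i j k a" .
  qed
  show ?thesis
    unfolding is_functor_def
  proof (intro conjI ballI impI)
    fix n show "fob C_simplex_functor n \<in> Ob SCat" "far C_simplex_functor (Idn simplex_cat n) = Idn SCat (fob C_simplex_functor n)"
      using C_simplex_scat[of n] I[of n] by (simp_all add: SCat_def) (simp_all add: C_simplex_functor_def)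
  next
    fix u assume u: "u \<in> Ar simplex_cat"
    then show "far C_simplex_functor u \<in> Ar SCat" using C_simplex_functor_sfun by (simp add: SCat_def)
    show "Dom SCat (far C_simplex_functor u) = fob C_simplex_functor (Dom simplex_cat u)"
      "Cod SCat (far C_simplex_functor u) = fob C_simplex_functor (Cod simplex_cat u)"
      by (cases u; simp add: SCat_def simplex_cat_def C_simplex_functor_def)+
    fix v assume "v \<in> Ar simplex_cat" "Dom simplex_cat v = Cod simplex_cat u"
    then show "far C_simplex_functor (Comp simplex_cat v u)
        = Comp SCat (far C_simplex_functor v) (far C_simplex_functor u)"
      using C[OF u] by (simp add: SCat_def)
  qed (rule S SCat_category)+
qed

lemma elements_category:
  assumes "is_presheaf C P" "is_category C" "Ob C = UNIV"
  shows "is_category (elements C P)"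
  using assms unfolding is_category_def is_presheaf_def
  by (auto simp: elements_def)

lemma elements_proj_functor:
  assumes "is_presheaf C P" "is_category C" "Ob C = UNIV"
  shows "is_functor (elements C P) C elements_proj"
  unfolding is_functor_def using elements_category[OF assms] assms(2,3)
  by (auto simp: elements_def elements_proj_def)

lemma fcompose_functor:
  assumes "is_functor C D F" "is_functor D E G" shows "is_functor C E (G \<circ>\<^sub>F F)"
  using assms unfolding is_functor_def fcompose_def by simp

text \<open>By \<open>scat_colim_universal\<close>, \<open>Rig_ob S\<close> is the colimit of the categories
  \<open>C_simplex n\<close> over the simplices of \<open>S\<close>.\<close>

lemma C_diagram_functor:
  assumes "is_presheaf simplex_cat S" 
  shows "scat_diagram (elements simplex_cat S) C_diagram"
proof
  have "is_category simplex_cat" "Ob simplex_cat = UNIV"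
    using C_simplex_functor by (simp_all add: is_functor_def simplex_cat_def)
  from fcompose_functor[OF elements_proj_functor[OF assms this] C_simplex_functor]
  show "is_functor (elements simplex_cat S) SCat C_diagram" by (simp add: C_diagram_def)
qed

definition Rig_ob :: "'a sset \<Rightarrow> ('a C_ob, 'a C_cell) scat" where
  "Rig_ob S = scat_colim (elements simplex_cat S) C_diagram"

definition Rig_omap :: "(simp_arr, 'a) psh_arr \<Rightarrow> 'a C_ob \<Rightarrow> 'a C_ob" where
  "Rig_omap = (\<lambda>(S, p, S'). \<lambda>X\<in>Obj (Rig_ob S).
     col_ob_rel (elements simplex_cat S') C_diagram `` ((\<lambda>((n, s), i). ((n, p n s), i)) ` X))"

definition Rig_ar :: "(simp_arr, 'a) psh_arr \<Rightarrow> ('a C_ob, 'a C_cell, 'a C_ob, 'a C_cell) sfun" where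
  "Rig_ar = (\<lambda>(S, p, S').
     \<lparr>Src = Rig_ob S, Tgt = Rig_ob S', Omap = Rig_omap (S, p, S'),
      Hmap = (\<lambda>X\<in>Obj (Rig_ob S). \<lambda>Y\<in>Obj (Rig_ob S). \<lambda>k. \<lambda>W\<in>cells (Hom (Rig_ob S) X Y) k.
        path_rel (elements simplex_cat S') C_diagram
            (Rig_omap (S, p, S') X) (Rig_omap (S, p, S') Y) k ``
          (map (\<lambda>((n, s), i, j, a). ((n, p n s), i, j, a)) ` W))\<rparr>)"

definition Rig ::
  "('a sset, (simp_arr, 'a) psh_arr,
    ('a C_ob, 'a C_cell) scat, ('a C_ob, 'a C_cell, 'a C_ob, 'a C_cell) sfun) func"
where
  "Rig = \<lparr>fob = Rig_ob, far = Rig_ar\<rparr>"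


section \<open>Natural isomorphism\<close>

text \<open>The two functors to simplicial categories may use different HOL types for objects and
  simplices, so the two instances of \<open>SCat\<close> are different constants and the components are
  isomorphisms between simplicial categories of different types.\<close>

definition is_scat_iso :: "('o, 'a, 'p, 'b) sfun \<Rightarrow> bool" where
  "is_scat_iso F \<longleftrightarrow> is_sfun F \<and>
     (\<exists>G :: ('p, 'b, 'o, 'a) sfun. is_sfun G \<and> Src G = Tgt F \<and> Tgt G = Src F \<and>
        efun_comp G F = efun_id (Src F) \<and> efun_comp F G = efun_id (Tgt F))"

definition naturally_isomorphic ::
  "('c, 'd) cat
     \<Rightarrow> ('c, 'd, ('o, 'a) scat, ('o, 'a, 'o, 'a) sfun) func
     \<Rightarrow> ('c, 'd, ('p, 'b) scat, ('p, 'b, 'p, 'b) sfun) func \<Rightarrow> bool"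
where
  "naturally_isomorphic C F G \<longleftrightarrow> is_functor C SCat F \<and> is_functor C SCat G \<and>
     (\<exists>\<eta> :: 'c \<Rightarrow> ('o, 'a, 'p, 'b) sfun.
        (\<forall>c\<in>Ob C. is_scat_iso (\<eta> c) \<and> Src (\<eta> c) = fob F c \<and> Tgt (\<eta> c) = fob G c) \<and>
        (\<forall>u\<in>Ar C. efun_comp (far G u) (\<eta> (Dom C u)) = efun_comp (\<eta> (Cod C u)) (far F u)))"

end

theory Submission
  imports Defs
begin

text \<open>For a simplicial set \<open>S\<close>, a simplex of a mapping space of \<open>T_ob (Cbox_ob S)\<close> is a class of pairs
  \<open>((f : T \<rightarrow> S, u), c)\<close>, where \<open>T\<close> is a necklace, \<open>u : \<one>\<^sup>n \<rightarrow> P\<^sub>\<one>(T)\<close> is a morphism of cubes and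
  \<open>c\<close> is a chain in \<open>\<one>\<^sup>n\<close>.  Pushing \<open>c\<close> forward along \<open>u\<close> one may assume that \<open>u\<close> is the identity;
  then the simplex is given by \<open>f\<close> and a chain \<open>C 0 \<subseteq> \<dots> \<subseteq> C k\<close> in the poset \<open>P(T)\<close>.  So the mapping
  spaces are the colimits of the nerves of \<open>P(T)\<close> over all necklaces \<open>T \<rightarrow> S\<close>, and composition is
  the wedge of necklaces (\<open>nec_simplexE\<close>, \<open>nec_simplex_shift\<close>, \<open>nec_simplex_invariant\<close>,
  \<open>nec_simplex_Cmp\<close>).

  The simplicial category \<open>Rig_ob S\<close> is presented by generators and relations.  Its generators,
  the letters, are the chains of subsets of \<open>{i..j}\<close> that contain \<open>i\<close> and \<open>j\<close>, for every simplex
  \<open>s\<close> of \<open>S\<close> and vertices \<open>i \<le> j\<close> of \<open>s\<close>.  Its simplices are words in these letters up to composition,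
  units and the simplicial operators.  A letter is a necklace with at most one bead together with a
  chain, and the three kinds of relations hold for those.  Thus the universal property of \<open>Rig_ob S\<close>
  gives a functor \<open>comparison S\<close> from \<open>Rig_ob S\<close> to \<open>T_ob (Cbox_ob S)\<close>.

  The functor is bijective on objects, which are the vertices of \<open>S\<close> on both sides.  It is
  surjective on simplices, because a necklace is the composite of its beads and a chain in \<open>P(T)\<close>
  decomposes accordingly (\<open>comparison_surj\<close>).  For injectivity, a word is assigned to every
  necklace \<open>f : T \<rightarrow> S\<close> with a chain \<open>C\<close>: cut \<open>T\<close> at all elements of the smallest set \<open>C 0\<close>.  As all
  joints belong to \<open>C 0\<close>, any two consecutive elements span a simplex of \<open>T\<close>, and as \<open>C 0\<close> is
  contained in every \<open>C t\<close>, the chain restricts to these simplices.  A map of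
  necklaces \<open>g\<close> carries \<open>C 0\<close> to \<open>g(C 0)\<close> and may collapse some of the segments; these only
  contribute units.  Hence the class of the word depends only on the simplex that is represented
  (\<open>nec_word_shift\<close>).  The word of a wedge is the concatenation of the words (\<open>nec_word_glue\<close>), and
  the word of a letter is equivalent to that letter (\<open>nec_word_letter\<close>), so every morphism of
  \<open>Rig_ob S\<close> can be recovered from its image.

  Naturality in \<open>S\<close> is clear on letters, which generate.  It remains to see that \<open>Cbox\<close> and
  \<open>T_functor\<close> are functors.  The main points are that \<open>P\<^sub>\<one>(f)\<close> is a
  composite of co-faces, co-degeneracies and co-connections for every map of necklaces \<open>f\<close>
  (\<open>P1_arrow\<close>), and that concatenation makes the category of cubes monoidal
  (\<open>box_plus_arrow\<close>), so that composition is well defined on the colimits (\<open>tri_mult_simplex\<close>,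
  \<open>rig_comp_cube\<close>).\<close>

section \<open>Colimits of presheaves\<close>

text \<open>Functions on quotients are defined below as images of whole classes under an equivalence
  relation.  Such an image is a single class as soon as all values are equivalent.\<close>

lemma eqcl_Image_set:
  assumes "a \<in> A" "\<And>b. b \<in> A \<Longrightarrow> eqcl R `` {b} = eqcl R `` {a}"
  shows "eqcl R `` A = eqcl R `` {a}"
proof -
  have "eqcl R `` A = (\<Union>b\<in>A. eqcl R `` {b})" by blast
  also have "\<dots> = (\<Union>b\<in>A. eqcl R `` {a})" by (rule SUP_cong[OF refl assms(2)])
  also have "\<dots> = eqcl R `` {a}" using assms(1) by blast
  finally show ?thesis .
qed

lemma eqcl_class_eq_iff: "eqcl R `` {a} = eqcl R `` {b} \<longleftrightarrow> (a, b) \<in> eqcl R"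
proof
  assume "eqcl R `` {a} = eqcl R `` {b}"
  moreover have "b \<in> eqcl R `` {b}" by simp
  ultimately show "(a, b) \<in> eqcl R" by blast
qed (rule eqcl_class_eq)

text \<open>The cell of a colimit presheaf represented by the pair \<open>e = (j, x)\<close>, where \<open>x\<close> is a cell
  of the \<open>j\<close>-th presheaf of the diagram.\<close>

definition psh_cls ::
  "('j, 'k) cat \<Rightarrow> ('j, 'k, ('m, 'a) psh, nat \<Rightarrow> 'a \<Rightarrow> 'a) func \<Rightarrow> nat \<Rightarrow> 'j \<times> 'a \<Rightarrow> ('j \<times> 'a) set"
where
  "psh_cls J F n e = psh_colim_rel J F n `` {e}"

text \<open>The common interface to tensor products, triangulations and colimits over necklaces.  A
  colimit of sets is the quotient by the relation that single arrows generate, so the assumptions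
  on \<open>J\<close> and \<open>F\<close> speak of single arrows only.\<close>

locale psh_diag =
  fixes C :: "(nat, 'm) cat" and J :: "('j, 'k) cat"
    and F :: "('j, 'k, ('m, 'a) psh, nat \<Rightarrow> 'a \<Rightarrow> 'a) func"
  assumes C: "is_category C" "Ob C = UNIV"
    and J_ar: "\<And>k. k \<in> Ar J \<Longrightarrow> Dom J k \<in> Ob J \<and> Cod J k \<in> Ob J"
    and F_ob: "\<And>j. j \<in> Ob J \<Longrightarrow> is_presheaf C (fob F j)"
    and F_ar: "\<And>k n x. k \<in> Ar J \<Longrightarrow> x \<in> cells (fob F (Dom J k)) n \<Longrightarrow>
      far F k n x \<in> cells (fob F (Cod J k)) n"
    and F_nat: "\<And>k u x. k \<in> Ar J \<Longrightarrow> u \<in> Ar C \<Longrightarrow> x \<in> cells (fob F (Dom J k)) (Cod C u) \<Longrightarrow>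
      far F k (Dom C u) (act (fob F (Dom J k)) u x) = act (fob F (Cod J k)) u (far F k (Cod C u) x)"

lemma psh_cls_step:
  assumes "k \<in> Ar J" "x \<in> cells (fob F (Dom J k)) n"
  shows "psh_cls J F n (Dom J k, x) = psh_cls J F n (Cod J k, far F k n x)"
  unfolding psh_cls_def psh_colim_rel_def colim_rel_def
  by (rule eqcl_class_eq, rule eqcl_base) (use assms in blast)

text \<open>Whether a function is well defined on a colimit may be checked along single arrows of the
  diagram.\<close>

lemma psh_cls_invariant:
  assumes "psh_cls J F n e = psh_cls J F n e'"
    and "\<And>k x. k \<in> Ar J \<Longrightarrow> x \<in> cells (fob F (Dom J k)) n \<Longrightarrow>
      f (Dom J k, x) = f (Cod J k, far F k n x)"
  shows "f e = f e'"
proof -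
  have "(e, e') \<in> psh_colim_rel J F n"
    using assms(1) unfolding psh_cls_def psh_colim_rel_def colim_rel_def eqcl_class_eq_iff .
  then show ?thesis unfolding psh_colim_rel_def colim_rel_def
    by (rule eqcl_invariant) (use assms(2) in auto)
qed

lemma psh_cls_self: "e \<in> psh_cls J F n e"
  unfolding psh_cls_def psh_colim_rel_def colim_rel_def by simp

lemma psh_cls_mem_eq:
  assumes "e' \<in> psh_cls J F n e" shows "psh_cls J F n e' = psh_cls J F n e"
  using assms eqcl_class_eq unfolding psh_cls_def psh_colim_rel_def colim_rel_def by fast

lemma psh_cls_Image:
  assumes "e \<in> A" "\<And>e'. e' \<in> A \<Longrightarrow> psh_cls J F n e' = psh_cls J F n e"
  shows "psh_colim_rel J F n `` A = psh_cls J F n e"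
  using assms unfolding psh_cls_def psh_colim_rel_def colim_rel_def by (rule eqcl_Image_set)

lemma psh_cls_map:
  assumes "\<And>k x. k \<in> Ar J \<Longrightarrow> x \<in> cells (fob F (Dom J k)) n \<Longrightarrow>
      psh_cls J' F' n' (h (Dom J k, x)) = psh_cls J' F' n' (h (Cod J k, far F k n x))"
  shows "psh_colim_rel J' F' n' `` (h ` psh_cls J F n e) = psh_cls J' F' n' (h e)"
proof (rule psh_cls_Image)
  show "h e \<in> h ` psh_cls J F n e" using psh_cls_self by fast
  fix e' assume "e' \<in> h ` psh_cls J F n e"
  then obtain d where d: "d \<in> psh_cls J F n e" "e' = h d" by blast
  show "psh_cls J' F' n' e' = psh_cls J' F' n' (h e)"
    using psh_cls_invariant[OF psh_cls_mem_eq[OF d(1)], of "\<lambda>d. psh_cls J' F' n' (h d)"] assms d(2) by simp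
qed

lemma quot_lift_psh_cls:
  assumes "\<And>k x. k \<in> Ar J \<Longrightarrow> x \<in> cells (fob F (Dom J k)) n \<Longrightarrow>
      f (Dom J k, x) = f (Cod J k, far F k n x)"
  shows "quot_lift f (psh_cls J F n e) = f e"
  unfolding psh_cls_def psh_colim_rel_def colim_rel_def
  by (rule quot_lift_class) (use assms in auto)

lemma cells_psh_colim:
  "cells (psh_colim C J F) n = {psh_cls J F n (j, x) | j x. j \<in> Ob J \<and> x \<in> cells (fob F j) n}"
  unfolding psh_colim_def colim_set_def quotient_def psh_cls_def psh_colim_rel_def by auto

context psh_diag
begin

lemma cls_in: "j \<in> Ob J \<Longrightarrow> x \<in> cells (fob F j) n \<Longrightarrow> psh_cls J F n (j, x) \<in> cells (psh_colim C J F) n"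
  by (auto simp: cells_psh_colim)

lemma cls_mem_valid:
  assumes "(j', x') \<in> psh_cls J F n (j, x)" "j \<in> Ob J" "x \<in> cells (fob F j) n"
  shows "j' \<in> Ob J" "x' \<in> cells (fob F j') n"
proof -
  have "((j, x), (j', x')) \<in> psh_colim_rel J F n" using assms(1) by (simp add: psh_cls_def)
  then have "(fst (j, x) \<in> Ob J \<and> snd (j, x) \<in> cells (fob F (fst (j, x))) n)
      = (fst (j', x') \<in> Ob J \<and> snd (j', x') \<in> cells (fob F (fst (j', x'))) n)"
    unfolding psh_colim_rel_def colim_rel_def
    by (rule eqcl_invariant) (use J_ar F_ar in auto)
  then show "j' \<in> Ob J" "x' \<in> cells (fob F j') n" using assms by auto
qed

lemma act_cls:
  assumes "u \<in> Ar C"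
  shows "act (psh_colim C J F) u (psh_cls J F (Cod C u) (j, x))
    = psh_cls J F (Dom C u) (j, act (fob F j) u x)"
proof -
  have "psh_colim_rel J F (Dom C u) `` ((\<lambda>(j, x). (j, act (fob F j) u x)) ` psh_cls J F (Cod C u) (j, x))
      = psh_cls J F (Dom C u) ((\<lambda>(j, x). (j, act (fob F j) u x)) (j, x))"
  proof (rule psh_cls_map)
    fix k x assume k: "k \<in> Ar J" and x: "x \<in> cells (fob F (Dom J k)) (Cod C u)"
    then have "act (fob F (Dom J k)) u x \<in> cells (fob F (Dom J k)) (Dom C u)"
      using J_ar F_ob psh_act_cells assms by metis
    then show "psh_cls J F (Dom C u) ((\<lambda>(j, x). (j, act (fob F j) u x)) (Dom J k, x))
        = psh_cls J F (Dom C u) ((\<lambda>(j, x). (j, act (fob F j) u x)) (Cod J k, far F k (Cod C u) x))"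
      using psh_cls_step[OF k \<open>act (fob F (Dom J k)) u x \<in> _\<close>] F_nat[OF k assms x] by simp
  qed
  then show ?thesis by (simp add: psh_colim_def)
qed

lemma psh_colim_presheaf: "is_presheaf C (psh_colim C J F)"
  unfolding is_presheaf_def
proof (intro conjI ballI allI impI)
  fix u X assume u: "u \<in> Ar C" and "X \<in> cells (psh_colim C J F) (Cod C u)"
  then obtain j x where jx: "j \<in> Ob J" "x \<in> cells (fob F j) (Cod C u)" "X = psh_cls J F (Cod C u) (j, x)"
    by (auto simp: cells_psh_colim)
  then show "act (psh_colim C J F) u X \<in> cells (psh_colim C J F) (Dom C u)"
    using act_cls[OF u] cls_in psh_act_cells[OF F_ob u] by metis
next
  fix n X assume "X \<in> cells (psh_colim C J F) n"
  then obtain j x where jx: "j \<in> Ob J" "x \<in> cells (fob F j) n" "X = psh_cls J F n (j, x)"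
    by (auto simp: cells_psh_colim)
  have i: "Idn C n \<in> Ar C" "Dom C (Idn C n) = n" "Cod C (Idn C n) = n"
    using C by (auto simp: is_category_def)
  have "act (fob F j) (Idn C n) x = x" using F_ob[OF jx(1)] jx(2) by (simp add: is_presheaf_def)
  then show "act (psh_colim C J F) (Idn C n) X = X"
    using act_cls[OF i(1), of j x] jx(3) by (simp add: i)
next
  fix u v X assume uv: "u \<in> Ar C" "v \<in> Ar C" "Dom C v = Cod C u"
    and "X \<in> cells (psh_colim C J F) (Cod C v)"
  then obtain j x where jx: "j \<in> Ob J" "x \<in> cells (fob F j) (Cod C v)" "X = psh_cls J F (Cod C v) (j, x)"
    by (auto simp: cells_psh_colim)
  have c: "Comp C v u \<in> Ar C" "Dom C (Comp C v u) = Dom C u" "Cod C (Comp C v u) = Cod C v"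
    using C uv unfolding is_category_def by blast+
  have "act (fob F j) (Comp C v u) x = act (fob F j) u (act (fob F j) v x)"
    using F_ob[OF jx(1)] jx(2) uv by (simp add: is_presheaf_def)
  then show "act (psh_colim C J F) (Comp C v u) X = act (psh_colim C J F) u (act (psh_colim C J F) v X)"
    using act_cls[OF c(1), of j x] act_cls[OF uv(2), of j x] act_cls[OF uv(1), of j "act (fob F j) v x"] jx(3) uv(3)
    by (simp add: c)
qed

end

lemma psh_hom_cell: "t \<in> psh_hom C P Q \<Longrightarrow> x \<in> cells P n \<Longrightarrow> t n x \<in> cells Q n"
  by (auto simp: psh_hom_def)

lemma psh_hom_act:
  "t \<in> psh_hom C P Q \<Longrightarrow> u \<in> Ar C \<Longrightarrow> x \<in> cells P (Cod C u) \<Longrightarrow>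
    t (Dom C u) (act P u x) = act Q u (t (Cod C u) x)"
  by (auto simp: psh_hom_def)

lemma psh_homI:
  assumes "\<And>n x. x \<in> cells P n \<Longrightarrow> t n x \<in> cells Q n"
    and "\<And>n x. x \<notin> cells P n \<Longrightarrow> t n x = undefined"
    and "\<And>u x. u \<in> Ar C \<Longrightarrow> x \<in> cells P (Cod C u) \<Longrightarrow>
      t (Dom C u) (act P u x) = act Q u (t (Cod C u) x)"
  shows "t \<in> psh_hom C P Q"
  using assms by (auto simp: psh_hom_def PiE_iff extensional_def)

lemma psh_comp_hom:
  assumes "is_presheaf C P" "s \<in> psh_hom C P Q" "t \<in> psh_hom C Q R"
  shows "psh_comp P t s \<in> psh_hom C P R"
proof (rule psh_homI)
  fix u x assume "u \<in> Ar C" "x \<in> cells P (Cod C u)"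
  then show "psh_comp P t s (Dom C u) (act P u x) = act R u (psh_comp P t s (Cod C u) x)"
    using psh_act_cells[OF assms(1)] psh_hom_act[OF assms(2)] psh_hom_act[OF assms(3)]
      psh_hom_cell[OF assms(2)] by (simp add: psh_comp_def)
qed (use psh_hom_cell[OF assms(2)] psh_hom_cell[OF assms(3)] in \<open>simp_all add: psh_comp_def\<close>)

lemma psh_hom_undefined: "t \<in> psh_hom C P Q \<Longrightarrow> x \<notin> cells P n \<Longrightarrow> t n x = undefined"
  unfolding psh_hom_def by (auto simp: PiE_iff extensional_def)

lemma psh_cat_category: "is_category (psh_cat C)"
proof -
  have 1: "psh_comp P t (psh_id P) = t" if "t \<in> psh_hom C P Q" for P Q t
    using psh_hom_undefined[OF that] by (auto simp: psh_comp_def psh_id_def fun_eq_iff)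
  have 2: "psh_comp P (psh_id Q) t = t" if "t \<in> psh_hom C P Q" for P Q t
    using psh_hom_undefined[OF that] psh_hom_cell[OF that]
    by (auto simp: psh_comp_def psh_id_def fun_eq_iff)
  have 3: "psh_comp P r (psh_comp P t s) = psh_comp P (psh_comp Q r t) s"
    if "s \<in> psh_hom C P Q" for P Q r s t
    using psh_hom_cell[OF that] by (auto simp: psh_comp_def fun_eq_iff)
  show ?thesis unfolding is_category_def
    by (auto simp: psh_cat_def 1 2 psh_id_hom intro: psh_comp_hom) (simp add: 3)
qed

lemma elements_graph:
  assumes "is_presheaf C P" "k \<in> Ar (elements C P)"
  shows "Dom (elements C P) k \<in> Ob (elements C P) \<and> Cod (elements C P) k \<in> Ob (elements C P)"
  using assms by (auto simp: elements_def is_presheaf_def)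


section \<open>The category of cubes\<close>

lemma cube_append [simp]: "s \<in> cube m \<Longrightarrow> t \<in> cube n \<Longrightarrow> s @ t \<in> cube (m + n)"
  by (simp add: cube_def)

lemma cube_splitE:
  assumes "s \<in> cube (m + n)" obtains a b where "s = a @ b" "a \<in> cube m" "b \<in> cube n"
  using assms that[of "take m s" "drop m s"] by (simp add: cube_def)

lemma box_arrow_map:
  assumes "(m, n, f) \<in> box_arrows"
  shows "f \<in> cube m \<rightarrow>\<^sub>E cube n"
    "\<And>s t. s \<in> cube m \<Longrightarrow> t \<in> cube m \<Longrightarrow> cube_le s t \<Longrightarrow> cube_le (f s) (f t)"
proof -
  have "snd (snd u) \<in> cube (fst u) \<rightarrow>\<^sub>E cube (fst (snd u)) \<and>
     (\<forall>s\<in>cube (fst u). \<forall>t\<in>cube (fst u). cube_le s t \<longrightarrow> cube_le (snd (snd u) s) (snd (snd u) t))"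
    if "u \<in> box_arrows" for u
    using that
  proof (induction rule: box_arrows.induct)
    case (4 j n)
    have "max (s ! (j - 1)) (s ! j) \<le> max (t ! (j - 1)) (t ! j)"
      if "cube_le s t" "length s = n" for s t :: "bool list"
      using that(2) 4 list_all2_nthD[OF that(1), of "j - 1"] list_all2_nthD[OF that(1), of j]
      by (intro max.mono) simp_all
    then have "cube_le (snd (snd (coconnection j n)) s) (snd (snd (coconnection j n)) t)"
      if "s \<in> cube n" "t \<in> cube n" "cube_le s t" for s t
      using that unfolding coconnection_def cube_def
      by (auto simp del: le_bool_def max_less_iff_conj intro!: list_all2_appendI list_all2_takeI list_all2_dropI)
    moreover have "snd (snd (coconnection j n)) \<in> cube n \<rightarrow>\<^sub>E cube (n - 1)"
      using 4 by (intro PiE_I) (simp_all add: coconnection_def cube_def)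
    moreover have "fst (coconnection j n) = n" "fst (snd (coconnection j n)) = n - 1"
      by (simp_all add: coconnection_def)
    ultimately show ?case by metis
  next
    case (5 u v)
    obtain m n f n' p g where "u = (m, n, f)" "v = (n', p, g)" by (cases u, cases v)
    with 5 show ?case by (auto simp: box_comp_def PiE_iff extensional_def)
  qed (auto simp: box_id_def coface_def codegeneracy_def cube_def
      list_all2_takeI list_all2_dropI intro!: list_all2_appendI split: if_splits)
  from this[OF assms] show "f \<in> cube m \<rightarrow>\<^sub>E cube n"
    "\<And>s t. s \<in> cube m \<Longrightarrow> t \<in> cube m \<Longrightarrow> cube_le s t \<Longrightarrow> cube_le (f s) (f t)" by auto
qed

lemma box_arrow_in: "(m, n, f) \<in> box_arrows \<Longrightarrow> s \<in> cube m \<Longrightarrow> f s \<in> cube n"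
  using box_arrow_map(1) by fast

lemma box_cat_sel [simp]:
  "Dom box_cat (m, n, f) = m" "Cod box_cat (m, n, f) = n" "Ar box_cat = box_arrows"
  "Idn box_cat = box_id" "Comp box_cat = box_comp" "Ob box_cat = UNIV"
  by (simp_all add: box_cat_def)

lemma box_comp_simp [simp]: "box_comp (n', p, g) (m, n, f) = (m, p, \<lambda>s\<in>cube m. g (f s))"
  by (simp add: box_comp_def)

lemma box_comp_arrow:
  "(m, n, f) \<in> box_arrows \<Longrightarrow> (n, p, g) \<in> box_arrows \<Longrightarrow> box_comp (n, p, g) (m, n, f) \<in> box_arrows"
  using box_arrows.intros(5)[of "(m, n, f)" "(n, p, g)"] by simp

lemma box_id_sel [simp]: "Dom box_cat (box_id n) = n" "Cod box_cat (box_id n) = n" "box_id n \<in> box_arrows"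
  using box_arrows.intros(1) by (simp_all add: box_id_def)

lemma box_comp_id:
  assumes "(m, n, f) \<in> box_arrows"
  shows "box_comp (m, n, f) (box_id m) = (m, n, f)" "box_comp (box_id n) (m, n, f) = (m, n, f)"
  using box_arrow_map(1)[OF assms] by (auto simp: box_id_def PiE_iff extensional_def fun_eq_iff)

lemma box_cat_category: "is_category box_cat"
  unfolding is_category_def
proof (intro conjI ballI impI)
  fix f g h assume "f \<in> Ar box_cat" "g \<in> Ar box_cat" "h \<in> Ar box_cat" "Dom box_cat g = Cod box_cat f"
  then show "Comp box_cat h (Comp box_cat g f) = Comp box_cat (Comp box_cat h g) f"
    using box_arrow_in by (cases f, cases g, cases h) (auto simp: fun_eq_iff)
next
  fix f g assume "f \<in> Ar box_cat" "g \<in> Ar box_cat" "Dom box_cat g = Cod box_cat f"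
  then show "Comp box_cat g f \<in> Ar box_cat" "Dom box_cat (Comp box_cat g f) = Dom box_cat f"
    "Cod box_cat (Comp box_cat g f) = Cod box_cat g"
    using box_comp_arrow by (cases f, cases g; fastforce)+
next
  fix f assume "f \<in> Ar box_cat"
  then show "Comp box_cat f (Idn box_cat (Dom box_cat f)) = f" "Comp box_cat (Idn box_cat (Cod box_cat f)) f = f"
    using box_comp_id by (cases f; simp)+
qed simp_all

lemma box_comp_assoc:
  assumes "(m, n, f) \<in> box_arrows" "(n, p, g) \<in> box_arrows"
  shows "box_comp (p, q, h) (box_comp (n, p, g) (m, n, f)) = box_comp (box_comp (p, q, h) (n, p, g)) (m, n, f)"
  using assms box_arrow_in by (auto simp: fun_eq_iff)

lemma box_plus_simp:
  "box_plus (m, n, f) (m', n', f') = (m + m', n + n', \<lambda>s\<in>cube (m + m'). f (take m s) @ f' (drop m s))"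
  by (simp add: box_plus_def)

lemma box_arr_eqI:
  "m = m' \<Longrightarrow> n = n' \<Longrightarrow> (\<And>s. s \<in> cube m \<Longrightarrow> f s = g s) \<Longrightarrow> (m, n, restrict f (cube m)) = (m', n', restrict g (cube m'))"
  by (auto intro: restrict_ext)

lemma box_plus_comp:
  assumes "(m, n, f) \<in> box_arrows" "(n, p, g) \<in> box_arrows" "(m', n', f') \<in> box_arrows" "(n', p', g') \<in> box_arrows"
  shows "box_plus (box_comp (n, p, g) (m, n, f)) (box_comp (n', p', g') (m', n', f'))
    = box_comp (box_plus (n, p, g) (n', p', g')) (box_plus (m, n, f) (m', n', f'))"
proof -
  have "f (take m s) \<in> cube n" "f' (drop m s) \<in> cube n'" if "s \<in> cube (m + m')" for s
    using box_arrow_in[OF assms(1)] box_arrow_in[OF assms(3)] that by (simp_all add: cube_def)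
  then show ?thesis by (auto simp: box_plus_simp fun_eq_iff cube_def)
qed

lemma box_plus_id: "box_plus (box_id m) (box_id n) = box_id (m + n)"
  by (auto simp: box_id_def box_plus_simp fun_eq_iff cube_def)

lemma box_plus_assoc:
  "box_plus (box_plus (m, n, f) (m', n', f')) (m'', n'', f'')
    = box_plus (m, n, f) (box_plus (m', n', f') (m'', n'', f''))"
  unfolding box_plus_simp
  by (rule box_arr_eqI) (auto simp: cube_def take_drop min_def add.commute)

lemma box_plus_unit:
  assumes "u \<in> box_arrows"
  shows "box_plus (box_id 0) u = u" "box_plus u (box_id 0) = u"
proof -
  obtain m n f where u: "u = (m, n, f)" by (cases u)
  have e: "f \<in> extensional (cube m)" using box_arrow_map(1) assms u by (auto simp: PiE_iff)
  have "box_plus (box_id 0) u = (m, n, \<lambda>s\<in>cube m. f s)"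
    unfolding u box_id_def box_plus_simp by (rule box_arr_eqI) (simp_all add: cube_def)
  moreover have "box_plus u (box_id 0) = (m, n, \<lambda>s\<in>cube m. f s)"
    unfolding u box_id_def box_plus_simp by (rule box_arr_eqI) (simp_all add: cube_def)
  ultimately show "box_plus (box_id 0) u = u" "box_plus u (box_id 0) = u"
    using e u by (simp_all add: extensional_restrict)
qed

text \<open>The product of a generating functor with an identity functor is again a generator, so
  \<open>\<one>\<^sup>m \<times> \<one>\<^sup>n = \<one>\<^sup>m\<^sup>+\<^sup>n\<close> makes the category of cubes monoidal.\<close>

lemma box_plus_id_right: "u \<in> box_arrows \<Longrightarrow> box_plus u (box_id k) \<in> box_arrows"
proof (induction rule: box_arrows.induct)
  case (1 n)
  then show ?case by (simp add: box_plus_id)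
next
  case (2 j n e)
  have "box_plus (coface e j n) (box_id k) = coface e j (n + k)"
    unfolding box_id_def coface_def box_plus_simp
    by (rule box_arr_eqI, simp, simp, erule cube_splitE) (use 2 in \<open>simp add: cube_def\<close>)
  then show ?case using 2 box_arrows.intros(2) by simp
next
  case (3 j n)
  have "box_plus (codegeneracy j n) (box_id k) = codegeneracy j (n + k)"
    unfolding box_id_def codegeneracy_def box_plus_simp
    by (rule box_arr_eqI, simp, use 3 in simp, erule cube_splitE) (use 3 in \<open>simp add: cube_def\<close>)
  then show ?case using 3 box_arrows.intros(3) by simp
next
  case (4 j n)
  have "box_plus (coconnection j n) (box_id k) = coconnection j (n + k)"
    unfolding box_id_def coconnection_def box_plus_simp
    by (rule box_arr_eqI, simp, use 4 in simp, erule cube_splitE)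
      (use 4 in \<open>auto simp: cube_def nth_append\<close>)
  then show ?case using 4 box_arrows.intros(4) by simp
next
  case (5 u v)
  obtain m n f n' p g where "u = (m, n, f)" "v = (n', p, g)" by (cases u, cases v)
  then have uv: "u = (m, n, f)" "v = (n, p, g)" using 5 by simp_all
  have i: "box_id k = (k, k, \<lambda>s\<in>cube k. s)" by (simp add: box_id_def)
  have ii: "box_comp (box_id k) (box_id k) = box_id k" by (simp add: box_id_def cube_def fun_eq_iff)
  have ik: "(k, k, \<lambda>s\<in>cube k. s) \<in> box_arrows" using box_arrows.intros(1)[of k] by (simp add: box_id_def)
  have eq: "box_plus (box_comp v u) (box_id k) = box_comp (box_plus v (box_id k)) (box_plus u (box_id k))"
    using box_plus_comp[of m n f p g k k _ k, OF _ _ ik ik] 5 uv ii unfolding i by simp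
  show ?case unfolding eq by (rule box_arrows.intros(5), fact, fact) (simp add: uv box_plus_simp i)
qed

lemma box_plus_id_left: "u \<in> box_arrows \<Longrightarrow> box_plus (box_id k) u \<in> box_arrows"
proof (induction rule: box_arrows.induct)
  case (1 n)
  then show ?case by (simp add: box_plus_id)
next
  case (2 j n e)
  have "box_plus (box_id k) (coface e j n) = coface e (k + j) (k + n)"
    unfolding box_id_def coface_def box_plus_simp
    by (rule box_arr_eqI, simp, simp, erule cube_splitE) (use 2 in \<open>simp add: cube_def\<close>)
  then show ?case using 2 box_arrows.intros(2) by simp
next
  case (3 j n)
  have "box_plus (box_id k) (codegeneracy j n) = codegeneracy (k + j) (k + n)"
    unfolding box_id_def codegeneracy_def box_plus_simp
    by (rule box_arr_eqI, simp, use 3 in simp, erule cube_splitE) (use 3 in \<open>simp add: cube_def\<close>)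
  then show ?case using 3 box_arrows.intros(3) by simp
next
  case (4 j n)
  have "box_plus (box_id k) (coconnection j n) = coconnection (k + j) (k + n)"
    unfolding box_id_def coconnection_def box_plus_simp
    by (rule box_arr_eqI, simp, use 4 in simp, erule cube_splitE)
      (use 4 in \<open>auto simp: cube_def nth_append\<close>)
  then show ?case using 4 box_arrows.intros(4) by simp
next
  case (5 u v)
  obtain m n f n' p g where "u = (m, n, f)" "v = (n', p, g)" by (cases u, cases v)
  then have uv: "u = (m, n, f)" "v = (n, p, g)" using 5 by simp_all
  have i: "box_id k = (k, k, \<lambda>s\<in>cube k. s)" by (simp add: box_id_def)
  have ii: "box_comp (box_id k) (box_id k) = box_id k" by (simp add: box_id_def cube_def fun_eq_iff)
  have ik: "(k, k, \<lambda>s\<in>cube k. s) \<in> box_arrows" using box_arrows.intros(1)[of k] by (simp add: box_id_def)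
  have eq: "box_plus (box_id k) (box_comp v u) = box_comp (box_plus (box_id k) v) (box_plus (box_id k) u)"
    using box_plus_comp[of k k _ k _ m n f p g, OF ik ik] 5 uv ii unfolding i by simp
  show ?case unfolding eq by (rule box_arrows.intros(5), fact, fact) (simp add: uv box_plus_simp i)
qed

text \<open>\<open>u \<times> v\<close> is the composite of \<open>u \<times> 1\<close> and \<open>1 \<times> v\<close>.\<close>

lemma box_plus_arrow:
  assumes "u \<in> box_arrows" "v \<in> box_arrows" shows "box_plus u v \<in> box_arrows"
proof -
  obtain m n f m' n' f' where uv: "u = (m, n, f)" "v = (m', n', f')" by (cases u, cases v)
  have i: "(n, n, \<lambda>s\<in>cube n. s) \<in> box_arrows" "(m', m', \<lambda>s\<in>cube m'. s) \<in> box_arrows"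
    using box_arrows.intros(1)[of n] box_arrows.intros(1)[of m'] by (simp_all add: box_id_def)
  have "box_plus u v = box_plus (box_comp (box_id n) u) (box_comp v (box_id m'))"
    using box_comp_id assms uv by simp
  also have "\<dots> = box_comp (box_plus (box_id n) v) (box_plus u (box_id m'))"
    using box_plus_comp[of m n f n "\<lambda>s\<in>cube n. s" m' m' "\<lambda>s\<in>cube m'. s" n' f'] i assms uv
    by (simp add: box_id_def)
  finally show ?thesis
    using box_plus_id_left[OF assms(2), of n] box_plus_id_right[OF assms(1), of m'] uv
      box_arrows.intros(5)[of "box_plus u (box_id m')" "box_plus (box_id n) v"]
    by (simp add: box_id_def box_plus_simp)
qed


section \<open>Cubes of tensor products\<close>

definition box_hom :: "nat \<Rightarrow> nat \<Rightarrow> box_arr set" where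
  "box_hom m n = {u \<in> box_arrows. Dom box_cat u = m \<and> Cod box_cat u = n}"

lemma box_homE:
  assumes "u \<in> box_hom m n" obtains f where "u = (m, n, f)" "(m, n, f) \<in> box_arrows"
  using assms by (cases u) (auto simp: box_hom_def)

lemma box_hom_iff [simp]: "(m', n', f) \<in> box_hom m n \<longleftrightarrow> (m', n', f) \<in> box_arrows \<and> m' = m \<and> n' = n"
  by (auto simp: box_hom_def)

lemma box_id_hom [simp]: "box_id n \<in> box_hom n n"
  by (simp add: box_hom_def)

lemma box_comp_hom: "u \<in> box_hom m n \<Longrightarrow> v \<in> box_hom n p \<Longrightarrow> box_comp v u \<in> box_hom m p"
  using box_comp_arrow by (elim box_homE) fastforce

lemma box_plus_hom: "u \<in> box_hom m n \<Longrightarrow> v \<in> box_hom m' n' \<Longrightarrow> box_plus u v \<in> box_hom (m + m') (n + n')"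
  using box_plus_arrow[of u v] by (elim box_homE) (simp add: box_plus_simp)

lemma box_hom_comp_assoc:
  "u \<in> box_hom m n \<Longrightarrow> v \<in> box_hom n p \<Longrightarrow> w \<in> box_hom p q \<Longrightarrow>
    box_comp w (box_comp v u) = box_comp (box_comp w v) u"
  using box_comp_assoc by (elim box_homE) fast

lemma box_hom_comp_id: "u \<in> box_hom m n \<Longrightarrow> box_comp u (box_id m) = u"
  "u \<in> box_hom m n \<Longrightarrow> box_comp (box_id n) u = u"
  using box_comp_id by (auto elim!: box_homE simp del: box_comp_simp)

lemma box_hom_plus_comp:
  "u \<in> box_hom m n \<Longrightarrow> v \<in> box_hom n p \<Longrightarrow> u' \<in> box_hom m' n' \<Longrightarrow> v' \<in> box_hom n' p' \<Longrightarrow>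
    box_plus (box_comp v u) (box_comp v' u') = box_comp (box_plus v v') (box_plus u u')"
  using box_plus_comp by (elim box_homE) fast

lemma box_hom_plus_assoc:
  "u \<in> box_hom m n \<Longrightarrow> v \<in> box_hom m' n' \<Longrightarrow> w \<in> box_hom m'' n'' \<Longrightarrow>
    box_plus (box_plus u v) w = box_plus u (box_plus v w)"
  using box_plus_assoc by (elim box_homE) fast

lemma box_psh_act_cell:
  "is_presheaf box_cat K \<Longrightarrow> u \<in> box_hom m n \<Longrightarrow> x \<in> cells K n \<Longrightarrow> act K u x \<in> cells K m"
  using psh_act_cells[of box_cat K u x] by (auto simp: box_hom_def)

lemma box_psh_act_comp:
  "is_presheaf box_cat K \<Longrightarrow> u \<in> box_hom m n \<Longrightarrow> v \<in> box_hom n p \<Longrightarrow> x \<in> cells K p \<Longrightarrow>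
    act K (box_comp v u) x = act K u (act K v x)"
  by (auto simp: is_presheaf_def box_hom_def)

lemma box_psh_act_id: "is_presheaf box_cat K \<Longrightarrow> x \<in> cells K n \<Longrightarrow> act K (box_id n) x = x"
  by (auto simp: is_presheaf_def)

lemma box_psh_hom_act:
  "t \<in> psh_hom box_cat K L \<Longrightarrow> u \<in> box_hom m n \<Longrightarrow> x \<in> cells K n \<Longrightarrow>
    t m (act K u x) = act L u (t n x)"
  using psh_hom_act[of t box_cat K L u x] by (auto simp: box_hom_def)

lemma yoneda_box_sel:
  "cells (fob (yoneda box_cat) n) d = box_hom d n"
  "act (fob (yoneda box_cat) n) v u = box_comp u v"
  "far (yoneda box_cat) w d = (\<lambda>u\<in>box_hom d (Dom box_cat w). box_comp w u)"
  by (auto simp: yoneda_def box_hom_def)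

lemma yoneda_box_presheaf: "is_presheaf box_cat (fob (yoneda box_cat) n)"
  unfolding is_presheaf_def yoneda_box_sel
proof (intro conjI ballI allI impI)
  fix u v x assume *: "u \<in> Ar box_cat" "v \<in> Ar box_cat" "Dom box_cat v = Cod box_cat u" "x \<in> box_hom (Cod box_cat v) n"
  then have "u \<in> box_hom (Dom box_cat u) (Cod box_cat u)" "v \<in> box_hom (Cod box_cat u) (Cod box_cat v)"
    by (simp_all add: box_hom_def)
  from box_hom_comp_assoc[OF this *(4)]
  show "box_comp x (Comp box_cat v u) = box_comp (box_comp x v) u" by simp
next
  fix u x assume "u \<in> Ar box_cat" "x \<in> box_hom (Cod box_cat u) n"
  then show "box_comp x u \<in> box_hom (Dom box_cat u) n"
    using box_comp_hom[of u "Dom box_cat u" "Cod box_cat u" x n] by (simp add: box_hom_def)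
next
  fix m x assume "x \<in> box_hom m n"
  then show "box_comp x (Idn box_cat m) = x" by (simp add: box_hom_comp_id)
qed

lemma elements_box_arr:
  "k \<in> Ar (elements box_cat K) \<longleftrightarrow>
     (\<exists>m n u y. k = ((m, act K u y), u, (n, y)) \<and> u \<in> box_hom m n \<and> y \<in> cells K n)"
  by (auto simp: elements_def box_hom_def)

lemma elements_box_arrI:
  "u \<in> box_hom m n \<Longrightarrow> y \<in> cells K n \<Longrightarrow> ((m, act K u y), u, (n, y)) \<in> Ar (elements box_cat K)"
  unfolding elements_box_arr by blast

lemma elements_sel [simp]:
  "Dom (elements C P) (a, u, b) = a" "Cod (elements C P) (a, u, b) = b"
  "(n, x) \<in> Ob (elements C P) \<longleftrightarrow> x \<in> cells P n"
  by (simp_all add: elements_def)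

lemma tensor_index_sel [simp]:
  "Dom (tensor_index K L) (k, l) = (Dom (elements box_cat K) k, Dom (elements box_cat L) l)"
  "Cod (tensor_index K L) (k, l) = (Cod (elements box_cat K) k, Cod (elements box_cat L) l)"
  "((n, x), (m, y)) \<in> Ob (tensor_index K L) \<longleftrightarrow> x \<in> cells K n \<and> y \<in> cells L m"
  "(k, l) \<in> Ar (tensor_index K L) \<longleftrightarrow> k \<in> Ar (elements box_cat K) \<and> l \<in> Ar (elements box_cat L)"
  by (simp_all add: tensor_index_def prod_cat_def)

lemma tensor_diagram_sel:
  "fob tensor_diagram ((n, x), (m, y)) = fob (yoneda box_cat) (n + m)"
  "far tensor_diagram ((a, u, b), (c, v, d)) = far (yoneda box_cat) (box_plus u v)"
  by (simp_all add: tensor_diagram_def fcompose_def box_plus_functor_def prod_functor_def elements_proj_def)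

lemma tensor_index_arrE:
  assumes "k \<in> Ar (tensor_index K L)"
  obtains n n' u x m m' v y where
    "k = (((n, act K u x), u, (n', x)), ((m, act L v y), v, (m', y)))"
    "u \<in> box_hom n n'" "x \<in> cells K n'" "v \<in> box_hom m m'" "y \<in> cells L m'"
  using assms by (cases k) (auto simp: elements_box_arr)

lemma tensor_psh_diag:
  assumes "is_presheaf box_cat K" "is_presheaf box_cat L"
  shows "psh_diag box_cat (tensor_index K L) tensor_diagram"
proof
  fix k assume "k \<in> Ar (tensor_index K L)"
  then obtain n n' u x m m' v y where k: "k = (((n, act K u x), u, (n', x)), ((m, act L v y), v, (m', y)))"
    and u: "u \<in> box_hom n n'" "x \<in> cells K n'" "v \<in> box_hom m m'" "y \<in> cells L m'"
    by (rule tensor_index_arrE)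
  have p: "box_plus u v \<in> box_hom (n + m) (n' + m')" using box_plus_hom u by blast
  then have d: "Dom box_cat (box_plus u v) = n + m" by (simp add: box_hom_def)
  show "Dom (tensor_index K L) k \<in> Ob (tensor_index K L) \<and> Cod (tensor_index K L) k \<in> Ob (tensor_index K L)"
    using u assms by (auto simp: k intro: box_psh_act_cell)
  fix l w assume "w \<in> cells (fob tensor_diagram (Dom (tensor_index K L) k)) l"
  then have w: "w \<in> box_hom l (n + m)" by (simp add: k tensor_diagram_sel yoneda_box_sel)
  then show "far tensor_diagram k l w \<in> cells (fob tensor_diagram (Cod (tensor_index K L) k)) l"
    using box_comp_hom[OF w p] by (simp add: k tensor_diagram_sel yoneda_box_sel d)
next
  fix k w l assume "k \<in> Ar (tensor_index K L)" and w: "w \<in> Ar box_cat"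
    and l: "l \<in> cells (fob tensor_diagram (Dom (tensor_index K L) k)) (Cod box_cat w)"
  then obtain n n' u x m m' v y where k: "k = (((n, act K u x), u, (n', x)), ((m, act L v y), v, (m', y)))"
    and u: "u \<in> box_hom n n'" "x \<in> cells K n'" "v \<in> box_hom m m'" "y \<in> cells L m'"
    by (elim tensor_index_arrE)
  have p: "box_plus u v \<in> box_hom (n + m) (n' + m')" using box_plus_hom u by blast
  then have d: "Dom box_cat (box_plus u v) = n + m" by (simp add: box_hom_def)
  have l: "l \<in> box_hom (Cod box_cat w) (n + m)" using l by (simp add: k tensor_diagram_sel yoneda_box_sel)
  have w: "w \<in> box_hom (Dom box_cat w) (Cod box_cat w)" using w by (simp add: box_hom_def)
  show "far tensor_diagram k (Dom box_cat w) (act (fob tensor_diagram (Dom (tensor_index K L) k)) w l)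
     = act (fob tensor_diagram (Cod (tensor_index K L) k)) w (far tensor_diagram k (Cod box_cat w) l)"
    using box_comp_hom[OF w l] box_hom_comp_assoc[OF w l p] l
    by (simp add: k tensor_diagram_sel yoneda_box_sel d)
next
  fix j assume "j \<in> Ob (tensor_index K L)"
  then show "is_presheaf box_cat (fob tensor_diagram j)"
    using yoneda_box_presheaf by (cases j) (auto simp: tensor_diagram_sel)
qed (simp_all add: box_cat_category)

lemma tensor_cube_cls:
  "tensor_cube K L n x m y = psh_cls (tensor_index K L) tensor_diagram (n + m) (((n, x), (m, y)), box_id (n + m))"
  by (simp add: tensor_cube_def tensor_rel_def psh_cls_def)

context
  fixes K :: "'a cset" and L :: "'b cset"
  assumes KL: "is_presheaf box_cat K" "is_presheaf box_cat L"
begin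

interpretation psh_diag box_cat "tensor_index K L" tensor_diagram
  by (rule tensor_psh_diag[OF KL])

lemma tensor_presheaf: "is_presheaf box_cat (tensor K L)"
  unfolding tensor_def by (rule psh_colim_presheaf)

lemma tensor_cube_cell:
  "x \<in> cells K n \<Longrightarrow> y \<in> cells L m \<Longrightarrow> tensor_cube K L n x m y \<in> cells (tensor K L) (n + m)"
  unfolding tensor_cube_cls tensor_def by (rule cls_in) (simp_all add: tensor_diagram_sel yoneda_box_sel)

lemma act_tensor_cube:
  assumes "w \<in> box_hom k (n + m)"
  shows "act (tensor K L) w (tensor_cube K L n x m y)
    = psh_cls (tensor_index K L) tensor_diagram k (((n, x), (m, y)), w)"
proof -
  have w: "w \<in> Ar box_cat" "Dom box_cat w = k" "Cod box_cat w = n + m" using assms by (simp_all add: box_hom_def)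
  show ?thesis
    unfolding tensor_cube_cls tensor_def
    using act_cls[OF w(1), of "((n, x), (m, y))" "box_id (n + m)", unfolded w] box_hom_comp_id(2)[OF assms]
    by (simp add: tensor_diagram_sel yoneda_box_sel)
qed

text \<open>Every cube of \<open>K \<otimes> L\<close> is \<open>w\<^sup>*(x \<otimes> y)\<close>, so maps out of a tensor product are determined by
  their values on the cubes \<open>x \<otimes> y\<close>.\<close>

lemma tensor_cellE:
  assumes "t \<in> cells (tensor K L) k"
  obtains n x m y w where "x \<in> cells K n" "y \<in> cells L m" "w \<in> box_hom k (n + m)"
    "t = act (tensor K L) w (tensor_cube K L n x m y)"
    "t = psh_cls (tensor_index K L) tensor_diagram k (((n, x), (m, y)), w)"
proof -
  obtain j w where j: "j \<in> Ob (tensor_index K L)" "w \<in> cells (fob tensor_diagram j) k"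
    "t = psh_cls (tensor_index K L) tensor_diagram k (j, w)"
    using assms unfolding tensor_def cells_psh_colim by blast
  obtain n x m y where "j = ((n, x), (m, y))" by (cases j) auto
  then show thesis using that[of x n y m w] j act_tensor_cube by (simp add: tensor_diagram_sel yoneda_box_sel)
qed

lemma tensor_cube_act:
  assumes "u \<in> box_hom n' n" "x \<in> cells K n" "v \<in> box_hom m' m" "y \<in> cells L m"
  shows "tensor_cube K L n' (act K u x) m' (act L v y) = act (tensor K L) (box_plus u v) (tensor_cube K L n x m y)"
proof -
  let ?k = "(((n', act K u x), u, (n, x)), ((m', act L v y), v, (m, y)))"
  have p: "box_plus u v \<in> box_hom (n' + m') (n + m)" using box_plus_hom assms by blast
  then have d: "Dom box_cat (box_plus u v) = n' + m'" by (simp add: box_hom_def)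
  have "?k \<in> Ar (tensor_index K L)" using assms by (simp add: elements_box_arrI)
  from psh_cls_step[OF this, of "box_id (n' + m')" tensor_diagram "n' + m'"]
  show ?thesis
    using box_hom_comp_id(1)[OF p]
    by (simp add: tensor_diagram_sel yoneda_box_sel d tensor_cube_cls[of K L n'] act_tensor_cube[OF p])
qed

lemma tensor_map_cls:
  assumes "s \<in> psh_hom box_cat K K'" "t \<in> psh_hom box_cat L L'"
  shows "tensor_map K' L' s t k (psh_cls (tensor_index K L) tensor_diagram k (((n, x), (m, y)), w))
    = psh_cls (tensor_index K' L') tensor_diagram k (((n, s n x), (m, t m y)), w)"
proof -
  let ?h = "\<lambda>(((n, x), (m, y)), w). (((n, s n x), (m, t m y)), w)"
  have "psh_colim_rel (tensor_index K' L') tensor_diagram k ``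
       (?h ` psh_cls (tensor_index K L) tensor_diagram k (((n, x), (m, y)), w))
      = psh_cls (tensor_index K' L') tensor_diagram k (?h (((n, x), (m, y)), w))"
  proof (rule psh_cls_map)
    fix k' w assume "k' \<in> Ar (tensor_index K L)" and w: "w \<in> cells (fob tensor_diagram (Dom (tensor_index K L) k')) k"
    then obtain n n' u x m m' v y where k: "k' = (((n, act K u x), u, (n', x)), ((m, act L v y), v, (m', y)))"
      and u: "u \<in> box_hom n n'" "x \<in> cells K n'" "v \<in> box_hom m m'" "y \<in> cells L m'"
      by (elim tensor_index_arrE)
    let ?k = "(((n, act K' u (s n' x)), u, (n', s n' x)), ((m, act L' v (t m' y)), v, (m', t m' y)))"
    have "?k \<in> Ar (tensor_index K' L')"
      using u psh_hom_cell[OF assms(1)] psh_hom_cell[OF assms(2)] by (simp add: elements_box_arrI)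
    from psh_cls_step[OF this, of w tensor_diagram k] w
    show "psh_cls (tensor_index K' L') tensor_diagram k (?h (Dom (tensor_index K L) k', w))
        = psh_cls (tensor_index K' L') tensor_diagram k (?h (Cod (tensor_index K L) k', far tensor_diagram k' k w))"
      using box_psh_hom_act[OF assms(1) u(1,2)] box_psh_hom_act[OF assms(2) u(3,4)]
      by (simp add: k tensor_diagram_sel)
  qed
  then show ?thesis by (simp add: tensor_map_def tensor_rel_def)
qed

end

lemma tensor_map_act_cube:
  assumes "is_presheaf box_cat K" "is_presheaf box_cat L" "is_presheaf box_cat K'" "is_presheaf box_cat L'"
    "s \<in> psh_hom box_cat K K'" "t \<in> psh_hom box_cat L L'" "w \<in> box_hom k (n + m)"
  shows "tensor_map K' L' s t k (act (tensor K L) w (tensor_cube K L n x m y))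
    = act (tensor K' L') w (tensor_cube K' L' n (s n x) m (t m y))"
  using assms by (simp add: act_tensor_cube tensor_map_cls)

lemma tensor_map_cube:
  assumes "is_presheaf box_cat K" "is_presheaf box_cat L" "s \<in> psh_hom box_cat K K'" "t \<in> psh_hom box_cat L L'"
  shows "tensor_map K' L' s t (n + m) (tensor_cube K L n x m y) = tensor_cube K' L' n (s n x) m (t m y)"
  using assms by (simp add: tensor_map_cls tensor_cube_cls)


section \<open>The category of cubical categories\<close>

lemma ccat_psh: "is_ccat A \<Longrightarrow> x \<in> Obj A \<Longrightarrow> y \<in> Obj A \<Longrightarrow> is_presheaf box_cat (Hom A x y)"
  by (simp add: is_ccat_def)

lemma ccat_unit: "is_ccat A \<Longrightarrow> x \<in> Obj A \<Longrightarrow> Unit A x \<in> cells (Hom A x x) 0"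
  by (simp add: is_ccat_def)

lemma ccat_cmp_hom:
  "is_ccat A \<Longrightarrow> x \<in> Obj A \<Longrightarrow> y \<in> Obj A \<Longrightarrow> z \<in> Obj A \<Longrightarrow>
    Cmp A x y z \<in> psh_hom box_cat (tensor (Hom A x y) (Hom A y z)) (Hom A x z)"
  by (simp add: is_ccat_def)

lemma ccat_cube_cmp_cell:
  "is_ccat A \<Longrightarrow> x \<in> Obj A \<Longrightarrow> y \<in> Obj A \<Longrightarrow> z \<in> Obj A \<Longrightarrow>
    a \<in> cells (Hom A x y) n \<Longrightarrow> b \<in> cells (Hom A y z) m \<Longrightarrow>
    cube_cmp A x y z n a m b \<in> cells (Hom A x z) (n + m)"
  unfolding cube_cmp_def by (intro psh_hom_cell[OF ccat_cmp_hom] tensor_cube_cell ccat_psh)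

lemma ccat_cmp_act_cube:
  assumes "is_ccat A" "x \<in> Obj A" "y \<in> Obj A" "z \<in> Obj A"
    "a \<in> cells (Hom A x y) n" "b \<in> cells (Hom A y z) m" "w \<in> box_hom k (n + m)"
  shows "Cmp A x y z k (act (tensor (Hom A x y) (Hom A y z)) w (tensor_cube (Hom A x y) (Hom A y z) n a m b))
    = act (Hom A x z) w (cube_cmp A x y z n a m b)"
  unfolding cube_cmp_def
  by (rule box_psh_hom_act[OF ccat_cmp_hom]) (use assms in \<open>simp_all add: tensor_cube_cell ccat_psh\<close>)

lemma ccat_cube_cmp_unit:
  assumes "is_ccat A" "x \<in> Obj A" "y \<in> Obj A" "a \<in> cells (Hom A x y) n"
  shows "cube_cmp A x x y 0 (Unit A x) n a = a" "cube_cmp A x y y n a 0 (Unit A y) = a"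
  using assms by (simp_all add: is_ccat_def)

lemma ccat_cube_cmp_assoc:
  assumes "is_ccat A" "w \<in> Obj A" "x \<in> Obj A" "y \<in> Obj A" "z \<in> Obj A"
    "a \<in> cells (Hom A w x) n" "b \<in> cells (Hom A x y) m" "c \<in> cells (Hom A y z) k"
  shows "cube_cmp A w y z (n + m) (cube_cmp A w x y n a m b) k c
    = cube_cmp A w x z n a (m + k) (cube_cmp A x y z m b k c)"
  using assms by (simp add: is_ccat_def)

lemma cfun_ob: "is_cfun F \<Longrightarrow> x \<in> Obj (Src F) \<Longrightarrow> Omap F x \<in> Obj (Tgt F)"
  by (auto simp: is_cfun_def)

lemma cfun_hom:
  assumes "is_cfun F" "x \<in> Obj (Src F)" "y \<in> Obj (Src F)"
  shows "Hmap F x y \<in> psh_hom box_cat (Hom (Src F) x y) (Hom (Tgt F) (Omap F x) (Omap F y))"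
proof -
  have "Hmap F \<in> (\<Pi>\<^sub>E x\<in>Obj (Src F). \<Pi>\<^sub>E y\<in>Obj (Src F).
       psh_hom box_cat (Hom (Src F) x y) (Hom (Tgt F) (Omap F x) (Omap F y)))"
    using assms by (simp add: is_cfun_def)
  from PiE_mem[OF PiE_mem[OF this assms(2)] assms(3)] show ?thesis .
qed

lemma cfun_cell:
  "is_cfun F \<Longrightarrow> x \<in> Obj (Src F) \<Longrightarrow> y \<in> Obj (Src F) \<Longrightarrow> a \<in> cells (Hom (Src F) x y) n \<Longrightarrow>
    Hmap F x y n a \<in> cells (Hom (Tgt F) (Omap F x) (Omap F y)) n"
  by (rule psh_hom_cell[OF cfun_hom])

lemma cfun_unit: "is_cfun F \<Longrightarrow> x \<in> Obj (Src F) \<Longrightarrow> Hmap F x x 0 (Unit (Src F) x) = Unit (Tgt F) (Omap F x)"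
  by (simp add: is_cfun_def)

lemma cfun_cats: "is_cfun F \<Longrightarrow> is_ccat (Src F)" "is_cfun F \<Longrightarrow> is_ccat (Tgt F)"
  unfolding is_cfun_def by blast+

lemma cfun_cmp:
  assumes "is_cfun F" "x \<in> Obj (Src F)" "y \<in> Obj (Src F)" "z \<in> Obj (Src F)"
    "t \<in> cells (tensor (Hom (Src F) x y) (Hom (Src F) y z)) n"
  shows "Hmap F x z n (Cmp (Src F) x y z n t) = Cmp (Tgt F) (Omap F x) (Omap F y) (Omap F z) n
      (tensor_map (Hom (Tgt F) (Omap F x) (Omap F y)) (Hom (Tgt F) (Omap F y) (Omap F z))
         (Hmap F x y) (Hmap F y z) n t)"
  using assms(1)[unfolded is_cfun_def, THEN conjunct2, THEN conjunct2, THEN conjunct2, THEN conjunct2,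
      THEN conjunct2, rule_format, OF assms(2-5)] .

lemma cfun_cube_cmp:
  assumes F: "is_cfun F" and xyz: "x \<in> Obj (Src F)" "y \<in> Obj (Src F)" "z \<in> Obj (Src F)"
    and ab: "a \<in> cells (Hom (Src F) x y) n" "b \<in> cells (Hom (Src F) y z) m"
  shows "Hmap F x z (n + m) (cube_cmp (Src F) x y z n a m b)
    = cube_cmp (Tgt F) (Omap F x) (Omap F y) (Omap F z) n (Hmap F x y n a) m (Hmap F y z m b)"
proof -
  note A = cfun_cats[OF F]
  note p = ccat_psh[OF A(1)]
  have "tensor_cube (Hom (Src F) x y) (Hom (Src F) y z) n a m b
      \<in> cells (tensor (Hom (Src F) x y) (Hom (Src F) y z)) (n + m)"
    by (rule tensor_cube_cell[OF p[OF xyz(1,2)] p[OF xyz(2,3)] ab])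
  then show ?thesis
    unfolding cube_cmp_def cfun_cmp[OF F xyz \<open>tensor_cube _ _ n a m b \<in> _\<close>]
    using tensor_map_cube[OF p[OF xyz(1,2)] p[OF xyz(2,3)] cfun_hom[OF F xyz(1,2)] cfun_hom[OF F xyz(2,3)]]
    by simp
qed

text \<open>The cubes \<open>a \<otimes> b\<close> generate the tensor products, so a functor of cubical categories has to
  preserve composites of pairs of cubes only.\<close>

lemma cfunI:
  assumes A: "is_ccat (Src F)" "is_ccat (Tgt F)"
    and o: "Omap F \<in> Obj (Src F) \<rightarrow>\<^sub>E Obj (Tgt F)"
    and h: "Hmap F \<in> (\<Pi>\<^sub>E x\<in>Obj (Src F). \<Pi>\<^sub>E y\<in>Obj (Src F).
       psh_hom box_cat (Hom (Src F) x y) (Hom (Tgt F) (Omap F x) (Omap F y)))"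
    and u: "\<And>x. x \<in> Obj (Src F) \<Longrightarrow> Hmap F x x 0 (Unit (Src F) x) = Unit (Tgt F) (Omap F x)"
    and c: "\<And>x y z n m a b. x \<in> Obj (Src F) \<Longrightarrow> y \<in> Obj (Src F) \<Longrightarrow> z \<in> Obj (Src F) \<Longrightarrow>
      a \<in> cells (Hom (Src F) x y) n \<Longrightarrow> b \<in> cells (Hom (Src F) y z) m \<Longrightarrow>
      Hmap F x z (n + m) (cube_cmp (Src F) x y z n a m b)
        = cube_cmp (Tgt F) (Omap F x) (Omap F y) (Omap F z) n (Hmap F x y n a) m (Hmap F y z m b)"
  shows "is_cfun F"
proof -
  have hh: "Hmap F x y \<in> psh_hom box_cat (Hom (Src F) x y) (Hom (Tgt F) (Omap F x) (Omap F y))"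
    if "x \<in> Obj (Src F)" "y \<in> Obj (Src F)" for x y
    using PiE_mem[OF PiE_mem[OF h that(1)] that(2)] .
  have ob: "Omap F x \<in> Obj (Tgt F)" if "x \<in> Obj (Src F)" for x using o that by auto
  have "Hmap F x z k (Cmp (Src F) x y z k t)
          = Cmp (Tgt F) (Omap F x) (Omap F y) (Omap F z) k
              (tensor_map (Hom (Tgt F) (Omap F x) (Omap F y)) (Hom (Tgt F) (Omap F y) (Omap F z))
                 (Hmap F x y) (Hmap F y z) k t)"
    if xyz: "x \<in> Obj (Src F)" "y \<in> Obj (Src F)" "z \<in> Obj (Src F)"
      and t: "t \<in> cells (tensor (Hom (Src F) x y) (Hom (Src F) y z)) k" for x y z k t
  proof -
    note p = ccat_psh[OF A(1) xyz(1,2)] ccat_psh[OF A(1) xyz(2,3)]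
      ccat_psh[OF A(2) ob[OF xyz(1)] ob[OF xyz(2)]] ccat_psh[OF A(2) ob[OF xyz(2)] ob[OF xyz(3)]]
    obtain n a m b w where ab: "a \<in> cells (Hom (Src F) x y) n" "b \<in> cells (Hom (Src F) y z) m"
      and w: "w \<in> box_hom k (n + m)"
      and t: "t = act (tensor (Hom (Src F) x y) (Hom (Src F) y z)) w
        (tensor_cube (Hom (Src F) x y) (Hom (Src F) y z) n a m b)"
      by (rule tensor_cellE[OF p(1,2) t])
    have ab': "Hmap F x y n a \<in> cells (Hom (Tgt F) (Omap F x) (Omap F y)) n"
      "Hmap F y z m b \<in> cells (Hom (Tgt F) (Omap F y) (Omap F z)) m"
      by (rule psh_hom_cell[OF hh]; fact)+
    have "Hmap F x z k (Cmp (Src F) x y z k t)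
        = act (Hom (Tgt F) (Omap F x) (Omap F z)) w (Hmap F x z (n + m) (cube_cmp (Src F) x y z n a m b))"
      unfolding t ccat_cmp_act_cube[OF A(1) xyz ab w]
      by (rule box_psh_hom_act[OF hh[OF xyz(1,3)] w ccat_cube_cmp_cell[OF A(1) xyz ab]])
    also have "\<dots> = Cmp (Tgt F) (Omap F x) (Omap F y) (Omap F z) k
       (act (tensor (Hom (Tgt F) (Omap F x) (Omap F y)) (Hom (Tgt F) (Omap F y) (Omap F z))) w
        (tensor_cube (Hom (Tgt F) (Omap F x) (Omap F y)) (Hom (Tgt F) (Omap F y) (Omap F z)) n (Hmap F x y n a) m (Hmap F y z m b)))"
      unfolding c[OF xyz ab] using ccat_cmp_act_cube[OF A(2) ob[OF xyz(1)] ob[OF xyz(2)] ob[OF xyz(3)] ab' w] by simp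
    finally show ?thesis
      unfolding t tensor_map_act_cube[OF p hh[OF xyz(1,2)] hh[OF xyz(2,3)] w] .
  qed
  then show ?thesis unfolding is_cfun_def using A o h u by blast
qed

lemma cfun_eqI:
  assumes F: "is_cfun F" and G: "is_cfun G" and st: "Src F = Src G" "Tgt F = Tgt G"
    and o: "\<And>x. x \<in> Obj (Src F) \<Longrightarrow> Omap F x = Omap G x"
    and h: "\<And>x y n a. x \<in> Obj (Src F) \<Longrightarrow> y \<in> Obj (Src F) \<Longrightarrow> a \<in> cells (Hom (Src F) x y) n
      \<Longrightarrow> Hmap F x y n a = Hmap G x y n a"
  shows "F = G"
proof -
  have oF: "Omap F \<in> extensional (Obj (Src F))" "Omap G \<in> extensional (Obj (Src F))"
    using F G st by (simp_all add: is_cfun_def PiE_iff)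
  have oe: "Omap F = Omap G" by (rule extensionalityI[OF oF o])
  have hF: "Hmap F \<in> extensional (Obj (Src F))" "Hmap G \<in> extensional (Obj (Src F))"
    using F G st by (simp_all add: is_cfun_def PiE_iff)
  have hFx: "Hmap F x \<in> extensional (Obj (Src F))" "Hmap G x \<in> extensional (Obj (Src F))"
    if "x \<in> Obj (Src F)" for x
    using F G st that by (simp_all add: is_cfun_def PiE_iff)
  have "Hmap F x y = Hmap G x y" if "x \<in> Obj (Src F)" "y \<in> Obj (Src F)" for x y
  proof (rule psh_hom_ext[OF cfun_hom[OF F that]])
    show "Hmap G x y \<in> psh_hom box_cat (Hom (Src F) x y) (Hom (Tgt G) (Omap G x) (Omap G y))"
      using cfun_hom[OF G] that st by simp
  qed (rule h[OF that])
  then have "Hmap F x = Hmap G x" if "x \<in> Obj (Src F)" for x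
    using extensionalityI[OF hFx[OF that]] that by blast
  then have "Hmap F = Hmap G" using extensionalityI[OF hF] by blast
  then show ?thesis using oe st by (simp add: efun.equality)
qed

lemma cfun_comp:
  assumes F: "is_cfun F" and G: "is_cfun G" and FG: "Tgt F = Src G"
  shows "is_cfun (efun_comp G F)"
proof -
  let ?H = "efun_comp G F"
  have st: "Src ?H = Src F" "Tgt ?H = Tgt G" by (simp_all add: efun_comp_def)
  note ob = cfun_ob[OF F, unfolded FG]
  note A = cfun_cats[OF F] cfun_cats[OF G]
  have o: "Omap ?H x = Omap G (Omap F x)" if "x \<in> Obj (Src F)" for x
    using that by (simp add: efun_comp_def)
  have h: "Hmap ?H x y n a = Hmap G (Omap F x) (Omap F y) n (Hmap F x y n a)"
    if "x \<in> Obj (Src F)" "y \<in> Obj (Src F)" "a \<in> cells (Hom (Src F) x y) n" for x y n a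
    using that by (simp add: efun_comp_def psh_comp_def)
  note c = cfun_cell[OF F, unfolded FG]
  have H: "Hmap ?H x y \<in> psh_hom box_cat (Hom (Src F) x y) (Hom (Tgt G) (Omap ?H x) (Omap ?H y))"
    if xy: "x \<in> Obj (Src F)" "y \<in> Obj (Src F)" for x y
    using psh_comp_hom[OF ccat_psh[OF A(1) xy] cfun_hom[OF F xy, unfolded FG] cfun_hom[OF G ob[OF xy(1)] ob[OF xy(2)]]] xy
    by (simp add: efun_comp_def)
  show ?thesis
  proof (rule cfunI, unfold st)
    show "Omap ?H \<in> Obj (Src F) \<rightarrow>\<^sub>E Obj (Tgt G)"
      using cfun_ob[OF G] ob by (auto simp: efun_comp_def)
    show "Hmap ?H \<in> (\<Pi>\<^sub>E x\<in>Obj (Src F). \<Pi>\<^sub>E y\<in>Obj (Src F).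
       psh_hom box_cat (Hom (Src F) x y) (Hom (Tgt G) (Omap ?H x) (Omap ?H y)))"
      by (intro PiE_I H) (simp_all add: efun_comp_def)
    fix x assume x: "x \<in> Obj (Src F)"
    show "Hmap ?H x x 0 (Unit (Src F) x) = Unit (Tgt G) (Omap ?H x)"
      using h[OF x x ccat_unit[OF A(1) x]] cfun_unit[OF F x] cfun_unit[OF G ob[OF x]] FG o[OF x] by simp
  next
    fix x y z n m a b
    assume *: "x \<in> Obj (Src F)" "y \<in> Obj (Src F)" "z \<in> Obj (Src F)"
      "a \<in> cells (Hom (Src F) x y) n" "b \<in> cells (Hom (Src F) y z) m"
    show "Hmap ?H x z (n + m) (cube_cmp (Src F) x y z n a m b)
        = cube_cmp (Tgt G) (Omap ?H x) (Omap ?H y) (Omap ?H z) n (Hmap ?H x y n a) m (Hmap ?H y z m b)"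
      using cfun_cube_cmp[OF F *]
        cfun_cube_cmp[OF G ob[OF *(1)] ob[OF *(2)] ob[OF *(3)] c[OF *(1,2,4)] c[OF *(2,3,5)]]
        ccat_cube_cmp_cell[OF A(1) *] FG *
      by (simp add: h o)
  qed (use A in auto)
qed

lemma efun_id_cfun:
  assumes "is_ccat A" shows "is_cfun (efun_id A)"
proof (rule cfunI)
  have "Hmap (efun_id A) \<in> (\<Pi>\<^sub>E x\<in>Obj A. \<Pi>\<^sub>E y\<in>Obj A.
      psh_hom box_cat (Hom A x y) (Hom A (Omap (efun_id A) x) (Omap (efun_id A) y)))"
    using psh_id_hom[OF ccat_psh[OF assms]] by (intro PiE_I) (simp_all add: efun_id_def)
  then show "Hmap (efun_id A) \<in> (\<Pi>\<^sub>E x\<in>Obj (Src (efun_id A)). \<Pi>\<^sub>E y\<in>Obj (Src (efun_id A)).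
       psh_hom box_cat (Hom (Src (efun_id A)) x y) (Hom (Tgt (efun_id A)) (Omap (efun_id A) x) (Omap (efun_id A) y)))"
    by (simp add: efun_id_def)
qed (use assms ccat_unit[OF assms] ccat_cube_cmp_cell[OF assms] in \<open>simp_all add: efun_id_def psh_id_def\<close>)

lemma CCat_category: "is_category (CCat :: (('o, 'a) ccat, ('o, 'a, 'o, 'a) cfun) cat)"
proof -
  have l: "efun_comp F (efun_id (Src F)) = F" if F: "is_cfun F" for F :: "('o, 'a, 'o, 'a) cfun"
  proof (rule cfun_eqI)
    show "is_cfun (efun_comp F (efun_id (Src F)))"
      using cfun_comp[OF efun_id_cfun[OF cfun_cats(1)[OF F]] F] by (simp add: efun_id_def)
  qed (use F in \<open>auto simp: efun_comp_def efun_id_def psh_comp_def psh_id_def\<close>)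
  have r: "efun_comp (efun_id (Tgt F)) F = F" if F: "is_cfun F" for F :: "('o, 'a, 'o, 'a) cfun"
  proof (rule cfun_eqI)
    show "is_cfun (efun_comp (efun_id (Tgt F)) F)"
      using cfun_comp[OF F efun_id_cfun[OF cfun_cats(2)[OF F]]] by (simp add: efun_id_def)
  qed (use F cfun_ob[OF F] cfun_cell[OF F] in
        \<open>auto simp: efun_comp_def efun_id_def psh_comp_def psh_id_def\<close>)
  have a: "efun_comp K (efun_comp G F) = efun_comp (efun_comp K G) F"
    if F: "is_cfun F" and G: "is_cfun G" and K: "is_cfun K" and "Src G = Tgt F" "Src K = Tgt G"
    for F G K :: "('o, 'a, 'o, 'a) cfun"
  proof (rule cfun_eqI)
    have s: "Src (efun_comp G F) = Src F" "Tgt (efun_comp G F) = Tgt G"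
      "Src (efun_comp K G) = Src G" "Tgt (efun_comp K G) = Tgt K" by (simp_all add: efun_comp_def)
    have GF: "is_cfun (efun_comp G F)" and KG: "is_cfun (efun_comp K G)"
      using that cfun_comp by metis+
    show "is_cfun (efun_comp K (efun_comp G F))" "is_cfun (efun_comp (efun_comp K G) F)"
      using cfun_comp[OF GF K] cfun_comp[OF F KG] s that by simp_all
  qed (use that cfun_ob[OF F] cfun_cell[OF F] in \<open>simp_all add: efun_comp_def psh_comp_def\<close>)
  have s: "Src (efun_id A) = A" "Tgt (efun_id A) = A" for A :: "('o, 'a) ccat"
    by (simp_all add: efun_id_def)
  have t: "Src (efun_comp G F) = Src F" "Tgt (efun_comp G F) = Tgt G" for F G :: "('o, 'a, 'o, 'a) cfun"
    by (simp_all add: efun_comp_def)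
  show ?thesis
    unfolding is_category_def CCat_def
    by (simp add: s t cfun_cats l r a efun_id_cfun cfun_comp)
qed


section \<open>Triangulation\<close>

lemma prod_psh_presheaf:
  assumes "is_presheaf C P" "is_presheaf C Q" shows "is_presheaf C (prod_psh P Q)"
  using assms unfolding is_presheaf_def prod_psh_def by auto

lemma simplex_cat_sel [simp]:
  "Dom simplex_cat (m, n, f) = m" "Cod simplex_cat (m, n, f) = n" "Ob simplex_cat = UNIV"
  "(m, n, f) \<in> Ar simplex_cat \<longleftrightarrow> f \<in> {..m} \<rightarrow>\<^sub>E {..n} \<and> mono_on {..m} f"
  by (simp_all add: simplex_cat_def)

lemma nerve_cell_iff:
  "c \<in> cells (nerve A le) k \<longleftrightarrow> c \<in> extensional {..k} \<and> (\<forall>i\<le>k. c i \<in> A) \<and> (\<forall>i j. i \<le> j \<and> j \<le> k \<longrightarrow> le (c i) (c j))"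
  by (auto simp: nerve_def PiE_iff)

lemma act_nerve: "act (nerve A le) (m, n, f) c = (\<lambda>i\<in>{..m}. c (f i))"
  by (simp add: nerve_def)

abbreviation cube_chains :: "nat \<Rightarrow> nat \<Rightarrow> (nat \<Rightarrow> bool list) set" where
  "cube_chains n k \<equiv> cells (nerve (cube n) cube_le) k"

lemma cube_chain_map:
  assumes "(m, n, f) \<in> box_arrows" "c \<in> cube_chains m k"
  shows "(\<lambda>i\<in>{..k}. f (c i)) \<in> cube_chains n k"
  using assms box_arrow_in[OF assms(1)] box_arrow_map(2)[OF assms(1)] by (simp add: nerve_cell_iff)

lemma cube_chain_append:
  assumes "c \<in> cube_chains n k" "d \<in> cube_chains m k"
  shows "(\<lambda>i\<in>{..k}. c i @ d i) \<in> cube_chains (n + m) k"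
  using assms by (simp add: nerve_cell_iff list_all2_appendI)

lemma cube_chain_empty: "(\<lambda>i\<in>{..k}. []) \<in> cube_chains 0 k"
  by (simp add: nerve_cell_iff cube_def)

lemma nerve_act_cell:
  "u \<in> Ar simplex_cat \<Longrightarrow> c \<in> cells (nerve A le) (Cod simplex_cat u) \<Longrightarrow>
    act (nerve A le) u c \<in> cells (nerve A le) (Dom simplex_cat u)"
  by (rule psh_act_cells[OF nerve_psh])

text \<open>The simplex of \<open>|K|\<close> given by the \<open>n\<close>-cube \<open>x\<close> of \<open>K\<close> and a chain \<open>c\<close> in \<open>\<one>\<^sup>n\<close>.\<close>

definition tri_simplex :: "'a cset \<Rightarrow> nat \<Rightarrow> nat \<Rightarrow> 'a \<Rightarrow> (nat \<Rightarrow> bool list) \<Rightarrow> 'a tri_cell" where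
  "tri_simplex K k n x c = psh_cls (elements box_cat K) (cube_nerve \<circ>\<^sub>F elements_proj) k ((n, x), c)"

lemma tri_diagram_sel:
  "fob (cube_nerve \<circ>\<^sub>F elements_proj) (n, x) = nerve (cube n) cube_le"
  "far (cube_nerve \<circ>\<^sub>F elements_proj) (a, (m, n, f), b) = nerve_map (cube m) cube_le f"
  by (simp_all add: fcompose_def cube_nerve_def elements_proj_def)

lemma elements_box_arrE:
  assumes "k \<in> Ar (elements box_cat K)"
  obtains m n f y where "k = ((m, act K (m, n, f) y), (m, n, f), (n, y))"
    "(m, n, f) \<in> box_arrows" "y \<in> cells K n"
  using assms unfolding elements_box_arr by (metis box_homE)

lemma tri_psh_diag:
  assumes "is_presheaf box_cat K"
  shows "psh_diag simplex_cat (elements box_cat K) (cube_nerve \<circ>\<^sub>F elements_proj)"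
proof
  fix k assume k: "k \<in> Ar (elements box_cat K)"
  show "Dom (elements box_cat K) k \<in> Ob (elements box_cat K) \<and> Cod (elements box_cat K) k \<in> Ob (elements box_cat K)"
    by (rule elements_graph[OF assms k])
  from k obtain m n f y where k: "k = ((m, act K (m, n, f) y), (m, n, f), (n, y))"
    and f: "(m, n, f) \<in> box_arrows" "y \<in> cells K n" by (rule elements_box_arrE)
  have h: "nerve_map (cube m) cube_le f \<in> psh_hom simplex_cat (nerve (cube m) cube_le) (nerve (cube n) cube_le)"
    by (rule nerve_map_hom) (use box_arrow_in[OF f(1)] box_arrow_map(2)[OF f(1)] in auto)
  show "far (cube_nerve \<circ>\<^sub>F elements_proj) k l c \<in> cells (fob (cube_nerve \<circ>\<^sub>F elements_proj) (Cod (elements box_cat K) k)) l"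
    if "c \<in> cells (fob (cube_nerve \<circ>\<^sub>F elements_proj) (Dom (elements box_cat K) k)) l" for c l
    using psh_hom_cell[OF h] that by (simp add: k tri_diagram_sel)
  show "far (cube_nerve \<circ>\<^sub>F elements_proj) k (Dom simplex_cat u) (act (fob (cube_nerve \<circ>\<^sub>F elements_proj) (Dom (elements box_cat K) k)) u c)
     = act (fob (cube_nerve \<circ>\<^sub>F elements_proj) (Cod (elements box_cat K) k)) u (far (cube_nerve \<circ>\<^sub>F elements_proj) k (Cod simplex_cat u) c)"
    if "u \<in> Ar simplex_cat" "c \<in> cells (fob (cube_nerve \<circ>\<^sub>F elements_proj) (Dom (elements box_cat K) k)) (Cod simplex_cat u)" for u c
    using psh_hom_act[OF h that(1)] that(2) by (simp add: k tri_diagram_sel)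
next
  fix j show "is_presheaf simplex_cat (fob (cube_nerve \<circ>\<^sub>F elements_proj) j)"
    using nerve_psh by (cases j) (simp only: tri_diagram_sel)
qed (simp_all add: simplex_cat_category)

text \<open>To define a function on the simplices of \<open>|K|\<close> it suffices to define it on all pairs of an
  \<open>n\<close>-cube and a chain in \<open>\<one>\<^sup>n\<close>, compatibly with the morphisms of the category of cubes.\<close>

lemma tri_simplex_invariant:
  assumes "tri_simplex K k n x c = tri_simplex K k n' x' c'"
    and "\<And>m n f y c. (m, n, f) \<in> box_arrows \<Longrightarrow> y \<in> cells K n \<Longrightarrow> c \<in> cube_chains m k \<Longrightarrow>
      F m (act K (m, n, f) y) c = F n y (\<lambda>i\<in>{..k}. f (c i))"
  shows "F n x c = F n' x' c'"
proof -
  have "(\<lambda>((n, x), c). F n x c) ((n, x), c) = (\<lambda>((n, x), c). F n x c) ((n', x'), c')"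
  proof (rule psh_cls_invariant[OF assms(1)[unfolded tri_simplex_def]])
    fix l c assume "l \<in> Ar (elements box_cat K)"
      and c: "c \<in> cells (fob (cube_nerve \<circ>\<^sub>F elements_proj) (Dom (elements box_cat K) l)) k"
    then obtain m n f y where l: "l = ((m, act K (m, n, f) y), (m, n, f), (n, y))"
      and f: "(m, n, f) \<in> box_arrows" "y \<in> cells K n" by (elim elements_box_arrE)
    then show "(\<lambda>((n, x), c). F n x c) (Dom (elements box_cat K) l, c)
      = (\<lambda>((n, x), c). F n x c) (Cod (elements box_cat K) l, far (cube_nerve \<circ>\<^sub>F elements_proj) l k c)"
      using assms(2)[OF f] c by (simp add: tri_diagram_sel nerve_map_def)
  qed
  then show ?thesis by simp
qed

lemma tri_simplex_shift:
  assumes "(m, n, f) \<in> box_arrows" "y \<in> cells K n" "c \<in> cube_chains m k"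
  shows "tri_simplex K k m (act K (m, n, f) y) c = tri_simplex K k n y (\<lambda>i\<in>{..k}. f (c i))"
proof -
  have "((m, act K (m, n, f) y), (m, n, f), (n, y)) \<in> Ar (elements box_cat K)"
    using assms by (intro elements_box_arrI) simp_all
  from psh_cls_step[OF this, of c "cube_nerve \<circ>\<^sub>F elements_proj" k]
  show ?thesis using assms(3) by (simp add: tri_simplex_def tri_diagram_sel nerve_map_def)
qed

lemma tri_cellE:
  assumes "X \<in> cells (tri K) k"
  obtains n x c where "x \<in> cells K n" "c \<in> cube_chains n k" "X = tri_simplex K k n x c"
proof -
  obtain j c where j: "j \<in> Ob (elements box_cat K)" "c \<in> cells (fob (cube_nerve \<circ>\<^sub>F elements_proj) j) k"
    "X = psh_cls (elements box_cat K) (cube_nerve \<circ>\<^sub>F elements_proj) k (j, c)"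
    using assms unfolding tri_def cells_psh_colim by blast
  obtain n x where "j = (n, x)" by (cases j)
  then show thesis using that[of x n c] j by (simp add: tri_diagram_sel tri_simplex_def)
qed

lemma tri_map_simplex:
  assumes "is_presheaf box_cat K" "t \<in> psh_hom box_cat K L" "x \<in> cells K n" "c \<in> cube_chains n k"
  shows "tri_map K L t k (tri_simplex K k n x c) = tri_simplex L k n (t n x) c"
proof -
  let ?h = "\<lambda>((n, x), c). ((n, t n x), c)"
  have "psh_colim_rel (elements box_cat L) (cube_nerve \<circ>\<^sub>F elements_proj) k ``
      (?h ` psh_cls (elements box_cat K) (cube_nerve \<circ>\<^sub>F elements_proj) k ((n, x), c))
      = psh_cls (elements box_cat L) (cube_nerve \<circ>\<^sub>F elements_proj) k (?h ((n, x), c))"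
  proof (rule psh_cls_map)
    fix l c assume "l \<in> Ar (elements box_cat K)"
      and c: "c \<in> cells (fob (cube_nerve \<circ>\<^sub>F elements_proj) (Dom (elements box_cat K) l)) k"
    then obtain m n f y where l: "l = ((m, act K (m, n, f) y), (m, n, f), (n, y))"
      and f: "(m, n, f) \<in> box_arrows" "y \<in> cells K n" by (elim elements_box_arrE)
    have "t m (act K (m, n, f) y) = act L (m, n, f) (t n y)"
      by (rule box_psh_hom_act[OF assms(2)]) (use f in simp_all)
    then show "psh_cls (elements box_cat L) (cube_nerve \<circ>\<^sub>F elements_proj) k (?h (Dom (elements box_cat K) l, c))
      = psh_cls (elements box_cat L) (cube_nerve \<circ>\<^sub>F elements_proj) k
          (?h (Cod (elements box_cat K) l, far (cube_nerve \<circ>\<^sub>F elements_proj) l k c))"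
      using tri_simplex_shift[OF f(1) psh_hom_cell[OF assms(2) f(2)], of c k] c
      by (simp add: l tri_simplex_def tri_diagram_sel nerve_map_def)
  qed
  moreover have "tri_simplex K k n x c \<in> cells (tri K) k"
    using assms unfolding tri_def tri_simplex_def cells_psh_colim
    by (simp add: tri_diagram_sel) (metis elements_sel(3) tri_diagram_sel(1))
  ultimately show ?thesis by (simp add: tri_map_def tri_simplex_def tri_rel_def)
qed

context
  fixes K :: "'a cset"
  assumes K: "is_presheaf box_cat K"
begin

interpretation psh_diag simplex_cat "elements box_cat K" "cube_nerve \<circ>\<^sub>F elements_proj"
  by (rule tri_psh_diag[OF K])

lemma tri_presheaf: "is_presheaf simplex_cat (tri K)"
  unfolding tri_def by (rule psh_colim_presheaf)

lemma tri_simplex_cell: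
  "x \<in> cells K n \<Longrightarrow> c \<in> cube_chains n k \<Longrightarrow> tri_simplex K k n x c \<in> cells (tri K) k"
  unfolding tri_simplex_def tri_def by (rule cls_in) (simp_all add: tri_diagram_sel)

lemma tri_simplex_act:
  assumes "u \<in> Ar simplex_cat"
  shows "act (tri K) u (tri_simplex K (Cod simplex_cat u) n x c)
    = tri_simplex K (Dom simplex_cat u) n x (act (nerve (cube n) cube_le) u c)"
  using act_cls[OF assms] unfolding tri_def tri_simplex_def by (simp add: tri_diagram_sel)

lemma tri_simplex_mem:
  assumes "((n', x'), c') \<in> tri_simplex K k n x c" "x \<in> cells K n" "c \<in> cube_chains n k"
  shows "x' \<in> cells K n'" "c' \<in> cube_chains n' k" "tri_simplex K k n' x' c' = tri_simplex K k n x c"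
  using cls_mem_valid[OF assms(1)[unfolded tri_simplex_def]] assms(2,3)
    psh_cls_mem_eq[OF assms(1)[unfolded tri_simplex_def]]
  by (simp_all add: tri_diagram_sel tri_simplex_def)

lemma tri_map_hom:
  assumes L: "is_presheaf box_cat L" and t: "t \<in> psh_hom box_cat K L"
  shows "tri_map K L t \<in> psh_hom simplex_cat (tri K) (tri L)"
proof (rule psh_homI)
  fix k X assume "X \<in> cells (tri K) k"
  then obtain n x c where x: "x \<in> cells K n" "c \<in> cube_chains n k" "X = tri_simplex K k n x c"
    by (rule tri_cellE)
  interpret L: psh_diag simplex_cat "elements box_cat L" "cube_nerve \<circ>\<^sub>F elements_proj"
    by (rule tri_psh_diag[OF L])
  show "tri_map K L t k X \<in> cells (tri L) k"
    using x psh_hom_cell[OF t x(1)] L.cls_in[of "(n, t n x)" c k]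
    by (simp add: tri_map_simplex[OF K t] tri_simplex_def[of L] tri_def tri_diagram_sel)
next
  fix u X assume u: "u \<in> Ar simplex_cat" and "X \<in> cells (tri K) (Cod simplex_cat u)"
  then obtain n x c where x: "x \<in> cells K n" "c \<in> cube_chains n (Cod simplex_cat u)"
    "X = tri_simplex K (Cod simplex_cat u) n x c" by (elim tri_cellE)
  interpret L: psh_diag simplex_cat "elements box_cat L" "cube_nerve \<circ>\<^sub>F elements_proj"
    by (rule tri_psh_diag[OF L])
  have "act (tri L) u (tri_simplex L (Cod simplex_cat u) n (t n x) c)
    = tri_simplex L (Dom simplex_cat u) n (t n x) (act (nerve (cube n) cube_le) u c)"
    using L.act_cls[OF u] unfolding tri_def tri_simplex_def by (simp add: tri_diagram_sel)
  then show "tri_map K L t (Dom simplex_cat u) (act (tri K) u X) = act (tri L) u (tri_map K L t (Cod simplex_cat u) X)"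
    using x nerve_act_cell[OF u x(2)] by (simp add: tri_simplex_act[OF u] tri_map_simplex[OF K t])
qed (simp add: tri_map_def)

end

text \<open>The right-hand side does not depend on the choice of representatives.  The relation that
  defines a triangulation is generated by morphisms of cubes, so this is checked for one factor at a
  time, by taking the product of a morphism of cubes with an identity.\<close>

lemma tri_mult_simplex:
  assumes K: "is_presheaf box_cat K" and L: "is_presheaf box_cat L"
    and x: "x \<in> cells K n" "c \<in> cube_chains n k" and y: "y \<in> cells L m" "d \<in> cube_chains m k"
  shows "tri_mult K L k (tri_simplex K k n x c, tri_simplex L k m y d)
    = tri_simplex (tensor K L) k (n + m) (tensor_cube K L n x m y) (\<lambda>i\<in>{..k}. c i @ d i)"
proof -
  let ?A = "{((n' + m', tensor_cube K L n' x' m' y'), \<lambda>i\<in>{..k}. c' i @ d' i) | n' x' c' m' y' d'.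
          ((n', x'), c') \<in> tri_simplex K k n x c \<and> ((m', y'), d') \<in> tri_simplex L k m y d}"
  define M where "M n x c m y d
    = tri_simplex (tensor K L) k (n + m) (tensor_cube K L n x m y) (\<lambda>i\<in>{..k}. c i @ d i)" for n x c m y d
  have step: "M n (act K (n, n', f) x) c m (act L (m, m', g) y) d = M n' x (\<lambda>i\<in>{..k}. f (c i)) m' y (\<lambda>i\<in>{..k}. g (d i))"
    if f: "(n, n', f) \<in> box_arrows" "x \<in> cells K n'" "c \<in> cube_chains n k"
      and g: "(m, m', g) \<in> box_arrows" "y \<in> cells L m'" "d \<in> cube_chains m k"
    for n n' f x c m m' g y d
  proof -
    have p: "box_plus (n, n', f) (m, m', g) \<in> box_arrows" using box_plus_arrow f g by blast
    have "c i \<in> cube n" "d i \<in> cube m" if "i \<le> k" for i using f(3) g(3) that by (auto simp: nerve_cell_iff)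
    then have e: "(\<lambda>i\<in>{..k}. (\<lambda>s\<in>cube (n + m). f (take n s) @ g (drop n s)) ((\<lambda>i\<in>{..k}. c i @ d i) i))
        = (\<lambda>i\<in>{..k}. (\<lambda>i\<in>{..k}. f (c i)) i @ (\<lambda>i\<in>{..k}. g (d i)) i)"
      by (intro restrict_ext) (auto simp: cube_def)
    have "tensor_cube K L n (act K (n, n', f) x) m (act L (m, m', g) y)
        = act (tensor K L) (box_plus (n, n', f) (m, m', g)) (tensor_cube K L n' x m' y)"
      by (rule tensor_cube_act[OF K L]) (use f g in simp_all)
    then show ?thesis
      unfolding M_def box_plus_simp
      using tri_simplex_shift[OF p[unfolded box_plus_simp] tensor_cube_cell[OF K L f(2) g(2)] cube_chain_append[OF f(3) g(3)]] e
      by simp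
  qed
  have id: "act K (n, n, \<lambda>s\<in>cube n. s) x = x" "(n, n, \<lambda>s\<in>cube n. s) \<in> box_arrows"
    "c \<in> cube_chains n k \<Longrightarrow> (\<lambda>i\<in>{..k}. (\<lambda>s\<in>cube n. s) (c i)) = c"
    if "is_presheaf box_cat K" "x \<in> cells K n" for K :: "'c cset" and x n c
    using box_psh_act_id[OF that] box_arrows.intros(1)[of n]
    by (auto simp: box_id_def nerve_cell_iff extensional_def fun_eq_iff)
  have 1: "M n' x' c' m y d = M n x c m y d"
    if "tri_simplex K k n' x' c' = tri_simplex K k n x c" "y \<in> cells L m" "d \<in> cube_chains m k"
    for n' x' c' n x c m y d
  proof (rule tri_simplex_invariant[OF that(1)])
    fix p q f x c assume "(p, q, f) \<in> box_arrows" "x \<in> cells K q" "c \<in> cube_chains p k"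
    from step[OF this id(2)[OF L that(2)] that(2,3)]
    show "M p (act K (p, q, f) x) c m y d = M q x (\<lambda>i\<in>{..k}. f (c i)) m y d"
      unfolding id(1)[OF L that(2)] id(3)[OF L that(2,3)] .
  qed
  have 2: "M n x c m' y' d' = M n x c m y d"
    if "tri_simplex L k m' y' d' = tri_simplex L k m y d" "x \<in> cells K n" "c \<in> cube_chains n k"
    for m' y' d' n x c m y d
  proof (rule tri_simplex_invariant[OF that(1)])
    fix p q f y d assume "(p, q, f) \<in> box_arrows" "y \<in> cells L q" "d \<in> cube_chains p k"
    from step[OF id(2)[OF K that(2)] that(2,3) this]
    show "M n x c p (act L (p, q, f) y) d = M n x c q y (\<lambda>i\<in>{..k}. f (d i))"
      unfolding id(1)[OF K that(2)] id(3)[OF K that(2,3)] .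
  qed
  have "tri_rel (tensor K L) k `` ?A = tri_simplex (tensor K L) k (n + m) (tensor_cube K L n x m y) (\<lambda>i\<in>{..k}. c i @ d i)"
    unfolding tri_rel_def tri_simplex_def[of "tensor K L"]
  proof (rule psh_cls_Image)
    have "((n, x), c) \<in> tri_simplex K k n x c" "((m, y), d) \<in> tri_simplex L k m y d"
      unfolding tri_simplex_def by (rule psh_cls_self)+
    then show "((n + m, tensor_cube K L n x m y), \<lambda>i\<in>{..k}. c i @ d i) \<in> ?A" by blast
    fix e assume "e \<in> ?A"
    then obtain n' x' c' m' y' d' where e: "e = ((n' + m', tensor_cube K L n' x' m' y'), \<lambda>i\<in>{..k}. c' i @ d' i)"
      and *: "((n', x'), c') \<in> tri_simplex K k n x c" "((m', y'), d') \<in> tri_simplex L k m y d" by blast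
    have "M n' x' c' m' y' d' = M n x c m' y' d'"
      by (rule 1[OF tri_simplex_mem(3)[OF K *(1) x] tri_simplex_mem(1,2)[OF L *(2) y]])
    also have "\<dots> = M n x c m y d"
      by (rule 2[OF tri_simplex_mem(3)[OF L *(2) y] x])
    finally show "psh_cls (elements box_cat (tensor K L)) (cube_nerve \<circ>\<^sub>F elements_proj) k e
       = psh_cls (elements box_cat (tensor K L)) (cube_nerve \<circ>\<^sub>F elements_proj) k
           ((n + m, tensor_cube K L n x m y), \<lambda>i\<in>{..k}. c i @ d i)"
      unfolding M_def tri_simplex_def e .
  qed
  moreover have "(tri_simplex K k n x c, tri_simplex L k m y d) \<in> cells (prod_psh (tri K) (tri L)) k"
    using tri_simplex_cell[OF K x] tri_simplex_cell[OF L y] by (simp add: prod_psh_def)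
  ultimately show ?thesis by (simp add: tri_mult_def)
qed

lemma tri_mult_hom:
  assumes K: "is_presheaf box_cat K" and L: "is_presheaf box_cat L"
  shows "tri_mult K L \<in> psh_hom simplex_cat (prod_psh (tri K) (tri L)) (tri (tensor K L))"
proof (rule psh_homI)
  note KL = tensor_presheaf[OF K L]
  fix k P assume "P \<in> cells (prod_psh (tri K) (tri L)) k"
  then obtain X Y where "P = (X, Y)" "X \<in> cells (tri K) k" "Y \<in> cells (tri L) k" by (auto simp: prod_psh_def)
  then show "tri_mult K L k P \<in> cells (tri (tensor K L)) k"
    by (elim tri_cellE) (simp add: tri_mult_simplex[OF K L] tri_simplex_cell[OF KL] tensor_cube_cell[OF K L] cube_chain_append)
next
  note KL = tensor_presheaf[OF K L]
  fix u P assume u: "u \<in> Ar simplex_cat" and "P \<in> cells (prod_psh (tri K) (tri L)) (Cod simplex_cat u)"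
  then obtain X Y where P: "P = (X, Y)" and XY: "X \<in> cells (tri K) (Cod simplex_cat u)" "Y \<in> cells (tri L) (Cod simplex_cat u)"
    by (auto simp: prod_psh_def)
  obtain n x c where x: "x \<in> cells K n" "c \<in> cube_chains n (Cod simplex_cat u)" "X = tri_simplex K (Cod simplex_cat u) n x c"
    using XY(1) by (rule tri_cellE)
  obtain m y d where y: "y \<in> cells L m" "d \<in> cube_chains m (Cod simplex_cat u)" "Y = tri_simplex L (Cod simplex_cat u) m y d"
    using XY(2) by (rule tri_cellE)
  obtain p q f where uf: "u = (p, q, f)" by (cases u)
  then have f: "\<And>i. i \<le> p \<Longrightarrow> f i \<le> q" using u by auto
  show "tri_mult K L (Dom simplex_cat u) (act (prod_psh (tri K) (tri L)) u P)
      = act (tri (tensor K L)) u (tri_mult K L (Cod simplex_cat u) P)"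
    using x y nerve_act_cell[OF u x(2)] nerve_act_cell[OF u y(2)] f
    by (simp add: P prod_psh_def tri_simplex_act[OF K u, unfolded uf simplex_cat_sel]
        tri_simplex_act[OF L u, unfolded uf simplex_cat_sel] tri_simplex_act[OF KL u, unfolded uf simplex_cat_sel]
        tri_mult_simplex[OF K L] uf act_nerve cong: restrict_cong)
qed (auto simp: tri_mult_def)

lemma T_ob_sel [simp]:
  "Obj (T_ob A) = Obj A" "Hom (T_ob A) x y = tri (Hom A x y)"
  "Unit (T_ob A) x = tri_simplex (Hom A x x) 0 0 (Unit A x) (\<lambda>i\<in>{..0}. [])"
  by (simp_all add: T_ob_def tri_simplex_def psh_cls_def tri_rel_def)

lemma T_ob_Cmp:
  assumes A: "is_ccat A" "x \<in> Obj A" "y \<in> Obj A" "z \<in> Obj A"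
    and a: "a \<in> cells (Hom A x y) n" "c \<in> cube_chains n k"
    and b: "b \<in> cells (Hom A y z) m" "d \<in> cube_chains m k"
  shows "Cmp (T_ob A) x y z k (tri_simplex (Hom A x y) k n a c, tri_simplex (Hom A y z) k m b d)
     = tri_simplex (Hom A x z) k (n + m) (cube_cmp A x y z n a m b) (\<lambda>i\<in>{..k}. c i @ d i)"
proof -
  note p = ccat_psh[OF A(1,2,3)] ccat_psh[OF A(1,3,4)]
  have "(tri_simplex (Hom A x y) k n a c, tri_simplex (Hom A y z) k m b d) \<in> cells (prod_psh (tri (Hom A x y)) (tri (Hom A y z))) k"
    using tri_simplex_cell[OF p(1) a] tri_simplex_cell[OF p(2) b] by (simp add: prod_psh_def)
  then show ?thesis
    using tri_map_simplex[OF tensor_presheaf[OF p] ccat_cmp_hom[OF A] tensor_cube_cell[OF p a(1) b(1)] cube_chain_append[OF a(2) b(2)]]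
    by (simp add: T_ob_def psh_comp_def tri_mult_simplex[OF p a b] cube_cmp_def)
qed

lemma T_ob_unit_simplex:
  assumes "is_ccat A" "x \<in> Obj A"
  shows "unit_simplex (T_ob A) x k = tri_simplex (Hom A x x) k 0 (Unit A x) (\<lambda>i\<in>{..k}. [])"
proof -
  have "act (nerve (cube 0) cube_le) (k, 0, \<lambda>i\<in>{..k}. 0) (\<lambda>i\<in>{..0}. []) = (\<lambda>i\<in>{..k}. [])"
    unfolding act_nerve by (rule restrict_ext) simp
  then show ?thesis
    using tri_simplex_act[OF ccat_psh[OF assms assms(2)] simplex_const_arr(1)[of k], of 0 "Unit A x" "\<lambda>i\<in>{..0}. []"]
    unfolding unit_simplex_def T_ob_sel simplex_cat_sel by simp
qed

text \<open>On representatives, composition composes the cubes and concatenates the chains pointwise.  So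
  the laws of \<open>T_ob A\<close> are those of \<open>A\<close> and of concatenation of lists.\<close>

lemma T_ob_scat:
  assumes A: "is_ccat A" shows "is_scat (T_ob A)"
  unfolding is_scat_def
proof (intro conjI ballI allI, unfold T_ob_sel)
  fix x y assume x: "x \<in> Obj A" and y: "y \<in> Obj A"
  show "is_presheaf simplex_cat (tri (Hom A x y))" using tri_presheaf[OF ccat_psh[OF A x y]] .
next
  fix x assume x: "x \<in> Obj A"
  show "tri_simplex (Hom A x x) 0 0 (Unit A x) (\<lambda>i\<in>{..0}. []) \<in> cells (tri (Hom A x x)) 0"
    by (rule tri_simplex_cell[OF ccat_psh[OF A x x] ccat_unit[OF A x] cube_chain_empty])
next
  fix x y z assume x: "x \<in> Obj A" and y: "y \<in> Obj A" and z: "z \<in> Obj A"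
  note p = ccat_psh[OF A x y] ccat_psh[OF A y z] ccat_psh[OF A x z]
  show "Cmp (T_ob A) x y z \<in> psh_hom simplex_cat (prod_psh (tri (Hom A x y)) (tri (Hom A y z))) (tri (Hom A x z))"
    unfolding T_ob_def ecat.simps
    by (rule psh_comp_hom[OF prod_psh_presheaf[OF tri_presheaf[OF p(1)] tri_presheaf[OF p(2)]] tri_mult_hom[OF p(1,2)]
          tri_map_hom[OF tensor_presheaf[OF p(1,2)] p(3) ccat_cmp_hom[OF A x y z]]])
next
  fix x y k X assume x: "x \<in> Obj A" and y: "y \<in> Obj A" and "X \<in> cells (tri (Hom A x y)) k"
  then obtain n a c where a: "a \<in> cells (Hom A x y) n" "c \<in> cube_chains n k" "X = tri_simplex (Hom A x y) k n a c"
    by (elim tri_cellE)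
  note u = ccat_unit[OF A x] cube_chain_empty
  note u' = ccat_unit[OF A y] cube_chain_empty
  have e: "c \<in> extensional {..k}" using a(2) by (simp add: nerve_cell_iff)
  show "Cmp (T_ob A) x x y k (unit_simplex (T_ob A) x k, X) = X"
    using T_ob_Cmp[OF A x x y u a(1,2)] ccat_cube_cmp_unit[OF A x y a(1)] e
    by (simp add: a(3) T_ob_unit_simplex[OF A x] extensional_restrict cong: restrict_cong)
  show "Cmp (T_ob A) x y y k (X, unit_simplex (T_ob A) y k) = X"
    using T_ob_Cmp[OF A x y y a(1,2) u'] ccat_cube_cmp_unit[OF A x y a(1)] e
    by (simp add: a(3) T_ob_unit_simplex[OF A y] extensional_restrict cong: restrict_cong)
next
  fix w x y z k X Y Z
  assume w: "w \<in> Obj A" and x: "x \<in> Obj A" and y: "y \<in> Obj A" and z: "z \<in> Obj A"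
    and X: "X \<in> cells (tri (Hom A w x)) k" and Y: "Y \<in> cells (tri (Hom A x y)) k" and Z: "Z \<in> cells (tri (Hom A y z)) k"
  obtain n a c where a: "a \<in> cells (Hom A w x) n" "c \<in> cube_chains n k" and X: "X = tri_simplex (Hom A w x) k n a c"
    using X by (rule tri_cellE)
  obtain n' a' c' where a': "a' \<in> cells (Hom A x y) n'" "c' \<in> cube_chains n' k" and Y: "Y = tri_simplex (Hom A x y) k n' a' c'"
    using Y by (rule tri_cellE)
  obtain n'' a'' c'' where a'': "a'' \<in> cells (Hom A y z) n''" "c'' \<in> cube_chains n'' k" and Z: "Z = tri_simplex (Hom A y z) k n'' a'' c''"
    using Z by (rule tri_cellE)
  show "Cmp (T_ob A) w y z k (Cmp (T_ob A) w x y k (X, Y), Z) = Cmp (T_ob A) w x z k (X, Cmp (T_ob A) x y z k (Y, Z))"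
    unfolding X Y Z T_ob_Cmp[OF A w x y a a'] T_ob_Cmp[OF A x y z a' a'']
      T_ob_Cmp[OF A w y z ccat_cube_cmp_cell[OF A w x y a(1) a'(1)] cube_chain_append[OF a(2) a'(2)] a'']
      T_ob_Cmp[OF A w x z a ccat_cube_cmp_cell[OF A x y z a'(1) a''(1)] cube_chain_append[OF a'(2) a''(2)]]
      ccat_cube_cmp_assoc[OF A w x y z a(1) a'(1) a''(1)]
    by (simp add: add.assoc cong: restrict_cong)
qed

lemma T_ar_sfun:
  assumes F: "is_cfun F" shows "is_sfun (T_ar F)"
proof -
  note A = cfun_cats[OF F]
  note ob = cfun_ob[OF F]
  have st: "Src (T_ar F) = T_ob (Src F)" "Tgt (T_ar F) = T_ob (Tgt F)" "Omap (T_ar F) = Omap F"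
    by (simp_all add: T_ar_def)
  have h: "Hmap (T_ar F) x y = tri_map (Hom (Src F) x y) (Hom (Tgt F) (Omap F x) (Omap F y)) (Hmap F x y)"
    if "x \<in> Obj (Src F)" "y \<in> Obj (Src F)" for x y using that by (simp add: T_ar_def)
  have hs: "Hmap (T_ar F) x y k (tri_simplex (Hom (Src F) x y) k n a c)
      = tri_simplex (Hom (Tgt F) (Omap F x) (Omap F y)) k n (Hmap F x y n a) c"
    if "x \<in> Obj (Src F)" "y \<in> Obj (Src F)" "a \<in> cells (Hom (Src F) x y) n" "c \<in> cube_chains n k" for x y k n a c
    unfolding h[OF that(1,2)] by (rule tri_map_simplex[OF ccat_psh[OF A(1) that(1,2)] cfun_hom[OF F that(1,2)] that(3,4)])
  show ?thesis
    unfolding is_sfun_def st T_ob_sel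
  proof (intro conjI ballI allI)
    show "Omap F \<in> Obj (Src F) \<rightarrow>\<^sub>E Obj (Tgt F)" using F unfolding is_cfun_def by blast
    show "Hmap (T_ar F) \<in> (\<Pi>\<^sub>E x\<in>Obj (Src F). \<Pi>\<^sub>E y\<in>Obj (Src F).
       psh_hom simplex_cat (tri (Hom (Src F) x y)) (tri (Hom (Tgt F) (Omap F x) (Omap F y))))"
      using tri_map_hom[OF ccat_psh[OF A(1)] ccat_psh[OF A(2) ob ob] cfun_hom[OF F]]
      by (intro PiE_I) (simp_all add: T_ar_def)
  next
    fix x assume x: "x \<in> Obj (Src F)"
    show "Hmap (T_ar F) x x 0 (tri_simplex (Hom (Src F) x x) 0 0 (Unit (Src F) x) (\<lambda>i\<in>{..0}. []))
      = tri_simplex (Hom (Tgt F) (Omap F x) (Omap F x)) 0 0 (Unit (Tgt F) (Omap F x)) (\<lambda>i\<in>{..0}. [])"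
      unfolding hs[OF x x ccat_unit[OF A(1) x] cube_chain_empty] cfun_unit[OF F x] ..
  next
    fix x y z k X Y assume x: "x \<in> Obj (Src F)" and y: "y \<in> Obj (Src F)" and z: "z \<in> Obj (Src F)"
      and X: "X \<in> cells (tri (Hom (Src F) x y)) k" and Y: "Y \<in> cells (tri (Hom (Src F) y z)) k"
    obtain n a c where a: "a \<in> cells (Hom (Src F) x y) n" "c \<in> cube_chains n k" and X: "X = tri_simplex (Hom (Src F) x y) k n a c"
      using X by (rule tri_cellE)
    obtain m b d where b: "b \<in> cells (Hom (Src F) y z) m" "d \<in> cube_chains m k" and Y: "Y = tri_simplex (Hom (Src F) y z) k m b d"
      using Y by (rule tri_cellE)
    show "Hmap (T_ar F) x z k (Cmp (T_ob (Src F)) x y z k (X, Y))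
      = Cmp (T_ob (Tgt F)) (Omap F x) (Omap F y) (Omap F z) k (Hmap (T_ar F) x y k X, Hmap (T_ar F) y z k Y)"
      unfolding X Y T_ob_Cmp[OF A(1) x y z a b] hs[OF x y a] hs[OF y z b]
        hs[OF x z ccat_cube_cmp_cell[OF A(1) x y z a(1) b(1)] cube_chain_append[OF a(2) b(2)]]
        T_ob_Cmp[OF A(2) ob[OF x] ob[OF y] ob[OF z] cfun_cell[OF F x y a(1)] a(2) cfun_cell[OF F y z b(1)] b(2)]
        cfun_cube_cmp[OF F x y z a(1) b(1)] ..
  qed (rule T_ob_scat A)+
qed

lemma T_ar_Hmap:
  assumes F: "is_cfun F" and "x \<in> Obj (Src F)" "y \<in> Obj (Src F)" "a \<in> cells (Hom (Src F) x y) n" "c \<in> cube_chains n k"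
  shows "Hmap (T_ar F) x y k (tri_simplex (Hom (Src F) x y) k n a c)
      = tri_simplex (Hom (Tgt F) (Omap F x) (Omap F y)) k n (Hmap F x y n a) c"
  using tri_map_simplex[OF ccat_psh[OF cfun_cats(1)[OF F] assms(2,3)] cfun_hom[OF F assms(2,3)] assms(4,5)] assms(2,3)
  by (simp add: T_ar_def)

theorem T_functor_functor:
  "is_functor CCat SCat (T_functor :: (('o, 'a) ccat, ('o, 'a, 'o, 'a) cfun, _, _) func)"
proof -
  have sel: "Src (T_ar F) = T_ob (Src F)" "Tgt (T_ar F) = T_ob (Tgt F)" "Omap (T_ar F) = Omap F" for F :: "('o, 'a, 'o, 'a) cfun"
    by (simp_all add: T_ar_def)
  have sid: "Src (efun_id A) = A" "Tgt (efun_id A) = A" for A :: "('x, 'm, 'y, 't) ecat" by (simp_all add: efun_id_def)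
  have scomp: "Src (efun_comp G F) = Src F" "Tgt (efun_comp G F) = Tgt G" for F :: "('o, 'a, 'o, 'a) cfun" and G :: "('o, 'a, 'o, 'a) cfun"
    by (simp_all add: efun_comp_def)
  have scomp': "Src (efun_comp G F) = Src F" "Tgt (efun_comp G F) = Tgt G" for F G :: "('o, 'a tri_cell, 'o, 'a tri_cell) sfun"
    by (simp_all add: efun_comp_def)
  have i: "T_ar (efun_id A) = efun_id (T_ob A)" if A: "is_ccat A" for A :: "('o, 'a) ccat"
  proof (rule sfun_eqI[OF T_ar_sfun[OF efun_id_cfun[OF A]] efun_id_sfun[OF T_ob_scat[OF A]]])
    fix x y k X assume "x \<in> Obj (Src (T_ar (efun_id A)))" "y \<in> Obj (Src (T_ar (efun_id A)))"
      and X: "X \<in> cells (Hom (Src (T_ar (efun_id A))) x y) k"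
    then have x: "x \<in> Obj A" and y: "y \<in> Obj A" and X: "X \<in> cells (tri (Hom A x y)) k" by (simp_all add: sel sid)
    from X obtain n a c where a: "a \<in> cells (Hom A x y) n" "c \<in> cube_chains n k" "X = tri_simplex (Hom A x y) k n a c" by (rule tri_cellE)
    show "Hmap (T_ar (efun_id A)) x y k X = Hmap (efun_id (T_ob A)) x y k X"
      using T_ar_Hmap[OF efun_id_cfun[OF A], unfolded sid, OF x y a(1,2)] x y a X
      by (simp add: efun_id_def psh_id_def)
  qed (simp_all add: sel sid efun_id_def)
  have c: "T_ar (efun_comp G F) = efun_comp (T_ar G) (T_ar F)"
    if F: "is_cfun F" and G: "is_cfun G" and FG: "Src G = Tgt F" for F G :: "('o, 'a, 'o, 'a) cfun"
  proof (rule sfun_eqI[OF T_ar_sfun[OF cfun_comp[OF F G FG[symmetric]]] sfun_comp[OF T_ar_sfun[OF F] T_ar_sfun[OF G]]])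
    fix x y k X assume "x \<in> Obj (Src (T_ar (efun_comp G F)))" "y \<in> Obj (Src (T_ar (efun_comp G F)))"
      and X: "X \<in> cells (Hom (Src (T_ar (efun_comp G F))) x y) k"
    then have x: "x \<in> Obj (Src F)" and y: "y \<in> Obj (Src F)" and X: "X \<in> cells (tri (Hom (Src F) x y)) k" by (simp_all add: sel scomp)
    from X obtain n a c where a: "a \<in> cells (Hom (Src F) x y) n" "c \<in> cube_chains n k" "X = tri_simplex (Hom (Src F) x y) k n a c" by (rule tri_cellE)
    note o = cfun_ob[OF F x, folded FG] cfun_ob[OF F y, folded FG]
    show "Hmap (T_ar (efun_comp G F)) x y k X = Hmap (efun_comp (T_ar G) (T_ar F)) x y k X"
      using T_ar_Hmap[OF cfun_comp[OF F G FG[symmetric]], unfolded scomp, OF x y a(1,2)]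
        T_ar_Hmap[OF F x y a(1,2)] T_ar_Hmap[OF G o cfun_cell[OF F x y a(1), folded FG] a(2)] x y a X FG
      by (simp add: efun_comp_def psh_comp_def sel)
  qed (auto simp: sel scomp scomp' FG efun_comp_def)
  show ?thesis
    unfolding is_functor_def
    using CCat_category SCat_category by (auto simp: CCat_def SCat_def T_functor_def T_ob_scat T_ar_sfun i c sel)
qed


section \<open>Necklaces and their maps\<close>

lemma Nec_Ob: "T \<in> Ob Nec \<longleftrightarrow> (\<forall>n\<in>set T. 1 \<le> n)"
  by (simp add: Nec_def)

lemma Nec_append [simp]: "T @ U \<in> Ob Nec \<longleftrightarrow> T \<in> Ob Nec \<and> U \<in> Ob Nec"
  by (auto simp: Nec_Ob)

lemma joints_image: "joints T = (\<lambda>i. sum_list (take i T)) ` {..length T}"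
  by (auto simp: joints_def)

lemma joints_append: "joints (T @ U) = joints T \<union> (+) (sum_list T) ` joints U"
proof -
  have "{..length (T @ U)} = {..length T} \<union> (+) (length T) ` {..length U}"
  proof -
    have "i \<in> (+) (length T) ` {..length U}" if "\<not> i \<le> length T" "i \<le> length T + length U" for i
      using that by (intro image_eqI[of _ _ "i - length T"]) auto
    then show ?thesis by auto
  qed
  then show ?thesis by (simp add: joints_image image_Un image_image)
qed

lemma joints_ends: "0 \<in> joints T" "sum_list T \<in> joints T"
  unfolding joints_image by (rule image_eqI[of _ _ 0]; simp) (rule image_eqI[of _ _ "length T"]; simp)

lemma joints_le: "joints T \<subseteq> {..sum_list T}"
  using sum_take_le by (auto simp: joints_image)

lemma joints_bead: "joints [n] = {0, n}"
  by (auto simp: joints_image atMost_Suc)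

lemma joints_Nil: "joints [] = {0}"
  by (auto simp: joints_image)

lemma sum_take_mono: "i \<le> j \<Longrightarrow> sum_list (take i T) \<le> sum_list (take j (T :: nat list))"
  by (metis le_add1 min.absorb2 min.commute sum_take_le take_take)

lemma bead_joint_free:
  assumes "v \<in> joints T" shows "\<not> (sum_list (take i T) < v \<and> v < sum_list (take (Suc i) T))"
proof -
  obtain j where "v = sum_list (take j T)" using assms by (auto simp: joints_image)
  then show ?thesis using sum_take_mono[of j i T] sum_take_mono[of "Suc i" j T] by (cases "j \<le> i") auto
qed

text \<open>A sequence of vertices is a simplex of a necklace iff it does not jump over a joint.  This
  describes a necklace by its number of vertices and its set of joints, without any reference
  to single beads.\<close>

lemma necklace_cell_iff:
  assumes "T \<in> Ob Nec"
  shows "c \<in> cells (necklace T) m \<longleftrightarrow>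
    c \<in> {..m} \<rightarrow>\<^sub>E {..sum_list T} \<and> mono_on {..m} c \<and> (\<forall>v\<in>joints T. \<not> (c 0 < v \<and> v < c m))"
    (is "_ \<longleftrightarrow> ?R")
proof
  assume c: "c \<in> cells (necklace T) m"
  then have 1: "c \<in> {..m} \<rightarrow>\<^sub>E {..sum_list T}" "mono_on {..m} c"
    by (simp_all add: necklace_def std_simplex_cells)
  have "\<not> (c 0 < v \<and> v < c m)" if v: "v \<in> joints T" for v
  proof (cases "T = []")
    case True
    then show ?thesis using 1 by (auto simp: PiE_iff)
  next
    case False
    then obtain i where "c ` {..m} \<subseteq> {sum_list (take i T) .. sum_list (take (Suc i) T)}"
      using c by (auto simp: necklace_def)
    then have "sum_list (take i T) \<le> c 0" "c m \<le> sum_list (take (Suc i) T)" by auto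
    then show ?thesis using bead_joint_free[OF v, of i] by linarith
  qed
  with 1 show ?R by blast
next
  assume R: ?R
  have c: "c 0 \<le> c i" "c i \<le> c m" if "i \<le> m" for i
    using R that by (auto simp: mono_on_def)
  show "c \<in> cells (necklace T) m"
  proof (cases "c 0 < sum_list T")
    case True
    then obtain i where i: "i < length T" "sum_list (take i T) \<le> c 0" "c 0 < sum_list (take (Suc i) T)"
      using bead_containing by blast
    then have "sum_list (take (Suc i) T) \<in> joints T" by (auto simp: joints_image)
    then have m: "c m \<le> sum_list (take (Suc i) T)" using R i by force
    have "c j \<in> {sum_list (take i T) .. sum_list (take (Suc i) T)}" if "j \<le> m" for j
      using c[OF that] i m by simp
    then show ?thesis using R by (intro necklace_edge_vertex_cells[OF i(1)]) (auto simp: PiE_iff)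
  next
    case False
    then have "c i = sum_list T" if "i \<le> m" for i using c[OF that] R that by (auto simp: PiE_iff le_antisym)
    then have "c = (\<lambda>i\<in>{..m}. sum_list T)" using R by (auto simp: fun_eq_iff PiE_iff extensional_def)
    then show ?thesis using const_in_necklace[OF assms] by simp
  qed
qed

lemma necklace_cell_le: "c \<in> cells (necklace T) m \<Longrightarrow> i \<le> m \<Longrightarrow> c i \<le> sum_list T"
  by (auto simp: necklace_def std_simplex_cells)

lemma necklace_cell_mono: "c \<in> cells (necklace T) m \<Longrightarrow> mono_on {..m} c"
  by (auto simp: necklace_def std_simplex_cells)

lemma necklace_cell_ext: "c \<in> cells (necklace T) m \<Longrightarrow> c \<in> extensional {..m}"
  by (auto simp: necklace_def std_simplex_cells PiE_iff)

lemma necklace_cell_restrict: "c \<in> cells (necklace T) m \<Longrightarrow> (\<lambda>i\<in>{..m}. c i) = c"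
  by (simp add: extensional_restrict necklace_cell_ext)

lemma act_necklace: "act (necklace T) (m, n, f) c = (\<lambda>i\<in>{..m}. c (f i))"
  by (simp add: necklace_def std_simplex_def act_nerve)

lemma necklace_act_cell:
  assumes "c \<in> cells (necklace T) n" "f \<in> {..m} \<rightarrow>\<^sub>E {..n}" "mono_on {..m} f"
  shows "(\<lambda>i\<in>{..m}. c (f i)) \<in> cells (necklace T) m"
proof -
  have "act (std_simplex (sum_list T)) (m, n, f) c \<in> cells (std_simplex (sum_list T)) m"
    using psh_act_cells[OF nerve_psh, of "(m, n, f)" c "{..sum_list T}" "(\<le>)"] assms
    by (simp add: std_simplex_def necklace_def)
  then show ?thesis using assms(1,2) by (fastforce simp: necklace_def std_simplex_def act_nerve)
qed

lemma necklace_presheaf: "is_presheaf simplex_cat (necklace T)"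
  unfolding is_presheaf_def
proof (intro conjI ballI allI impI)
  fix u c assume "u \<in> Ar simplex_cat" "c \<in> cells (necklace T) (Cod simplex_cat u)"
  then show "act (necklace T) u c \<in> cells (necklace T) (Dom simplex_cat u)"
    by (cases u) (simp add: act_necklace necklace_act_cell)
next
  fix n c assume "c \<in> cells (necklace T) n"
  then show "act (necklace T) (Idn simplex_cat n) c = c"
    by (simp add: simplex_cat_def act_necklace necklace_cell_restrict cong: restrict_cong)
next
  fix u v c assume "u \<in> Ar simplex_cat" "v \<in> Ar simplex_cat" "Dom simplex_cat v = Cod simplex_cat u"
    "c \<in> cells (necklace T) (Cod simplex_cat v)"
  then show "act (necklace T) (Comp simplex_cat v u) c = act (necklace T) u (act (necklace T) v c)"
    by (cases u, cases v) (auto simp: act_necklace simplex_cat_def fun_eq_iff)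
qed

lemma vtx_cell: "T \<in> Ob Nec \<Longrightarrow> v \<le> sum_list T \<Longrightarrow> vtx v \<in> cells (necklace T) 0"
  unfolding vtx_def by (rule const_in_necklace)

lemma vertex_incl_arr: "i \<le> m \<Longrightarrow> (0, m, \<lambda>j\<in>{..0::nat}. i) \<in> Ar simplex_cat"
  by (auto simp: mono_on_def)

text \<open>Maps of necklaces are the same as monotone maps of vertices that preserve the end points
  and whose image of the set of joints contains all joints.  The last property is what makes
  \<open>P(f)\<close> well defined.\<close>

definition nec_vertex_map :: "nat list \<Rightarrow> nat list \<Rightarrow> (nat \<Rightarrow> nat) \<Rightarrow> bool" where
  "nec_vertex_map T U g \<longleftrightarrow> mono_on {..sum_list T} g \<and> g 0 = 0 \<and> g (sum_list T) = sum_list U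
     \<and> joints U \<subseteq> g ` joints T"

definition nec_map :: "nat list \<Rightarrow> (nat \<Rightarrow> nat) \<Rightarrow> necklace_map" where
  "nec_map T g = (\<lambda>m. \<lambda>c\<in>cells (necklace T) m. \<lambda>i\<in>{..m}. g (c i))"

lemma nec_vertex_map_le:
  "nec_vertex_map T U g \<Longrightarrow> v \<le> sum_list T \<Longrightarrow> g v \<le> sum_list U"
  unfolding nec_vertex_map_def using mono_onD[of "{..sum_list T}" g v "sum_list T"] by simp

lemma nec_vertex_map_mono:
  "nec_vertex_map T U g \<Longrightarrow> v \<le> w \<Longrightarrow> w \<le> sum_list T \<Longrightarrow> g v \<le> g w"
  unfolding nec_vertex_map_def using mono_onD[of "{..sum_list T}" g v w] by simp

lemma nec_map_cell:
  assumes T: "T \<in> Ob Nec" and U: "U \<in> Ob Nec" and g: "nec_vertex_map T U g" and c: "c \<in> cells (necklace T) m"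
  shows "(\<lambda>i\<in>{..m}. g (c i)) \<in> cells (necklace U) m"
proof -
  note le = nec_vertex_map_le[OF g] and mono = nec_vertex_map_mono[OF g]
  have cc: "c i \<le> sum_list T" if "i \<le> m" for i using necklace_cell_le[OF c that] .
  have cm: "c i \<le> c j" if "i \<le> j" "j \<le> m" for i j
    using necklace_cell_mono[OF c] that by (auto simp: mono_on_def)
  have "\<not> (g (c 0) < v \<and> v < g (c m))" if v: "v \<in> joints U" for v
  proof
    assume *: "g (c 0) < v \<and> v < g (c m)"
    obtain w where w: "w \<in> joints T" "v = g w" using g v by (auto simp: nec_vertex_map_def)
    have "w \<le> sum_list T" using w joints_le by blast
    then have "c 0 < w" "w < c m"
      using * w mono[of w "c 0"] mono[of "c m" w] cc[of 0] by (metis le0 not_le)+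
    then show False using c w(1) necklace_cell_iff[OF T] by blast
  qed
  then show ?thesis
    unfolding necklace_cell_iff[OF U] using le[OF cc] mono[OF cm cc] by (auto simp: mono_on_def)
qed

lemma nec_map_simp: "c \<in> cells (necklace T) m \<Longrightarrow> nec_map T g m c = (\<lambda>i\<in>{..m}. g (c i))"
  by (simp add: nec_map_def)

lemma nec_map_hom:
  assumes "T \<in> Ob Nec" "U \<in> Ob Nec" "nec_vertex_map T U g"
  shows "nec_map T g \<in> psh_hom simplex_cat (necklace T) (necklace U)"
proof (rule psh_homI)
  fix n c assume "c \<in> cells (necklace T) n"
  then show "nec_map T g n c \<in> cells (necklace U) n" using nec_map_cell[OF assms] by (simp add: nec_map_simp)
next
  fix u c assume u: "u \<in> Ar simplex_cat" and c: "c \<in> cells (necklace T) (Cod simplex_cat u)"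
  obtain m n f where uf: "u = (m, n, f)" by (cases u)
  have "(\<lambda>i\<in>{..m}. c (f i)) \<in> cells (necklace T) m" using necklace_act_cell u c uf by simp
  moreover have "f i \<le> n" if "i \<le> m" for i using u uf that by auto
  ultimately show "nec_map T g (Dom simplex_cat u) (act (necklace T) u c)
      = act (necklace U) u (nec_map T g (Cod simplex_cat u) c)"
    using c by (simp add: uf act_necklace nec_map_simp cong: restrict_cong)
qed (simp add: nec_map_def)

lemma nec_map_vtx: "T \<in> Ob Nec \<Longrightarrow> v \<le> sum_list T \<Longrightarrow> nec_map T g 0 (vtx v) = vtx (g v)"
proof -
  assume T: "T \<in> Ob Nec" "v \<le> sum_list T"
  have "(\<lambda>i\<in>{..0}. g (vtx v i)) = vtx (g v)" unfolding vtx_def by (rule restrict_ext) simp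
  then show ?thesis using nec_map_simp[OF vtx_cell[OF T]] by (simp only:)
qed

lemma nec_map_arr:
  assumes "T \<in> Ob Nec" "U \<in> Ob Nec" "nec_vertex_map T U g"
  shows "(T, nec_map T g, U) \<in> Ar Nec"
  using assms nec_map_hom[OF assms] by (simp add: Nec_def nec_map_vtx nec_vertex_map_def)

text \<open>Simplices of a necklace are determined by their vertices, so a map is determined by its
  effect \<open>g\<close> on vertices.  It is monotone because consecutive vertices form an edge.  Let \<open>v\<close> be a
  joint of \<open>U\<close> before the last vertex, and choose a bead of \<open>T\<close> whose initial vertex is mapped to some vertex up to
  \<open>v\<close> and whose final vertex is mapped beyond \<open>v\<close>.  They form an edge, whose image cannot jump over
  \<open>v\<close>; so the initial vertex is mapped to \<open>v\<close>.\<close>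

lemma Nec_arrE:
  assumes "(T, h, U) \<in> Ar Nec"
  obtains g where "T \<in> Ob Nec" "U \<in> Ob Nec" "nec_vertex_map T U g" "h = nec_map T g"
proof -
  have T: "T \<in> Ob Nec" and U: "U \<in> Ob Nec" and h: "h \<in> psh_hom simplex_cat (necklace T) (necklace U)"
    and ends: "h 0 (vtx 0) = vtx 0" "h 0 (vtx (sum_list T)) = vtx (sum_list U)"
    using assms by (auto simp: Nec_def)
  define g where "g = vertex_map h"
  have hg: "h m c i = g (c i)" if c: "c \<in> cells (necklace T) m" and i: "i \<le> m" for m c i
  proof -
    have "h 0 (act (necklace T) (0, m, \<lambda>j\<in>{..0}. i) c) = act (necklace U) (0, m, \<lambda>j\<in>{..0}. i) (h m c)"
      using psh_hom_act[OF h vertex_incl_arr[OF i]] c by simp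
    moreover have "act (necklace T) (0, m, \<lambda>j\<in>{..0}. i) c = vtx (c i)"
      unfolding act_necklace vtx_def by (rule restrict_ext) simp
    ultimately show ?thesis by (simp add: g_def vertex_map_def act_necklace)
  qed
  have "h m c = nec_map T g m c" for m c
  proof (cases "c \<in> cells (necklace T) m")
    case True
    have "h m c \<in> extensional {..m}" using necklace_cell_ext[OF psh_hom_cell[OF h True]] .
    then show ?thesis using hg[OF True] True by (auto simp: nec_map_simp extensional_def fun_eq_iff)
  next
    case False
    then show ?thesis using psh_hom_undefined[OF h] by (simp add: nec_map_def)
  qed
  then have e: "h = nec_map T g" by blast
  have edge: "(\<lambda>i\<in>{..1}. if i = 0 then v else w) \<in> cells (necklace T) 1"
    if "v \<le> w" "w \<le> sum_list T" "\<And>z. z \<in> joints T \<Longrightarrow> \<not> (v < z \<and> z < w)" for v w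
    unfolding necklace_cell_iff[OF T] using that by (auto simp: mono_on_def)
  have gedge: "g v \<le> g w" "\<And>z. z \<in> joints U \<Longrightarrow> \<not> (g v < z \<and> z < g w)"
    if "v \<le> w" "w \<le> sum_list T" "\<And>z. z \<in> joints T \<Longrightarrow> \<not> (v < z \<and> z < w)" for v w
  proof -
    let ?e = "\<lambda>i\<in>{..1::nat}. if i = 0 then v else w"
    have c: "h 1 ?e \<in> cells (necklace U) 1" using psh_hom_cell[OF h edge[OF that]] .
    moreover have "h 1 ?e 0 = g v" "h 1 ?e 1 = g w" using hg[OF edge[OF that]] by simp_all
    ultimately show "g v \<le> g w" "\<And>z. z \<in> joints U \<Longrightarrow> \<not> (g v < z \<and> z < g w)"
      using mono_onD[OF necklace_cell_mono[OF c], of 0 1] necklace_cell_iff[OF U, of "h 1 ?e" 1] by auto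
  qed
  have mono: "g v \<le> g w" if "v \<le> w" "w \<le> sum_list T" for v w
    using that
  proof (induction w rule: dec_induct)
    case (step w)
    then show ?case using gedge(1)[of w "Suc w"] by fastforce
  qed simp
  have g0: "g 0 = 0" "g (sum_list T) = sum_list U"
    using ends by (simp_all add: g_def vertex_map_def vtx_def fun_eq_iff)
  have "v \<in> g ` joints T" if v: "v \<in> joints U" for v
  proof (cases "v = sum_list U")
    case True
    then show ?thesis using g0 joints_ends[of T] by (metis imageI)
  next
    case False
    then have vU: "v < sum_list U" using v joints_le by fastforce
    let ?W = "{w. w \<le> sum_list T \<and> g w \<le> v}"
    have fin: "finite ?W" by simp
    define w where "w = Max ?W"
    have "0 \<in> ?W" using g0 by simp
    then have w: "w \<le> sum_list T" "g w \<le> v" using Max_in[OF fin] unfolding w_def by blast+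
    have "w \<noteq> sum_list T" using w g0 vU by auto
    then have w': "w < sum_list T" using w by simp
    have "v < g (Suc w)"
    proof (rule ccontr)
      assume "\<not> v < g (Suc w)"
      then have "Suc w \<le> w" using Max_ge[OF fin, of "Suc w"] w' by (simp add: w_def)
      then show False by simp
    qed
    obtain i where i: "i < length T" "sum_list (take i T) \<le> w" "w < sum_list (take (Suc i) T)"
      using bead_containing[OF w'] by blast
    have "\<not> (g (sum_list (take i T)) < v \<and> v < g (sum_list (take (Suc i) T)))"
      using gedge(2)[OF _ _ _ v] bead_joint_free sum_take_mono[of i "Suc i"] sum_take_le by (metis le_SucI order_refl)
    moreover have "g (sum_list (take i T)) \<le> v" using mono[of "sum_list (take i T)" w] i w by simp
    moreover have "v < g (sum_list (take (Suc i) T))"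
      using \<open>v < g (Suc w)\<close> mono[of "Suc w" "sum_list (take (Suc i) T)"] i sum_take_le[of "Suc i" T] by simp
    ultimately have "v = g (sum_list (take i T))" by simp
    then show ?thesis using i by (auto simp: joints_image)
  qed
  then have "nec_vertex_map T U g" using mono g0 by (auto simp: nec_vertex_map_def mono_on_def)
  then show thesis using that T U e by blast
qed

lemma nec_map_id: "nec_map T (\<lambda>v. v) = psh_id (necklace T)"
  unfolding nec_map_def psh_id_def by (intro ext restrict_ext) (simp add: necklace_cell_restrict)

lemma nec_vertex_map_id: "nec_vertex_map T T (\<lambda>v. v)"
  by (simp add: nec_vertex_map_def mono_on_def)

section \<open>Cubes of necklaces\<close>

definition free_vertices :: "nat list \<Rightarrow> nat list" where
  "free_vertices T = sorted_list_of_set ({..sum_list T} - joints T)"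

definition nec_dim :: "nat list \<Rightarrow> nat" where
  "nec_dim T = length (free_vertices T)"

lemma set_free_vertices [simp]: "set (free_vertices T) = {..sum_list T} - joints T"
  by (simp add: free_vertices_def)

lemma phi_eq: "T \<in> Ob Nec \<Longrightarrow> phi T X = map (\<lambda>y. y \<in> X) (free_vertices T)"
  by (simp add: phi_def free_vertices_def vertices_eq)

lemma phi_cube: "T \<in> Ob Nec \<Longrightarrow> phi T X \<in> cube (nec_dim T)"
  by (simp add: phi_eq cube_def nec_dim_def)

lemma P_ob_iff: "T \<in> Ob Nec \<Longrightarrow> X \<in> P_ob T \<longleftrightarrow> joints T \<subseteq> X \<and> X \<subseteq> {..sum_list T}"
  by (auto simp: P_ob_def vertices_eq)

lemma phi_inj:
  assumes "T \<in> Ob Nec" "X \<in> P_ob T" "Y \<in> P_ob T" "phi T X = phi T Y" shows "X = Y"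
proof -
  have "\<forall>y\<in>{..sum_list T} - joints T. (y \<in> X) = (y \<in> Y)"
    using assms(4) unfolding phi_eq[OF assms(1)] map_eq_conv by simp
  then show ?thesis using assms(2,3) unfolding P_ob_iff[OF assms(1)] by blast
qed

lemma phi_surj:
  assumes "T \<in> Ob Nec" "s \<in> cube (nec_dim T)" obtains X where "X \<in> P_ob T" "phi T X = s"
proof
  let ?X = "joints T \<union> {free_vertices T ! i | i. i < nec_dim T \<and> s ! i}"
  show "?X \<in> P_ob T"
    unfolding P_ob_iff[OF assms(1)] using joints_le nth_mem[of _ "free_vertices T"] by (fastforce simp: nec_dim_def)
  have d: "distinct (free_vertices T)" by (simp add: free_vertices_def)
  show "phi T ?X = s"
  proof (rule nth_equalityI)
    show "length (phi T ?X) = length s" using assms phi_cube[OF assms(1)] by (simp add: cube_def)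
    fix i assume "i < length (phi T ?X)"
    then have i: "i < nec_dim T" using phi_cube[OF assms(1)] by (simp add: cube_def)
    then have "free_vertices T ! i \<notin> joints T" using nth_mem[of i "free_vertices T"] by (simp add: nec_dim_def)
    then have "(free_vertices T ! i \<in> ?X) = s ! i"
      using i d by (auto simp: nec_dim_def nth_eq_iff_index_eq)
    then show "phi T ?X ! i = s ! i" using i by (simp add: phi_eq[OF assms(1)] nec_dim_def)
  qed
qed

lemma P1_ob: "T \<in> Ob Nec \<Longrightarrow> fob P1 T = nec_dim T"
  by (simp add: P1_def vertices_eq nec_dim_def free_vertices_def)

lemma P1_sel:
  assumes "T \<in> Ob Nec" "U \<in> Ob Nec"
  shows "far P1 (T, h, U) = (nec_dim T, nec_dim U, \<lambda>s\<in>cube (nec_dim T). phi U (vertex_map h ` inv_into (P_ob T) (phi T) s))"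
  using P1_ob[OF assms(1)] P1_ob[OF assms(2)] by (simp add: P1_def)

lemma P1_phi:
  assumes T: "T \<in> Ob Nec" and X: "X \<in> P_ob T"
  shows "phi U (vertex_map (nec_map T g) ` inv_into (P_ob T) (phi T) (phi T X)) = phi U (g ` X)"
proof -
  have "inj_on (phi T) (P_ob T)" using phi_inj[OF T] by (auto simp: inj_on_def)
  then have "inv_into (P_ob T) (phi T) (phi T X) = X" using X by simp
  moreover have "vertex_map (nec_map T g) v = g v" if "v \<in> X" for v
  proof -
    have "v \<le> sum_list T" using X that P_ob_iff[OF T] by auto
    then show ?thesis using vtx_cell[OF T] by (simp add: vertex_map_def nec_map_simp) (simp add: vtx_def)
  qed
  ultimately show ?thesis by (simp cong: image_cong)
qed

lemma nec_vertex_map_P_ob: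
  assumes "T \<in> Ob Nec" "U \<in> Ob Nec" "nec_vertex_map T U g" "X \<in> P_ob T" shows "g ` X \<in> P_ob U"
proof -
  have X: "joints T \<subseteq> X" "X \<subseteq> {..sum_list T}" using assms(4) P_ob_iff[OF assms(1)] by simp_all
  have "g ` X \<subseteq> {..sum_list U}" using X(2) nec_vertex_map_le[OF assms(3)] by force
  moreover have "joints U \<subseteq> g ` X"
    using assms(3) image_mono[OF X(1), of g] unfolding nec_vertex_map_def by (auto dest: subsetD)
  ultimately show ?thesis using P_ob_iff[OF assms(2)] by simp
qed

lemma P1_eq:
  assumes "T \<in> Ob Nec" "U \<in> Ob Nec"
    and "\<And>X. X \<in> P_ob T \<Longrightarrow> f (phi T X) = phi U (g ` X)"
  shows "far P1 (T, nec_map T g, U) = (nec_dim T, nec_dim U, restrict f (cube (nec_dim T)))"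
  unfolding P1_sel[OF assms(1,2)]
proof (intro arg_cong[of _ _ "\<lambda>f. (nec_dim T, nec_dim U, f)"] restrict_ext)
  fix s assume "s \<in> cube (nec_dim T)"
  then obtain X where "X \<in> P_ob T" "phi T X = s" by (rule phi_surj[OF assms(1)])
  then show "phi U (vertex_map (nec_map T g) ` inv_into (P_ob T) (phi T) s) = f s"
    using P1_phi[OF assms(1)] assms(3) by metis
qed

text \<open>To see that \<open>P\<^sub>\<one>(f)\<close> is generated by co-faces, co-degeneracies and co-connections, consider
  maps of the following form: \<open>ds\<close> assigns a label to every input coordinate, \<open>zs\<close> to every
  output coordinate, and an output is the disjunction of all inputs of the same label, or
  constantly true if its label is in \<open>A\<close>.  Disjunctions of several inputs are iterated
  connections, empty ones are faces, and inputs whose label is in \<open>A\<close> or not among the output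
  labels are removed by degeneracies.\<close>

definition label_map :: "nat list \<Rightarrow> nat set \<Rightarrow> nat list \<Rightarrow> box_arr" where
  "label_map ds A zs =
     (length ds, length zs, \<lambda>s\<in>cube (length ds). map (\<lambda>z. z \<in> A \<or> (True, z) \<in> set (zip s ds)) zs)"

lemma cube_Cons [simp]: "b # t \<in> cube (Suc n) \<longleftrightarrow> t \<in> cube n"
  by (simp add: cube_def)

lemma cube_0 [simp]: "s \<in> cube 0 \<longleftrightarrow> s = []"
  by (simp add: cube_def)

lemma cube_Suc: "s \<in> cube (Suc n) \<Longrightarrow> \<exists>b t. s = b # t \<and> t \<in> cube n"
  by (cases s) (auto simp: cube_def)

text \<open>The inputs are processed from the left: an input that does not affect the output is
  deleted, and two inputs that do are replaced by their disjunction.\<close>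

lemma label_map_single: "label_map ds A [z] \<in> box_arrows"
proof (induction "length ds" arbitrary: ds rule: less_induct)
  case less
  show ?case
  proof (cases ds)
    case Nil
    have "label_map [] A [z] = coface (z \<in> A) 1 0"
      unfolding label_map_def coface_def by (rule box_arr_eqI) (auto simp: cube_def)
    then show ?thesis using box_arrows.intros(2)[of 1 0] Nil by simp
  next
    case (Cons d ds')
    show ?thesis
    proof (cases "z \<in> A \<or> d \<noteq> z")
      case True
      have eq: "label_map ds A [z] = box_comp (label_map ds' A [z]) (codegeneracy 1 (Suc (length ds')))"
        unfolding label_map_def codegeneracy_def box_comp_simp Cons
        by (rule box_arr_eqI) (use True in \<open>auto dest!: cube_Suc\<close>)
      have IH: "label_map ds' A [z] \<in> box_arrows" using less Cons by simp
      show ?thesis unfolding eq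
        by (rule box_arrows.intros(5)[OF box_arrows.intros(3) IH]) (simp_all add: label_map_def codegeneracy_def)
    next
      case False
      then have z: "d = z" "z \<notin> A" by auto
      show ?thesis
      proof (cases ds')
        case Nil
        have "label_map ds A [z] = box_id 1"
          unfolding label_map_def box_id_def Cons Nil z(1)
          by (rule box_arr_eqI) (use z in \<open>auto dest!: cube_Suc\<close>)
        then show ?thesis using box_arrows.intros(1)[of 1] by simp
      next
        case C': (Cons d' ds'')
        have IH: "label_map (z # ds'') A [z] \<in> box_arrows" using less Cons C' by simp
        show ?thesis
        proof (cases "d' = z")
          case True
          have eq: "label_map ds A [z] = box_comp (label_map (z # ds'') A [z]) (coconnection 1 (Suc (Suc (length ds''))))"
            unfolding label_map_def coconnection_def box_comp_simp Cons C' z(1) True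
            by (rule box_arr_eqI) (use z in \<open>auto dest!: cube_Suc simp: max_def numeral_2_eq_2\<close>)
          show ?thesis unfolding eq
            by (rule box_arrows.intros(5)[OF box_arrows.intros(4) IH]) (simp_all add: label_map_def coconnection_def)
        next
          case False
          have eq: "label_map ds A [z] = box_comp (label_map (z # ds'') A [z]) (codegeneracy 2 (Suc (Suc (length ds''))))"
            unfolding label_map_def codegeneracy_def box_comp_simp Cons C' z(1)
            by (rule box_arr_eqI) (use z False in \<open>auto dest!: cube_Suc simp: numeral_2_eq_2\<close>)
          show ?thesis unfolding eq
            by (rule box_arrows.intros(5)[OF box_arrows.intros(3) IH]) (simp_all add: label_map_def codegeneracy_def)
        qed
      qed
    qed
  qed
qed

lemma label_map_Nil: "label_map ds A [] \<in> box_arrows"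
proof (induction ds)
  case Nil
  have "label_map [] A [] = box_id 0"
    unfolding label_map_def box_id_def by (rule box_arr_eqI) (simp_all add: cube_def)
  then show ?case using box_arrows.intros(1)[of 0] by simp
next
  case (Cons d ds)
  have "label_map (d # ds) A [] = box_comp (label_map ds A []) (codegeneracy 1 (Suc (length ds)))"
    unfolding label_map_def codegeneracy_def box_comp_simp
    by (rule box_arr_eqI) (auto simp: cube_def)
  then show ?case
    using box_arrows.intros(5)[OF box_arrows.intros(3)[of 1 "Suc (length ds)"] Cons]
    by (simp add: label_map_def codegeneracy_def)
qed

text \<open>As the labels of the inputs and of the outputs are sorted, the map is a product of maps
  with a single output.\<close>

lemma label_map_arrow:
  assumes "sorted ds" "sorted_wrt (<) zs" shows "label_map ds A zs \<in> box_arrows"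
  using assms
proof (induction zs arbitrary: ds)
  case Nil
  then show ?case by (simp add: label_map_Nil)
next
  case (Cons z zs)
  define p where "p = takeWhile (\<lambda>d. d \<le> z) ds"
  define q where "q = dropWhile (\<lambda>d. d \<le> z) ds"
  have ds: "ds = p @ q" by (simp add: p_def q_def)
  have p: "d \<le> z" if "d \<in> set p" for d using that set_takeWhileD unfolding p_def by metis
  have q: "z < d" if "d \<in> set q" for d
  proof -
    have s: "sorted q" using Cons.prems(1) ds sorted_append by blast
    have "q \<noteq> []" using that by auto
    then have "z < hd q" using hd_dropWhile[of "\<lambda>d. d \<le> z" ds] by (auto simp: q_def)
    moreover have "hd q \<le> d" using s that \<open>q \<noteq> []\<close> by (cases q) auto
    ultimately show ?thesis by simp
  qed
  have "label_map ds A (z # zs) = box_plus (label_map p A [z]) (label_map q A zs)"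
    unfolding label_map_def box_plus_simp
  proof (rule box_arr_eqI)
    fix s assume "s \<in> cube (length ds)"
    then obtain a b where s: "s = a @ b" "a \<in> cube (length p)" "b \<in> cube (length q)"
      unfolding ds by (auto elim: cube_splitE)
    have zip: "zip s ds = zip a p @ zip b q" using s by (simp add: ds cube_def)
    have "(True, z) \<notin> set (zip b q)" using q by (auto dest: set_zip_rightD)
    moreover have "(True, z') \<notin> set (zip a p)" if "z' \<in> set zs" for z'
      using p[of z'] Cons.prems(2) that by (auto dest!: set_zip_rightD)
    ultimately show "map (\<lambda>z. z \<in> A \<or> (True, z) \<in> set (zip s ds)) (z # zs)
        = (\<lambda>s\<in>cube (length p). map (\<lambda>z. z \<in> A \<or> (True, z) \<in> set (zip s p)) [z]) (take (length p) s) @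
          (\<lambda>s\<in>cube (length q). map (\<lambda>z. z \<in> A \<or> (True, z) \<in> set (zip s q)) zs) (drop (length p) s)"
      using s unfolding zip by (auto simp: cube_def)
  qed (simp_all add: ds)
  moreover have "sorted q" using Cons.prems(1) ds sorted_append by blast
  ultimately show ?case using box_plus_arrow[OF label_map_single[of p A z] Cons.IH[of q]] Cons.prems(2) by simp
qed

text \<open>Label a free vertex \<open>y\<close> of \<open>T\<close> by \<open>g y\<close>.  A vertex \<open>z\<close> of \<open>U\<close> belongs to \<open>g(X)\<close> iff it is the image of a
  joint, which is in \<open>X\<close> anyway, or of some free vertex in \<open>X\<close>.\<close>

lemma P1_arrow:
  assumes T: "T \<in> Ob Nec" and U: "U \<in> Ob Nec" and g: "nec_vertex_map T U g"
  shows "far P1 (T, nec_map T g, U) \<in> box_hom (nec_dim T) (nec_dim U)"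
proof -
  let ?ds = "map g (free_vertices T)"
  have e: "far P1 (T, nec_map T g, U) = label_map ?ds (g ` joints T) (free_vertices U)"
  proof -
    have "map (\<lambda>z. z \<in> g ` joints T \<or> (True, z) \<in> set (zip (phi T X) ?ds)) (free_vertices U) = phi U (g ` X)"
      if X: "X \<in> P_ob T" for X
    proof -
      have "(True, z) \<in> set (zip (phi T X) ?ds) \<longleftrightarrow> z \<in> g ` (X - joints T)" for z
      proof -
        have "set (zip (phi T X) ?ds) = (\<lambda>y. (y \<in> X, g y)) ` set (free_vertices T)"
          unfolding phi_eq[OF T] by (induction "free_vertices T") (auto simp: zip_map_map zip_same_conv_map)
        then show ?thesis using X P_ob_iff[OF T] by (auto simp: image_iff)
      qed
      moreover have "X = joints T \<union> (X - joints T)" using X P_ob_iff[OF T] by blast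
      ultimately show ?thesis unfolding phi_eq[OF U] by (metis (no_types, lifting) Un_iff image_Un)
    qed
    from P1_eq[OF T U this] show ?thesis unfolding label_map_def by (simp add: nec_dim_def)
  qed
  have s: "sorted ?ds"
  proof -
    have "sorted (free_vertices T)" by (simp add: free_vertices_def)
    then show ?thesis unfolding sorted_map
      by (rule sorted_wrt_mono_rel[rotated]) (use nec_vertex_map_mono[OF g] in auto)
  qed
  have "sorted_wrt (<) (free_vertices U)" by (simp add: free_vertices_def)
  from label_map_arrow[OF s this] show ?thesis unfolding e by (simp add: label_map_def nec_dim_def)
qed

lemma P1_id:
  assumes "T \<in> Ob Nec" shows "far P1 (T, nec_map T (\<lambda>v. v), T) = box_id (nec_dim T)"
  using P1_eq[OF assms assms, of "\<lambda>s. s" "\<lambda>v. v"] by (simp add: box_id_def)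


section \<open>Wedges of necklaces\<close>

lemma free_vertices_append:
  "free_vertices (T @ U) = free_vertices T @ map ((+) (sum_list T)) (free_vertices U)" (is "?l = ?r")
proof (rule sorted_distinct_set_unique)
  have lt: "v < sum_list T" if "v \<in> set (free_vertices T)" for v
    using that joints_ends[of T] by (cases "v = sum_list T") auto
  have "sorted (map ((+) (sum_list T)) (free_vertices U))"
    by (simp add: sorted_map free_vertices_def)
  then show "sorted ?r" using lt by (force simp: sorted_append free_vertices_def[of T])
  have "distinct (map ((+) (sum_list T)) (free_vertices U))" by (simp add: distinct_map free_vertices_def)
  then show "distinct ?r" using lt by (force simp: free_vertices_def[of T])
  show "set ?l = set ?r"
  proof -
    have "{..sum_list (T @ U)} = {..sum_list T} \<union> (+) (sum_list T) ` {..sum_list U}"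
    proof -
      have "i \<in> (+) (sum_list T) ` {..sum_list U}" if "\<not> i \<le> sum_list T" "i \<le> sum_list T + sum_list U" for i
        using that by (intro image_eqI[of _ _ "i - sum_list T"]) auto
      then show ?thesis by auto
    qed
    moreover have "v \<notin> (+) (sum_list T) ` joints U" if "v \<in> {..sum_list T} - joints T" for v
      using that joints_ends[of T] by auto
    moreover have "sum_list T + v \<notin> joints T" if "v \<in> {..sum_list U} - joints U" for v
      using that joints_ends[of U] joints_le[of T] by (cases "v = 0") auto
    ultimately show ?thesis using joints_ends[of T] joints_ends[of U] joints_le[of T]
      by (auto simp: joints_append)
  qed
qed (simp_all add: free_vertices_def)

lemma nec_dim_append: "nec_dim (T @ U) = nec_dim T + nec_dim U"
  by (simp add: nec_dim_def free_vertices_append)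

lemma P_ob_append:
  assumes T: "T \<in> Ob Nec" and U: "U \<in> Ob Nec" and "X \<in> P_ob T" "Y \<in> P_ob U"
  shows "X \<union> (+) (sum_list T) ` Y \<in> P_ob (T @ U)"
  using assms(3,4) T U by (auto simp: P_ob_iff joints_append)

lemma phi_append:
  assumes T: "T \<in> Ob Nec" and U: "U \<in> Ob Nec" and X: "X \<in> P_ob T" and Y: "Y \<in> P_ob U"
  shows "phi (T @ U) (X \<union> (+) (sum_list T) ` Y) = phi T X @ phi U Y"
proof -
  have "v \<notin> (+) (sum_list T) ` Y" if "v \<in> set (free_vertices T)" for v
    using that joints_ends[of T] by (cases "v = sum_list T") auto
  moreover have "sum_list T + v \<notin> X" if "v \<in> set (free_vertices U)" for v
    using that joints_ends[of U] X P_ob_iff[OF T] by (cases "v = 0") auto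
  ultimately show ?thesis using T U by (auto simp: phi_eq free_vertices_append)
qed

definition wedge_map :: "nat list \<Rightarrow> nat list \<Rightarrow> (nat \<Rightarrow> nat) \<Rightarrow> (nat \<Rightarrow> nat) \<Rightarrow> nat \<Rightarrow> nat" where
  "wedge_map T T' g h v = (if v \<le> sum_list T then g v else sum_list T' + h (v - sum_list T))"

lemma wedge_map_right:
  assumes "nec_vertex_map T T' g" "nec_vertex_map U U' h"
  shows "wedge_map T T' g h (sum_list T + v) = sum_list T' + h v"
  using assms by (cases "v = 0") (simp_all add: wedge_map_def nec_vertex_map_def)

lemma wedge_map_image:
  assumes "nec_vertex_map T T' g" "nec_vertex_map U U' h" "X \<subseteq> {..sum_list T}"
  shows "wedge_map T T' g h ` (X \<union> (+) (sum_list T) ` Y) = g ` X \<union> (+) (sum_list T') ` h ` Y"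
proof -
  have "wedge_map T T' g h ` X = g ` X" by (rule image_cong) (use assms(3) in \<open>auto simp: wedge_map_def\<close>)
  then show ?thesis by (simp add: image_Un image_image wedge_map_right[OF assms(1,2)])
qed

lemma wedge_vertex_map:
  assumes g: "nec_vertex_map T T' g" and h: "nec_vertex_map U U' h"
  shows "nec_vertex_map (T @ U) (T' @ U') (wedge_map T T' g h)"
proof -
  have "joints (T' @ U') \<subseteq> wedge_map T T' g h ` joints (T @ U)"
    unfolding joints_append wedge_map_image[OF g h joints_le] using g h by (auto simp: nec_vertex_map_def)
  moreover have "wedge_map T T' g h v \<le> wedge_map T T' g h w" if "v \<le> w" "w \<le> sum_list T + sum_list U" for v w
    using that nec_vertex_map_mono[OF g, of v w] nec_vertex_map_mono[OF h, of "v - sum_list T" "w - sum_list T"]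
      nec_vertex_map_le[OF g, of v]
    by (auto simp: wedge_map_def)
  ultimately show ?thesis
    using wedge_map_right[OF g h, of "sum_list U"] g h by (auto simp: nec_vertex_map_def mono_on_def wedge_map_def)
qed

text \<open>The functor \<open>P\<^sub>\<one>\<close> turns wedges into products of cubes.  This makes composition in the colimits
  over necklaces compatible with maps of necklaces.\<close>

lemma P1_wedge:
  assumes T: "T \<in> Ob Nec" and T': "T' \<in> Ob Nec" and g: "nec_vertex_map T T' g"
    and U: "U \<in> Ob Nec" and U': "U' \<in> Ob Nec" and h: "nec_vertex_map U U' h"
  shows "far P1 (T @ U, nec_map (T @ U) (wedge_map T T' g h), T' @ U')
    = box_plus (far P1 (T, nec_map T g, T')) (far P1 (U, nec_map U h, U'))"
proof -
  let ?f = "\<lambda>s\<in>cube (nec_dim T). phi T' (vertex_map (nec_map T g) ` inv_into (P_ob T) (phi T) s)"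
  let ?k = "\<lambda>s\<in>cube (nec_dim U). phi U' (vertex_map (nec_map U h) ` inv_into (P_ob U) (phi U) s)"
  have TU: "T @ U \<in> Ob Nec" "T' @ U' \<in> Ob Nec" using T U T' U' by simp_all
  have "?f (take (nec_dim T) (phi (T @ U) Z)) @ ?k (drop (nec_dim T) (phi (T @ U) Z)) = phi (T' @ U') (wedge_map T T' g h ` Z)"
    if Z: "Z \<in> P_ob (T @ U)" for Z
  proof -
    obtain X where X: "X \<in> P_ob T" "phi T X = take (nec_dim T) (phi (T @ U) Z)"
      by (rule phi_surj[OF T, of "take (nec_dim T) (phi (T @ U) Z)"])
        (use phi_cube[OF TU(1), of Z] in \<open>simp add: cube_def nec_dim_append\<close>)
    obtain Y where Y: "Y \<in> P_ob U" "phi U Y = drop (nec_dim T) (phi (T @ U) Z)"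
      by (rule phi_surj[OF U, of "drop (nec_dim T) (phi (T @ U) Z)"])
        (use phi_cube[OF TU(1), of Z] in \<open>simp add: cube_def nec_dim_append\<close>)
    have "phi (T @ U) (X \<union> (+) (sum_list T) ` Y) = phi (T @ U) Z"
      using phi_append[OF T U X(1) Y(1)] X Y by simp
    then have Zeq: "Z = X \<union> (+) (sum_list T) ` Y"
      using phi_inj[OF TU(1) P_ob_append[OF T U X(1) Y(1)] Z] by simp
    have "wedge_map T T' g h ` Z = g ` X \<union> (+) (sum_list T') ` h ` Y"
      unfolding Zeq using X(1) P_ob_iff[OF T] by (intro wedge_map_image[OF g h]) blast
    then have "phi (T' @ U') (wedge_map T T' g h ` Z) = phi T' (g ` X) @ phi U' (h ` Y)"
      using phi_append[OF T' U' nec_vertex_map_P_ob[OF T T' g X(1)] nec_vertex_map_P_ob[OF U U' h Y(1)]] by simp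
    then show ?thesis
      using P1_phi[OF T X(1), of T' g] P1_phi[OF U Y(1), of U' h] phi_cube[OF T, of X] phi_cube[OF U, of Y]
      by (simp flip: X(2) Y(2))
  qed
  from P1_eq[OF TU this] show ?thesis
    unfolding P1_sel[OF T T'] P1_sel[OF U U'] box_plus_simp by (simp add: nec_dim_append)
qed

lemma psh_hom_const:
  assumes f: "f \<in> psh_hom simplex_cat (necklace T) S" and T: "T \<in> Ob Nec" "v \<le> sum_list T"
  shows "f m (\<lambda>i\<in>{..m}. v) = act S (m, 0, \<lambda>i\<in>{..m}. 0) (f 0 (vtx v))"
proof -
  have "act (necklace T) (m, 0, \<lambda>i\<in>{..m}. 0) (vtx v) = (\<lambda>i\<in>{..m}. v)"
    unfolding act_necklace by (rule restrict_ext) (simp add: vtx_def)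
  then show ?thesis
    using psh_hom_act[OF f simplex_const_arr(1)[of m], unfolded simplex_cat_sel, OF vtx_cell[OF T]] by simp
qed

context
  fixes S :: "'a sset" and T U :: "nat list" and f g
  assumes T: "T \<in> Ob Nec" and U: "U \<in> Ob Nec"
    and f: "f \<in> psh_hom simplex_cat (necklace T) S" and g: "g \<in> psh_hom simplex_cat (necklace U) S"
    and fg: "f 0 (vtx (sum_list T)) = g 0 (vtx 0)"
begin

lemma glue_left: "c \<in> cells (necklace T) m \<Longrightarrow> glue T U f g m c = f m c"
  using necklace_append_left[OF T U] by (auto simp: glue_def)

lemma glue_right:
  assumes d: "d \<in> cells (necklace U) m"
  shows "glue T U f g m (\<lambda>i\<in>{..m}. sum_list T + d i) = g m d"
proof (cases "(\<lambda>i\<in>{..m}. sum_list T + d i) \<in> cells (necklace T) m")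
  case True
  then have c: "(\<lambda>i\<in>{..m}. sum_list T + d i) = (\<lambda>i\<in>{..m}. sum_list T)"
    using necklace_append_Int[OF T U, of m] d by blast
  have "d i = 0" if "i \<le> m" for i using fun_cong[OF c, of i] that by simp
  then have "d = (\<lambda>i\<in>{..m}. 0)" using necklace_cell_ext[OF d] by (auto simp: fun_eq_iff extensional_def)
  then show ?thesis
    using glue_left[OF True] psh_hom_const[OF f T order_refl, of m] psh_hom_const[OF g U, of 0 m] fg
    unfolding c by simp
next
  case False
  have "(\<lambda>i\<in>{..m}. (\<lambda>i\<in>{..m}. sum_list T + d i) i - sum_list T) = d"
    using necklace_cell_ext[OF d] by (auto simp: fun_eq_iff extensional_def)
  then show ?thesis using False necklace_append_right[OF T U d] by (simp add: glue_def)
qed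

lemma glue_cell_cases:
  assumes "c \<in> cells (necklace (T @ U)) m"
  obtains "c \<in> cells (necklace T) m" | d where "d \<in> cells (necklace U) m" "c = (\<lambda>i\<in>{..m}. sum_list T + d i)"
  using assms unfolding necklace_append[OF T U] by blast

lemma glue_hom: "glue T U f g \<in> psh_hom simplex_cat (necklace (T @ U)) S"
proof (rule psh_homI)
  fix m c assume "c \<in> cells (necklace (T @ U)) m"
  then show "glue T U f g m c \<in> cells S m"
    by (cases rule: glue_cell_cases) (simp_all add: glue_left glue_right psh_hom_cell[OF f] psh_hom_cell[OF g])
next
  fix u c assume u: "u \<in> Ar simplex_cat" and c: "c \<in> cells (necklace (T @ U)) (Cod simplex_cat u)"
  obtain m n k where uf: "u = (m, n, k)" by (cases u)
  from c show "glue T U f g (Dom simplex_cat u) (act (necklace (T @ U)) u c) = act S u (glue T U f g (Cod simplex_cat u) c)"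
  proof (cases rule: glue_cell_cases)
    case 1
    then show ?thesis
      using psh_hom_act[OF f u 1] glue_left[OF psh_act_cells[OF necklace_presheaf u 1]]
      by (simp add: glue_left uf act_necklace)
  next
    case (2 d)
    have "act (necklace (T @ U)) u c = (\<lambda>i\<in>{..m}. sum_list T + (act (necklace U) u d) i)"
      using u by (auto simp: 2 uf act_necklace fun_eq_iff PiE_iff)
    then show ?thesis
      using psh_hom_act[OF g u 2(1)] glue_right[OF psh_act_cells[OF necklace_presheaf u 2(1)]] glue_right[OF 2(1)] 2(2)
      by (simp add: uf)
  qed
qed (simp add: glue_def)

lemma glue_first: "glue T U f g 0 (vtx 0) = f 0 (vtx 0)"
  using glue_left vtx_cell[OF T] by simp

lemma glue_last: "glue T U f g 0 (vtx (sum_list (T @ U))) = g 0 (vtx (sum_list U))"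
proof -
  have "vtx (sum_list (T @ U)) = (\<lambda>i\<in>{..0}. sum_list T + vtx (sum_list U) i)" by (auto simp: vtx_def)
  then show ?thesis using glue_right[OF vtx_cell[OF U order_refl]] by (simp only:)
qed

lemma glue_unique:
  assumes "h \<in> psh_hom simplex_cat (necklace (T @ U)) S"
    and "\<And>m c. c \<in> cells (necklace T) m \<Longrightarrow> h m c = f m c"
    and "\<And>m d. d \<in> cells (necklace U) m \<Longrightarrow> h m (\<lambda>i\<in>{..m}. sum_list T + d i) = g m d"
  shows "h = glue T U f g"
proof (rule psh_hom_ext[OF assms(1) glue_hom])
  fix m c assume "c \<in> cells (necklace (T @ U)) m"
  then show "h m c = glue T U f g m c"
    by (cases rule: glue_cell_cases) (simp_all add: glue_left glue_right assms(2,3))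
qed

end


lemma psh_comp_cell: "x \<in> cells P n \<Longrightarrow> psh_comp P t s n x = t n (s n x)"
  by (simp add: psh_comp_def)

lemma nec_map_wedge_left:
  assumes T: "T \<in> Ob Nec" and U: "U \<in> Ob Nec" and c: "c \<in> cells (necklace T) m"
  shows "nec_map (T @ U) (wedge_map T T' g h) m c = nec_map T g m c"
proof -
  have "wedge_map T T' g h (c i) = g (c i)" if "i \<le> m" for i
    using necklace_cell_le[OF c that] by (simp add: wedge_map_def)
  then show ?thesis using necklace_append_left[OF T U] c by (auto simp: nec_map_simp subset_iff cong: restrict_cong)
qed

lemma nec_map_wedge_right:
  assumes "T \<in> Ob Nec" "U \<in> Ob Nec" "nec_vertex_map T T' g" "nec_vertex_map U U' h" and d: "d \<in> cells (necklace U) m"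
  shows "nec_map (T @ U) (wedge_map T T' g h) m (\<lambda>i\<in>{..m}. sum_list T + d i)
    = (\<lambda>i\<in>{..m}. sum_list T' + nec_map U h m d i)"
  using necklace_append_right[OF assms(1,2) d] d
  by (simp add: nec_map_simp wedge_map_right[OF assms(3,4)] cong: restrict_cong)

lemma glue_wedge:
  assumes T: "T \<in> Ob Nec" and T': "T' \<in> Ob Nec" and g: "nec_vertex_map T T' g"
    and U: "U \<in> Ob Nec" and U': "U' \<in> Ob Nec" and h: "nec_vertex_map U U' h"
    and f': "f' \<in> psh_hom simplex_cat (necklace T') S" and k': "k' \<in> psh_hom simplex_cat (necklace U') S"
    and m: "f' 0 (vtx (sum_list T')) = k' 0 (vtx 0)"
  shows "psh_comp (necklace (T @ U)) (glue T' U' f' k') (nec_map (T @ U) (wedge_map T T' g h))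
    = glue T U (psh_comp (necklace T) f' (nec_map T g)) (psh_comp (necklace U) k' (nec_map U h))"
proof (rule glue_unique[OF T U])
  have TU: "T @ U \<in> Ob Nec" "T' @ U' \<in> Ob Nec" using T U T' U' by simp_all
  note gh = nec_map_hom[OF T T' g] nec_map_hom[OF U U' h] nec_map_hom[OF TU wedge_vertex_map[OF g h]]
  show "psh_comp (necklace T) f' (nec_map T g) \<in> psh_hom simplex_cat (necklace T) S"
    by (rule psh_comp_hom[OF necklace_presheaf gh(1) f'])
  show "psh_comp (necklace U) k' (nec_map U h) \<in> psh_hom simplex_cat (necklace U) S"
    by (rule psh_comp_hom[OF necklace_presheaf gh(2) k'])
  show "psh_comp (necklace (T @ U)) (glue T' U' f' k') (nec_map (T @ U) (wedge_map T T' g h))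
      \<in> psh_hom simplex_cat (necklace (T @ U)) S"
    by (rule psh_comp_hom[OF necklace_presheaf gh(3) glue_hom[OF T' U' f' k' m]])
  show "psh_comp (necklace T) f' (nec_map T g) 0 (vtx (sum_list T)) = psh_comp (necklace U) k' (nec_map U h) 0 (vtx 0)"
    using g h m by (simp add: psh_comp_def vtx_cell[OF T] vtx_cell[OF U] nec_map_vtx[OF T] nec_map_vtx[OF U] nec_vertex_map_def)
  fix n c assume c: "c \<in> cells (necklace T) n"
  then show "psh_comp (necklace (T @ U)) (glue T' U' f' k') (nec_map (T @ U) (wedge_map T T' g h)) n c
      = psh_comp (necklace T) f' (nec_map T g) n c"
    using necklace_append_left[OF T U] glue_left[OF T' U' f' k' m psh_hom_cell[OF gh(1) c]]
    by (auto simp: psh_comp_def nec_map_wedge_left[OF T U])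
next
  have TU: "T @ U \<in> Ob Nec" "T' @ U' \<in> Ob Nec" using T U T' U' by simp_all
  note gh = nec_map_hom[OF T T' g] nec_map_hom[OF U U' h] nec_map_hom[OF TU wedge_vertex_map[OF g h]]
  fix n d assume d: "d \<in> cells (necklace U) n"
  then show "psh_comp (necklace (T @ U)) (glue T' U' f' k') (nec_map (T @ U) (wedge_map T T' g h)) n (\<lambda>i\<in>{..n}. sum_list T + d i)
      = psh_comp (necklace U) k' (nec_map U h) n d"
    using necklace_append_right[OF T U d] glue_right[OF T' U' f' k' m psh_hom_cell[OF gh(2) d]]
    by (simp add: psh_comp_def nec_map_wedge_right[OF T U g h d])
qed

lemma glue_assoc:
  assumes T: "T \<in> Ob Nec" and U: "U \<in> Ob Nec" and V: "V \<in> Ob Nec"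
    and f: "f \<in> psh_hom simplex_cat (necklace T) S" and g: "g \<in> psh_hom simplex_cat (necklace U) S"
    and h: "h \<in> psh_hom simplex_cat (necklace V) S"
    and fg: "f 0 (vtx (sum_list T)) = g 0 (vtx 0)" and gh: "g 0 (vtx (sum_list U)) = h 0 (vtx 0)"
  shows "glue (T @ U) V (glue T U f g) h = glue T (U @ V) f (glue U V g h)"
proof (rule glue_unique)
  have TU: "T @ U \<in> Ob Nec" using T U by simp
  note k = glue_hom[OF T U f g fg]
  have kh: "glue T U f g 0 (vtx (sum_list (T @ U))) = h 0 (vtx 0)" using glue_last[OF T U f g fg] gh by simp
  show "U @ V \<in> Ob Nec" using U V by simp
  show "glue U V g h \<in> psh_hom simplex_cat (necklace (U @ V)) S" by (rule glue_hom[OF U V g h gh])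
  show "f 0 (vtx (sum_list T)) = glue U V g h 0 (vtx 0)" using glue_first[OF U V g h gh] fg by simp
  show "glue (T @ U) V (glue T U f g) h \<in> psh_hom simplex_cat (necklace (T @ U @ V)) S"
    using glue_hom[OF TU V k h kh] by simp
  show "glue (T @ U) V (glue T U f g) h m c = f m c" if c: "c \<in> cells (necklace T) m" for m c
    using glue_left[OF TU V k h kh, of c m] glue_left[OF T U f g fg c] necklace_append_left[OF T U, of m] c by auto
  show "glue (T @ U) V (glue T U f g) h m (\<lambda>i\<in>{..m}. sum_list T + d i) = glue U V g h m d"
    if "d \<in> cells (necklace (U @ V)) m" for m d
    using U V g h gh that
  proof (cases rule: glue_cell_cases)
    case 1
    then show ?thesis
      using glue_left[OF TU V k h kh necklace_append_right[OF T U 1]] glue_right[OF T U f g fg 1] glue_left[OF U V g h gh 1] by (simp only:)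
  next
    case (2 e)
    have "(\<lambda>i\<in>{..m}. sum_list T + d i) = (\<lambda>i\<in>{..m}. sum_list (T @ U) + e i)"
      unfolding 2(2) by (rule restrict_ext) simp
    then show ?thesis using glue_right[OF TU V k h kh 2(1)] glue_right[OF U V g h gh 2(1)] 2(2) by simp
  qed
qed (rule T f)+

lemma glue_post_comp:
  assumes T: "T \<in> Ob Nec" and U: "U \<in> Ob Nec"
    and f: "f \<in> psh_hom simplex_cat (necklace T) S" and g: "g \<in> psh_hom simplex_cat (necklace U) S"
    and fg: "f 0 (vtx (sum_list T)) = g 0 (vtx 0)" and p: "p \<in> psh_hom simplex_cat S S'"
  shows "psh_comp (necklace (T @ U)) p (glue T U f g)
    = glue T U (psh_comp (necklace T) p f) (psh_comp (necklace U) p g)"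
proof (rule glue_unique[OF T U])
  note n = necklace_presheaf
  show "psh_comp (necklace (T @ U)) p (glue T U f g) m c = psh_comp (necklace T) p f m c"
    if c: "c \<in> cells (necklace T) m" for m c
    using c necklace_append_left[OF T U, of m] glue_left[OF T U f g fg c] by (auto simp: psh_comp_def)
  show "psh_comp (necklace (T @ U)) p (glue T U f g) m (\<lambda>i\<in>{..m}. sum_list T + d i) = psh_comp (necklace U) p g m d"
    if d: "d \<in> cells (necklace U) m" for m d
    using d necklace_append_right[OF T U d] glue_right[OF T U f g fg d] by (simp add: psh_comp_def)
qed (use psh_comp_hom[OF necklace_presheaf _ p] f g glue_hom[OF T U f g fg] fg
    in \<open>auto simp: psh_comp_cell vtx_cell T U\<close>)

lemma necklace_Nil_cell: "c \<in> cells (necklace []) m \<longleftrightarrow> c = (\<lambda>i\<in>{..m}. 0)"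
  by (auto simp: necklace_def std_simplex_cells PiE_iff extensional_def fun_eq_iff mono_on_def)

definition const_nec :: "'a sset \<Rightarrow> 'a \<Rightarrow> nat \<Rightarrow> (nat \<Rightarrow> nat) \<Rightarrow> 'a" where
  "const_nec S x = (\<lambda>m. \<lambda>c\<in>cells (necklace []) m. act S (m, 0, \<lambda>i\<in>{..m}. 0) x)"

lemma const_nec_hom:
  assumes S: "is_presheaf simplex_cat S" and x: "x \<in> cells S 0"
  shows "const_nec S x \<in> psh_hom simplex_cat (necklace []) S"
proof (rule psh_homI)
  fix m c assume "c \<in> cells (necklace []) m"
  then show "const_nec S x m c \<in> cells S m"
    using psh_act_cells[OF S simplex_const_arr(1)[of m], of x] x by (simp add: const_nec_def)
next
  fix u c assume u: "u \<in> Ar simplex_cat" and c: "c \<in> cells (necklace []) (Cod simplex_cat u)"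
  have "act S (Comp simplex_cat (Cod simplex_cat u, 0, \<lambda>i\<in>{..Cod simplex_cat u}. 0) u) x
      = act S u (act S (Cod simplex_cat u, 0, \<lambda>i\<in>{..Cod simplex_cat u}. 0) x)"
    using S u simplex_const_arr(1)[of "Cod simplex_cat u"] x unfolding is_presheaf_def by simp
  then show "const_nec S x (Dom simplex_cat u) (act (necklace []) u c) = act S u (const_nec S x (Cod simplex_cat u) c)"
    using psh_act_cells[OF necklace_presheaf u c] c by (simp add: const_nec_def simplex_const[OF u])
qed (simp add: const_nec_def)

lemma const_nec_vtx:
  assumes S: "is_presheaf simplex_cat S" and x: "x \<in> cells S 0"
  shows "const_nec S x 0 (vtx 0) = x"
proof -
  have "(0, 0, \<lambda>i\<in>{..0}. 0) = Idn simplex_cat 0" by (auto simp: simplex_cat_def fun_eq_iff)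
  then have "act S (0, 0, \<lambda>i\<in>{..0}. 0) x = x" using S x by (simp add: is_presheaf_def)
  moreover have "vtx 0 \<in> cells (necklace []) 0" by (rule vtx_cell) (simp_all add: Nec_Ob)
  ultimately show ?thesis by (simp add: const_nec_def)
qed

lemma psh_hom_Nil:
  assumes S: "is_presheaf simplex_cat S" and f: "f \<in> psh_hom simplex_cat (necklace []) S"
  shows "f = const_nec S (f 0 (vtx 0))"
proof -
  have N: "[] \<in> Ob Nec" by (simp add: Nec_Ob)
  have "f 0 (vtx 0) \<in> cells S 0" using psh_hom_cell[OF f] vtx_cell[OF N] by simp
  then show ?thesis
    using psh_hom_const[OF f N] by (intro psh_hom_ext[OF f const_nec_hom[OF S]]) (auto simp: necklace_Nil_cell const_nec_def)
qed

lemma glue_const_left: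
  assumes S: "is_presheaf simplex_cat S" and U: "U \<in> Ob Nec" and g: "g \<in> psh_hom simplex_cat (necklace U) S"
  shows "glue [] U (const_nec S (g 0 (vtx 0))) g = g"
proof (rule glue_unique[symmetric])
  have x: "g 0 (vtx 0) \<in> cells S 0" using psh_hom_cell[OF g] vtx_cell[OF U] by simp
  show "[] \<in> Ob Nec" by (simp add: Nec_Ob)
  show "const_nec S (g 0 (vtx 0)) \<in> psh_hom simplex_cat (necklace []) S" by (rule const_nec_hom[OF S x])
  show "const_nec S (g 0 (vtx 0)) 0 (vtx (sum_list [])) = g 0 (vtx 0)" using const_nec_vtx[OF S x] by simp
  show "g m c = const_nec S (g 0 (vtx 0)) m c" if "c \<in> cells (necklace []) m" for m c
    using that psh_hom_const[OF g U, of 0 m] by (simp add: const_nec_def necklace_Nil_cell)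
  show "g m (\<lambda>i\<in>{..m}. sum_list [] + d i) = g m d" if "d \<in> cells (necklace U) m" for m d
    using that by (simp add: necklace_cell_restrict)
qed (use U g in simp_all)

lemma glue_const_right:
  assumes S: "is_presheaf simplex_cat S" and T: "T \<in> Ob Nec" and f: "f \<in> psh_hom simplex_cat (necklace T) S"
  shows "glue T [] f (const_nec S (f 0 (vtx (sum_list T)))) = f"
proof (rule glue_unique[symmetric])
  have x: "f 0 (vtx (sum_list T)) \<in> cells S 0" using psh_hom_cell[OF f] vtx_cell[OF T] by simp
  show "[] \<in> Ob Nec" by (simp add: Nec_Ob)
  show "const_nec S (f 0 (vtx (sum_list T))) \<in> psh_hom simplex_cat (necklace []) S" by (rule const_nec_hom[OF S x])
  show "f 0 (vtx (sum_list T)) = const_nec S (f 0 (vtx (sum_list T))) 0 (vtx 0)" using const_nec_vtx[OF S x] by simp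
  show "f m (\<lambda>i\<in>{..m}. sum_list T + d i) = const_nec S (f 0 (vtx (sum_list T))) m d" if "d \<in> cells (necklace []) m" for m d
    using that psh_hom_const[OF f T order_refl, of m] by (simp add: const_nec_def necklace_Nil_cell cong: restrict_cong)
qed (use T f in simp_all)


section \<open>Mapping spaces as colimits over necklaces\<close>

definition nec_between :: "'a sset \<Rightarrow> 'a \<Rightarrow> 'a \<Rightarrow> nat list \<Rightarrow> (nat \<Rightarrow> (nat \<Rightarrow> nat) \<Rightarrow> 'a) \<Rightarrow> bool" where
  "nec_between S x y T f \<longleftrightarrow> T \<in> Ob Nec \<and> f \<in> psh_hom simplex_cat (necklace T) S
     \<and> f 0 (vtx 0) = x \<and> f 0 (vtx (sum_list T)) = y"

lemma nec_betweenD: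
  assumes "nec_between S x y T f"
  shows "T \<in> Ob Nec" "f \<in> psh_hom simplex_cat (necklace T) S" "f 0 (vtx 0) = x" "f 0 (vtx (sum_list T)) = y"
  using assms by (simp_all add: nec_between_def)

lemma nec_between_glue:
  assumes "nec_between S x y T f" "nec_between S y z U g"
  shows "nec_between S x z (T @ U) (glue T U f g)"
proof -
  note T = nec_betweenD[OF assms(1)] and U = nec_betweenD[OF assms(2)]
  have m: "f 0 (vtx (sum_list T)) = g 0 (vtx 0)" using T U by simp
  show ?thesis
    using glue_hom[OF T(1) U(1) T(2) U(2) m] glue_first[OF T(1) U(1) T(2) U(2) m] glue_last[OF T(1) U(1) T(2) U(2) m]
      T U by (simp add: nec_between_def)
qed

lemma nec_between_pull:
  assumes U: "nec_between S x y U h" and T: "T \<in> Ob Nec" and g: "nec_vertex_map T U g"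
  shows "nec_between S x y T (psh_comp (necklace T) h (nec_map T g))"
  using psh_comp_hom[OF necklace_presheaf nec_map_hom[OF T _ g]] nec_betweenD[OF U] T g
  by (simp add: nec_between_def psh_comp_cell vtx_cell nec_map_vtx nec_vertex_map_def)

lemma nec_between_const:
  assumes "is_presheaf simplex_cat S" "x \<in> cells S 0" shows "nec_between S x x [] (const_nec S x)"
  using const_nec_hom[OF assms] const_nec_vtx[OF assms] by (simp add: nec_between_def Nec_Ob)

lemma nec_between_post_comp:
  assumes T: "nec_between S x y T f" and p: "p \<in> psh_hom simplex_cat S S'"
  shows "nec_between S' (p 0 x) (p 0 y) T (psh_comp (necklace T) p f)"
  using psh_comp_hom[OF necklace_presheaf nec_betweenD(2)[OF T] p] nec_betweenD[OF T]
  by (simp add: nec_between_def psh_comp_cell vtx_cell)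

lemma nec_over_sel [simp]:
  "(T, f) \<in> Ob (nec_over S x y) \<longleftrightarrow> nec_between S x y T f"
  "Dom (nec_over S x y) (a, u, b) = a" "Cod (nec_over S x y) (a, u, b) = b"
  by (simp_all add: nec_over_def Let_def nec_between_def)

lemma nec_over_arrI:
  assumes U: "nec_between S x y U h" and T: "T \<in> Ob Nec" and g: "nec_vertex_map T U g"
  shows "((T, psh_comp (necklace T) h (nec_map T g)), (T, nec_map T g, U), (U, h)) \<in> Ar (nec_over S x y)"
  using nec_between_pull[OF assms] U nec_map_arr[OF T nec_betweenD(1)[OF U] g]
  unfolding nec_over_def Let_def nec_between_def by (simp add: Nec_def)

lemma nec_over_arrE:
  assumes "k \<in> Ar (nec_over S x y)"
  obtains T U g h where "k = ((T, psh_comp (necklace T) h (nec_map T g)), (T, nec_map T g, U), (U, h))"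
    "nec_between S x y U h" "T \<in> Ob Nec" "nec_vertex_map T U g"
proof -
  obtain T f u U h where k: "k = ((T, f), u, (U, h))" "u \<in> Ar Nec" "Dom Nec u = T" "Cod Nec u = U"
    "f = psh_comp (necklace T) h (fst (snd u))" and U: "nec_between S x y U h"
    using assms by (auto simp: nec_over_def Let_def nec_between_def)
  then have u: "u = (T, fst (snd u), U)" by (cases u) (simp add: Nec_def)
  have "(T, fst (snd u), U) \<in> Ar Nec" using k(2) u by simp
  then obtain g where g: "T \<in> Ob Nec" "nec_vertex_map T U g" "fst (snd u) = nec_map T g" by (rule Nec_arrE)
  have "u = (T, nec_map T g, U)" using u g(3) by simp
  with k g have "k = ((T, psh_comp (necklace T) h (nec_map T g)), (T, nec_map T g, U), (U, h))" by simp
  then show thesis using that U g by blast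
qed

abbreviation (input) "rig_diagram \<equiv> C_nec \<circ>\<^sub>F nec_over_proj"

lemma rig_diagram_sel:
  "T \<in> Ob Nec \<Longrightarrow> fob rig_diagram (T, f) = fob (yoneda box_cat) (nec_dim T)"
  "far rig_diagram (a, u, b) = far (yoneda box_cat) (far P1 u)"
  by (simp_all add: fcompose_def C_nec_def nec_over_proj_def P1_ob)

lemma rig_psh_diag: "psh_diag box_cat (nec_over S x y) rig_diagram"
proof
  fix k assume "k \<in> Ar (nec_over S x y)"
  then obtain T U g h where k: "k = ((T, psh_comp (necklace T) h (nec_map T g)), (T, nec_map T g, U), (U, h))"
    and U: "nec_between S x y U h" and T: "T \<in> Ob Nec" and g: "nec_vertex_map T U g" by (rule nec_over_arrE)
  note U' = nec_betweenD(1)[OF U]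
  note P = P1_arrow[OF T U' g]
  then have d: "Dom box_cat (far P1 (T, nec_map T g, U)) = nec_dim T" by (simp add: box_hom_def)
  show "Dom (nec_over S x y) k \<in> Ob (nec_over S x y) \<and> Cod (nec_over S x y) k \<in> Ob (nec_over S x y)"
    using U nec_between_pull[OF U T g] by (simp add: k)
  show "far rig_diagram k n u \<in> cells (fob rig_diagram (Cod (nec_over S x y) k)) n"
    if "u \<in> cells (fob rig_diagram (Dom (nec_over S x y) k)) n" for n u
    using that box_comp_hom[OF _ P, of u n] by (simp add: k rig_diagram_sel T U' yoneda_box_sel d)
  show "far rig_diagram k (Dom box_cat w) (act (fob rig_diagram (Dom (nec_over S x y) k)) w u)
      = act (fob rig_diagram (Cod (nec_over S x y) k)) w (far rig_diagram k (Cod box_cat w) u)"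
    if w: "w \<in> Ar box_cat" and u: "u \<in> cells (fob rig_diagram (Dom (nec_over S x y) k)) (Cod box_cat w)" for w u
  proof -
    have w: "w \<in> box_hom (Dom box_cat w) (Cod box_cat w)" using w by (simp add: box_hom_def)
    have u: "u \<in> box_hom (Cod box_cat w) (nec_dim T)" using u by (simp add: k rig_diagram_sel T yoneda_box_sel)
    show ?thesis using box_hom_comp_assoc[OF w u P] box_comp_hom[OF w u] u
      by (simp add: k rig_diagram_sel T U' yoneda_box_sel d)
  qed
next
  fix j assume "j \<in> Ob (nec_over S x y)"
  then show "is_presheaf box_cat (fob rig_diagram j)"
    using yoneda_box_presheaf by (cases j) (simp add: rig_diagram_sel nec_between_def)
qed (simp_all add: box_cat_category)

text \<open>The cube represented by the necklace \<open>f : T \<rightarrow> S\<close> and the \<open>n\<close>-cube \<open>u : \<one>\<^sup>n \<rightarrow> P\<^sub>\<one>(T)\<close> of \<open>C(T)\<close>.\<close>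

definition rig_cube :: "'a sset \<Rightarrow> 'a \<Rightarrow> 'a \<Rightarrow> nat \<Rightarrow> nat list \<Rightarrow> (nat \<Rightarrow> (nat \<Rightarrow> nat) \<Rightarrow> 'a) \<Rightarrow> box_arr \<Rightarrow> 'a rig_cube" where
  "rig_cube S x y n T f u = psh_cls (nec_over S x y) rig_diagram n ((T, f), u)"

lemma rig_presheaf: "is_presheaf box_cat (rig_hom S x y)"
  unfolding rig_hom_def by (rule psh_diag.psh_colim_presheaf[OF rig_psh_diag])

lemma rig_cube_cell:
  "nec_between S x y T f \<Longrightarrow> u \<in> box_hom n (nec_dim T) \<Longrightarrow> rig_cube S x y n T f u \<in> cells (rig_hom S x y) n"
  unfolding rig_hom_def rig_cube_def
  by (rule psh_diag.cls_in[OF rig_psh_diag]) (simp_all add: rig_diagram_sel yoneda_box_sel nec_between_def)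

lemma rig_cellE:
  assumes "X \<in> cells (rig_hom S x y) n"
  obtains T f u where "nec_between S x y T f" "u \<in> box_hom n (nec_dim T)" "X = rig_cube S x y n T f u"
proof -
  obtain j u where j: "j \<in> Ob (nec_over S x y)" "u \<in> cells (fob rig_diagram j) n"
    "X = psh_cls (nec_over S x y) rig_diagram n (j, u)"
    using assms unfolding rig_hom_def cells_psh_colim by blast
  obtain T f where jT: "j = (T, f)" by (cases j)
  have T: "nec_between S x y T f" using j jT by simp
  then show thesis using that[OF T] j jT by (simp add: rig_diagram_sel yoneda_box_sel rig_cube_def nec_between_def)
qed

lemma rig_cube_act:
  assumes "w \<in> box_hom k n" "nec_between S x y T f"
  shows "act (rig_hom S x y) w (rig_cube S x y n T f u) = rig_cube S x y k T f (box_comp u w)"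
proof -
  have w: "w \<in> Ar box_cat" "Dom box_cat w = k" "Cod box_cat w = n" using assms by (simp_all add: box_hom_def)
  show ?thesis
    using psh_diag.act_cls[OF rig_psh_diag w(1), unfolded w, of S x y "(T, f)" u] nec_betweenD(1)[OF assms(2)]
    by (simp add: rig_hom_def rig_cube_def rig_diagram_sel yoneda_box_sel)
qed

lemma rig_cube_shift:
  assumes U: "nec_between S x y U h" and T: "T \<in> Ob Nec" and g: "nec_vertex_map T U g" and u: "u \<in> box_hom n (nec_dim T)"
  shows "rig_cube S x y n T (psh_comp (necklace T) h (nec_map T g)) u
    = rig_cube S x y n U h (box_comp (far P1 (T, nec_map T g, U)) u)"
proof -
  have d: "Dom box_cat (far P1 (T, nec_map T g, U)) = nec_dim T"
    using P1_arrow[OF T nec_betweenD(1)[OF U] g] by (simp add: box_hom_def)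
  show ?thesis
    using psh_cls_step[OF nec_over_arrI[OF U T g], of u rig_diagram n] u
    by (simp add: rig_cube_def rig_diagram_sel T yoneda_box_sel d)
qed

text \<open>Functions on cubes of \<open>rig_hom S x y\<close> may be defined on necklaces over \<open>S\<close>, provided that they
  respect maps of necklaces.\<close>

lemma rig_cube_step_invariant:
  assumes "\<And>T U g h u. nec_between S x y U h \<Longrightarrow> T \<in> Ob Nec \<Longrightarrow> nec_vertex_map T U g \<Longrightarrow> u \<in> box_hom n (nec_dim T) \<Longrightarrow>
      F T (psh_comp (necklace T) h (nec_map T g)) u = F U h (box_comp (far P1 (T, nec_map T g, U)) u)"
    and k: "k \<in> Ar (nec_over S x y)" and u: "u \<in> cells (fob rig_diagram (Dom (nec_over S x y) k)) n"
  shows "(\<lambda>((T, f), u). F T f u) (Dom (nec_over S x y) k, u)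
    = (\<lambda>((T, f), u). F T f u) (Cod (nec_over S x y) k, far rig_diagram k n u)"
proof -
  obtain T U g h where k: "k = ((T, psh_comp (necklace T) h (nec_map T g)), (T, nec_map T g, U), (U, h))"
    and U: "nec_between S x y U h" and T: "T \<in> Ob Nec" and g: "nec_vertex_map T U g" using k by (rule nec_over_arrE)
  have d: "Dom box_cat (far P1 (T, nec_map T g, U)) = nec_dim T"
    using P1_arrow[OF T nec_betweenD(1)[OF U] g] by (simp add: box_hom_def)
  have u: "u \<in> box_hom n (nec_dim T)" using u by (simp add: k rig_diagram_sel T yoneda_box_sel)
  then show ?thesis using assms(1)[OF U T g u] by (simp add: k rig_diagram_sel yoneda_box_sel d)
qed

lemma rig_cube_invariant:
  assumes "rig_cube S x y n T f u = rig_cube S x y n T' f' u'"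
    and "\<And>T U g h u. nec_between S x y U h \<Longrightarrow> T \<in> Ob Nec \<Longrightarrow> nec_vertex_map T U g \<Longrightarrow> u \<in> box_hom n (nec_dim T) \<Longrightarrow>
      F T (psh_comp (necklace T) h (nec_map T g)) u = F U h (box_comp (far P1 (T, nec_map T g, U)) u)"
  shows "F T f u = F T' f' u'"
  using psh_cls_invariant[OF assms(1)[unfolded rig_cube_def], of "\<lambda>((T, f), u). F T f u",
      OF rig_cube_step_invariant[of S x y n F, OF assms(2)]]
  by simp

lemma rig_cube_quot_lift:
  assumes "\<And>T U g h u. nec_between S x y U h \<Longrightarrow> T \<in> Ob Nec \<Longrightarrow> nec_vertex_map T U g \<Longrightarrow> u \<in> box_hom n (nec_dim T) \<Longrightarrow>
      F T (psh_comp (necklace T) h (nec_map T g)) u = F U h (box_comp (far P1 (T, nec_map T g, U)) u)"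
  shows "quot_lift (\<lambda>((T, f), u). F T f u) (rig_cube S x y n T f u) = F T f u"
  using quot_lift_psh_cls[of "nec_over S x y" rig_diagram n "\<lambda>((T, f), u). F T f u" "((T, f), u)",
      OF rig_cube_step_invariant[of S x y n F, OF assms]]
  by (simp add: rig_cube_def)

lemma rig_cube_mem:
  assumes "((T', f'), u') \<in> rig_cube S x y n T f u" "nec_between S x y T f" "u \<in> box_hom n (nec_dim T)"
  shows "nec_between S x y T' f'" "u' \<in> box_hom n (nec_dim T')" "rig_cube S x y n T' f' u' = rig_cube S x y n T f u"
proof -
  note v = psh_diag.cls_mem_valid[OF rig_psh_diag assms(1)[unfolded rig_cube_def]]
  show T': "nec_between S x y T' f'" using v assms(2,3) by (simp add: rig_diagram_sel yoneda_box_sel nec_between_def)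
  show "u' \<in> box_hom n (nec_dim T')"
    using v(2) assms(2,3) T' by (simp add: rig_diagram_sel yoneda_box_sel nec_between_def)
  show "rig_cube S x y n T' f' u' = rig_cube S x y n T f u"
    using psh_cls_mem_eq[OF assms(1)[unfolded rig_cube_def]] by (simp add: rig_cube_def)
qed

lemma rig_cube_glue_shift:
  assumes T': "nec_between S x y T' f'" and T: "T \<in> Ob Nec" and g: "nec_vertex_map T T' g"
    and U': "nec_between S y z U' k'" and U: "U \<in> Ob Nec" and h: "nec_vertex_map U U' h"
    and u: "u \<in> box_hom n (nec_dim T)" and v: "v \<in> box_hom m (nec_dim U)"
  shows "rig_cube S x z (n + m) (T @ U) (glue T U (psh_comp (necklace T) f' (nec_map T g)) (psh_comp (necklace U) k' (nec_map U h))) (box_plus u v)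
    = rig_cube S x z (n + m) (T' @ U') (glue T' U' f' k')
        (box_plus (box_comp (far P1 (T, nec_map T g, T')) u) (box_comp (far P1 (U, nec_map U h, U')) v))"
proof -
  note t = nec_betweenD[OF T'] and r = nec_betweenD[OF U']
  have m: "f' 0 (vtx (sum_list T')) = k' 0 (vtx 0)" using t r by simp
  have TU: "T @ U \<in> Ob Nec" using T U by simp
  have "box_plus u v \<in> box_hom (n + m) (nec_dim (T @ U))" using box_plus_hom[OF u v] by (simp add: nec_dim_append)
  from rig_cube_shift[OF nec_between_glue[OF T' U'] TU wedge_vertex_map[OF g h] this]
  show ?thesis
    unfolding glue_wedge[OF T t(1) g U r(1) h t(2) r(2) m] P1_wedge[OF T t(1) g U r(1) h]
      box_hom_plus_comp[OF u P1_arrow[OF T t(1) g] v P1_arrow[OF U r(1) h]] .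
qed

lemma psh_comp_nec_id:
  assumes "f \<in> psh_hom simplex_cat (necklace T) S"
  shows "psh_comp (necklace T) f (nec_map T (\<lambda>v. v)) = f"
  unfolding nec_map_id using psh_hom_undefined[OF assms] by (auto simp: psh_comp_def psh_id_def fun_eq_iff)


section \<open>The cubical rigidification is a functor\<close>

text \<open>Composition of an \<open>n\<close>-cube and an \<open>m\<close>-cube in terms of all their
  representatives: the wedge of the necklaces and the product of the cubes.\<close>

definition rig_comp :: "'a sset \<Rightarrow> 'a \<Rightarrow> 'a \<Rightarrow> nat \<Rightarrow> 'a rig_cube \<Rightarrow> nat \<Rightarrow> 'a rig_cube \<Rightarrow> 'a rig_cube" where
  "rig_comp S x z n a m b = rig_rel S x z (n + m) ``
     {((T @ U, glue T U f g), box_plus u v) | T f u U g v. ((T, f), u) \<in> a \<and> ((U, g), v) \<in> b}"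

text \<open>As for products of triangulations, independence of the representatives is checked for one
  factor at a time, by taking the wedge of a map of necklaces with an identity.\<close>

lemma rig_comp_cube:
  assumes T: "nec_between S x y T f" "u \<in> box_hom n (nec_dim T)"
    and U: "nec_between S y z U g" "v \<in> box_hom m (nec_dim U)"
  shows "rig_comp S x z n (rig_cube S x y n T f u) m (rig_cube S y z m U g v)
    = rig_cube S x z (n + m) (T @ U) (glue T U f g) (box_plus u v)"
proof -
  let ?A = "{((T' @ U', glue T' U' f' g'), box_plus u' v') | T' f' u' U' g' v'.
    ((T', f'), u') \<in> rig_cube S x y n T f u \<and> ((U', g'), v') \<in> rig_cube S y z m U g v}"
  define M where "M T f u U g v = rig_cube S x z (n + m) (T @ U) (glue T U f g) (box_plus u v)" for T f u U g v
  have 1: "M T' f' u' U g v = M T f u U g v"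
    if "rig_cube S x y n T' f' u' = rig_cube S x y n T f u" "nec_between S y z U g" "v \<in> box_hom m (nec_dim U)"
    for T' f' u' T f u U g v
  proof (rule rig_cube_invariant[OF that(1)])
    fix T U' k h u assume *: "nec_between S x y U' h" "T \<in> Ob Nec" "nec_vertex_map T U' k" "u \<in> box_hom n (nec_dim T)"
    note U = nec_betweenD[OF that(2)]
    from rig_cube_glue_shift[OF *(1-3) that(2) U(1) nec_vertex_map_id *(4) that(3)]
    show "M T (psh_comp (necklace T) h (nec_map T k)) u U g v = M U' h (box_comp (far P1 (T, nec_map T k, U')) u) U g v"
      unfolding M_def psh_comp_nec_id[OF U(2)] P1_id[OF U(1)] box_hom_comp_id(2)[OF that(3)] .
  qed
  have 2: "M T f u U' g' v' = M T f u U g v"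
    if "rig_cube S y z m U' g' v' = rig_cube S y z m U g v" "nec_between S x y T f" "u \<in> box_hom n (nec_dim T)"
    for U' g' v' T f u U g v
  proof (rule rig_cube_invariant[OF that(1)])
    fix U U' k h v assume *: "nec_between S y z U' h" "U \<in> Ob Nec" "nec_vertex_map U U' k" "v \<in> box_hom m (nec_dim U)"
    note T = nec_betweenD[OF that(2)]
    from rig_cube_glue_shift[OF that(2) T(1) nec_vertex_map_id *(1-3) that(3) *(4)]
    show "M T f u U (psh_comp (necklace U) h (nec_map U k)) v = M T f u U' h (box_comp (far P1 (U, nec_map U k, U')) v)"
      unfolding M_def psh_comp_nec_id[OF T(2)] P1_id[OF T(1)] box_hom_comp_id(2)[OF that(3)] .
  qed
  show ?thesis unfolding rig_comp_def rig_rel_def rig_cube_def[of S x z]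
  proof (rule psh_cls_Image)
    have "((T, f), u) \<in> rig_cube S x y n T f u" "((U, g), v) \<in> rig_cube S y z m U g v"
      unfolding rig_cube_def by (rule psh_cls_self)+
    then show "((T @ U, glue T U f g), box_plus u v) \<in> ?A" by blast
    fix e assume "e \<in> ?A"
    then obtain T' f' u' U' g' v' where e: "e = ((T' @ U', glue T' U' f' g'), box_plus u' v')"
      and *: "((T', f'), u') \<in> rig_cube S x y n T f u" "((U', g'), v') \<in> rig_cube S y z m U g v" by blast
    note U' = rig_cube_mem[OF *(2) U]
    have "M T' f' u' U' g' v' = M T f u U' g' v'" by (rule 1[OF rig_cube_mem(3)[OF *(1) T] U'(1,2)])
    also have "\<dots> = M T f u U g v" by (rule 2[OF U'(3) T])
    finally show "psh_cls (nec_over S x z) rig_diagram (n + m) e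
        = psh_cls (nec_over S x z) rig_diagram (n + m) ((T @ U, glue T U f g), box_plus u v)"
      unfolding M_def rig_cube_def e .
  qed
qed

lemma rig_comp_cell:
  assumes "a \<in> cells (rig_hom S x y) n" "b \<in> cells (rig_hom S y z) m"
  shows "rig_comp S x z n a m b \<in> cells (rig_hom S x z) (n + m)"
  using assms by (elim rig_cellE)
    (auto simp: rig_comp_cube nec_dim_append intro!: rig_cube_cell nec_between_glue box_plus_hom)

lemma rig_comp_act:
  assumes "a \<in> cells (rig_hom S x y) n" "b \<in> cells (rig_hom S y z) m" "s \<in> box_hom n' n" "t \<in> box_hom m' m"
  shows "rig_comp S x z n' (act (rig_hom S x y) s a) m' (act (rig_hom S y z) t b)
    = act (rig_hom S x z) (box_plus s t) (rig_comp S x z n a m b)"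
proof -
  obtain T f u where T: "nec_between S x y T f" "u \<in> box_hom n (nec_dim T)" "a = rig_cube S x y n T f u"
    using assms(1) by (rule rig_cellE)
  obtain U g v where U: "nec_between S y z U g" "v \<in> box_hom m (nec_dim U)" "b = rig_cube S y z m U g v"
    using assms(2) by (rule rig_cellE)
  show ?thesis
    unfolding T(3) U(3) rig_cube_act[OF assms(3) T(1)] rig_cube_act[OF assms(4) U(1)] rig_comp_cube[OF T(1,2) U(1,2)]
      rig_comp_cube[OF T(1) box_comp_hom[OF assms(3) T(2)] U(1) box_comp_hom[OF assms(4) U(2)]]
      rig_cube_act[OF box_plus_hom[OF assms(3,4)] nec_between_glue[OF T(1) U(1)]]
      box_hom_plus_comp[OF assms(3) T(2) assms(4) U(2)] ..
qed

lemma Cbox_ob_sel [simp]: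
  "Obj (Cbox_ob S) = cells S 0" "Hom (Cbox_ob S) = rig_hom S"
  "Unit (Cbox_ob S) x = rig_cube S x x 0 [] (const_nec S x) (box_id 0)"
  by (simp_all add: Cbox_ob_def rig_cube_def psh_cls_def rig_rel_def const_nec_def)

lemma Cbox_Cmp:
  assumes a: "a \<in> cells (rig_hom S x y) n" and b: "b \<in> cells (rig_hom S y z) m" and w: "w \<in> box_hom k (n + m)"
  shows "Cmp (Cbox_ob S) x y z k (act (tensor (rig_hom S x y) (rig_hom S y z)) w (tensor_cube (rig_hom S x y) (rig_hom S y z) n a m b))
    = act (rig_hom S x z) w (rig_comp S x z n a m b)"
proof -
  let ?K = "rig_hom S x y" and ?L = "rig_hom S y z"
  note KL = rig_presheaf[of S x y] rig_presheaf[of S y z]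
  let ?X = "psh_cls (tensor_index ?K ?L) tensor_diagram k (((n, a), (m, b)), w)"
  let ?A = "{((T @ U, glue T U f g), box_comp (box_plus u v) w) | n a m b w T f u U g v.
             (((n, a), (m, b)), w) \<in> ?X \<and> ((T, f), u) \<in> a \<and> ((U, g), v) \<in> b}"
  define \<Phi> where "\<Phi> = (\<lambda>(((n, a), (m, b)), w). act (rig_hom S x z) w (rig_comp S x z n a m b))"
  have inv: "\<Phi> (Dom (tensor_index ?K ?L) l, w) = \<Phi> (Cod (tensor_index ?K ?L) l, far tensor_diagram l k w)"
    if l: "l \<in> Ar (tensor_index ?K ?L)" and w: "w \<in> cells (fob tensor_diagram (Dom (tensor_index ?K ?L) l)) k" for l w
  proof -
    obtain n n' u a m m' v b where l: "l = (((n, act ?K u a), u, (n', a)), ((m, act ?L v b), v, (m', b)))"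
      and u: "u \<in> box_hom n n'" and a: "a \<in> cells ?K n'" and v: "v \<in> box_hom m m'" and b: "b \<in> cells ?L m'"
      using l by (rule tensor_index_arrE)
    have w: "w \<in> box_hom k (n + m)" using w by (simp add: l tensor_diagram_sel yoneda_box_sel)
    note p = box_plus_hom[OF u v]
    then have d: "Dom box_cat (box_plus u v) = n + m" by (simp add: box_hom_def)
    show ?thesis
      using rig_comp_act[OF a b u v] box_psh_act_comp[OF rig_presheaf w p rig_comp_cell[OF a b]] w
      by (simp add: \<Phi>_def l tensor_diagram_sel yoneda_box_sel d)
  qed
  obtain T f u where T: "nec_between S x y T f" "u \<in> box_hom n (nec_dim T)" "a = rig_cube S x y n T f u"
    using a by (rule rig_cellE)
  obtain U g v where U: "nec_between S y z U g" "v \<in> box_hom m (nec_dim U)" "b = rig_cube S y z m U g v"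
    using b by (rule rig_cellE)
  have \<Phi>_cube: "\<Phi> (((n, rig_cube S x y n T f u), (m, rig_cube S y z m U g v)), w)
      = rig_cube S x z k (T @ U) (glue T U f g) (box_comp (box_plus u v) w)"
    if "nec_between S x y T f" "u \<in> box_hom n (nec_dim T)" "nec_between S y z U g" "v \<in> box_hom m (nec_dim U)" "w \<in> box_hom k (n + m)"
    for n T f u m U g v w
    by (simp add: \<Phi>_def rig_comp_cube[OF that(1-4)] rig_cube_act[OF that(5) nec_between_glue[OF that(1,3)]])
  have "rig_rel S x z k `` ?A = rig_cube S x z k (T @ U) (glue T U f g) (box_comp (box_plus u v) w)"
    unfolding rig_rel_def rig_cube_def[of S x z]
  proof (rule psh_cls_Image)
    have "((T, f), u) \<in> a" "((U, g), v) \<in> b" unfolding T(3) U(3) rig_cube_def by (rule psh_cls_self)+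
    moreover have "(((n, a), (m, b)), w) \<in> ?X" by (rule psh_cls_self)
    ultimately show "((T @ U, glue T U f g), box_comp (box_plus u v) w) \<in> ?A" by blast
    fix e assume "e \<in> ?A"
    then obtain n' a' m' b' w' T' f' u' U' g' v' where e: "e = ((T' @ U', glue T' U' f' g'), box_comp (box_plus u' v') w')"
      and X: "(((n', a'), (m', b')), w') \<in> ?X" and mem: "((T', f'), u') \<in> a'" "((U', g'), v') \<in> b'" by blast
    note val = psh_diag.cls_mem_valid[OF tensor_psh_diag[OF KL] X]
    have a': "a' \<in> cells ?K n'" "b' \<in> cells ?L m'" and w': "w' \<in> box_hom k (n' + m')"
      using val a b w by (simp_all add: tensor_diagram_sel yoneda_box_sel)
    obtain T0 f0 u0 where T0: "nec_between S x y T0 f0" "u0 \<in> box_hom n' (nec_dim T0)" "a' = rig_cube S x y n' T0 f0 u0"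
      using a'(1) by (rule rig_cellE)
    obtain U0 g0 v0 where U0: "nec_between S y z U0 g0" "v0 \<in> box_hom m' (nec_dim U0)" "b' = rig_cube S y z m' U0 g0 v0"
      using a'(2) by (rule rig_cellE)
    note T' = rig_cube_mem[OF mem(1)[unfolded T0(3)] T0(1,2)]
    note U' = rig_cube_mem[OF mem(2)[unfolded U0(3)] U0(1,2)]
    have "rig_cube S x z k (T' @ U') (glue T' U' f' g') (box_comp (box_plus u' v') w') = \<Phi> (((n', a'), (m', b')), w')"
      using \<Phi>_cube[OF T'(1,2) U'(1,2) w'] T'(3) U'(3) T0(3) U0(3) by simp
    also have "\<dots> = \<Phi> (((n, a), (m, b)), w)"
      by (rule psh_cls_invariant[OF psh_cls_mem_eq[OF X] inv])
    also have "\<dots> = rig_cube S x z k (T @ U) (glue T U f g) (box_comp (box_plus u v) w)"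
      using \<Phi>_cube[OF T(1,2) U(1,2) w] T(3) U(3) by simp
    finally show "psh_cls (nec_over S x z) rig_diagram k e
       = psh_cls (nec_over S x z) rig_diagram k ((T @ U, glue T U f g), box_comp (box_plus u v) w)"
      unfolding e rig_cube_def .
  qed
  also have "\<dots> = act (rig_hom S x z) w (rig_comp S x z n a m b)"
    using \<Phi>_cube[OF T(1,2) U(1,2) w] T(3) U(3) by (simp add: \<Phi>_def)
  finally have "rig_rel S x z k `` ?A = act (rig_hom S x z) w (rig_comp S x z n a m b)" .
  moreover have "?X \<in> cells (tensor ?K ?L) k"
    using psh_act_cells[OF tensor_presheaf[OF KL], of w "tensor_cube ?K ?L n a m b"] tensor_cube_cell[OF KL a b] w
    by (simp add: box_hom_def act_tensor_cube[OF KL w, symmetric])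
  ultimately show ?thesis
    unfolding act_tensor_cube[OF KL w] by (simp add: Cbox_ob_def)
qed

lemma Cbox_cube_cmp:
  assumes "a \<in> cells (rig_hom S x y) n" "b \<in> cells (rig_hom S y z) m"
  shows "cube_cmp (Cbox_ob S) x y z n a m b = rig_comp S x z n a m b"
proof -
  note KL = rig_presheaf[of S x y] rig_presheaf[of S y z]
  have "act (tensor (rig_hom S x y) (rig_hom S y z)) (box_id (n + m)) (tensor_cube (rig_hom S x y) (rig_hom S y z) n a m b)
      = tensor_cube (rig_hom S x y) (rig_hom S y z) n a m b"
    by (rule box_psh_act_id[OF tensor_presheaf[OF KL] tensor_cube_cell[OF KL assms]])
  then show ?thesis
    using Cbox_Cmp[OF assms box_id_hom] box_psh_act_id[OF rig_presheaf rig_comp_cell[OF assms]]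
    by (simp add: cube_cmp_def)
qed

text \<open>Wedges of necklaces are strictly associative, with the necklace \<open>\<Delta>\<^sup>0\<close> as strict unit.  Together with
  the same property of products of cubes this gives the laws of composition.\<close>

lemma Cbox_ob_ccat:
  assumes S: "is_presheaf simplex_cat S" shows "is_ccat (Cbox_ob S)"
  unfolding is_ccat_def
proof (intro conjI ballI allI, unfold Cbox_ob_sel)
  fix x y z
  note KL = rig_presheaf[of S x y] rig_presheaf[of S y z]
  let ?K = "tensor (rig_hom S x y) (rig_hom S y z)"
  show "Cmp (Cbox_ob S) x y z \<in> psh_hom box_cat ?K (rig_hom S x z)"
  proof (rule psh_homI)
    fix k t assume "t \<in> cells ?K k"
    then obtain n a m b w where ab: "a \<in> cells (rig_hom S x y) n" "b \<in> cells (rig_hom S y z) m" "w \<in> box_hom k (n + m)"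
      and t: "t = act ?K w (tensor_cube (rig_hom S x y) (rig_hom S y z) n a m b)" by (rule tensor_cellE[OF KL])
    show "Cmp (Cbox_ob S) x y z k t \<in> cells (rig_hom S x z) k"
      unfolding t Cbox_Cmp[OF ab] by (rule box_psh_act_cell[OF rig_presheaf ab(3) rig_comp_cell[OF ab(1,2)]])
  next
    fix u t assume "u \<in> Ar box_cat" and t: "t \<in> cells ?K (Cod box_cat u)"
    then have u: "u \<in> box_hom (Dom box_cat u) (Cod box_cat u)" by (simp add: box_hom_def)
    obtain n a m b w where ab: "a \<in> cells (rig_hom S x y) n" "b \<in> cells (rig_hom S y z) m" and w: "w \<in> box_hom (Cod box_cat u) (n + m)"
      and t: "t = act ?K w (tensor_cube (rig_hom S x y) (rig_hom S y z) n a m b)" using t by (rule tensor_cellE[OF KL])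
    have "act ?K u t = act ?K (box_comp w u) (tensor_cube (rig_hom S x y) (rig_hom S y z) n a m b)"
      unfolding t by (rule box_psh_act_comp[symmetric, OF tensor_presheaf[OF KL] u w tensor_cube_cell[OF KL ab]])
    then show "Cmp (Cbox_ob S) x y z (Dom box_cat u) (act ?K u t) = act (rig_hom S x z) u (Cmp (Cbox_ob S) x y z (Cod box_cat u) t)"
      unfolding t using Cbox_Cmp[OF ab w] Cbox_Cmp[OF ab box_comp_hom[OF u w]]
        box_psh_act_comp[OF rig_presheaf u w rig_comp_cell[OF ab]] by simp
  qed (simp add: Cbox_ob_def)
next
  fix x assume "x \<in> cells S 0"
  then show "rig_cube S x x 0 [] (const_nec S x) (box_id 0) \<in> cells (rig_hom S x x) 0"
    by (intro rig_cube_cell nec_between_const[OF S]) (simp_all add: nec_dim_def free_vertices_def joints_Nil)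
next
  fix x y n a assume xy: "x \<in> cells S 0" "y \<in> cells S 0" and a: "a \<in> cells (rig_hom S x y) n"
  then obtain T f u where T: "nec_between S x y T f" "u \<in> box_hom n (nec_dim T)" "a = rig_cube S x y n T f u" by (elim rig_cellE)
  note t = nec_betweenD[OF T(1)]
  have d: "box_id 0 \<in> box_hom 0 (nec_dim [])" by (simp add: nec_dim_def free_vertices_def joints_Nil)
  have u: "u \<in> box_arrows" using T(2) by (simp add: box_hom_def)
  note c = nec_between_const[OF S xy(1)] nec_between_const[OF S xy(2)]
  show "cube_cmp (Cbox_ob S) x x y 0 (rig_cube S x x 0 [] (const_nec S x) (box_id 0)) n a = a"
    unfolding Cbox_cube_cmp[OF rig_cube_cell[OF c(1) d] a] unfolding T(3) rig_comp_cube[OF c(1) d T(1,2)]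
    using glue_const_left[OF S t(1,2)] box_plus_unit(1)[OF u] t by simp
  show "cube_cmp (Cbox_ob S) x y y n a 0 (rig_cube S y y 0 [] (const_nec S y) (box_id 0)) = a"
    unfolding Cbox_cube_cmp[OF a rig_cube_cell[OF c(2) d]] unfolding T(3) rig_comp_cube[OF T(1,2) c(2) d]
    using glue_const_right[OF S t(1,2)] box_plus_unit(2)[OF u] t by simp
next
  fix w x y z n m k a b c
  assume a: "a \<in> cells (rig_hom S w x) n" and b: "b \<in> cells (rig_hom S x y) m" and c: "c \<in> cells (rig_hom S y z) k"
  obtain T f u where T: "nec_between S w x T f" "u \<in> box_hom n (nec_dim T)" "a = rig_cube S w x n T f u" using a by (rule rig_cellE)
  obtain U g v where U: "nec_between S x y U g" "v \<in> box_hom m (nec_dim U)" "b = rig_cube S x y m U g v" using b by (rule rig_cellE)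
  obtain V h r where V: "nec_between S y z V h" "r \<in> box_hom k (nec_dim V)" "c = rig_cube S y z k V h r" using c by (rule rig_cellE)
  note t = nec_betweenD[OF T(1)] and u = nec_betweenD[OF U(1)] and v = nec_betweenD[OF V(1)]
  have "glue (T @ U) V (glue T U f g) h = glue T (U @ V) f (glue U V g h)"
    by (rule glue_assoc[OF t(1) u(1) v(1) t(2) u(2) v(2)]) (use t u v in simp_all)
  moreover have "box_plus u v \<in> box_hom (n + m) (nec_dim (T @ U))" "box_plus v r \<in> box_hom (m + k) (nec_dim (U @ V))"
    using box_plus_hom T U V by (simp_all add: nec_dim_append)
  ultimately show "cube_cmp (Cbox_ob S) w y z (n + m) (cube_cmp (Cbox_ob S) w x y n a m b) k c
          = cube_cmp (Cbox_ob S) w x z n a (m + k) (cube_cmp (Cbox_ob S) x y z m b k c)"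
    using rig_comp_cell[OF a b] rig_comp_cell[OF b c]
    by (simp add: Cbox_cube_cmp[OF a b] Cbox_cube_cmp[OF b c] Cbox_cube_cmp[OF rig_comp_cell[OF a b] c]
        Cbox_cube_cmp[OF a rig_comp_cell[OF b c]])
      (simp add: T(3) U(3) V(3) rig_comp_cube[OF T(1,2) U(1,2)] rig_comp_cube[OF U(1,2) V(1,2)]
        rig_comp_cube[OF nec_between_glue[OF T(1) U(1)] _ V(1,2)] rig_comp_cube[OF T(1,2) nec_between_glue[OF U(1) V(1)]]
        box_hom_plus_assoc[OF T(2) U(2) V(2)] add.assoc)
qed (rule rig_presheaf)

lemma psh_comp_assoc:
  "s \<in> psh_hom C P Q \<Longrightarrow> psh_comp P r (psh_comp P t s) = psh_comp P (psh_comp Q r t) s"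
  using psh_hom_cell by (fastforce simp: psh_comp_def fun_eq_iff)

lemma psh_comp_id_left: "s \<in> psh_hom C P Q \<Longrightarrow> psh_comp P (psh_id Q) s = s"
  using psh_hom_cell psh_hom_undefined by (fastforce simp: psh_comp_def psh_id_def fun_eq_iff)

lemma Cbox_ar_sel [simp]:
  "Src (Cbox_ar (S, p, S')) = Cbox_ob S" "Tgt (Cbox_ar (S, p, S')) = Cbox_ob S'" "Omap (Cbox_ar (S, p, S')) = p 0"
  by (simp_all add: Cbox_ar_def)

context
  fixes S S' :: "'a sset" and p
  assumes S: "is_presheaf simplex_cat S" and S': "is_presheaf simplex_cat S'" and p: "p \<in> psh_hom simplex_cat S S'"
begin

lemma Cbox_ar_cube:
  assumes xy: "x \<in> cells S 0" "y \<in> cells S 0" and T: "nec_between S x y T f" "u \<in> box_hom n (nec_dim T)"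
  shows "Hmap (Cbox_ar (S, p, S')) x y n (rig_cube S x y n T f u)
    = rig_cube S' (p 0 x) (p 0 y) n T (psh_comp (necklace T) p f) u"
proof -
  let ?h = "\<lambda>((T, f), u). ((T, psh_comp (necklace T) p f), u)"
  have "psh_colim_rel (nec_over S' (p 0 x) (p 0 y)) rig_diagram n `` (?h ` psh_cls (nec_over S x y) rig_diagram n ((T, f), u))
      = psh_cls (nec_over S' (p 0 x) (p 0 y)) rig_diagram n (?h ((T, f), u))"
  proof (rule psh_cls_map)
    fix k v assume k: "k \<in> Ar (nec_over S x y)" and v: "v \<in> cells (fob rig_diagram (Dom (nec_over S x y) k)) n"
    have "(\<lambda>((T, f), u). rig_cube S' (p 0 x) (p 0 y) n T (psh_comp (necklace T) p f) u) (Dom (nec_over S x y) k, v)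
      = (\<lambda>((T, f), u). rig_cube S' (p 0 x) (p 0 y) n T (psh_comp (necklace T) p f) u) (Cod (nec_over S x y) k, far rig_diagram k n v)"
    proof (rule rig_cube_step_invariant[OF _ k v])
      fix T U g h u assume U: "nec_between S x y U h" and T: "T \<in> Ob Nec" and g: "nec_vertex_map T U g" and u: "u \<in> box_hom n (nec_dim T)"
      show "rig_cube S' (p 0 x) (p 0 y) n T (psh_comp (necklace T) p (psh_comp (necklace T) h (nec_map T g))) u
        = rig_cube S' (p 0 x) (p 0 y) n U (psh_comp (necklace U) p h) (box_comp (far P1 (T, nec_map T g, U)) u)"
        unfolding psh_comp_assoc[OF nec_map_hom[OF T nec_betweenD(1)[OF U] g]]
        by (rule rig_cube_shift[OF nec_between_post_comp[OF U p] T g u])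
    qed
    then show "psh_cls (nec_over S' (p 0 x) (p 0 y)) rig_diagram n (?h (Dom (nec_over S x y) k, v))
      = psh_cls (nec_over S' (p 0 x) (p 0 y)) rig_diagram n (?h (Cod (nec_over S x y) k, far rig_diagram k n v))"
      by (simp add: rig_cube_def split_beta)
  qed
  moreover have "rig_cube S x y n T f u \<in> cells (rig_hom S x y) n" by (rule rig_cube_cell[OF T])
  ultimately show ?thesis using xy by (simp add: Cbox_ar_def rig_cube_def rig_rel_def)
qed

lemma Cbox_ar_cfun: "is_cfun (Cbox_ar (S, p, S'))"
proof (rule cfunI, unfold Cbox_ar_sel Cbox_ob_sel)
  show "is_ccat (Cbox_ob S)" "is_ccat (Cbox_ob S')" using Cbox_ob_ccat S S' by blast+
  show "p 0 \<in> cells S 0 \<rightarrow>\<^sub>E cells S' 0" using p by (simp add: psh_hom_def)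
  have "Hmap (Cbox_ar (S, p, S')) x y \<in> psh_hom box_cat (rig_hom S x y) (rig_hom S' (p 0 x) (p 0 y))"
    if xy: "x \<in> cells S 0" "y \<in> cells S 0" for x y
  proof (rule psh_homI)
    fix n X assume "X \<in> cells (rig_hom S x y) n"
    then obtain T f u where T: "nec_between S x y T f" "u \<in> box_hom n (nec_dim T)" "X = rig_cube S x y n T f u"
      by (rule rig_cellE)
    show "Hmap (Cbox_ar (S, p, S')) x y n X \<in> cells (rig_hom S' (p 0 x) (p 0 y)) n"
      unfolding T(3) Cbox_ar_cube[OF xy T(1,2)] by (rule rig_cube_cell[OF nec_between_post_comp[OF T(1) p] T(2)])
  next
    fix w X assume "w \<in> Ar box_cat" and X: "X \<in> cells (rig_hom S x y) (Cod box_cat w)"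
    then have w: "w \<in> box_hom (Dom box_cat w) (Cod box_cat w)" by (simp add: box_hom_def)
    from X obtain T f u where T: "nec_between S x y T f" "u \<in> box_hom (Cod box_cat w) (nec_dim T)"
      "X = rig_cube S x y (Cod box_cat w) T f u" by (rule rig_cellE)
    show "Hmap (Cbox_ar (S, p, S')) x y (Dom box_cat w) (act (rig_hom S x y) w X)
       = act (rig_hom S' (p 0 x) (p 0 y)) w (Hmap (Cbox_ar (S, p, S')) x y (Cod box_cat w) X)"
      unfolding T(3) rig_cube_act[OF w T(1)] Cbox_ar_cube[OF xy T(1,2)] Cbox_ar_cube[OF xy T(1) box_comp_hom[OF w T(2)]]
        rig_cube_act[OF w nec_between_post_comp[OF T(1) p]] ..
  next
    fix n X assume "X \<notin> cells (rig_hom S x y) n"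
    then show "Hmap (Cbox_ar (S, p, S')) x y n X = undefined" using xy by (simp add: Cbox_ar_def)
  qed
  then show "Hmap (Cbox_ar (S, p, S')) \<in> (\<Pi>\<^sub>E x\<in>cells S 0. \<Pi>\<^sub>E y\<in>cells S 0.
       psh_hom box_cat (rig_hom S x y) (rig_hom S' (p 0 x) (p 0 y)))"
    by (intro PiE_I) (simp_all add: Cbox_ar_def)
next
  fix x assume x: "x \<in> cells S 0"
  have px: "p 0 x \<in> cells S' 0" using psh_hom_cell[OF p x] .
  have N: "[] \<in> Ob Nec" by (simp add: Nec_Ob)
  have d: "box_id 0 \<in> box_hom 0 (nec_dim [])" by (simp add: nec_dim_def free_vertices_def joints_Nil)
  note c = nec_between_const[OF S x]
  have "psh_comp (necklace []) p (const_nec S x) = const_nec S' (p 0 x)"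
    using psh_hom_Nil[OF S' nec_betweenD(2)[OF nec_between_post_comp[OF c p]]] nec_betweenD(3)[OF nec_between_post_comp[OF c p]]
    by simp
  then show "Hmap (Cbox_ar (S, p, S')) x x 0 (rig_cube S x x 0 [] (const_nec S x) (box_id 0))
      = rig_cube S' (p 0 x) (p 0 x) 0 [] (const_nec S' (p 0 x)) (box_id 0)"
    unfolding Cbox_ar_cube[OF x x c d] by simp
next
  fix x y z n m a b
  assume x: "x \<in> cells S 0" and y: "y \<in> cells S 0" and z: "z \<in> cells S 0"
    and a: "a \<in> cells (rig_hom S x y) n" and b: "b \<in> cells (rig_hom S y z) m"
  obtain T f u where T: "nec_between S x y T f" "u \<in> box_hom n (nec_dim T)" and a': "a = rig_cube S x y n T f u" using a by (rule rig_cellE)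
  obtain U g v where U: "nec_between S y z U g" "v \<in> box_hom m (nec_dim U)" and b': "b = rig_cube S y z m U g v" using b by (rule rig_cellE)
  note t = nec_betweenD[OF T(1)] and u = nec_betweenD[OF U(1)]
  have m: "f 0 (vtx (sum_list T)) = g 0 (vtx 0)" using t u by simp
  have uv: "box_plus u v \<in> box_hom (n + m) (nec_dim (T @ U))" using box_plus_hom[OF T(2) U(2)] by (simp add: nec_dim_append)
  note pT = nec_between_post_comp[OF T(1) p] and pU = nec_between_post_comp[OF U(1) p]
  show "Hmap (Cbox_ar (S, p, S')) x z (n + m) (cube_cmp (Cbox_ob S) x y z n a m b)
      = cube_cmp (Cbox_ob S') (p 0 x) (p 0 y) (p 0 z) n (Hmap (Cbox_ar (S, p, S')) x y n a) m (Hmap (Cbox_ar (S, p, S')) y z m b)"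
    unfolding Cbox_cube_cmp[OF a b]
    unfolding a' b' rig_comp_cube[OF T U] Cbox_ar_cube[OF x y T] Cbox_ar_cube[OF y z U]
      Cbox_ar_cube[OF x z nec_between_glue[OF T(1) U(1)] uv] glue_post_comp[OF t(1) u(1) t(2) u(2) m p]
      Cbox_cube_cmp[OF rig_cube_cell[OF pT T(2)] rig_cube_cell[OF pU U(2)]] rig_comp_cube[OF pT T(2) pU U(2)] ..
qed

end

lemma SSet_sel:
  "S \<in> Ob SSet \<longleftrightarrow> is_presheaf simplex_cat S"
  "(S, p, S') \<in> Ar SSet \<longleftrightarrow> is_presheaf simplex_cat S \<and> is_presheaf simplex_cat S' \<and> p \<in> psh_hom simplex_cat S S'"
  "Dom SSet (S, p, S') = S" "Cod SSet (S, p, S') = S'" "Idn SSet S = (S, psh_id S, S)"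
  "Comp SSet (S2, q, S'') (S, p, S1) = (S, psh_comp S q p, S'')"
  by (simp_all add: psh_cat_def)

theorem Cbox_functor: "is_functor (SSet :: ('a sset, (simp_arr, 'a) psh_arr) cat) CCat Cbox"
proof -
  have i: "Cbox_ar (S, psh_id S, S) = efun_id (Cbox_ob S)" if S: "is_presheaf simplex_cat S" for S :: "'a sset"
  proof (rule cfun_eqI)
    note p = psh_id_hom[OF S]
    show "is_cfun (Cbox_ar (S, psh_id S, S))" by (rule Cbox_ar_cfun[OF S S p])
    show "is_cfun (efun_id (Cbox_ob S))" by (rule efun_id_cfun[OF Cbox_ob_ccat[OF S]])
    fix x y n a assume "x \<in> Obj (Src (Cbox_ar (S, psh_id S, S)))" "y \<in> Obj (Src (Cbox_ar (S, psh_id S, S)))"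
      "a \<in> cells (Hom (Src (Cbox_ar (S, psh_id S, S))) x y) n"
    then have xy: "x \<in> cells S 0" "y \<in> cells S 0" and a: "a \<in> cells (rig_hom S x y) n" by simp_all
    from a obtain T f u where T: "nec_between S x y T f" "u \<in> box_hom n (nec_dim T)" "a = rig_cube S x y n T f u" by (rule rig_cellE)
    have "Hmap (Cbox_ar (S, psh_id S, S)) x y n a = a"
      unfolding T(3) Cbox_ar_cube[OF S S p xy T(1,2)] psh_comp_id_left[OF nec_betweenD(2)[OF T(1)]]
      using xy by (simp add: psh_id_def)
    then show "Hmap (Cbox_ar (S, psh_id S, S)) x y n a = Hmap (efun_id (Cbox_ob S)) x y n a"
      using xy a by (simp add: efun_id_def psh_id_def)
  qed (simp_all add: efun_id_def psh_id_def)
  have c: "Cbox_ar (S, psh_comp S q p, S2) = efun_comp (Cbox_ar (S1, q, S2)) (Cbox_ar (S, p, S1))"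
    if S: "is_presheaf simplex_cat S" and S1: "is_presheaf simplex_cat S1" and S2: "is_presheaf simplex_cat S2"
      and p: "p \<in> psh_hom simplex_cat S S1" and q: "q \<in> psh_hom simplex_cat S1 S2" for S S1 S2 :: "'a sset" and p q
  proof (rule cfun_eqI)
    note qp = psh_comp_hom[OF S p q]
    have st: "Src (efun_comp (Cbox_ar (S1, q, S2)) (Cbox_ar (S, p, S1))) = Cbox_ob S"
      "Tgt (efun_comp (Cbox_ar (S1, q, S2)) (Cbox_ar (S, p, S1))) = Cbox_ob S2" by (simp_all add: efun_comp_def)
    show "is_cfun (Cbox_ar (S, psh_comp S q p, S2))" by (rule Cbox_ar_cfun[OF S S2 qp])
    show "is_cfun (efun_comp (Cbox_ar (S1, q, S2)) (Cbox_ar (S, p, S1)))"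
      by (rule cfun_comp[OF Cbox_ar_cfun[OF S S1 p] Cbox_ar_cfun[OF S1 S2 q]]) simp
    show "Src (Cbox_ar (S, psh_comp S q p, S2)) = Src (efun_comp (Cbox_ar (S1, q, S2)) (Cbox_ar (S, p, S1)))"
      "Tgt (Cbox_ar (S, psh_comp S q p, S2)) = Tgt (efun_comp (Cbox_ar (S1, q, S2)) (Cbox_ar (S, p, S1)))" by (simp_all add: st)
    show "Omap (Cbox_ar (S, psh_comp S q p, S2)) x = Omap (efun_comp (Cbox_ar (S1, q, S2)) (Cbox_ar (S, p, S1))) x"
      if "x \<in> Obj (Src (Cbox_ar (S, psh_comp S q p, S2)))" for x using that by (simp add: efun_comp_def psh_comp_cell)
    fix x y n a assume "x \<in> Obj (Src (Cbox_ar (S, psh_comp S q p, S2)))" "y \<in> Obj (Src (Cbox_ar (S, psh_comp S q p, S2)))"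
      "a \<in> cells (Hom (Src (Cbox_ar (S, psh_comp S q p, S2))) x y) n"
    then have xy: "x \<in> cells S 0" "y \<in> cells S 0" and a: "a \<in> cells (rig_hom S x y) n" by simp_all
    from a obtain T f u where T: "nec_between S x y T f" "u \<in> box_hom n (nec_dim T)" "a = rig_cube S x y n T f u" by (rule rig_cellE)
    note p0 = psh_hom_cell[OF p xy(1)] psh_hom_cell[OF p xy(2)]
    have "Hmap (efun_comp (Cbox_ar (S1, q, S2)) (Cbox_ar (S, p, S1))) x y n a
        = Hmap (Cbox_ar (S1, q, S2)) (p 0 x) (p 0 y) n (Hmap (Cbox_ar (S, p, S1)) x y n a)"
      using xy a by (simp add: efun_comp_def psh_comp_cell)
    also have "\<dots> = rig_cube S2 (q 0 (p 0 x)) (q 0 (p 0 y)) n T (psh_comp (necklace T) q (psh_comp (necklace T) p f)) u"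
      unfolding T(3) Cbox_ar_cube[OF S S1 p xy T(1,2)] Cbox_ar_cube[OF S1 S2 q p0 nec_between_post_comp[OF T(1) p] T(2)] ..
    also have "\<dots> = Hmap (Cbox_ar (S, psh_comp S q p, S2)) x y n a"
      unfolding T(3) Cbox_ar_cube[OF S S2 qp xy T(1,2)] psh_comp_assoc[OF nec_betweenD(2)[OF T(1)]]
        psh_comp_cell[OF xy(1)] psh_comp_cell[OF xy(2)] ..
    finally show "Hmap (Cbox_ar (S, psh_comp S q p, S2)) x y n a = Hmap (efun_comp (Cbox_ar (S1, q, S2)) (Cbox_ar (S, p, S1))) x y n a" ..
  qed
  show ?thesis
    unfolding is_functor_def
  proof (intro conjI ballI impI)
    fix S :: "'a sset" assume "S \<in> Ob SSet"
    then show "fob Cbox S \<in> Ob CCat" "far Cbox (Idn SSet S) = Idn CCat (fob Cbox S)"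
      by (simp_all add: SSet_sel Cbox_def CCat_def Cbox_ob_ccat i)
  next
    fix f :: "(simp_arr, 'a) psh_arr" assume f: "f \<in> Ar SSet"
    obtain S p S' where fe: "f = (S, p, S')" by (cases f)
    show "far Cbox f \<in> Ar CCat" "Dom CCat (far Cbox f) = fob Cbox (Dom SSet f)" "Cod CCat (far Cbox f) = fob Cbox (Cod SSet f)"
      using f by (simp_all add: fe SSet_sel Cbox_def CCat_def Cbox_ar_cfun)
    fix g :: "(simp_arr, 'a) psh_arr" assume g: "g \<in> Ar SSet" "Dom SSet g = Cod SSet f"
    obtain S1 q S2 where ge: "g = (S1, q, S2)" by (cases g)
    show "far Cbox (Comp SSet g f) = Comp CCat (far Cbox g) (far Cbox f)"
      using f g c[of S S' S2 p q] by (simp add: fe ge SSet_sel Cbox_def CCat_def)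
  qed (rule psh_cat_category CCat_category)+
qed


section \<open>The rigidification is a functor\<close>

lemma C_diagram_sel [simp]:
  "fob C_diagram (n, s) = C_simplex n"
  "Omap (far C_diagram (a, (m, n, f), b)) = f"
  "i \<le> m \<Longrightarrow> j \<le> m \<Longrightarrow> Hmap (far C_diagram (a, (m, n, f), b)) i j = nerve_map (path_poset i j) (\<subseteq>) (\<lambda>X. f ` X)"
  by (simp_all add: C_diagram_def fcompose_def C_simplex_functor_def elements_proj_def)

lemma elements_simplex_arrE:
  assumes "k \<in> Ar (elements simplex_cat S)"
  obtains m n f s where "k = ((m, act S (m, n, f) s), (m, n, f), (n, s))"
    "(m, n, f) \<in> Ar simplex_cat" "s \<in> cells S n"
proof -
  obtain x u y where k: "k = (x, u, y)" by (cases k)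
  obtain m n f where u: "u = (m, n, f)" by (cases u)
  show thesis using assms that[of m n f "snd y"] by (cases x, cases y) (auto simp: k u elements_def)
qed

lemma elements_simplex_arrI:
  "(m, n, f) \<in> Ar simplex_cat \<Longrightarrow> s \<in> cells S n \<Longrightarrow>
    ((m, act S (m, n, f) s), (m, n, f), (n, s)) \<in> Ar (elements simplex_cat S)"
  by (simp add: elements_def)

lemma psh_id_cell: "x \<in> cells P n \<Longrightarrow> psh_id P n x = x"
  by (simp add: psh_id_def)

definition relabel :: "(nat \<Rightarrow> 'a \<Rightarrow> 'b) \<Rightarrow> ('a element, nat, 'c) letter \<Rightarrow> ('b element, nat, 'c) letter" where
  "relabel p = (\<lambda>((n, s), i, j, a). ((n, p n s), i, j, a))"

lemma relabel_simp [simp]: "relabel p ((n, s), i, j, a) = ((n, p n s), i, j, a)"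
  by (simp add: relabel_def)

definition rig_vertex :: "'a sset \<Rightarrow> nat \<Rightarrow> 'a \<Rightarrow> nat \<Rightarrow> 'a C_ob" where
  "rig_vertex S n s i = scat_diagram.q (elements simplex_cat S) C_diagram (n, s) i"

abbreviation rig_word where
  "rig_word S n \<equiv> is_path (elements simplex_cat S) C_diagram n"

text \<open>The simplex of a mapping space that a word represents.  A letter \<open>((n, s), i, j, c)\<close> consists
  of an \<open>n\<close>-simplex \<open>s\<close> of \<open>S\<close> and a simplex \<open>c\<close> of the mapping space from \<open>i\<close> to \<open>j\<close> of \<open>C_simplex n\<close>.\<close>

definition rig_class :: "'a sset \<Rightarrow> 'a C_ob \<Rightarrow> 'a C_ob \<Rightarrow> nat \<Rightarrow> ('a element, nat, nat \<Rightarrow> nat set) letter list \<Rightarrow> 'a C_cell" where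
  "rig_class S X Y n w = scat_diagram.cl (elements simplex_cat S) C_diagram X Y n w"

abbreviation path_chains :: "nat \<Rightarrow> nat \<Rightarrow> nat \<Rightarrow> (nat \<Rightarrow> nat set) set" where
  "path_chains i j k \<equiv> cells (nerve (path_poset i j) (\<subseteq>)) k"

context
  fixes S :: "'a sset"
  assumes S: "is_presheaf simplex_cat S"
begin

interpretation scat_diagram "elements simplex_cat S" C_diagram
  by (rule C_diagram_functor[OF S])

lemma Rig_ob_L: "Rig_ob S = scat_colim (elements simplex_cat S) C_diagram"
  by (simp add: Rig_ob_def)

lemma Rig_Obj: "Obj (Rig_ob S) = {rig_vertex S n s i | n s i. s \<in> cells S n \<and> i \<le> n}"
  unfolding Rig_ob_L Obj_L rig_vertex_def by fastforce

lemma Rig_ObjE: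
  assumes "X \<in> Obj (Rig_ob S)" obtains n s i where "s \<in> cells S n" "i \<le> n" "X = rig_vertex S n s i"
  using assms unfolding Rig_Obj by blast

lemma rig_vertex_in: "s \<in> cells S n \<Longrightarrow> i \<le> n \<Longrightarrow> rig_vertex S n s i \<in> Obj (Rig_ob S)"
  unfolding Rig_Obj by blast

lemma rig_word_Cons:
  "rig_word S k X (((n, s), i, j, a) # w) Y \<longleftrightarrow> s \<in> cells S n \<and> i \<le> n \<and> j \<le> n \<and> a \<in> path_chains i j k
     \<and> X = rig_vertex S n s i \<and> rig_word S k (rig_vertex S n s j) w Y"
  by (simp add: rig_vertex_def)

lemma rig_word_append: "rig_word S k X (v @ w) Z \<longleftrightarrow> (\<exists>Y. rig_word S k X v Y \<and> rig_word S k Y w Z)"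
  by (rule path_append)

lemma Rig_cell_iff: "cells (Hom (Rig_ob S) X Y) k = {rig_class S X Y k w | w. rig_word S k X w Y}"
  unfolding Rig_ob_L cells_L rig_class_def ..

lemma rig_class_cell: "rig_word S k X w Y \<Longrightarrow> rig_class S X Y k w \<in> cells (Hom (Rig_ob S) X Y) k"
  unfolding Rig_cell_iff by blast

lemma Rig_cellE:
  assumes "W \<in> cells (Hom (Rig_ob S) X Y) k" obtains w where "rig_word S k X w Y" "W = rig_class S X Y k w"
  using assms unfolding Rig_cell_iff by blast

lemma Rig_act:
  assumes "u \<in> Ar simplex_cat"
  shows "act (Hom (Rig_ob S) X Y) u (rig_class S X Y (Cod simplex_cat u) w)
    = rig_class S X Y (Dom simplex_cat u) (map (lact u) w)"
  unfolding Rig_ob_L rig_class_def by (rule act_cl[OF assms])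

lemma Rig_Cmp:
  "rig_word S k X v Y \<Longrightarrow> rig_word S k Y w Z \<Longrightarrow>
    Cmp (Rig_ob S) X Y Z k (rig_class S X Y k v, rig_class S Y Z k w) = rig_class S X Z k (v @ w)"
  unfolding Rig_ob_L rig_class_def by (rule Cmp_cl)

lemma Rig_Unit: "Unit (Rig_ob S) X = rig_class S X X 0 []"
  unfolding Rig_ob_L rig_class_def by (rule Unit_cl)

lemma Rig_unit_simplex: "unit_simplex (Rig_ob S) X k = rig_class S X X k []"
  unfolding Rig_ob_L rig_class_def by (rule unit_simplex_cl)

lemma Rig_scat: "is_scat (Rig_ob S)"
  unfolding Rig_ob_L by (rule scat_L)

text \<open>A word may be changed anywhere by composing two adjacent letters of the same simplex, by
  deleting the letter of an identity, or by moving a letter along a simplicial operator.\<close>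

lemma rig_class_step:
  "path_step (elements simplex_cat S) C_diagram k v w \<Longrightarrow> rig_word S k X v Y \<Longrightarrow> rig_word S k X w Y \<Longrightarrow>
    rig_class S X Y k v = rig_class S X Y k w"
  unfolding rig_class_def by (rule cl_step)

lemma rig_vertex_shift:
  assumes "(m, n, f) \<in> Ar simplex_cat" "s \<in> cells S n" "i \<le> m"
  shows "rig_vertex S m (act S (m, n, f) s) i = rig_vertex S n s (f i)"
  unfolding rig_vertex_def using q_arr[OF elements_simplex_arrI[of m n f s S], of i] assms by simp

end

context
  fixes S S' :: "'a sset" and p
  assumes S: "is_presheaf simplex_cat S" and S': "is_presheaf simplex_cat S'" and p: "p \<in> psh_hom simplex_cat S S'"
begin

interpretation A: scat_diagram "elements simplex_cat S" C_diagram
  by (rule C_diagram_functor[OF S])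

interpretation B: scat_diagram "elements simplex_cat S'" C_diagram
  by (rule C_diagram_functor[OF S'])

lemma relabel_arr:
  assumes "((m, act S (m, n, f) s), (m, n, f), (n, s)) \<in> Ar (elements simplex_cat S)"
  shows "((m, p m (act S (m, n, f) s)), (m, n, f), (n, p n s)) \<in> Ar (elements simplex_cat S')"
proof -
  have f: "(m, n, f) \<in> Ar simplex_cat" "s \<in> cells S n" using assms by (simp_all add: elements_def)
  show ?thesis
    using elements_simplex_arrI[OF f(1) psh_hom_cell[OF p f(2)]] psh_hom_act[OF p f(1)] f by simp
qed

lemma Rig_omap_vertex:
  assumes "s \<in> cells S n" "i \<le> n"
  shows "Rig_omap (S, p, S') (rig_vertex S n s i) = rig_vertex S' n (p n s) i"
proof -
  let ?h = "\<lambda>((n, s), i). ((n, p n s), i)"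
  have "col_ob_rel (elements simplex_cat S') C_diagram `` (?h ` (col_ob_rel (elements simplex_cat S) C_diagram `` {((n, s), i)}))
      = col_ob_rel (elements simplex_cat S') C_diagram `` {?h ((n, s), i)}"
    unfolding col_ob_rel_def colim_rel_def
  proof (rule eqcl_saturate, rule eqcl_base)
    fix v w assume "(v, w) \<in> {((Dom (elements simplex_cat S) u, x), Cod (elements simplex_cat S) u, Omap (far C_diagram u) x) | u x.
        u \<in> Ar (elements simplex_cat S) \<and> x \<in> Obj (fob C_diagram (Dom (elements simplex_cat S) u))}"
    then obtain l x where l: "l \<in> Ar (elements simplex_cat S)" and x: "x \<in> Obj (fob C_diagram (Dom (elements simplex_cat S) l))"
      and v: "v = (Dom (elements simplex_cat S) l, x)" and w: "w = (Cod (elements simplex_cat S) l, Omap (far C_diagram l) x)"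
      by blast
    obtain m n f s where k: "l = ((m, act S (m, n, f) s), (m, n, f), (n, s))" using l by (rule elements_simplex_arrE)
    define l' where "l' = ((m, p m (act S (m, n, f) s)), (m, n, f), (n, p n s))"
    have "l' \<in> Ar (elements simplex_cat S')" unfolding l'_def using relabel_arr l k by blast
    moreover have "x \<in> Obj (fob C_diagram (Dom (elements simplex_cat S') l'))" using x by (simp add: k l'_def)
    moreover have "?h v = (Dom (elements simplex_cat S') l', x)"
      "?h w = (Cod (elements simplex_cat S') l', Omap (far C_diagram l') x)"
      by (simp_all add: v w k l'_def)
    ultimately show "(?h v, ?h w) \<in> {((Dom (elements simplex_cat S') u, x), Cod (elements simplex_cat S') u, Omap (far C_diagram u) x) | u x.
        u \<in> Ar (elements simplex_cat S') \<and> x \<in> Obj (fob C_diagram (Dom (elements simplex_cat S') u))}"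
      by blast
  qed
  then show ?thesis
    using rig_vertex_in[OF S assms] by (simp add: Rig_omap_def rig_vertex_def A.q_def B.q_def)
qed

lemma rig_word_relabel:
  "rig_word S k X w Y \<Longrightarrow> rig_word S' k (Rig_omap (S, p, S') X) (map (relabel p) w) (Rig_omap (S, p, S') Y)"
proof (induction w arbitrary: X)
  case (Cons l w)
  obtain n s i j a where l: "l = ((n, s), i, j, a)" by (cases l) auto
  have *: "s \<in> cells S n" "i \<le> n" "j \<le> n" "a \<in> path_chains i j k" "X = rig_vertex S n s i"
    "rig_word S k (rig_vertex S n s j) w Y"
    using Cons.prems unfolding l rig_word_Cons[OF S] by blast+
  show ?case
    unfolding l list.map relabel_simp rig_word_Cons[OF S'] *(5) Rig_omap_vertex[OF *(1,2)]
    using Cons.IH[OF *(6)] *(2-4) psh_hom_cell[OF p *(1)] unfolding Rig_omap_vertex[OF *(1,3)] by blast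
qed simp

lemma path_step_relabel:
  assumes "path_step (elements simplex_cat S) C_diagram k v w"
  shows "path_step (elements simplex_cat S') C_diagram k (map (relabel p) v) (map (relabel p) w)"
  using assms
proof (induction rule: path_step.cases)
  case (1 v j x y a z b w)
  obtain n s where j: "j = (n, s)" by (cases j)
  show ?case
    using path_step.intros(1)[of "elements simplex_cat S'" C_diagram k "map (relabel p) v" "(n, p n s)" x y a z b "map (relabel p) w"]
    by (simp add: 1 j)
next
  case (2 v j x w)
  obtain n s where j: "j = (n, s)" by (cases j)
  show ?case
    using path_step.intros(2)[of "elements simplex_cat S'" C_diagram k "map (relabel p) v" "(n, p n s)" x "map (relabel p) w"]
    by (simp add: 2 j)
next
  case (3 u v x y a w)
  obtain m n f s where u: "u = ((m, act S (m, n, f) s), (m, n, f), (n, s))" using 3(3) by (rule elements_simplex_arrE)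
  have "far C_diagram ((m, p m (act S (m, n, f) s)), (m, n, f), (n, p n s)) = far C_diagram u"
    by (simp add: C_diagram_def fcompose_def elements_proj_def u)
  then show ?case
    using path_step.intros(3)[OF relabel_arr[OF 3(3)[unfolded u]], of C_diagram k "map (relabel p) v" x y a "map (relabel p) w"]
    by (simp add: 3 u)
qed

lemma Rig_ar_sel [simp]:
  "Src (Rig_ar (S, p, S')) = Rig_ob S" "Tgt (Rig_ar (S, p, S')) = Rig_ob S'" "Omap (Rig_ar (S, p, S')) = Rig_omap (S, p, S')"
  by (simp_all add: Rig_ar_def)

lemma Rig_ar_class:
  assumes "X \<in> Obj (Rig_ob S)" "Y \<in> Obj (Rig_ob S)" "rig_word S k X w Y"
  shows "Hmap (Rig_ar (S, p, S')) X Y k (rig_class S X Y k w)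
    = rig_class S' (Rig_omap (S, p, S') X) (Rig_omap (S, p, S') Y) k (map (relabel p) w)"
proof -
  let ?X = "Rig_omap (S, p, S') X" and ?Y = "Rig_omap (S, p, S') Y"
  have "path_rel (elements simplex_cat S') C_diagram ?X ?Y k `` (map (relabel p) ` (path_rel (elements simplex_cat S) C_diagram X Y k `` {w}))
     = path_rel (elements simplex_cat S') C_diagram ?X ?Y k `` {map (relabel p) w}"
    unfolding path_rel_def
    by (rule eqcl_saturate, rule eqcl_base) (auto intro: rig_word_relabel path_step_relabel)
  moreover have "rig_class S X Y k w \<in> cells (Hom (Rig_ob S) X Y) k" by (rule rig_class_cell[OF S assms(3)])
  ultimately show ?thesis
    using assms(1,2) by (simp add: Rig_ar_def relabel_def rig_class_def A.cl_def B.cl_def)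
qed

lemma Rig_omap_in: "X \<in> Obj (Rig_ob S) \<Longrightarrow> Rig_omap (S, p, S') X \<in> Obj (Rig_ob S')"
  by (elim Rig_ObjE[OF S]) (simp add: Rig_omap_vertex rig_vertex_in[OF S'] psh_hom_cell[OF p])

lemma Rig_ar_sfun: "is_sfun (Rig_ar (S, p, S'))"
  unfolding is_sfun_def Rig_ar_sel
proof (intro conjI ballI allI)
  show "Rig_omap (S, p, S') \<in> Obj (Rig_ob S) \<rightarrow>\<^sub>E Obj (Rig_ob S')"
    using Rig_omap_in by (intro PiE_I) (simp_all add: Rig_omap_def)
  have "Hmap (Rig_ar (S, p, S')) X Y \<in> psh_hom simplex_cat (Hom (Rig_ob S) X Y) (Hom (Rig_ob S') (Rig_omap (S, p, S') X) (Rig_omap (S, p, S') Y))"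
    if XY: "X \<in> Obj (Rig_ob S)" "Y \<in> Obj (Rig_ob S)" for X Y
  proof (rule psh_homI)
    fix k W assume "W \<in> cells (Hom (Rig_ob S) X Y) k"
    then obtain w where "rig_word S k X w Y" "W = rig_class S X Y k w" by (rule Rig_cellE[OF S])
    then show "Hmap (Rig_ar (S, p, S')) X Y k W \<in> cells (Hom (Rig_ob S') (Rig_omap (S, p, S') X) (Rig_omap (S, p, S') Y)) k"
      using Rig_ar_class[OF XY] rig_class_cell[OF S'] rig_word_relabel by metis
  next
    fix k W assume "W \<notin> cells (Hom (Rig_ob S) X Y) k"
    then show "Hmap (Rig_ar (S, p, S')) X Y k W = undefined" using XY by (simp add: Rig_ar_def)
  next
    fix u W assume u: "u \<in> Ar simplex_cat" and "W \<in> cells (Hom (Rig_ob S) X Y) (Cod simplex_cat u)"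
    then obtain w where w: "rig_word S (Cod simplex_cat u) X w Y" "W = rig_class S X Y (Cod simplex_cat u) w" by (elim Rig_cellE[OF S])
    have "map (relabel p) (map (A.lact u) w) = map (B.lact u) (map (relabel p) w)"
      using w(1) by (induction w arbitrary: X) (auto simp: A.lact_def B.lact_def)
    then show "Hmap (Rig_ar (S, p, S')) X Y (Dom simplex_cat u) (act (Hom (Rig_ob S) X Y) u W)
       = act (Hom (Rig_ob S') (Rig_omap (S, p, S') X) (Rig_omap (S, p, S') Y)) u (Hmap (Rig_ar (S, p, S')) X Y (Cod simplex_cat u) W)"
      unfolding w(2) Rig_act[OF S u] Rig_ar_class[OF XY w(1)] Rig_act[OF S' u] Rig_ar_class[OF XY A.path_lact[OF u w(1)]] by (simp only:)
  qed
  then show "Hmap (Rig_ar (S, p, S')) \<in> (\<Pi>\<^sub>E X\<in>Obj (Rig_ob S). \<Pi>\<^sub>E Y\<in>Obj (Rig_ob S). psh_hom simplex_cat (Hom (Rig_ob S) X Y)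
      (Hom (Rig_ob S') (Rig_omap (S, p, S') X) (Rig_omap (S, p, S') Y)))"
    by (intro PiE_I) (simp_all add: Rig_ar_def)
next
  fix X assume "X \<in> Obj (Rig_ob S)"
  then show "Hmap (Rig_ar (S, p, S')) X X 0 (Unit (Rig_ob S) X) = Unit (Rig_ob S') (Rig_omap (S, p, S') X)"
    using Rig_ar_class[of X X 0 "[]"] by (simp add: Rig_Unit[OF S] Rig_Unit[OF S'])
next
  fix X Y Z k V W assume XYZ: "X \<in> Obj (Rig_ob S)" "Y \<in> Obj (Rig_ob S)" "Z \<in> Obj (Rig_ob S)"
    and V: "V \<in> cells (Hom (Rig_ob S) X Y) k" and W: "W \<in> cells (Hom (Rig_ob S) Y Z) k"
  obtain v where v: "rig_word S k X v Y" "V = rig_class S X Y k v" using V by (rule Rig_cellE[OF S])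
  obtain w where w: "rig_word S k Y w Z" "W = rig_class S Y Z k w" using W by (rule Rig_cellE[OF S])
  have vw: "rig_word S k X (v @ w) Z" using v w rig_word_append[OF S] by blast
  show "Hmap (Rig_ar (S, p, S')) X Z k (Cmp (Rig_ob S) X Y Z k (V, W))
      = Cmp (Rig_ob S') (Rig_omap (S, p, S') X) (Rig_omap (S, p, S') Y) (Rig_omap (S, p, S') Z) k
          (Hmap (Rig_ar (S, p, S')) X Y k V, Hmap (Rig_ar (S, p, S')) Y Z k W)"
    unfolding v(2) w(2) Rig_Cmp[OF S v(1) w(1)] Rig_ar_class[OF XYZ(1,2) v(1)] Rig_ar_class[OF XYZ(2,3) w(1)]
      Rig_ar_class[OF XYZ(1,3) vw] Rig_Cmp[OF S' rig_word_relabel[OF v(1)] rig_word_relabel[OF w(1)]] map_append ..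
qed (rule Rig_scat S S')+

end

theorem Rig_functor: "is_functor (SSet :: ('a sset, (simp_arr, 'a) psh_arr) cat) SCat Rig"
proof -
  have i: "Rig_ar (S, psh_id S, S) = efun_id (Rig_ob S)" if S: "is_presheaf simplex_cat S" for S :: "'a sset"
  proof (rule sfun_eqI)
    note p = psh_id_hom[OF S]
    show "is_sfun (Rig_ar (S, psh_id S, S))" by (rule Rig_ar_sfun[OF S S p])
    show "is_sfun (efun_id (Rig_ob S))" by (rule efun_id_sfun[OF Rig_scat[OF S]])
    have o: "Rig_omap (S, psh_id S, S) X = X" if "X \<in> Obj (Rig_ob S)" for X
      using that by (rule Rig_ObjE[OF S]) (simp add: Rig_omap_vertex[OF S S p] psh_id_cell)
    show "Omap (Rig_ar (S, psh_id S, S)) X = Omap (efun_id (Rig_ob S)) X" if "X \<in> Obj (Src (Rig_ar (S, psh_id S, S)))" for X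
      using that o by (simp add: efun_id_def Rig_ar_def)
    fix X Y k W assume "X \<in> Obj (Src (Rig_ar (S, psh_id S, S)))" "Y \<in> Obj (Src (Rig_ar (S, psh_id S, S)))"
      and W: "W \<in> cells (Hom (Src (Rig_ar (S, psh_id S, S))) X Y) k"
    then have XY: "X \<in> Obj (Rig_ob S)" "Y \<in> Obj (Rig_ob S)" and W: "W \<in> cells (Hom (Rig_ob S) X Y) k"
      by (simp_all add: Rig_ar_def)
    obtain w where w: "rig_word S k X w Y" "W = rig_class S X Y k w" using W by (rule Rig_cellE[OF S])
    have "map (relabel (psh_id S)) w = w"
      using w(1)
    proof (induction w arbitrary: X)
      case (Cons l w)
      then show ?case by (cases l) (auto simp: rig_word_Cons[OF S] psh_id_cell)
    qed simp
    then have "Hmap (Rig_ar (S, psh_id S, S)) X Y k W = W"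
      unfolding w(2) Rig_ar_class[OF S S p XY w(1)] o[OF XY(1)] o[OF XY(2)] by simp
    then show "Hmap (Rig_ar (S, psh_id S, S)) X Y k W = Hmap (efun_id (Rig_ob S)) X Y k W"
      using XY W by (simp add: efun_id_def psh_id_def)
  qed (simp_all add: efun_id_def Rig_ar_def)
  have c: "Rig_ar (S, psh_comp S q p, S2) = efun_comp (Rig_ar (S1, q, S2)) (Rig_ar (S, p, S1))"
    if S: "is_presheaf simplex_cat S" and S1: "is_presheaf simplex_cat S1" and S2: "is_presheaf simplex_cat S2"
      and p: "p \<in> psh_hom simplex_cat S S1" and q: "q \<in> psh_hom simplex_cat S1 S2" for S S1 S2 :: "'a sset" and p q
  proof (rule sfun_eqI)
    note qp = psh_comp_hom[OF S p q]
    have sel: "Src (Rig_ar (S, p, S')) = Rig_ob S" "Tgt (Rig_ar (S, p, S')) = Rig_ob S'" "Omap (Rig_ar (S, p, S')) = Rig_omap (S, p, S')"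
      for S S' :: "'a sset" and p by (simp_all add: Rig_ar_def)
    have st: "Src (efun_comp (Rig_ar (S1, q, S2)) (Rig_ar (S, p, S1))) = Rig_ob S"
      "Tgt (efun_comp (Rig_ar (S1, q, S2)) (Rig_ar (S, p, S1))) = Rig_ob S2" by (simp_all add: efun_comp_def sel)
    show "is_sfun (Rig_ar (S, psh_comp S q p, S2))" by (rule Rig_ar_sfun[OF S S2 qp])
    show "is_sfun (efun_comp (Rig_ar (S1, q, S2)) (Rig_ar (S, p, S1)))"
      by (rule sfun_comp[OF Rig_ar_sfun[OF S S1 p] Rig_ar_sfun[OF S1 S2 q]]) (simp add: sel)
    show "Src (Rig_ar (S, psh_comp S q p, S2)) = Src (efun_comp (Rig_ar (S1, q, S2)) (Rig_ar (S, p, S1)))"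
      "Tgt (Rig_ar (S, psh_comp S q p, S2)) = Tgt (efun_comp (Rig_ar (S1, q, S2)) (Rig_ar (S, p, S1)))" by (simp_all add: st sel)
    have o: "Rig_omap (S, psh_comp S q p, S2) X = Rig_omap (S1, q, S2) (Rig_omap (S, p, S1) X)" if "X \<in> Obj (Rig_ob S)" for X
      using that by (rule Rig_ObjE[OF S])
        (simp add: Rig_omap_vertex[OF S S2 qp] Rig_omap_vertex[OF S S1 p] Rig_omap_vertex[OF S1 S2 q] psh_hom_cell[OF p] psh_comp_cell)
    show "Omap (Rig_ar (S, psh_comp S q p, S2)) X = Omap (efun_comp (Rig_ar (S1, q, S2)) (Rig_ar (S, p, S1))) X"
      if "X \<in> Obj (Src (Rig_ar (S, psh_comp S q p, S2)))" for X using that o by (simp add: efun_comp_def sel)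
    fix X Y k W assume "X \<in> Obj (Src (Rig_ar (S, psh_comp S q p, S2)))" "Y \<in> Obj (Src (Rig_ar (S, psh_comp S q p, S2)))"
      and "W \<in> cells (Hom (Src (Rig_ar (S, psh_comp S q p, S2))) X Y) k"
    then have XY: "X \<in> Obj (Rig_ob S)" "Y \<in> Obj (Rig_ob S)" and W: "W \<in> cells (Hom (Rig_ob S) X Y) k" by (simp_all add: sel)
    obtain w where w: "rig_word S k X w Y" "W = rig_class S X Y k w" using W by (rule Rig_cellE[OF S])
    have "map (relabel (psh_comp S q p)) w = map (relabel q) (map (relabel p) w)"
      using w(1)
    proof (induction w arbitrary: X)
      case (Cons l w)
      then show ?case by (cases l) (auto simp: rig_word_Cons[OF S] psh_comp_cell)
    qed simp
    moreover have "Hmap (efun_comp (Rig_ar (S1, q, S2)) (Rig_ar (S, p, S1))) X Y k W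
        = Hmap (Rig_ar (S1, q, S2)) (Rig_omap (S, p, S1) X) (Rig_omap (S, p, S1) Y) k (Hmap (Rig_ar (S, p, S1)) X Y k W)"
      using XY W by (simp add: efun_comp_def psh_comp_cell sel)
    ultimately show "Hmap (Rig_ar (S, psh_comp S q p, S2)) X Y k W = Hmap (efun_comp (Rig_ar (S1, q, S2)) (Rig_ar (S, p, S1))) X Y k W"
      using Rig_ar_class[OF S S2 qp XY w(1)] Rig_ar_class[OF S S1 p XY w(1)] o[OF XY(1)] o[OF XY(2)]
        Rig_ar_class[OF S1 S2 q Rig_omap_in[OF S S1 p XY(1)] Rig_omap_in[OF S S1 p XY(2)] rig_word_relabel[OF S S1 p w(1)]]
      by (simp only: w(2))
  qed
  show ?thesis
    unfolding is_functor_def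
  proof (intro conjI ballI impI)
    fix S :: "'a sset" assume "S \<in> Ob SSet"
    then show "fob Rig S \<in> Ob SCat" "far Rig (Idn SSet S) = Idn SCat (fob Rig S)"
      by (simp_all add: SSet_sel Rig_def SCat_def Rig_scat i)
  next
    fix f :: "(simp_arr, 'a) psh_arr" assume f: "f \<in> Ar SSet"
    obtain S p S' where fe: "f = (S, p, S')" by (cases f)
    show "far Rig f \<in> Ar SCat" "Dom SCat (far Rig f) = fob Rig (Dom SSet f)" "Cod SCat (far Rig f) = fob Rig (Cod SSet f)"
      using f Rig_ar_sfun[of S S' p] by (simp_all add: fe SSet_sel Rig_def SCat_def Rig_ar_def)
    fix g :: "(simp_arr, 'a) psh_arr" assume g: "g \<in> Ar SSet" "Dom SSet g = Cod SSet f"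
    obtain S1 q S2 where ge: "g = (S1, q, S2)" by (cases g)
    show "far Rig (Comp SSet g f) = Comp SCat (far Rig g) (far Rig f)"
      using f g c[of S S' S2 p q] by (simp add: fe ge SSet_sel Rig_def SCat_def)
  qed (rule psh_cat_category SCat_category)+
qed


section \<open>Simplices given by necklaces\<close>

abbreviation nec_chains :: "nat list \<Rightarrow> nat \<Rightarrow> (nat \<Rightarrow> nat set) set" where
  "nec_chains T k \<equiv> cells (nerve (P_ob T) (\<subseteq>)) k"

lemma phi_le_iff:
  assumes T: "T \<in> Ob Nec" and X: "X \<in> P_ob T" and Y: "Y \<in> P_ob T"
  shows "cube_le (phi T X) (phi T Y) \<longleftrightarrow> X \<subseteq> Y"
proof -
  have "cube_le (phi T X) (phi T Y) \<longleftrightarrow> (\<forall>y\<in>set (free_vertices T). y \<in> X \<longrightarrow> y \<in> Y)"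
    unfolding phi_eq[OF T] by (simp add: list_all2_map1 list_all2_map2 list.rel_refl_strong list_all2_same)
  also have "\<dots> \<longleftrightarrow> X \<subseteq> Y" using X Y P_ob_iff[OF T] by auto
  finally show ?thesis .
qed

definition unphi :: "nat list \<Rightarrow> bool list \<Rightarrow> nat set" where
  "unphi T = inv_into (P_ob T) (phi T)"

lemma unphi:
  assumes T: "T \<in> Ob Nec"
  shows "s \<in> cube (nec_dim T) \<Longrightarrow> unphi T s \<in> P_ob T" "s \<in> cube (nec_dim T) \<Longrightarrow> phi T (unphi T s) = s"
    "X \<in> P_ob T \<Longrightarrow> unphi T (phi T X) = X"
proof -
  have "phi T ` P_ob T = cube (nec_dim T)"
    using phi_surj[OF T] phi_cube[OF T] by (auto simp: image_iff)
  moreover have "inj_on (phi T) (P_ob T)" using phi_inj[OF T] by (auto simp: inj_on_def)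
  ultimately show "s \<in> cube (nec_dim T) \<Longrightarrow> unphi T s \<in> P_ob T" "s \<in> cube (nec_dim T) \<Longrightarrow> phi T (unphi T s) = s"
    "X \<in> P_ob T \<Longrightarrow> unphi T (phi T X) = X"
    unfolding unphi_def by (metis inv_into_into, metis f_inv_into_f, metis inv_into_f_f)
qed

lemma phi_chain:
  assumes "T \<in> Ob Nec" "C \<in> nec_chains T k"
  shows "(\<lambda>t\<in>{..k}. phi T (C t)) \<in> cube_chains (nec_dim T) k"
  using assms phi_cube[OF assms(1)] by (simp add: nerve_cell_iff phi_le_iff)

lemma unphi_chain:
  assumes T: "T \<in> Ob Nec" and c: "c \<in> cube_chains (nec_dim T) k"
  shows "(\<lambda>t\<in>{..k}. unphi T (c t)) \<in> nec_chains T k"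
    "(\<lambda>t\<in>{..k}. phi T ((\<lambda>t\<in>{..k}. unphi T (c t)) t)) = c"
proof -
  have "c t \<in> cube (nec_dim T)" if "t \<le> k" for t using c that by (simp add: nerve_cell_iff)
  note u = unphi(1,2)[OF T this]
  show "(\<lambda>t\<in>{..k}. unphi T (c t)) \<in> nec_chains T k"
    using c u by (auto simp: nerve_cell_iff phi_le_iff[OF T, symmetric])
  show "(\<lambda>t\<in>{..k}. phi T ((\<lambda>t\<in>{..k}. unphi T (c t)) t)) = c"
    using c u by (auto simp: nerve_cell_iff extensional_def fun_eq_iff)
qed

lemma nec_chain_map:
  assumes "T \<in> Ob Nec" "U \<in> Ob Nec" "nec_vertex_map T U g" "C \<in> nec_chains T k"
  shows "(\<lambda>t\<in>{..k}. g ` C t) \<in> nec_chains U k"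
  using assms(4) nec_vertex_map_P_ob[OF assms(1-3)] by (auto simp: nerve_cell_iff) blast

lemma nec_chain_append:
  assumes "T \<in> Ob Nec" "U \<in> Ob Nec" "C \<in> nec_chains T k" "D \<in> nec_chains U k"
  shows "(\<lambda>t\<in>{..k}. C t \<union> (+) (sum_list T) ` D t) \<in> nec_chains (T @ U) k"
proof -
  have "C s \<union> (+) (sum_list T) ` D s \<subseteq> C t \<union> (+) (sum_list T) ` D t" if "s \<le> t" "t \<le> k" for s t
    using assms(3,4) that by (intro Un_mono image_mono) (simp_all add: nerve_cell_iff)
  then show ?thesis using assms(3,4) P_ob_append[OF assms(1,2)] by (simp add: nerve_cell_iff)
qed

text \<open>The simplex of the triangulated mapping space given by a necklace \<open>f\<close> over \<open>S\<close> and a chain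
  \<open>C\<close> in the poset \<open>P(T)\<close>.  The next lemmas say that the triangulated mapping spaces are the
  colimits over all necklaces of the nerves of the \<open>P(T)\<close>, and that composition is the
  wedge of necklaces.  From here on, subsets of vertices take the place of cubes.\<close>

definition nec_simplex ::
  "'a sset \<Rightarrow> 'a \<Rightarrow> 'a \<Rightarrow> nat \<Rightarrow> nat list \<Rightarrow> (nat \<Rightarrow> (nat \<Rightarrow> nat) \<Rightarrow> 'a) \<Rightarrow> (nat \<Rightarrow> nat set) \<Rightarrow> 'a rig_cube tri_cell"
where
  "nec_simplex S x y k T f C = tri_simplex (rig_hom S x y) k (nec_dim T)
     (rig_cube S x y (nec_dim T) T f (box_id (nec_dim T))) (\<lambda>t\<in>{..k}. phi T (C t))"

lemma nec_simplex_cell: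
  assumes "nec_between S x y T f" "C \<in> nec_chains T k"
  shows "nec_simplex S x y k T f C \<in> cells (tri (rig_hom S x y)) k"
  unfolding nec_simplex_def
  by (rule tri_simplex_cell[OF rig_presheaf rig_cube_cell[OF assms(1) box_id_hom] phi_chain[OF nec_betweenD(1)[OF assms(1)] assms(2)]])

lemma rig_cube_act_id:
  assumes "nec_between S x y T f" "u \<in> box_hom n (nec_dim T)"
  shows "act (rig_hom S x y) u (rig_cube S x y (nec_dim T) T f (box_id (nec_dim T))) = rig_cube S x y n T f u"
  using rig_cube_act[OF assms(2,1)] box_hom_comp_id(2)[OF assms(2)] by simp

lemma tri_rig_simplex:
  assumes T: "nec_between S x y T f" and u: "(n, nec_dim T, h) \<in> box_arrows" and c: "c \<in> cube_chains n k"
  shows "tri_simplex (rig_hom S x y) k n (rig_cube S x y n T f (n, nec_dim T, h)) c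
    = tri_simplex (rig_hom S x y) k (nec_dim T) (rig_cube S x y (nec_dim T) T f (box_id (nec_dim T))) (\<lambda>i\<in>{..k}. h (c i))"
  using tri_simplex_shift[OF u rig_cube_cell[OF T box_id_hom] c] rig_cube_act_id[OF T, of "(n, nec_dim T, h)" n] u by simp

text \<open>A chain in \<open>\<one>\<^sup>n\<close> can be pushed forward along \<open>u : \<one>\<^sup>n \<rightarrow> P\<^sub>\<one>(T)\<close>, so the identity cube of \<open>C(T)\<close> is enough.\<close>

lemma nec_simplexE:
  assumes "X \<in> cells (tri (rig_hom S x y)) k"
  obtains T f C where "nec_between S x y T f" "C \<in> nec_chains T k" "X = nec_simplex S x y k T f C"
proof -
  obtain n a c where a: "a \<in> cells (rig_hom S x y) n" and c: "c \<in> cube_chains n k" and X: "X = tri_simplex (rig_hom S x y) k n a c"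
    using assms by (rule tri_cellE)
  obtain T f u where T: "nec_between S x y T f" and u: "u \<in> box_hom n (nec_dim T)" and a: "a = rig_cube S x y n T f u"
    using a by (rule rig_cellE)
  obtain h where h: "u = (n, nec_dim T, h)" "(n, nec_dim T, h) \<in> box_arrows" using u by (rule box_homE)
  note t = nec_betweenD(1)[OF T]
  have X': "X = tri_simplex (rig_hom S x y) k (nec_dim T) (rig_cube S x y (nec_dim T) T f (box_id (nec_dim T))) (\<lambda>i\<in>{..k}. h (c i))"
    unfolding X a h(1) by (rule tri_rig_simplex[OF T h(2) c])
  note c' = unphi_chain[OF t cube_chain_map[OF h(2) c]]
  show thesis by (rule that[OF T c'(1)]) (simp only: X' nec_simplex_def c'(2))
qed

lemma nec_simplex_shift:
  assumes U: "nec_between S x y U h" and T: "T \<in> Ob Nec" and g: "nec_vertex_map T U g" and C: "C \<in> nec_chains T k"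
  shows "nec_simplex S x y k T (psh_comp (necklace T) h (nec_map T g)) C = nec_simplex S x y k U h (\<lambda>t\<in>{..k}. g ` C t)"
proof -
  note u = nec_betweenD(1)[OF U]
  define \<phi> where "\<phi> = (\<lambda>s\<in>cube (nec_dim T). phi U (vertex_map (nec_map T g) ` inv_into (P_ob T) (phi T) s))"
  have P: "far P1 (T, nec_map T g, U) = (nec_dim T, nec_dim U, \<phi>)" unfolding \<phi>_def by (rule P1_sel[OF T u])
  have Pa: "(nec_dim T, nec_dim U, \<phi>) \<in> box_arrows" using P1_arrow[OF T u g] by (simp add: P)
  have "rig_cube S x y (nec_dim T) T (psh_comp (necklace T) h (nec_map T g)) (box_id (nec_dim T))
      = rig_cube S x y (nec_dim T) U h (nec_dim T, nec_dim U, \<phi>)"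
    using rig_cube_shift[OF U T g box_id_hom] box_comp_id(1)[OF Pa] by (simp add: P del: box_comp_simp)
  moreover have "(\<lambda>t\<in>{..k}. \<phi> ((\<lambda>t\<in>{..k}. phi T (C t)) t)) = (\<lambda>t\<in>{..k}. phi U ((\<lambda>t\<in>{..k}. g ` C t) t))"
  proof (rule restrict_ext)
    fix t assume "t \<in> {..k}"
    moreover then have "C t \<in> P_ob T" using C by (simp add: nerve_cell_iff)
    ultimately show "\<phi> ((\<lambda>t\<in>{..k}. phi T (C t)) t) = phi U ((\<lambda>t\<in>{..k}. g ` C t) t)"
      using P1_phi[OF T, of "C t" U g] phi_cube[OF T, of "C t"] by (simp add: \<phi>_def)
  qed
  ultimately show ?thesis
    using tri_rig_simplex[OF U Pa phi_chain[OF T C]] by (simp add: nec_simplex_def)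
qed

lemma nec_simplex_act:
  assumes "u \<in> Ar simplex_cat"
  shows "act (tri (rig_hom S x y)) u (nec_simplex S x y (Cod simplex_cat u) T f C)
    = nec_simplex S x y (Dom simplex_cat u) T f (act (nerve (P_ob T) (\<subseteq>)) u C)"
proof -
  obtain m n h where u: "u = (m, n, h)" by (cases u)
  have "(\<lambda>i\<in>{..m}. (\<lambda>t\<in>{..n}. phi T (C t)) (h i)) = (\<lambda>t\<in>{..m}. phi T ((\<lambda>i\<in>{..m}. C (h i)) t))"
    by (rule restrict_ext) (use assms u in auto)
  then show ?thesis
    unfolding nec_simplex_def tri_simplex_act[OF rig_presheaf assms] by (simp only: u act_nerve simplex_cat_sel)
qed

lemma nec_simplex_Cmp:
  assumes S: "is_presheaf simplex_cat S" and x: "x \<in> cells S 0" and y: "y \<in> cells S 0" and z: "z \<in> cells S 0"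
    and T: "nec_between S x y T f" "C \<in> nec_chains T k" and U: "nec_between S y z U g" "D \<in> nec_chains U k"
  shows "Cmp (T_ob (Cbox_ob S)) x y z k (nec_simplex S x y k T f C, nec_simplex S y z k U g D)
    = nec_simplex S x z k (T @ U) (glue T U f g) (\<lambda>t\<in>{..k}. C t \<union> (+) (sum_list T) ` D t)"
proof -
  note t = nec_betweenD(1)[OF T(1)] and u = nec_betweenD(1)[OF U(1)]
  note a = rig_cube_cell[OF T(1) box_id_hom] and b = rig_cube_cell[OF U(1) box_id_hom]
  have "(\<lambda>i\<in>{..k}. (\<lambda>t\<in>{..k}. phi T (C t)) i @ (\<lambda>t\<in>{..k}. phi U (D t)) i)
      = (\<lambda>i\<in>{..k}. phi (T @ U) ((\<lambda>t\<in>{..k}. C t \<union> (+) (sum_list T) ` D t) i))"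
    using T(2) U(2) phi_append[OF t u] by (intro restrict_ext) (simp add: nerve_cell_iff)
  then show ?thesis
    using T_ob_Cmp[OF Cbox_ob_ccat[OF S], of x y z, unfolded Cbox_ob_sel, OF x y z a phi_chain[OF t T(2)] b phi_chain[OF u U(2)]]
    unfolding nec_simplex_def Cbox_cube_cmp[OF a b] rig_comp_cube[OF T(1) box_id_hom U(1) box_id_hom] box_plus_id nec_dim_append
    by simp
qed

lemma phi_Nil: "phi [] X = []" "nec_dim [] = 0"
  by (simp_all add: phi_eq Nec_Ob nec_dim_def free_vertices_def joints_Nil)

lemma nec_simplex_unit:
  assumes S: "is_presheaf simplex_cat S" and x: "x \<in> cells S 0"
  shows "unit_simplex (T_ob (Cbox_ob S)) x k = nec_simplex S x x k [] (const_nec S x) (\<lambda>t\<in>{..k}. {0})"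
  using T_ob_unit_simplex[OF Cbox_ob_ccat[OF S], of x k] x by (simp add: nec_simplex_def phi_Nil cong: restrict_cong)

lemma Nil_chain: "(\<lambda>t\<in>{..k}. {0}) \<in> nec_chains [] k"
  by (simp add: nerve_cell_iff P_ob_iff Nec_Ob joints_Nil)

text \<open>A simplex is a class of pairs of a cube and a chain, and the cube is itself a class.
  Accordingly \<open>F\<close> is first extended to the cubes of \<open>rig_hom S x y\<close> with a fixed chain, and then to
  the simplices of the triangulation.\<close>

lemma nec_simplex_invariant:
  assumes eq: "nec_simplex S x y k T f C = nec_simplex S x y k T' f' C'"
    and T: "nec_between S x y T f" "C \<in> nec_chains T k" and T': "nec_between S x y T' f'" "C' \<in> nec_chains T' k"
    and F: "\<And>T U g h C. nec_between S x y U h \<Longrightarrow> T \<in> Ob Nec \<Longrightarrow> nec_vertex_map T U g \<Longrightarrow> C \<in> nec_chains T k \<Longrightarrow>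
      F T (psh_comp (necklace T) h (nec_map T g)) C = F U h (\<lambda>t\<in>{..k}. g ` C t)"
  shows "F T f C = F T' f' C'"
proof -
  define G where "G c T f u = F T f (\<lambda>t\<in>{..k}. unphi T (snd (snd u) (c t)))" for c T f and u :: box_arr
  define F1 where "F1 a c = quot_lift (\<lambda>((T, f), u). G c T f u) a" for a c
  have F1: "F1 (rig_cube S x y n T f u) c = G c T f u" if c: "c \<in> cube_chains n k" for n T f u c
    unfolding F1_def
  proof (rule rig_cube_quot_lift)
    fix T U g h u assume U: "nec_between S x y U h" and T: "T \<in> Ob Nec" and g: "nec_vertex_map T U g" and u: "u \<in> box_hom n (nec_dim T)"
    obtain w where w: "u = (n, nec_dim T, w)" "(n, nec_dim T, w) \<in> box_arrows" using u by (rule box_homE)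
    note u' = nec_betweenD(1)[OF U]
    define \<phi> where "\<phi> = (\<lambda>s\<in>cube (nec_dim T). phi U (vertex_map (nec_map T g) ` inv_into (P_ob T) (phi T) s))"
    have P: "far P1 (T, nec_map T g, U) = (nec_dim T, nec_dim U, \<phi>)" unfolding \<phi>_def by (rule P1_sel[OF T u'])
    have ct: "c t \<in> cube n" if "t \<le> k" for t using c that by (simp add: nerve_cell_iff)
    have e: "g ` unphi T (w (c t)) = unphi U (\<phi> (w (c t)))" if t: "t \<le> k" for t
    proof -
      have s: "w (c t) \<in> cube (nec_dim T)" using box_arrow_in[OF w(2) ct[OF t]] .
      have "\<phi> (w (c t)) = phi U (g ` unphi T (w (c t)))"
        using P1_phi[OF T unphi(1)[OF T s], of U g] s by (simp add: \<phi>_def unphi(2)[OF T s])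
      then show ?thesis using unphi(3)[OF u' nec_vertex_map_P_ob[OF T u' g unphi(1)[OF T s]]] by simp
    qed
    have "(\<lambda>t\<in>{..k}. unphi T (w (c t))) \<in> nec_chains T k"
      using unphi_chain(1)[OF T cube_chain_map[OF w(2) c]] by (simp cong: restrict_cong)
    from F[OF U T g this]
    have "G c T (psh_comp (necklace T) h (nec_map T g)) u = F U h (\<lambda>t\<in>{..k}. g ` (\<lambda>t\<in>{..k}. unphi T (w (c t))) t)"
      by (simp add: G_def w)
    also have "(\<lambda>t\<in>{..k}. g ` (\<lambda>t\<in>{..k}. unphi T (w (c t))) t)
        = (\<lambda>t\<in>{..k}. unphi U (snd (snd (box_comp (far P1 (T, nec_map T g, U)) u)) (c t)))"
      using e ct by (intro restrict_ext) (simp add: P w)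
    finally show "G c T (psh_comp (necklace T) h (nec_map T g)) u = G c U h (box_comp (far P1 (T, nec_map T g, U)) u)"
      by (simp only: G_def)
  qed
  have F1_nec: "F1 (rig_cube S x y (nec_dim T) T f (box_id (nec_dim T))) (\<lambda>t\<in>{..k}. phi T (C t)) = F T f C"
    if T: "nec_between S x y T f" and C: "C \<in> nec_chains T k" for T f C
  proof -
    note t = nec_betweenD(1)[OF T]
    have "(\<lambda>s\<in>{..k}. unphi T ((\<lambda>s\<in>cube (nec_dim T). s) ((\<lambda>t\<in>{..k}. phi T (C t)) s))) = (\<lambda>s\<in>{..k}. C s)"
      using C unphi(3)[OF t] phi_cube[OF t] by (intro restrict_ext) (simp add: nerve_cell_iff)
    also have "\<dots> = C" using C by (simp add: nerve_cell_iff extensional_restrict)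
    finally show ?thesis unfolding F1[OF phi_chain[OF t C]] by (simp add: G_def box_id_def)
  qed
  have "(\<lambda>n. F1) (nec_dim T) (rig_cube S x y (nec_dim T) T f (box_id (nec_dim T))) (\<lambda>t\<in>{..k}. phi T (C t))
      = (\<lambda>n. F1) (nec_dim T') (rig_cube S x y (nec_dim T') T' f' (box_id (nec_dim T'))) (\<lambda>t\<in>{..k}. phi T' (C' t))"
  proof (rule tri_simplex_invariant[OF eq[unfolded nec_simplex_def]])
    fix m n w a c assume w: "(m, n, w) \<in> box_arrows" and a: "a \<in> cells (rig_hom S x y) n" and c: "c \<in> cube_chains m k"
    obtain T f u where T: "nec_between S x y T f" "u \<in> box_hom n (nec_dim T)" "a = rig_cube S x y n T f u" using a by (rule rig_cellE)
    obtain v where v: "u = (n, nec_dim T, v)" "(n, nec_dim T, v) \<in> box_arrows" using T(2) by (rule box_homE)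
    have ct: "c t \<in> cube m" if "t \<le> k" for t using c that by (simp add: nerve_cell_iff)
    have "act (rig_hom S x y) (m, n, w) a = rig_cube S x y m T f (box_comp u (m, n, w))"
      unfolding T(3) by (rule rig_cube_act[OF _ T(1)]) (use w in simp)
    then have "F1 (act (rig_hom S x y) (m, n, w) a) c = G c T f (box_comp u (m, n, w))" using F1[OF c] by simp
    also have "\<dots> = G (\<lambda>i\<in>{..k}. w (c i)) T f u" using ct by (simp add: G_def v cong: restrict_cong)
    also have "\<dots> = F1 a (\<lambda>i\<in>{..k}. w (c i))" unfolding T(3) using F1[OF cube_chain_map[OF w c]] by simp
    finally show "F1 (act (rig_hom S x y) (m, n, w) a) c = F1 a (\<lambda>i\<in>{..k}. w (c i))" .
  qed
  then show ?thesis using F1_nec[OF T] F1_nec[OF T'] by simp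
qed

lemma nec_simplex_map:
  assumes S: "is_presheaf simplex_cat S" and S': "is_presheaf simplex_cat S'" and p: "p \<in> psh_hom simplex_cat S S'"
    and xy: "x \<in> cells S 0" "y \<in> cells S 0" and T: "nec_between S x y T f" "C \<in> nec_chains T k"
  shows "Hmap (T_ar (Cbox_ar (S, p, S'))) x y k (nec_simplex S x y k T f C)
    = nec_simplex S' (p 0 x) (p 0 y) k T (psh_comp (necklace T) p f) C"
  unfolding nec_simplex_def
  using T_ar_Hmap[OF Cbox_ar_cfun[OF S S' p], unfolded Cbox_ar_sel Cbox_ob_sel, OF xy rig_cube_cell[OF T(1) box_id_hom]
      phi_chain[OF nec_betweenD(1)[OF T(1)] T(2)]] Cbox_ar_cube[OF S S' p xy T(1) box_id_hom] by simp


section \<open>The comparison functor\<close>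

text \<open>The standard simplex of dimension \<open>n\<close> as a necklace in preferred form.\<close>

definition bead :: "nat \<Rightarrow> nat list" where
  "bead n = (if n = 0 then [] else [n])"

lemma bead_simps [simp]: "bead n \<in> Ob Nec" "sum_list (bead n) = n" "joints (bead n) = {0, n}"
  by (simp_all add: bead_def Nec_Ob joints_bead joints_Nil)

definition vertex :: "'a sset \<Rightarrow> nat \<Rightarrow> 'a \<Rightarrow> nat \<Rightarrow> 'a" where
  "vertex S n s i = act S (0, n, \<lambda>t\<in>{..0}. i) s"

text \<open>The restriction of a simplex \<open>s\<close> to the necklace inside \<open>\<Delta>\<^sup>n\<close> that starts at the vertex \<open>i\<close>.\<close>

definition simplex_nec :: "'a sset \<Rightarrow> nat \<Rightarrow> 'a \<Rightarrow> nat \<Rightarrow> nat list \<Rightarrow> nat \<Rightarrow> (nat \<Rightarrow> nat) \<Rightarrow> 'a" where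
  "simplex_nec S n s i T = (\<lambda>m. \<lambda>c\<in>cells (necklace T) m. act S (m, n, \<lambda>t\<in>{..m}. i + c t) s)"

lemma simplex_nec_arr:
  assumes "i + sum_list T \<le> n" "c \<in> cells (necklace T) m"
  shows "(m, n, \<lambda>t\<in>{..m}. i + c t) \<in> Ar simplex_cat"
proof -
  have "i + c t \<le> n" if "t \<le> m" for t using necklace_cell_le[OF assms(2) that] assms(1) by simp
  then show ?thesis using necklace_cell_mono[OF assms(2)] by (auto simp: mono_on_def)
qed

lemma act_Comp:
  assumes "is_presheaf simplex_cat S" "(l, m, g) \<in> Ar simplex_cat" "(m, n, f) \<in> Ar simplex_cat" "s \<in> cells S n"
  shows "act S (l, m, g) (act S (m, n, f) s) = act S (l, n, \<lambda>i\<in>{..l}. f (g i)) s"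
proof -
  have "act S (Comp simplex_cat (m, n, f) (l, m, g)) s = act S (l, m, g) (act S (m, n, f) s)"
    using assms unfolding is_presheaf_def by (simp del: simplex_cat_sel(4))
  then show ?thesis by (simp add: simplex_cat_def)
qed

definition unshift :: "nat \<Rightarrow> nat \<Rightarrow> (nat \<Rightarrow> nat set) \<Rightarrow> nat \<Rightarrow> nat set" where
  "unshift i k c = (\<lambda>t\<in>{..k}. {v. i + v \<in> c t})"

lemma path_chain_le:
  assumes "c \<in> path_chains i j k" shows "i \<le> j"
proof -
  have "c 0 \<in> path_poset i j" using assms by (simp add: path_nerve_cell)
  then show ?thesis by (simp add: path_poset_def split: if_splits)
qed

lemma path_chain_mem:
  assumes "c \<in> path_chains i j k" "t \<le> k" shows "i \<in> c t" "j \<in> c t" "c t \<subseteq> {i..j}"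
proof -
  have "c t \<in> path_poset i j" using assms by (simp add: path_nerve_cell)
  then show "i \<in> c t" "j \<in> c t" "c t \<subseteq> {i..j}" by (simp_all add: path_poset_def split: if_splits)
qed

lemma path_chainI:
  assumes "c \<in> extensional {..k}" "\<And>t. t \<le> k \<Longrightarrow> i \<in> c t \<and> j \<in> c t \<and> c t \<subseteq> {i..j}"
    "\<And>s t. s \<le> t \<Longrightarrow> t \<le> k \<Longrightarrow> c s \<subseteq> c t"
  shows "c \<in> path_chains i j k"
proof -
  have "i \<le> j" using assms(2)[of 0] by auto
  then show ?thesis using assms unfolding path_nerve_cell by (simp add: path_poset_def)
qed

lemma unshift_chain:
  assumes c: "c \<in> path_chains i j k" shows "unshift i k c \<in> nec_chains (bead (j - i)) k"
proof -
  have "0 \<in> {v. i + v \<in> c t}" "j - i \<in> {v. i + v \<in> c t}" "{v. i + v \<in> c t} \<subseteq> {..j - i}" if "t \<le> k" for t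
    using path_chain_mem[OF c that] path_chain_le[OF c] by auto
  moreover have "c s \<subseteq> c t" if "s \<le> t" "t \<le> k" for s t using c that unfolding path_nerve_cell by blast
  ultimately show ?thesis by (auto simp: nerve_cell_iff unshift_def P_ob_iff subset_iff)
qed

context
  fixes S :: "'a sset"
  assumes S: "is_presheaf simplex_cat S"
begin

lemma act_simplex_cell: "(m, n, f) \<in> Ar simplex_cat \<Longrightarrow> s \<in> cells S n \<Longrightarrow> act S (m, n, f) s \<in> cells S m"
  using psh_act_cells[OF S, of "(m, n, f)" s] by simp

lemma vertex_cell: "s \<in> cells S n \<Longrightarrow> i \<le> n \<Longrightarrow> vertex S n s i \<in> cells S 0"
  unfolding vertex_def by (rule act_simplex_cell[OF vertex_incl_arr])

lemma vertex_act:
  assumes "(m, n, f) \<in> Ar simplex_cat" "s \<in> cells S n" "i \<le> m"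
  shows "vertex S m (act S (m, n, f) s) i = vertex S n s (f i)"
  unfolding vertex_def act_Comp[OF S vertex_incl_arr[OF assms(3)] assms(1,2)]
  by (rule arg_cong[of _ _ "\<lambda>h. act S (0, n, h) s"]) (rule restrict_ext, simp)

lemma vertex_0: "x \<in> cells S 0 \<Longrightarrow> vertex S 0 x 0 = x"
proof -
  assume "x \<in> cells S 0"
  moreover have "(0, 0, \<lambda>i\<in>{..0}. 0) = Idn simplex_cat 0" by (auto simp: simplex_cat_def fun_eq_iff)
  ultimately show ?thesis using S by (simp add: is_presheaf_def vertex_def)
qed

lemma simplex_nec_hom:
  assumes s: "s \<in> cells S n" and i: "i + sum_list T \<le> n"
  shows "simplex_nec S n s i T \<in> psh_hom simplex_cat (necklace T) S"
proof (rule psh_homI)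
  fix m c assume "c \<in> cells (necklace T) m"
  then show "simplex_nec S n s i T m c \<in> cells S m"
    using act_simplex_cell[OF simplex_nec_arr[OF i] s] by (simp add: simplex_nec_def)
next
  fix u c assume u: "u \<in> Ar simplex_cat" and c: "c \<in> cells (necklace T) (Cod simplex_cat u)"
  obtain l m h where uh: "u = (l, m, h)" by (cases u)
  have c: "c \<in> cells (necklace T) m" using c uh by simp
  have c': "(\<lambda>t\<in>{..l}. c (h t)) \<in> cells (necklace T) l" using necklace_act_cell[OF c] u uh by simp
  have "(\<lambda>t\<in>{..l}. (\<lambda>t\<in>{..m}. i + c t) (h t)) = (\<lambda>t\<in>{..l}. i + (\<lambda>t\<in>{..l}. c (h t)) t)"
    by (rule restrict_ext) (use u uh in auto)
  then show "simplex_nec S n s i T (Dom simplex_cat u) (act (necklace T) u c) = act S u (simplex_nec S n s i T (Cod simplex_cat u) c)"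
    using act_Comp[OF S _ simplex_nec_arr[OF i c] s, of l h] u c c' by (simp add: uh act_necklace simplex_nec_def)
qed (simp add: simplex_nec_def)

lemma simplex_nec_vtx:
  assumes "T \<in> Ob Nec" "v \<le> sum_list T" shows "simplex_nec S n s i T 0 (vtx v) = vertex S n s (i + v)"
proof -
  have "(\<lambda>t\<in>{..0}. i + vtx v t) = (\<lambda>t\<in>{..0}. i + v)" by (rule restrict_ext) (simp add: vtx_def)
  then show ?thesis using vtx_cell[OF assms] by (simp add: simplex_nec_def vertex_def del: atMost_0)
qed

lemma simplex_nec_between:
  assumes "s \<in> cells S n" "i + sum_list T \<le> n" "T \<in> Ob Nec"
  shows "nec_between S (vertex S n s i) (vertex S n s (i + sum_list T)) T (simplex_nec S n s i T)"
  using simplex_nec_hom[OF assms(1,2)] assms(3) by (simp add: nec_between_def simplex_nec_vtx)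

lemma simplex_nec_glue:
  assumes s: "s \<in> cells S n" and i: "i + sum_list T + sum_list U \<le> n" and T: "T \<in> Ob Nec" and U: "U \<in> Ob Nec"
  shows "glue T U (simplex_nec S n s i T) (simplex_nec S n s (i + sum_list T) U) = simplex_nec S n s i (T @ U)"
proof (rule glue_unique[OF T U, symmetric])
  show "simplex_nec S n s i T \<in> psh_hom simplex_cat (necklace T) S" by (rule simplex_nec_hom[OF s]) (use i in simp)
  show "simplex_nec S n s (i + sum_list T) U \<in> psh_hom simplex_cat (necklace U) S" by (rule simplex_nec_hom[OF s]) (use i in simp)
  show "simplex_nec S n s i (T @ U) \<in> psh_hom simplex_cat (necklace (T @ U)) S" by (rule simplex_nec_hom[OF s]) (use i in simp)
  show "simplex_nec S n s i T 0 (vtx (sum_list T)) = simplex_nec S n s (i + sum_list T) U 0 (vtx 0)"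
    by (simp add: simplex_nec_vtx T U)
  show "simplex_nec S n s i (T @ U) m c = simplex_nec S n s i T m c" if "c \<in> cells (necklace T) m" for m c
    using that necklace_append_left[OF T U, of m] by (auto simp: simplex_nec_def)
  show "simplex_nec S n s i (T @ U) m (\<lambda>t\<in>{..m}. sum_list T + d t) = simplex_nec S n s (i + sum_list T) U m d"
    if "d \<in> cells (necklace U) m" for m d
    using that necklace_append_right[OF T U that] by (simp add: simplex_nec_def add.assoc cong: restrict_cong)
qed

lemma simplex_nec_pull:
  assumes s: "s \<in> cells S n" and f: "(m, n, f) \<in> Ar simplex_cat" and i: "i + sum_list T \<le> m"
    and T: "T \<in> Ob Nec" and U: "U \<in> Ob Nec" and g: "nec_vertex_map T U g"
    and fg: "\<And>v. v \<le> sum_list T \<Longrightarrow> f (i + v) = f i + g v"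
  shows "psh_comp (necklace T) (simplex_nec S n s (f i) U) (nec_map T g) = simplex_nec S m (act S (m, n, f) s) i T"
proof -
  have "psh_comp (necklace T) (simplex_nec S n s (f i) U) (nec_map T g) l c = simplex_nec S m (act S (m, n, f) s) i T l c"
    if c: "c \<in> cells (necklace T) l" for l c
  proof -
    have "(\<lambda>t\<in>{..l}. f i + (\<lambda>t\<in>{..l}. g (c t)) t) = (\<lambda>t\<in>{..l}. f ((\<lambda>t\<in>{..l}. i + c t) t))"
      using fg[OF necklace_cell_le[OF c]] by (intro restrict_ext) simp
    then show ?thesis
      using c nec_map_cell[OF T U g c] act_Comp[OF S simplex_nec_arr[OF i c] f s]
      by (simp add: psh_comp_cell nec_map_simp simplex_nec_def)
  qed
  then show ?thesis by (auto simp: psh_comp_def simplex_nec_def fun_eq_iff)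
qed

text \<open>The image of a letter: the bead spanned by the vertices \<open>i, \<dots>, j\<close> of the simplex \<open>s\<close>.\<close>

definition letter_simplex :: "nat \<Rightarrow> nat \<Rightarrow> 'a \<Rightarrow> nat \<Rightarrow> nat \<Rightarrow> (nat \<Rightarrow> nat set) \<Rightarrow> 'a rig_cube tri_cell" where
  "letter_simplex k n s i j c = nec_simplex S (vertex S n s i) (vertex S n s j) k (bead (j - i))
     (simplex_nec S n s i (bead (j - i))) (unshift i k c)"

lemma bead_between:
  assumes "s \<in> cells S n" "i \<le> j" "j \<le> n"
  shows "nec_between S (vertex S n s i) (vertex S n s j) (bead (j - i)) (simplex_nec S n s i (bead (j - i)))"
  using simplex_nec_between[of s n i "bead (j - i)"] assms by simp

text \<open>The composite is given by the wedge of two beads.  The inclusion of this wedge into the single bead on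
  the vertices \<open>i, \<dots>, l\<close> is the identity on vertices, hence leaves the chain unchanged.\<close>

lemma letter_simplex_Cmp:
  assumes s: "s \<in> cells S n" and l: "l \<le> n" and c: "c \<in> path_chains i j k" and d: "d \<in> path_chains j l k"
  shows "Cmp (T_ob (Cbox_ob S)) (vertex S n s i) (vertex S n s j) (vertex S n s l) k (letter_simplex k n s i j c, letter_simplex k n s j l d)
    = letter_simplex k n s i l (\<lambda>t\<in>{..k}. c t \<union> d t)"
proof -
  have ijl: "i \<le> j" "j \<le> l" using path_chain_le c d by blast+
  let ?T = "bead (j - i)" and ?U = "bead (l - j)" and ?V = "bead (l - i)"
  note v = vertex_cell[OF s]
  have TU: "?T @ ?U \<in> Ob Nec" by simp
  have id: "nec_vertex_map (?T @ ?U) ?V (\<lambda>v. v)"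
    using ijl by (auto simp: nec_vertex_map_def mono_on_def joints_append)
  have n: "(n, n, \<lambda>i\<in>{..n}. i) \<in> Ar simplex_cat" by (auto simp: mono_on_def)
  have "act S (n, n, \<lambda>i\<in>{..n}. i) s = s" using S s by (simp add: is_presheaf_def simplex_cat_def)
  moreover have "psh_comp (necklace (?T @ ?U)) (simplex_nec S n s ((\<lambda>i\<in>{..n}. i) i) ?V) (nec_map (?T @ ?U) (\<lambda>v. v))
      = simplex_nec S n (act S (n, n, \<lambda>i\<in>{..n}. i) s) i (?T @ ?U)"
    by (rule simplex_nec_pull[OF s n _ TU _ id]) (use ijl l in auto)
  ultimately have pull: "psh_comp (necklace (?T @ ?U)) (simplex_nec S n s i ?V) (nec_map (?T @ ?U) (\<lambda>v. v)) = simplex_nec S n s i (?T @ ?U)"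
    using ijl l by simp
  have e: "(\<lambda>t\<in>{..k}. (\<lambda>v. v) ` (\<lambda>t\<in>{..k}. unshift i k c t \<union> (+) (sum_list ?T) ` unshift j k d t) t) = unshift i k (\<lambda>t\<in>{..k}. c t \<union> d t)"
    unfolding unshift_def
  proof (rule restrict_ext)
    fix t assume t: "t \<in> {..k}"
    have "w \<in> (+) (j - i) ` {v. j + v \<in> d t}" if "i + w \<in> d t" for w
      using that path_chain_mem[OF d, of t] t ijl by (intro image_eqI[of _ _ "i + w - j"]) auto
    then show "(\<lambda>v. v) ` (\<lambda>t\<in>{..k}. (\<lambda>t\<in>{..k}. {v. i + v \<in> c t}) t \<union> (+) (sum_list ?T) ` (\<lambda>t\<in>{..k}. {v. j + v \<in> d t}) t) t
        = {v. i + v \<in> (\<lambda>t\<in>{..k}. c t \<union> d t) t}"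
      using t ijl by auto
  qed
  have "Cmp (T_ob (Cbox_ob S)) (vertex S n s i) (vertex S n s j) (vertex S n s l) k (letter_simplex k n s i j c, letter_simplex k n s j l d)
      = nec_simplex S (vertex S n s i) (vertex S n s l) k (?T @ ?U) (glue ?T ?U (simplex_nec S n s i ?T) (simplex_nec S n s j ?U))
          (\<lambda>t\<in>{..k}. unshift i k c t \<union> (+) (sum_list ?T) ` unshift j k d t)"
    unfolding letter_simplex_def
    by (rule nec_simplex_Cmp[OF S v v v bead_between[OF s] unshift_chain[OF c] bead_between[OF s] unshift_chain[OF d]]) (use ijl l in simp_all)
  also have "glue ?T ?U (simplex_nec S n s i ?T) (simplex_nec S n s j ?U) = simplex_nec S n s i (?T @ ?U)"
    using simplex_nec_glue[OF s, of i ?T ?U] ijl l by simp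
  also have "nec_simplex S (vertex S n s i) (vertex S n s l) k (?T @ ?U) (simplex_nec S n s i (?T @ ?U))
          (\<lambda>t\<in>{..k}. unshift i k c t \<union> (+) (sum_list ?T) ` unshift j k d t) = letter_simplex k n s i l (\<lambda>t\<in>{..k}. c t \<union> d t)"
    unfolding letter_simplex_def pull[symmetric] e[symmetric]
    by (rule nec_simplex_shift[OF bead_between[OF s] TU id nec_chain_append[OF _ _ unshift_chain[OF c] unshift_chain[OF d]]])
      (use ijl l in simp_all)
  finally show ?thesis .
qed

lemma letter_simplex_unit:
  assumes s: "s \<in> cells S n" and i: "i \<le> n"
  shows "letter_simplex k n s i i (\<lambda>t\<in>{..k}. {i}) = unit_simplex (T_ob (Cbox_ob S)) (vertex S n s i) k"
proof -
  have "simplex_nec S n s i [] = const_nec S (vertex S n s i)"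
    using psh_hom_Nil[OF S simplex_nec_hom[OF s, of i "[]"]] i simplex_nec_vtx[of "[]" 0 n s i] by (simp add: Nec_Ob)
  moreover have "unshift i k (\<lambda>t\<in>{..k}. {i}) = (\<lambda>t\<in>{..k}. {0})"
    unfolding unshift_def by (rule restrict_ext) auto
  ultimately show ?thesis
    using nec_simplex_unit[OF S vertex_cell[OF s i]] by (simp add: letter_simplex_def bead_def)
qed

text \<open>A simplicial operator \<open>f\<close> restricts to the map of beads \<open>v \<mapsto> f(i + v) - f(i)\<close>.\<close>

lemma letter_simplex_shift:
  assumes s: "s \<in> cells S n" and f: "(m, n, f) \<in> Ar simplex_cat" and c: "c \<in> path_chains i j k" and j: "j \<le> m"
  shows "letter_simplex k m (act S (m, n, f) s) i j c = letter_simplex k n s (f i) (f j) (\<lambda>t\<in>{..k}. f ` c t)"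
proof -
  have ij: "i \<le> j" using path_chain_le[OF c] .
  have fm: "f a \<le> f b" if "a \<le> b" "b \<le> m" for a b using f that by (auto simp: mono_on_def)
  have fn: "f a \<le> n" if "a \<le> m" for a using f that by auto
  let ?T = "bead (j - i)" and ?U = "bead (f j - f i)" and ?g = "\<lambda>v. f (i + v) - f i"
  have g: "nec_vertex_map ?T ?U ?g"
    using ij j fm by (auto simp: nec_vertex_map_def mono_on_def intro!: diff_le_mono)
  have "f (i + v) = f i + ?g v" if "v \<le> sum_list ?T" for v using fm[of i "i + v"] that ij j by simp
  then have pull: "psh_comp (necklace ?T) (simplex_nec S n s (f i) ?U) (nec_map ?T ?g) = simplex_nec S m (act S (m, n, f) s) i ?T"
    using ij j by (intro simplex_nec_pull[OF s f _ _ _ g]) simp_all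
  have e: "(\<lambda>t\<in>{..k}. ?g ` unshift i k c t) = unshift (f i) k (\<lambda>t\<in>{..k}. f ` c t)"
    unfolding unshift_def
  proof (rule restrict_ext)
    fix t assume t: "t \<in> {..k}"
    have "w \<in> ?g ` {v. i + v \<in> c t}" if "f i + w = f x" "x \<in> c t" for w x
      using that path_chain_mem[OF c, of t] t by (intro image_eqI[of _ _ "x - i"]) (auto simp: that(1)[symmetric])
    moreover have "f i \<le> f (i + v)" if "i + v \<in> c t" for v
      using path_chain_mem(3)[OF c, of t] t that j by (intro fm) auto
    ultimately show "?g ` (\<lambda>t\<in>{..k}. {v. i + v \<in> c t}) t = {v. f i + v \<in> (\<lambda>t\<in>{..k}. f ` c t) t}" using t by force
  qed
  have v: "vertex S m (act S (m, n, f) s) i = vertex S n s (f i)" "vertex S m (act S (m, n, f) s) j = vertex S n s (f j)"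
    using vertex_act[OF f s] ij j by simp_all
  show ?thesis
    unfolding letter_simplex_def v pull[symmetric] e[symmetric]
    by (rule nec_simplex_shift[OF bead_between[OF s] _ g unshift_chain[OF c]]) (use ij j fm fn in simp_all)
qed

text \<open>The cocone on the diagram of the \<open>C_simplex n\<close>: a simplex of \<open>S\<close> gives necklaces with at most one bead.\<close>

definition simplex_functor :: "nat \<times> 'a \<Rightarrow> (nat, nat \<Rightarrow> nat set, 'a, 'a rig_cube tri_cell) sfun" where
  "simplex_functor = (\<lambda>(n, s). \<lparr>Src = C_simplex n, Tgt = T_ob (Cbox_ob S), Omap = (\<lambda>i\<in>{..n}. vertex S n s i),
     Hmap = (\<lambda>i\<in>{..n}. \<lambda>j\<in>{..n}. \<lambda>k. \<lambda>c\<in>path_chains i j k. letter_simplex k n s i j c)\<rparr>)"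

lemma simplex_functor_sel:
  "Src (simplex_functor (n, s)) = C_simplex n" "Tgt (simplex_functor (n, s)) = T_ob (Cbox_ob S)"
  "i \<le> n \<Longrightarrow> Omap (simplex_functor (n, s)) i = vertex S n s i"
  "i \<le> n \<Longrightarrow> j \<le> n \<Longrightarrow> c \<in> path_chains i j k \<Longrightarrow> Hmap (simplex_functor (n, s)) i j k c = letter_simplex k n s i j c"
  by (simp_all add: simplex_functor_def)

lemma simplex_functor_sfun:
  assumes s: "s \<in> cells S n" shows "is_sfun (simplex_functor (n, s))"
  unfolding is_sfun_def simplex_functor_sel(1,2) C_simplex_sel T_ob_sel(1) Cbox_ob_sel(1)
proof (intro conjI ballI allI)
  show "is_scat (T_ob (Cbox_ob S))" by (rule T_ob_scat[OF Cbox_ob_ccat[OF S]])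
  show "Omap (simplex_functor (n, s)) \<in> {..n} \<rightarrow>\<^sub>E cells S 0"
    using vertex_cell[OF s] by (auto simp: simplex_functor_def)
  have "Hmap (simplex_functor (n, s)) i j \<in> psh_hom simplex_cat (nerve (path_poset i j) (\<subseteq>)) (tri (rig_hom S (vertex S n s i) (vertex S n s j)))"
    if ij: "i \<le> n" "j \<le> n" for i j
  proof (rule psh_homI)
    fix k c assume c: "c \<in> path_chains i j k"
    show "Hmap (simplex_functor (n, s)) i j k c \<in> cells (tri (rig_hom S (vertex S n s i) (vertex S n s j))) k"
      unfolding simplex_functor_sel(4)[OF ij c] letter_simplex_def
      by (rule nec_simplex_cell[OF bead_between[OF s path_chain_le[OF c] ij(2)] unshift_chain[OF c]])
  next
    fix u c assume u: "u \<in> Ar simplex_cat" and c: "c \<in> path_chains i j (Cod simplex_cat u)"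
    obtain p q h where uh: "u = (p, q, h)" by (cases u)
    have "act (nerve (P_ob (bead (j - i))) (\<subseteq>)) u (unshift i (Cod simplex_cat u) c)
        = unshift i (Dom simplex_cat u) (act (nerve (path_poset i j) (\<subseteq>)) u c)"
      unfolding uh act_nerve unshift_def simplex_cat_sel by (rule restrict_ext) (use u uh in auto)
    then show "Hmap (simplex_functor (n, s)) i j (Dom simplex_cat u) (act (nerve (path_poset i j) (\<subseteq>)) u c)
        = act (tri (rig_hom S (vertex S n s i) (vertex S n s j))) u (Hmap (simplex_functor (n, s)) i j (Cod simplex_cat u) c)"
      unfolding simplex_functor_sel(4)[OF ij c] simplex_functor_sel(4)[OF ij nerve_act_cell[OF u c]] letter_simplex_def nec_simplex_act[OF u]
      by simp
  qed (use ij in \<open>simp add: simplex_functor_def\<close>)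
  then show "Hmap (simplex_functor (n, s)) \<in> (\<Pi>\<^sub>E i\<in>{..n}. \<Pi>\<^sub>E j\<in>{..n}. psh_hom simplex_cat (nerve (path_poset i j) (\<subseteq>))
       (Hom (T_ob (Cbox_ob S)) (Omap (simplex_functor (n, s)) i) (Omap (simplex_functor (n, s)) j)))"
    by (intro PiE_I) (simp_all add: simplex_functor_sel, simp_all add: simplex_functor_def)
next
  fix i assume i: "i \<in> {..n}"
  have "unit_simplex (T_ob (Cbox_ob S)) (vertex S n s i) 0 = Unit (T_ob (Cbox_ob S)) (vertex S n s i)"
    using T_ob_unit_simplex[OF Cbox_ob_ccat[OF S], of "vertex S n s i" 0] vertex_cell[OF s] i by simp
  then show "Hmap (simplex_functor (n, s)) i i 0 (\<lambda>t\<in>{..0}. {i}) = Unit (T_ob (Cbox_ob S)) (Omap (simplex_functor (n, s)) i)"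
    using letter_simplex_unit[OF s, of i 0] C_simplex_unit_cell[where k=0 and i=i] i by (simp add: simplex_functor_sel del: T_ob_sel atMost_0)
next
  fix i j l k c d assume "i \<in> {..n}" "j \<in> {..n}" "l \<in> {..n}" and c: "c \<in> path_chains i j k" and d: "d \<in> path_chains j l k"
  then have ijl: "i \<le> n" "j \<le> n" "l \<le> n" by simp_all
  show "Hmap (simplex_functor (n, s)) i l k (Cmp (C_simplex n) i j l k (c, d))
     = Cmp (T_ob (Cbox_ob S)) (Omap (simplex_functor (n, s)) i) (Omap (simplex_functor (n, s)) j) (Omap (simplex_functor (n, s)) l) k
         (Hmap (simplex_functor (n, s)) i j k c, Hmap (simplex_functor (n, s)) j l k d)"
    unfolding C_simplex_Cmp[OF c d] simplex_functor_sel(4)[OF ijl(1,2) c] simplex_functor_sel(4)[OF ijl(2,3) d]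
      simplex_functor_sel(4)[OF ijl(1,3) C_simplex_Cmp_cell[OF c d]] simplex_functor_sel(3)[OF ijl(1)] simplex_functor_sel(3)[OF ijl(2)]
      simplex_functor_sel(3)[OF ijl(3)] letter_simplex_Cmp[OF s ijl(3) c d] ..
qed (rule C_simplex_scat)

lemma simplex_functor_cocone:
  assumes "u \<in> Ar (elements simplex_cat S)"
  shows "efun_comp (simplex_functor (Cod (elements simplex_cat S) u)) (far C_diagram u) = simplex_functor (Dom (elements simplex_cat S) u)"
proof -
  obtain m n f s where u: "u = ((m, act S (m, n, f) s), (m, n, f), (n, s))" and f: "(m, n, f) \<in> Ar simplex_cat" and s: "s \<in> cells S n"
    using assms by (rule elements_simplex_arrE)
  have far: "far C_diagram u = far C_simplex_functor (m, n, f)" by (simp add: u C_diagram_def fcompose_def elements_proj_def)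
  have st: "Src (far C_simplex_functor (m, n, f)) = C_simplex m" "Tgt (far C_simplex_functor (m, n, f)) = C_simplex n"
    "Omap (far C_simplex_functor (m, n, f)) = f" by (simp_all add: C_simplex_functor_def)
  have F: "is_sfun (far C_simplex_functor (m, n, f))" by (rule C_simplex_functor_sfun[OF f])
  have fi: "f i \<le> n" if "i \<le> m" for i using f that by auto
  let ?L = "efun_comp (simplex_functor (n, s)) (far C_simplex_functor (m, n, f))" and ?R = "simplex_functor (m, act S (m, n, f) s)"
  have stL: "Src ?L = C_simplex m" "Tgt ?L = T_ob (Cbox_ob S)" by (simp_all add: efun_comp_def st simplex_functor_sel)
  have "?L = ?R"
  proof (rule sfun_eqI)
    show "is_sfun ?L" by (rule sfun_comp[OF F simplex_functor_sfun[OF s]]) (simp add: st simplex_functor_sel)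
    show "is_sfun ?R" by (rule simplex_functor_sfun[OF act_simplex_cell[OF f s]])
    show "Omap ?L i = Omap ?R i" if "i \<in> Obj (Src ?L)" for i
      using that fi vertex_act[OF f s, of i] by (simp add: stL) (simp add: efun_comp_def st simplex_functor_sel)
    fix i j k c assume "i \<in> Obj (Src ?L)" "j \<in> Obj (Src ?L)" and "c \<in> cells (Hom (Src ?L) i j) k"
    then have ij: "i \<le> m" "j \<le> m" and c: "c \<in> path_chains i j k" by (simp_all add: stL)
    have H: "Hmap (far C_simplex_functor (m, n, f)) i j k c = (\<lambda>t\<in>{..k}. f ` c t)"
      using ij c by (simp add: C_simplex_functor_def nerve_map_def)
    have c': "(\<lambda>t\<in>{..k}. f ` c t) \<in> path_chains (f i) (f j) k"
      using sfun_cell[OF F, unfolded st, of i j c k] ij c by (simp add: H)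
    show "Hmap ?L i j k c = Hmap ?R i j k c"
      using ij c c' fi letter_simplex_shift[OF s f c ij(2)]
      by (simp add: efun_comp_def st psh_comp_cell H simplex_functor_sel)
  qed (simp_all add: stL simplex_functor_sel)
  then show ?thesis unfolding far by (simp add: u)
qed

lemma comparison_exists:
  "\<exists>!H. is_sfun H \<and> Src H = Rig_ob S \<and> Tgt H = T_ob (Cbox_ob S)
     \<and> (\<forall>j\<in>Ob (elements simplex_cat S). efun_comp H (scat_diagram.incl (elements simplex_cat S) C_diagram j) = simplex_functor j)"
  unfolding Rig_ob_def
proof (rule scat_diagram.scat_colim_universal[OF C_diagram_functor[OF S]])
  fix j assume j: "j \<in> Ob (elements simplex_cat S)"
  then show "is_sfun (simplex_functor j) \<and> Src (simplex_functor j) = fob C_diagram j \<and> Tgt (simplex_functor j) = T_ob (Cbox_ob S)"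
    using simplex_functor_sfun by (cases j) (simp add: simplex_functor_sel)
qed (use T_ob_scat[OF Cbox_ob_ccat[OF S]] simplex_functor_cocone in blast)+

end

text \<open>The component at \<open>S\<close> of the natural isomorphism.\<close>

definition comparison :: "'a sset \<Rightarrow> ('a C_ob, 'a C_cell, 'a, 'a rig_cube tri_cell) sfun" where
  "comparison S = (THE H. is_sfun H \<and> Src H = Rig_ob S \<and> Tgt H = T_ob (Cbox_ob S)
     \<and> (\<forall>j\<in>Ob (elements simplex_cat S). efun_comp H (scat_diagram.incl (elements simplex_cat S) C_diagram j) = simplex_functor S j))"

lemma comparison:
  assumes "is_presheaf simplex_cat S"
  shows "is_sfun (comparison S)" "Src (comparison S) = Rig_ob S" "Tgt (comparison S) = T_ob (Cbox_ob S)"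
    "j \<in> Ob (elements simplex_cat S) \<Longrightarrow>
      efun_comp (comparison S) (scat_diagram.incl (elements simplex_cat S) C_diagram j) = simplex_functor S j"
  using theI'[OF comparison_exists[OF assms]] unfolding comparison_def by blast+

lemma comparison_vertex:
  assumes S: "is_presheaf simplex_cat S" and s: "s \<in> cells S n" and i: "i \<le> n"
  shows "Omap (comparison S) (rig_vertex S n s i) = vertex S n s i"
proof -
  have "Omap (efun_comp (comparison S) (scat_diagram.incl (elements simplex_cat S) C_diagram (n, s))) i = vertex S n s i"
    using comparison(4)[OF S, of "(n, s)"] s i by (simp add: simplex_functor_def[OF S])
  then show ?thesis
    using i by (simp add: efun_comp_def scat_diagram.incl_def[OF C_diagram_functor[OF S]] rig_vertex_def)
qed

lemma comparison_letter:
  assumes S: "is_presheaf simplex_cat S" and s: "s \<in> cells S n" and ij: "i \<le> n" "j \<le> n" and c: "c \<in> path_chains i j k"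
  shows "Hmap (comparison S) (rig_vertex S n s i) (rig_vertex S n s j) k (rig_class S (rig_vertex S n s i) (rig_vertex S n s j) k [((n, s), i, j, c)])
    = letter_simplex S k n s i j c"
proof -
  have "Hmap (efun_comp (comparison S) (scat_diagram.incl (elements simplex_cat S) C_diagram (n, s))) i j k c = letter_simplex S k n s i j c"
    using comparison(4)[OF S, of "(n, s)"] s ij c by (simp add: simplex_functor_def[OF S])
  then show ?thesis
    using ij c by (simp add: efun_comp_def psh_comp_cell scat_diagram.incl_def[OF C_diagram_functor[OF S]] rig_vertex_def rig_class_def)
qed


section \<open>Words of necklaces\<close>

(* The equation for a nonempty word is used in the form of rig_word_Cons. *)
declare is_path.simps(2) [simp del]

abbreviation pt :: "'a sset \<Rightarrow> 'a \<Rightarrow> 'a C_ob" where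
  "pt S x \<equiv> rig_vertex S 0 x 0"

text \<open>The letter of the simplex of \<open>S\<close> on the vertices \<open>a, \<dots>, b\<close> of the necklace \<open>f\<close>, together with the part
  of the chain \<open>C\<close> that lies between \<open>a\<close> and \<open>b\<close>.\<close>

definition seg :: "(nat \<Rightarrow> (nat \<Rightarrow> nat) \<Rightarrow> 'a) \<Rightarrow> (nat \<Rightarrow> nat set) \<Rightarrow> nat \<Rightarrow> nat \<Rightarrow> nat \<Rightarrow> ('a element, nat, nat \<Rightarrow> nat set) letter" where
  "seg f C k a b = ((b - a, f (b - a) (\<lambda>t\<in>{..b - a}. a + t)), 0, b - a, \<lambda>t\<in>{..k}. {v. v \<le> b - a \<and> a + v \<in> C t})"

lemma seg_eqI:
  assumes "b' - a' = b - a" "f' (b - a) (\<lambda>t\<in>{..b - a}. a' + t) = f (b - a) (\<lambda>t\<in>{..b - a}. a + t)"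
    and "\<And>t v. t \<le> k \<Longrightarrow> v \<le> b - a \<Longrightarrow> a' + v \<in> C' t \<longleftrightarrow> a + v \<in> C t"
  shows "seg f' C' k a' b' = seg f C k a b"
proof -
  have "(\<lambda>t\<in>{..k}. {v. v \<le> b - a \<and> a' + v \<in> C' t}) = (\<lambda>t\<in>{..k}. {v. v \<le> b - a \<and> a + v \<in> C t})"
    by (rule restrict_ext) (use assms(3) in auto)
  then show ?thesis unfolding seg_def assms(1,2) by (simp only:)
qed

fun segs where
  "segs f C k (a # b # xs) = seg f C k a b # segs f C k (b # xs)"
| "segs f C k _ = []"

text \<open>The necklace is cut at the elements of the smallest set of the chain.  These include all
  joints, and they belong to all sets of the chain; so the pieces are letters.  Unlike
  the set of joints, this set is carried by a map of necklaces to the corresponding set for the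
  image of the chain.\<close>

definition nec_word where
  "nec_word f C k = segs f C k (sorted_list_of_set (C 0))"

text \<open>The case \<open>a = b\<close> is included, because a map of necklaces may collapse a segment.\<close>

definition joint_free :: "nat list \<Rightarrow> nat set \<Rightarrow> nat \<Rightarrow> nat \<Rightarrow> bool" where
  "joint_free T D a b \<longleftrightarrow> a \<le> b \<and> a \<in> D \<and> b \<in> D \<and> (\<forall>j\<in>joints T. \<not> (a < j \<and> j < b))"

fun subdivision :: "nat list \<Rightarrow> nat set \<Rightarrow> nat list \<Rightarrow> bool" where
  "subdivision T D [] \<longleftrightarrow> False"
| "subdivision T D [a] \<longleftrightarrow> a \<in> D"
| "subdivision T D (a # b # xs) \<longleftrightarrow> joint_free T D a b \<and> subdivision T D (b # xs)"

lemma subdivisionI: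
  "xs \<noteq> [] \<Longrightarrow> sorted_wrt (<) xs \<Longrightarrow> set xs \<subseteq> D \<Longrightarrow> (\<And>j. j \<in> joints T \<Longrightarrow> hd xs \<le> j \<Longrightarrow> j \<in> set xs) \<Longrightarrow> subdivision T D xs"
proof (induction xs rule: induct_list012)
  case (3 a b xs)
  have ab: "a < b" using 3 by simp
  have "j \<in> set (b # xs)" if "j \<in> joints T" "b \<le> j" for j
    using "3.prems"(4)[OF that(1)] that(2) ab by auto
  then have "subdivision T D (b # xs)" using 3 by simp
  moreover have "\<not> (a < j \<and> j < b)" if "j \<in> joints T" for j
    using "3.prems"(2) "3.prems"(4)[OF that] by fastforce
  ultimately show ?case using 3 ab by (simp add: joint_free_def)
qed simp_all

lemma sorted_P_ob:
  assumes T: "T \<in> Ob Nec" and D: "D \<in> P_ob T"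
  shows "subdivision T D (sorted_list_of_set D)" "hd (sorted_list_of_set D) = 0" "last (sorted_list_of_set D) = sum_list T"
    "sorted_list_of_set D \<noteq> []"
proof -
  let ?xs = "sorted_list_of_set D"
  have DT: "joints T \<subseteq> D" "D \<subseteq> {..sum_list T}" using D P_ob_iff[OF T] by simp_all
  then have fin: "finite D" by (meson finite_atMost finite_subset)
  then have set: "set ?xs = D" by simp
  have D0: "0 \<in> D" "sum_list T \<in> D" using DT joints_ends[of T] by auto
  then show ne: "?xs \<noteq> []" using set by (metis empty_iff empty_set)
  have s: "sorted_wrt (<) ?xs" by simp
  show "subdivision T D ?xs" by (rule subdivisionI[OF ne s]) (use set DT in auto)
  have "hd ?xs \<le> 0" using D0(1) s set ne by (cases ?xs) force+
  then show "hd ?xs = 0" by simp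
  have "sum_list T \<le> last ?xs"
  proof -
    obtain ys b where yb: "?xs = ys @ [b]" using ne by (metis rev_exhaust)
    have "\<forall>v\<in>set ?xs. v \<le> b" using s unfolding yb by (auto simp: sorted_wrt_append)
    then show ?thesis using D0(2) set yb by (metis last_snoc)
  qed
  moreover have "last ?xs \<le> sum_list T" using last_in_set[OF ne] set DT by auto
  ultimately show "last ?xs = sum_list T" by simp
qed

context
  fixes S :: "'a sset"
  assumes S: "is_presheaf simplex_cat S"
begin

lemma pt_vertex: "s \<in> cells S n \<Longrightarrow> i \<le> n \<Longrightarrow> pt S (vertex S n s i) = rig_vertex S n s i"
  unfolding vertex_def using rig_vertex_shift[OF S vertex_incl_arr, of i n s 0] by simp

lemma rig_class_append_cong:
  assumes "rig_word S k X v Y" "rig_word S k X v' Y" "rig_word S k Y w Z" "rig_word S k Y w' Z"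
    and "rig_class S X Y k v = rig_class S X Y k v'" "rig_class S Y Z k w = rig_class S Y Z k w'"
  shows "rig_class S X Z k (v @ w) = rig_class S X Z k (v' @ w')"
  using Rig_Cmp[OF S assms(1,3)] Rig_Cmp[OF S assms(2,4)] assms(5,6) by simp

lemma rig_class_comp:
  assumes s: "s \<in> cells S n" and l: "j \<le> n" "l \<le> n" and c: "c \<in> path_chains i j k" "d \<in> path_chains j l k"
  shows "rig_class S (rig_vertex S n s i) (rig_vertex S n s l) k [((n, s), i, j, c), ((n, s), j, l, d)]
    = rig_class S (rig_vertex S n s i) (rig_vertex S n s l) k [((n, s), i, l, \<lambda>t\<in>{..k}. c t \<union> d t)]"
  using path_step.intros(1)[of "elements simplex_cat S" C_diagram k "[]" "(n, s)" i j c l d "[]"]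
    path_chain_le[OF c(1)] path_chain_le[OF c(2)] assms C_simplex_Cmp_cell[OF c]
  by (intro rig_class_step[OF S]) (simp_all add: C_simplex_Cmp[OF c] rig_word_Cons[OF S])

lemma rig_class_unit:
  assumes s: "s \<in> cells S n" and i: "i \<le> n"
  shows "rig_class S (rig_vertex S n s i) (rig_vertex S n s i) k [((n, s), i, i, \<lambda>t\<in>{..k}. {i})]
    = rig_class S (rig_vertex S n s i) (rig_vertex S n s i) k []"
  using path_step.intros(2)[of "elements simplex_cat S" C_diagram k "[]" "(n, s)" i "[]"] assms C_simplex_unit_cell[where k=k and i=i]
  by (intro rig_class_step[OF S]) (simp_all add: C_simplex_unit rig_word_Cons[OF S])

lemma rig_class_arrow:
  assumes f: "(m, n, f) \<in> Ar simplex_cat" and s: "s \<in> cells S n" and j: "j \<le> m" and c: "c \<in> path_chains i j k"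
  shows "rig_class S (rig_vertex S n s (f i)) (rig_vertex S n s (f j)) k [((m, act S (m, n, f) s), i, j, c)]
    = rig_class S (rig_vertex S n s (f i)) (rig_vertex S n s (f j)) k [((n, s), f i, f j, \<lambda>t\<in>{..k}. f ` c t)]"
proof (rule rig_class_step[OF S])
  have ij: "i \<le> m" using path_chain_le[OF c] j by simp
  have H: "nerve_map (path_poset i j) (\<subseteq>) (\<lambda>X. f ` X) k c = (\<lambda>t\<in>{..k}. f ` c t)" using c by (simp add: nerve_map_def)
  show "path_step (elements simplex_cat S) C_diagram k [((m, act S (m, n, f) s), i, j, c)] [((n, s), f i, f j, \<lambda>t\<in>{..k}. f ` c t)]"
    using path_step.intros(3)[OF elements_simplex_arrI[of m n f s S], of C_diagram k "[]" i j c "[]"] f s ij j H by simp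
  have v: "rig_vertex S m (act S (m, n, f) s) i = rig_vertex S n s (f i)" "rig_vertex S m (act S (m, n, f) s) j = rig_vertex S n s (f j)"
    using rig_vertex_shift[OF S f s] ij j by simp_all
  show "rig_word S k (rig_vertex S n s (f i)) [((m, act S (m, n, f) s), i, j, c)] (rig_vertex S n s (f j))"
    using act_simplex_cell[OF S f s] ij j c v by (simp add: rig_word_Cons[OF S])
  have F: "is_sfun (far C_simplex_functor (m, n, f))" by (rule C_simplex_functor_sfun[OF f])
  have "(\<lambda>t\<in>{..k}. f ` c t) \<in> path_chains (f i) (f j) k"
    using sfun_cell[OF F, of i j c k] ij j c H by (simp add: C_simplex_functor_def)
  moreover have "f i \<le> n" "f j \<le> n" using f ij j by auto
  ultimately show "rig_word S k (rig_vertex S n s (f i)) [((n, s), f i, f j, \<lambda>t\<in>{..k}. f ` c t)] (rig_vertex S n s (f j))"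
    using s by (simp add: rig_word_Cons[OF S])
qed

lemma seg_letter:
  assumes T: "nec_between S x y T f" and C: "C \<in> nec_chains T k" and ab: "joint_free T (C 0) a b"
  defines "s \<equiv> f (b - a) (\<lambda>t\<in>{..b - a}. a + t)"
  shows "(\<lambda>t\<in>{..b - a}. a + t) \<in> cells (necklace T) (b - a)" "s \<in> cells S (b - a)"
    "(\<lambda>t\<in>{..k}. {v. v \<le> b - a \<and> a + v \<in> C t}) \<in> path_chains 0 (b - a) k"
    "rig_vertex S (b - a) s 0 = pt S (f 0 (vtx a))" "rig_vertex S (b - a) s (b - a) = pt S (f 0 (vtx b))"
    "b \<le> sum_list T"
proof -
  note t = nec_betweenD[OF T]
  have C0: "C 0 \<subseteq> {..sum_list T}" using C P_ob_iff[OF t(1)] by (simp add: nerve_cell_iff)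
  have le: "a \<le> b" using ab by (simp add: joint_free_def)
  show b: "b \<le> sum_list T" using C0 ab by (auto simp: joint_free_def)
  show c: "(\<lambda>t\<in>{..b - a}. a + t) \<in> cells (necklace T) (b - a)"
    unfolding necklace_cell_iff[OF t(1)] using ab b by (auto simp: joint_free_def mono_on_def)
  then show s: "s \<in> cells S (b - a)" unfolding s_def by (rule psh_hom_cell[OF t(2)])
  have CC: "C s \<subseteq> C t" if "s \<le> t" "t \<le> k" for s t using C that by (simp add: nerve_cell_iff)
  have "a \<in> C t" "b \<in> C t" if "t \<le> k" for t using CC[of 0 t] that ab by (auto simp: joint_free_def)
  moreover have "{v. v \<le> b - a \<and> a + v \<in> C s} \<subseteq> {v. v \<le> b - a \<and> a + v \<in> C t}" if "s \<le> t" "t \<le> k" for s t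
    using CC[OF that] by blast
  ultimately show "(\<lambda>t\<in>{..k}. {v. v \<le> b - a \<and> a + v \<in> C t}) \<in> path_chains 0 (b - a) k"
    using le by (intro path_chainI) (simp_all add: subset_iff)
  have "vertex S (b - a) s i = f 0 (vtx (a + i))" if i: "i \<le> b - a" for i
  proof -
    have e: "act (necklace T) (0, b - a, \<lambda>t\<in>{..0}. i) (\<lambda>t\<in>{..b - a}. a + t) = vtx (a + i)"
      unfolding act_necklace vtx_def by (rule restrict_ext) (use i in simp)
    show ?thesis
      using psh_hom_act[OF t(2) vertex_incl_arr[OF i], unfolded simplex_cat_sel, OF c] unfolding e vertex_def s_def by (rule sym)
  qed
  then show "rig_vertex S (b - a) s 0 = pt S (f 0 (vtx a))" "rig_vertex S (b - a) s (b - a) = pt S (f 0 (vtx b))"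
    using pt_vertex[OF s, of 0] pt_vertex[OF s, of "b - a"] le by simp_all
qed

lemma seg_rig_word:
  assumes T: "nec_between S x y T f" and C: "C \<in> nec_chains T k" and ab: "joint_free T (C 0) a b"
  shows "rig_word S k (pt S (f 0 (vtx a))) [seg f C k a b] (pt S (f 0 (vtx b)))"
  using seg_letter[OF assms] by (simp add: seg_def rig_word_Cons[OF S])

lemma segs_rig_word:
  assumes T: "nec_between S x y T f" and C: "C \<in> nec_chains T k"
  shows "subdivision T (C 0) (a # xs) \<Longrightarrow>
    rig_word S k (pt S (f 0 (vtx a))) (segs f C k (a # xs)) (pt S (f 0 (vtx (last (a # xs)))))"
proof (induction xs arbitrary: a)
  case (Cons b xs)
  then have "rig_word S k (pt S (f 0 (vtx a))) ([seg f C k a b] @ segs f C k (b # xs)) (pt S (f 0 (vtx (last (a # b # xs)))))"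
    unfolding rig_word_append[OF S] using seg_rig_word[OF T C, of a b] Cons.IH[of b] by auto
  then show ?case by simp
qed simp

lemma nec_word_rig_word:
  assumes T: "nec_between S x y T f" and C: "C \<in> nec_chains T k"
  shows "rig_word S k (pt S x) (nec_word f C k) (pt S y)"
proof -
  note t = nec_betweenD[OF T]
  have "C 0 \<in> P_ob T" using C by (simp add: nerve_cell_iff)
  note D = sorted_P_ob[OF t(1) this]
  obtain a xs where xs: "sorted_list_of_set (C 0) = a # xs" using D(4) by (cases "sorted_list_of_set (C 0)") auto
  have "rig_word S k (pt S (f 0 (vtx 0))) (segs f C k (a # xs)) (pt S (f 0 (vtx (sum_list T))))"
    using segs_rig_word[OF T C D(1)[unfolded xs]] D(2) unfolding D(3)[unfolded xs] xs by (simp only: list.sel)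
  then show ?thesis unfolding nec_word_def xs t(3,4) .
qed

text \<open>On a segment, \<open>g\<close> is the simplicial operator \<open>v \<mapsto> g(a + v) - g(a)\<close>, along which the letter can be
  moved.\<close>

lemma seg_shift:
  assumes U: "nec_between S x y U h" and T: "T \<in> Ob Nec" and g: "nec_vertex_map T U g" and C: "C \<in> nec_chains T k"
    and ab: "joint_free T (C 0) a b"
  defines "f \<equiv> psh_comp (necklace T) h (nec_map T g)" and "C' \<equiv> \<lambda>t\<in>{..k}. g ` C t"
  shows "joint_free U (C' 0) (g a) (g b)" "f 0 (vtx a) = h 0 (vtx (g a))" "f 0 (vtx b) = h 0 (vtx (g b))"
    "rig_class S (pt S (f 0 (vtx a))) (pt S (f 0 (vtx b))) k [seg f C k a b]
      = rig_class S (pt S (f 0 (vtx a))) (pt S (f 0 (vtx b))) k [seg h C' k (g a) (g b)]"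
proof -
  note u = nec_betweenD[OF U]
  have Tf: "nec_between S x y T f" unfolding f_def by (rule nec_between_pull[OF U T g])
  have C': "C' \<in> nec_chains U k" unfolding C'_def by (rule nec_chain_map[OF T u(1) g C])
  note l = seg_letter[OF Tf C ab]
  have le: "a \<le> b" "a \<in> C 0" "b \<in> C 0" using ab by (simp_all add: joint_free_def)
  have mono: "g v \<le> g w" if "v \<le> w" "w \<le> b" for v w using nec_vertex_map_mono[OF g that(1)] that l(6) by simp
  have "\<not> (g a < j \<and> j < g b)" if "j \<in> joints U" for j
  proof
    assume *: "g a < j \<and> j < g b"
    have "j \<in> g ` joints T" using that g unfolding nec_vertex_map_def by (auto dest: subsetD)
    then obtain i where i: "i \<in> joints T" "j = g i" by blast
    then have "i \<le> sum_list T" using joints_le by blast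
    then have "a < i \<and> i < b"
      using * i(2) mono[of i a] nec_vertex_map_mono[OF g, of b i] le by (meson leD le_less_linear)
    then show False using ab i(1) by (auto simp: joint_free_def)
  qed
  then show ab': "joint_free U (C' 0) (g a) (g b)"
    using le mono by (auto simp: joint_free_def C'_def)
  note l' = seg_letter[OF U C' ab']
  show va: "f 0 (vtx a) = h 0 (vtx (g a))" and vb: "f 0 (vtx b) = h 0 (vtx (g b))"
    using le l(6) by (simp_all add: f_def psh_comp_cell vtx_cell[OF T] nec_map_vtx[OF T])
  define \<phi> where "\<phi> = (\<lambda>v\<in>{..b - a}. g (a + v) - g a)"
  have \<phi>: "(b - a, g b - g a, \<phi>) \<in> Ar simplex_cat"
    using le mono unfolding \<phi>_def by (auto simp: mono_on_def intro!: diff_le_mono)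
  have gv: "g a \<le> g (a + v)" if "v \<le> b - a" for v using mono that le by simp
  have s: "f (b - a) (\<lambda>t\<in>{..b - a}. a + t) = act S (b - a, g b - g a, \<phi>) (h (g b - g a) (\<lambda>t\<in>{..g b - g a}. g a + t))"
  proof -
    have e: "(\<lambda>i\<in>{..b - a}. (\<lambda>t\<in>{..g b - g a}. g a + t) (\<phi> i)) = (\<lambda>i\<in>{..b - a}. g ((\<lambda>t\<in>{..b - a}. a + t) i))"
      using gv \<phi> by (intro restrict_ext) (auto simp: \<phi>_def)
    show ?thesis
      unfolding f_def psh_comp_cell[OF l(1)] nec_map_simp[OF l(1)] e[symmetric]
      using psh_hom_act[OF u(2) \<phi>, unfolded simplex_cat_sel, OF l'(1)] unfolding act_necklace .
  qed
  have c: "(\<lambda>t\<in>{..k}. \<phi> ` (\<lambda>t\<in>{..k}. {v. v \<le> b - a \<and> a + v \<in> C t}) t) = (\<lambda>t\<in>{..k}. {v. v \<le> g b - g a \<and> g a + v \<in> C' t})"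
  proof (rule restrict_ext)
    fix t assume t: "t \<in> {..k}"
    have CC: "C 0 \<subseteq> C t" "C t \<subseteq> {..sum_list T}" using C t P_ob_iff[OF T] by (simp_all add: nerve_cell_iff)
    have "w \<in> \<phi> ` {v. v \<le> b - a \<and> a + v \<in> C t}" if w: "w \<le> g b - g a" "g a + w = g x" "x \<in> C t" for w x
    proof -
      \<comment> \<open>A vertex outside \<open>[a, b]\<close> with image in \<open>[g a, g b]\<close> has the same image as \<open>a\<close> or \<open>b\<close>.\<close>
      have "x \<le> sum_list T" using w CC by auto
      have abC: "a \<in> C t" "b \<in> C t" using le CC by auto
      obtain x' where x': "x' \<in> C t" "a \<le> x'" "x' \<le> b" "g x' = g a + w"
      proof (cases "x < a")
        case True
        then have "g a = g a + w" using w(2) mono[of x a] le by simp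
        then show thesis using that[of a] abC le by simp
      next
        case xa: False
        show thesis
        proof (cases "b < x")
          case True
          then have "g b = g a + w"
            using w(1,2) nec_vertex_map_mono[OF g, of b x] \<open>x \<le> sum_list T\<close> mono[of a b] le by simp
          then show thesis using that[of b] abC le by simp
        next
          case False
          then show thesis using that[of x] xa w by simp
        qed
      qed
      then show ?thesis by (intro image_eqI[of _ _ "x' - a"]) (simp_all add: \<phi>_def diff_le_mono)
    qed
    then show "\<phi> ` (\<lambda>t\<in>{..k}. {v. v \<le> b - a \<and> a + v \<in> C t}) t = {v. v \<le> g b - g a \<and> g a + v \<in> C' t}"
      using t gv mono le by (auto simp: \<phi>_def C'_def intro!: diff_le_mono)
  qed
  have \<phi>0: "\<phi> 0 = 0" "\<phi> (b - a) = g b - g a" using le by (simp_all add: \<phi>_def)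
  show "rig_class S (pt S (f 0 (vtx a))) (pt S (f 0 (vtx b))) k [seg f C k a b]
      = rig_class S (pt S (f 0 (vtx a))) (pt S (f 0 (vtx b))) k [seg h C' k (g a) (g b)]"
    using rig_class_arrow[OF \<phi> l'(2) order_refl l(3)] l'(4,5) unfolding \<phi>0 c seg_def s va vb by simp
qed

lemma seg_degenerate:
  assumes U: "nec_between S x y U h" and C: "C \<in> nec_chains U k" and a: "a \<in> C 0"
  shows "rig_class S (pt S (h 0 (vtx a))) (pt S (h 0 (vtx a))) k [seg h C k a a] = rig_class S (pt S (h 0 (vtx a))) (pt S (h 0 (vtx a))) k []"
proof -
  have "joint_free U (C 0) a a" using a by (simp add: joint_free_def)
  note l = seg_letter[OF U C this]
  have "a \<in> C t" if "t \<le> k" for t using C a that by (auto simp: nerve_cell_iff)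
  then have "(\<lambda>t\<in>{..k}. {v. v \<le> a - a \<and> a + v \<in> C t}) = (\<lambda>t\<in>{..k}. {0})" by (intro restrict_ext) auto
  then show ?thesis using rig_class_unit[OF l(2), of 0 k] l(4,5) by (simp add: seg_def)
qed

text \<open>If \<open>g a = g b\<close>, then the image of the segment from \<open>a\<close> to \<open>b\<close> is an identity, which can be deleted.  In
  the list of vertices this deletion is the removal of adjacent duplicates.\<close>

lemma segs_shift:
  assumes U: "nec_between S x y U h" and T: "T \<in> Ob Nec" and g: "nec_vertex_map T U g" and C: "C \<in> nec_chains T k"
  defines "f \<equiv> psh_comp (necklace T) h (nec_map T g)" and "C' \<equiv> \<lambda>t\<in>{..k}. g ` C t"
  shows "subdivision T (C 0) (a # xs) \<Longrightarrow> subdivision U (C' 0) (remdups_adj (map g (a # xs)))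
    \<and> f 0 (vtx (last (a # xs))) = h 0 (vtx (g (last (a # xs))))
    \<and> rig_class S (pt S (f 0 (vtx a))) (pt S (f 0 (vtx (last (a # xs))))) k (segs f C k (a # xs))
      = rig_class S (pt S (f 0 (vtx a))) (pt S (f 0 (vtx (last (a # xs))))) k (segs h C' k (remdups_adj (map g (a # xs))))"
proof (induction xs arbitrary: a)
  case Nil
  then have a: "a \<in> C 0" by simp
  then have "joint_free T (C 0) a a" by (simp add: joint_free_def)
  from seg_shift(2)[OF U T g C this] show ?case using a by (simp add: f_def C'_def)
next
  case (Cons b xs)
  have Tf: "nec_between S x y T f" unfolding f_def by (rule nec_between_pull[OF U T g])
  have C': "C' \<in> nec_chains U k" unfolding C'_def by (rule nec_chain_map[OF T nec_betweenD(1)[OF U] g C])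
  from Cons.prems have ab: "joint_free T (C 0) a b" and bxs: "subdivision T (C 0) (b # xs)" by simp_all
  note sh = seg_shift[OF U T g C ab, folded f_def C'_def]
  note IH = Cons.IH[OF bxs]
  obtain r where r: "remdups_adj (map g (b # xs)) = g b # r"
    by (metis list.simps(9) remdups_adj_Cons_alt)
  let ?l = "last (b # xs)"
  have sub: "subdivision U (C' 0) (g b # r)" using IH r by simp
  have last: "last (g b # r) = g ?l" using r by (metis last_map last_remdups_adj list.discI list.map_disc_iff)
  have w1: "rig_word S k (pt S (f 0 (vtx a))) [seg f C k a b] (pt S (f 0 (vtx b)))" by (rule seg_rig_word[OF Tf C ab])
  have w1': "rig_word S k (pt S (f 0 (vtx a))) [seg h C' k (g a) (g b)] (pt S (f 0 (vtx b)))"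
    unfolding sh(2,3) by (rule seg_rig_word[OF U C' sh(1)])
  have w2: "rig_word S k (pt S (f 0 (vtx b))) (segs f C k (b # xs)) (pt S (f 0 (vtx ?l)))" by (rule segs_rig_word[OF Tf C bxs])
  have w2': "rig_word S k (pt S (f 0 (vtx b))) (segs h C' k (g b # r)) (pt S (f 0 (vtx ?l)))"
    using segs_rig_word[OF U C' sub] sh(3) last IH by simp
  have "rig_class S (pt S (f 0 (vtx a))) (pt S (f 0 (vtx ?l))) k ([seg f C k a b] @ segs f C k (b # xs))
      = rig_class S (pt S (f 0 (vtx a))) (pt S (f 0 (vtx ?l))) k ([seg h C' k (g a) (g b)] @ segs h C' k (g b # r))"
    by (rule rig_class_append_cong[OF w1 w1' w2 w2' sh(4) IH[THEN conjunct2, THEN conjunct2, unfolded r]])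
  moreover have "subdivision U (C' 0) (remdups_adj (map g (a # b # xs)))
      \<and> rig_class S (pt S (f 0 (vtx a))) (pt S (f 0 (vtx ?l))) k ([seg h C' k (g a) (g b)] @ segs h C' k (g b # r))
        = rig_class S (pt S (f 0 (vtx a))) (pt S (f 0 (vtx ?l))) k (segs h C' k (remdups_adj (map g (a # b # xs))))"
  proof (cases "g a = g b")
    case True
    have v: "f 0 (vtx a) = h 0 (vtx (g b))" "f 0 (vtx b) = h 0 (vtx (g b))" using sh(2,3) True by simp_all
    have "g b \<in> C' 0" using sh(1) by (simp add: joint_free_def)
    from seg_degenerate[OF U C' this]
    have d: "rig_class S (pt S (f 0 (vtx a))) (pt S (f 0 (vtx b))) k [seg h C' k (g a) (g b)] = rig_class S (pt S (f 0 (vtx a))) (pt S (f 0 (vtx b))) k []"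
      unfolding v True .
    have "rig_class S (pt S (f 0 (vtx a))) (pt S (f 0 (vtx ?l))) k ([seg h C' k (g a) (g b)] @ segs h C' k (g b # r))
        = rig_class S (pt S (f 0 (vtx a))) (pt S (f 0 (vtx ?l))) k ([] @ segs h C' k (g b # r))"
      by (rule rig_class_append_cong[OF w1' _ w2' w2' d refl]) (simp add: v)
    moreover have "remdups_adj (map g (a # b # xs)) = g b # r" using True r by simp
    ultimately show ?thesis using sub by simp
  next
    case False
    then have "remdups_adj (map g (a # b # xs)) = g a # g b # r" using r by simp
    then show ?thesis using sub sh(1) by simp
  qed
  ultimately show ?case using IH by simp
qed

lemma remdups_adj_map_sorted:
  fixes g :: "nat \<Rightarrow> nat"
  assumes D: "finite D" and g: "\<And>v w. v \<in> D \<Longrightarrow> w \<in> D \<Longrightarrow> v \<le> w \<Longrightarrow> g v \<le> g w"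
  shows "remdups_adj (map g (sorted_list_of_set D)) = sorted_list_of_set (g ` D)"
proof (rule sorted_distinct_set_unique)
  have "sorted (map g (sorted_list_of_set D))"
    unfolding sorted_map by (rule sorted_wrt_mono_rel[of _ "(\<le>)"]) (use g D in auto)
  then show "sorted (remdups_adj (map g (sorted_list_of_set D)))" by (rule sorted_remdups_adj)
  have "sorted xs \<Longrightarrow> distinct (remdups_adj xs)" for xs :: "nat list"
    by (induction xs rule: remdups_adj.induct) auto
  then show "distinct (remdups_adj (map g (sorted_list_of_set D)))" using \<open>sorted (map _ _)\<close> by blast
qed (use D in simp_all)

text \<open>By \<open>nec_simplex_invariant\<close>, this makes the class of the word of a necklace a function of the
  simplex that the necklace represents.\<close>

lemma nec_word_shift:
  assumes U: "nec_between S x y U h" and T: "T \<in> Ob Nec" and g: "nec_vertex_map T U g" and C: "C \<in> nec_chains T k"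
  shows "rig_class S (pt S x) (pt S y) k (nec_word (psh_comp (necklace T) h (nec_map T g)) C k)
    = rig_class S (pt S x) (pt S y) k (nec_word h (\<lambda>t\<in>{..k}. g ` C t) k)"
proof -
  note t = nec_betweenD[OF nec_between_pull[OF U T g]]
  have CP: "C 0 \<in> P_ob T" using C by (simp add: nerve_cell_iff)
  note D = sorted_P_ob[OF T CP]
  obtain xs where xs: "sorted_list_of_set (C 0) = 0 # xs" using D(2,4) by (metis list.collapse)
  have C0: "C 0 \<subseteq> {..sum_list T}" using CP P_ob_iff[OF T] by simp
  then have fin: "finite (C 0)" by (meson finite_atMost finite_subset)
  have r: "remdups_adj (map g (0 # xs)) = sorted_list_of_set ((\<lambda>t\<in>{..k}. g ` C t) 0)"
    unfolding xs[symmetric] using C0 nec_vertex_map_mono[OF g] by (simp add: remdups_adj_map_sorted[OF fin] subset_iff)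
  show ?thesis
    using segs_shift[OF U T g C D(1)[unfolded xs], THEN conjunct2, THEN conjunct2]
    unfolding D(3)[unfolded xs] t(3,4) r nec_word_def xs .
qed

lemma segs_append: "segs f C k (xs @ p # ys) = segs f C k (xs @ [p]) @ segs f C k (p # ys)"
  by (induction xs rule: induct_list012) simp_all

lemma segs_map_cong:
  assumes "\<And>a b. joint_free T D a b \<Longrightarrow> seg f C k a b = seg f' C' k (r a) (r b)"
  shows "subdivision T D xs \<Longrightarrow> segs f C k xs = segs f' C' k (map r xs)"
  by (induction xs rule: induct_list012) (simp_all add: assms)

text \<open>The joint at which \<open>T\<close> and \<open>U\<close> are glued belongs to the smallest set of the chain, so no letter extends
  over both of them.\<close>

lemma nec_word_glue:
  assumes T: "nec_between S x y T f" "C \<in> nec_chains T k" and U: "nec_between S y z U g" "D \<in> nec_chains U k"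
  shows "nec_word (glue T U f g) (\<lambda>t\<in>{..k}. C t \<union> (+) (sum_list T) ` D t) k = nec_word f C k @ nec_word g D k"
proof -
  note t = nec_betweenD[OF T(1)] and u = nec_betweenD[OF U(1)]
  have m: "f 0 (vtx (sum_list T)) = g 0 (vtx 0)" using t u by simp
  let ?N = "sum_list T" and ?f = "glue T U f g" and ?E = "\<lambda>t\<in>{..k}. C t \<union> (+) (sum_list T) ` D t"
  have CP: "C t \<in> P_ob T" "D t \<in> P_ob U" if "t \<le> k" for t using T(2) U(2) that by (simp_all add: nerve_cell_iff)
  then have C: "joints T \<subseteq> C t" "C t \<subseteq> {..?N}" and D: "joints U \<subseteq> D t" "D t \<subseteq> {..sum_list U}" if "t \<le> k" for t
    using that P_ob_iff[OF t(1)] P_ob_iff[OF u(1)] by blast+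
  have NC: "?N \<in> C t" "0 \<in> D t" if "t \<le> k" for t using C(1)[OF that] D(1)[OF that] joints_ends[of T] joints_ends[of U] by auto
  note c = sorted_P_ob[OF t(1) CP(1)[of 0]] and d = sorted_P_ob[OF u(1) CP(2)[of 0]]
  obtain xs where xs: "sorted_list_of_set (C 0) = xs @ [?N]" using c(3,4) by (metis append_butlast_last_id le0)
  obtain ys where ys: "sorted_list_of_set (D 0) = 0 # ys" using d(2,4) by (metis le0 list.collapse)
  have fin: "finite (C 0)" "finite (D 0)" using C(2)[of 0] D(2)[of 0] by (simp_all add: finite_subset)
  have E: "sorted_list_of_set (?E 0) = xs @ ?N # map ((+) ?N) ys"
  proof (rule sorted_distinct_set_unique)
    have s: "sorted_wrt (<) (xs @ [?N])" "sorted_wrt (<) (0 # ys)"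
      using strict_sorted_list_of_set[of "C 0"] strict_sorted_list_of_set[of "D 0"] unfolding xs ys by blast+
    then have "sorted_wrt (<) (xs @ ?N # map ((+) ?N) ys)"
      by (auto simp: sorted_wrt_append sorted_wrt_map)
    then show "sorted (xs @ ?N # map ((+) ?N) ys)" "distinct (xs @ ?N # map ((+) ?N) ys)"
      by (simp_all only: strict_sorted_iff)
    have "set (xs @ [?N]) = C 0" "set (0 # ys) = D 0"
      using set_sorted_list_of_set[OF fin(1)] set_sorted_list_of_set[OF fin(2)] unfolding xs ys by blast+
    moreover have "set (xs @ ?N # map ((+) ?N) ys) = set (xs @ [?N]) \<union> (+) ?N ` set (0 # ys)" by auto
    ultimately show "set (sorted_list_of_set (?E 0)) = set (xs @ ?N # map ((+) ?N) ys)" using fin by simp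
  qed simp_all
  have "nec_word ?f ?E k = segs ?f ?E k (xs @ [?N]) @ segs ?f ?E k (?N # map ((+) ?N) ys)"
    unfolding nec_word_def E by (rule segs_append)
  also have "segs ?f ?E k (xs @ [?N]) = nec_word f C k"
  proof -
    have "seg f C k a b = seg ?f ?E k (id a) (id b)" if ab: "joint_free T (C 0) a b" for a b
    proof (rule seg_eqI[symmetric])
      note l = seg_letter[OF T(1,2) ab]
      show "?f (b - a) (\<lambda>t\<in>{..b - a}. id a + t) = f (b - a) (\<lambda>t\<in>{..b - a}. a + t)"
        unfolding id_apply by (rule glue_left[OF t(1) u(1) t(2) u(2) m l(1)])
      fix s v assume s: "s \<le> k" and v: "v \<le> b - a"
      have "a + v = ?N" if "a + v \<in> (+) ?N ` D s" using that v l(6) ab by (auto simp: joint_free_def)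
      then show "(id a + v \<in> ?E s) = (a + v \<in> C s)" using NC(1)[OF s] s by auto
    qed simp
    from segs_map_cong[OF this c(1)[OF le0]] show ?thesis unfolding nec_word_def xs by simp
  qed
  also have "segs ?f ?E k (?N # map ((+) ?N) ys) = nec_word g D k"
  proof -
    have "seg g D k a b = seg ?f ?E k (?N + a) (?N + b)" if ab: "joint_free U (D 0) a b" for a b
    proof (rule seg_eqI[symmetric])
      note l = seg_letter[OF U(1,2) ab]
      have "(\<lambda>t\<in>{..b - a}. ?N + a + t) = (\<lambda>i\<in>{..b - a}. ?N + (\<lambda>t\<in>{..b - a}. a + t) i)" by (rule restrict_ext) simp
      then show "?f (b - a) (\<lambda>t\<in>{..b - a}. ?N + a + t) = g (b - a) (\<lambda>t\<in>{..b - a}. a + t)"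
        using glue_right[OF t(1) u(1) t(2) u(2) m l(1)] by (simp only:)
      fix s v assume s: "s \<le> k"
      have "a + v = 0" if "?N + a + v \<in> C s" using C(2)[OF s] that by auto
      then show "(?N + a + v \<in> ?E s) = (a + v \<in> D s)" using NC[OF s] s by (auto simp: add.assoc)
    qed simp
    from segs_map_cong[OF this d(1)[OF le0]] show ?thesis unfolding nec_word_def ys by simp
  qed
  finally show ?thesis .
qed

text \<open>The word of a letter consists of its pieces between consecutive elements of the smallest set
  of the chain, and the relations allow to compose them again.  In the proof, \<open>R a b\<close> is the part of the
  letter between \<open>a\<close> and \<open>b\<close>.\<close>

lemma nec_word_letter:
  assumes s: "s \<in> cells S n" and j: "j \<le> n" and c: "c \<in> path_chains i j k"
  shows "rig_class S (rig_vertex S n s i) (rig_vertex S n s j) k (nec_word (simplex_nec S n s i (bead (j - i))) (unshift i k c) k)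
    = rig_class S (rig_vertex S n s i) (rig_vertex S n s j) k [((n, s), i, j, c)]"
proof -
  let ?T = "bead (j - i)" and ?f = "simplex_nec S n s i (bead (j - i))" and ?C = "unshift i k c"
  have ij: "i \<le> j" by (rule path_chain_le[OF c])
  note B = bead_between[OF S s ij j] and C = unshift_chain[OF c]
  have CC: "c s \<subseteq> c t" if "s \<le> t" "t \<le> k" for s t using c that unfolding path_nerve_cell by blast
  define R where "R a b = ((n, s), i + a, i + b, \<lambda>t\<in>{..k}. {w \<in> c t. i + a \<le> w \<and> w \<le> i + b})" for a b
  have mem: "i + a \<in> c t" "i + a \<le> j" if "a \<in> ?C 0" "t \<le> k" for a t
    using that CC[of 0 t] path_chain_mem(3)[OF c, of 0] by (auto simp: unshift_def)
  have R: "(\<lambda>t\<in>{..k}. {w \<in> c t. i + a \<le> w \<and> w \<le> i + b}) \<in> path_chains (i + a) (i + b) k"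
    if "a \<in> ?C 0" "b \<in> ?C 0" "a \<le> b" for a b
  proof -
    have "{w \<in> c s. i + a \<le> w \<and> w \<le> i + b} \<subseteq> {w \<in> c t. i + a \<le> w \<and> w \<le> i + b}" if "s \<le> t" "t \<le> k" for s t
      using CC[OF that] by blast
    then show ?thesis using mem[OF that(1)] mem[OF that(2)] that(3) by (intro path_chainI) (simp_all add: subset_iff)
  qed
  have v: "?f 0 (vtx a) = vertex S n s (i + a)" if "a \<in> ?C 0" for a
    using mem[OF that, of 0] ij by (simp add: simplex_nec_vtx[OF S])
  have pv: "pt S (?f 0 (vtx a)) = rig_vertex S n s (i + a)" if "a \<in> ?C 0" for a
    using v[OF that] pt_vertex[OF s, of "i + a"] mem[OF that, of 0] j by simp
  have single: "rig_class S (rig_vertex S n s (i + a)) (rig_vertex S n s (i + b)) k [seg ?f ?C k a b]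
      = rig_class S (rig_vertex S n s (i + a)) (rig_vertex S n s (i + b)) k [R a b]" if ab: "joint_free ?T (?C 0) a b" for a b
  proof -
    note l = seg_letter[OF B C ab]
    have a: "a \<in> ?C 0" "b \<in> ?C 0" "a \<le> b" using ab by (simp_all add: joint_free_def)
    define \<phi> where "\<phi> = (\<lambda>v\<in>{..b - a}. i + (a + v))"
    have \<phi>: "(b - a, n, \<phi>) \<in> Ar simplex_cat"
      using mem[OF a(2), of 0] a(3) j by (auto simp: \<phi>_def mono_on_def)
    have "(\<lambda>t\<in>{..b - a}. i + (\<lambda>t\<in>{..b - a}. a + t) t) = \<phi>" unfolding \<phi>_def by (rule restrict_ext) simp
    then have "?f (b - a) (\<lambda>t\<in>{..b - a}. a + t) = act S (b - a, n, \<phi>) s" using l(1) by (simp add: simplex_nec_def)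
    moreover have "(\<lambda>t\<in>{..k}. \<phi> ` (\<lambda>t\<in>{..k}. {v. v \<le> b - a \<and> a + v \<in> ?C t}) t) = (\<lambda>t\<in>{..k}. {w \<in> c t. i + a \<le> w \<and> w \<le> i + b})"
    proof (rule restrict_ext)
      fix t assume "t \<in> {..k}"
      moreover have "w \<in> \<phi> ` {v. v \<le> b - a \<and> i + (a + v) \<in> c t}" if "w \<in> c t" "i + a \<le> w" "w \<le> i + b" for w
        using that by (intro image_eqI[of _ _ "w - (i + a)"]) (auto simp: \<phi>_def)
      ultimately show "\<phi> ` (\<lambda>t\<in>{..k}. {v. v \<le> b - a \<and> a + v \<in> ?C t}) t = {w \<in> c t. i + a \<le> w \<and> w \<le> i + b}"
        using a(3) by (auto simp: \<phi>_def unshift_def)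
    qed
    moreover have "\<phi> 0 = i + a" "\<phi> (b - a) = i + b" using a(3) by (simp_all add: \<phi>_def)
    ultimately show ?thesis using rig_class_arrow[OF \<phi> s order_refl l(3)] by (simp add: seg_def R_def)
  qed
  have main: "rig_class S (rig_vertex S n s (i + a)) (rig_vertex S n s (i + last (a # xs))) k (segs ?f ?C k (a # xs))
      = rig_class S (rig_vertex S n s (i + a)) (rig_vertex S n s (i + last (a # xs))) k [R a (last (a # xs))]
      \<and> a \<le> last (a # xs) \<and> last (a # xs) \<in> ?C 0"
    if "subdivision ?T (?C 0) (a # xs)" for a xs
    using that
  proof (induction xs arbitrary: a)
    case Nil
    then have a: "a \<in> ?C 0" by simp
    have "(\<lambda>t\<in>{..k}. {w \<in> c t. i + a \<le> w \<and> w \<le> i + a}) = (\<lambda>t\<in>{..k}. {i + a})"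
      using mem[OF a] by (intro restrict_ext) auto
    then show ?case using rig_class_unit[OF s, of "i + a" k] mem[OF a, of 0] j a by (simp add: R_def)
  next
    case (Cons b xs)
    then have ab: "joint_free ?T (?C 0) a b" and bxs: "subdivision ?T (?C 0) (b # xs)" by simp_all
    then have a: "a \<in> ?C 0" "b \<in> ?C 0" "a \<le> b" by (simp_all add: joint_free_def)
    note IH = Cons.IH[OF bxs]
    let ?l = "last (b # xs)"
    have l: "?l \<in> ?C 0" "b \<le> ?l" using IH by simp_all
    have in_n: "i + d \<le> n" if "d \<in> ?C 0" for d using mem(2)[OF that, of 0] j by simp
    have wR: "rig_word S k (rig_vertex S n s (i + d)) [R d e] (rig_vertex S n s (i + e))"
      if "d \<in> ?C 0" "e \<in> ?C 0" "d \<le> e" for d e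
      using R[OF that] in_n[OF that(1)] in_n[OF that(2)] s by (simp add: R_def rig_word_Cons[OF S])
    have "rig_class S (rig_vertex S n s (i + a)) (rig_vertex S n s (i + ?l)) k ([seg ?f ?C k a b] @ segs ?f ?C k (b # xs))
        = rig_class S (rig_vertex S n s (i + a)) (rig_vertex S n s (i + ?l)) k ([R a b] @ [R b ?l])"
    proof (rule rig_class_append_cong[OF _ wR[OF a] _ wR[OF a(2) l] single[OF ab]])
      show "rig_word S k (rig_vertex S n s (i + a)) [seg ?f ?C k a b] (rig_vertex S n s (i + b))"
        using seg_rig_word[OF B C ab] by (simp only: pv[OF a(1)] pv[OF a(2)])
      show "rig_word S k (rig_vertex S n s (i + b)) (segs ?f ?C k (b # xs)) (rig_vertex S n s (i + ?l))"
        using segs_rig_word[OF B C bxs] by (simp only: pv[OF a(2)] pv[OF l(1)])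
    qed (use IH in blast)
    also have "\<dots> = rig_class S (rig_vertex S n s (i + a)) (rig_vertex S n s (i + ?l)) k [R a ?l]"
    proof -
      have "(\<lambda>t\<in>{..k}. (\<lambda>t\<in>{..k}. {w \<in> c t. i + a \<le> w \<and> w \<le> i + b}) t \<union> (\<lambda>t\<in>{..k}. {w \<in> c t. i + b \<le> w \<and> w \<le> i + ?l}) t)
          = (\<lambda>t\<in>{..k}. {w \<in> c t. i + a \<le> w \<and> w \<le> i + ?l})"
        using a(3) l(2) by (intro restrict_ext) auto
      then show ?thesis using rig_class_comp[OF s in_n[OF a(2)] in_n[OF l(1)] R[OF a] R[OF a(2) l]] by (simp add: R_def)
    qed
    finally show ?case using a l by simp
  qed
  have P: "?C 0 \<in> P_ob ?T" using C by (simp add: nerve_cell_iff)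
  note D = sorted_P_ob[OF bead_simps(1) P]
  obtain xs where xs: "sorted_list_of_set (?C 0) = 0 # xs" using D(2,4) by (metis list.collapse)
  have l: "last (0 # xs) = j - i" using D(3) unfolding xs by (simp only: bead_simps)
  have ends: "i + 0 = i" "i + (j - i) = j" using ij by simp_all
  have "(\<lambda>t\<in>{..k}. {w \<in> c t. i \<le> w \<and> w \<le> j}) = (\<lambda>t\<in>{..k}. c t)"
  proof (rule restrict_ext)
    fix t assume "t \<in> {..k}"
    then show "{w \<in> c t. i \<le> w \<and> w \<le> j} = c t" using path_chain_mem(3)[OF c, of t] by auto
  qed
  also have "\<dots> = c" using c by (simp add: path_nerve_cell extensional_restrict)
  finally have R0: "R 0 (j - i) = ((n, s), i, j, c)" using ij by (simp add: R_def)
  show ?thesis using main[OF D(1)[unfolded xs], THEN conjunct1] unfolding l ends R0 nec_word_def xs .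
qed


section \<open>The comparison functor is an isomorphism\<close>

lemma Rig_Obj_pt: "Obj (Rig_ob S) = pt S ` cells S 0"
proof -
  have "rig_vertex S n s i \<in> pt S ` cells S 0" if "s \<in> cells S n" "i \<le> n" for n s i
    using pt_vertex[OF that] vertex_cell[OF S that] by (metis imageI)
  then show ?thesis using rig_vertex_in[OF S] unfolding Rig_Obj[OF S] by auto
qed

lemma comparison_pt: "x \<in> cells S 0 \<Longrightarrow> Omap (comparison S) (pt S x) = x"
  using comparison_vertex[OF S, of x 0 0] vertex_0[OF S] by simp

lemma pt_inj: "x \<in> cells S 0 \<Longrightarrow> y \<in> cells S 0 \<Longrightarrow> pt S x = pt S y \<Longrightarrow> x = y"
  by (metis comparison_pt)

lemma pt_in: "x \<in> cells S 0 \<Longrightarrow> pt S x \<in> Obj (Rig_ob S)"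
  unfolding Rig_Obj_pt by blast

lemma nec_chains_Nil: "C \<in> nec_chains [] k \<Longrightarrow> C = (\<lambda>t\<in>{..k}. {0})"
  by (auto simp: nerve_cell_iff P_ob_iff Nec_Ob joints_Nil extensional_def fun_eq_iff)

lemma comparison_Nil:
  assumes x: "x \<in> cells S 0"
  shows "Hmap (comparison S) (pt S x) (pt S x) k (rig_class S (pt S x) (pt S x) k [])
    = nec_simplex S x x k [] (const_nec S x) (\<lambda>t\<in>{..k}. {0})"
  using sfun_unit[OF comparison(1)[OF S], unfolded comparison(2,3)[OF S], OF pt_in[OF x], of k]
  by (simp add: Rig_unit_simplex[OF S] comparison_pt[OF x] nec_simplex_unit[OF S x] del: atMost_0)

lemma comparison_append:
  assumes xyz: "x \<in> cells S 0" "y \<in> cells S 0" "z \<in> cells S 0"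
    and v: "rig_word S k (pt S x) v (pt S y)" and w: "rig_word S k (pt S y) w (pt S z)"
  shows "Hmap (comparison S) (pt S x) (pt S z) k (rig_class S (pt S x) (pt S z) k (v @ w))
    = Cmp (T_ob (Cbox_ob S)) x y z k
        (Hmap (comparison S) (pt S x) (pt S y) k (rig_class S (pt S x) (pt S y) k v),
         Hmap (comparison S) (pt S y) (pt S z) k (rig_class S (pt S y) (pt S z) k w))"
  using sfun_cmp[OF comparison(1)[OF S], unfolded comparison(2,3)[OF S], OF pt_in[OF xyz(1)] pt_in[OF xyz(2)] pt_in[OF xyz(3)]
      rig_class_cell[OF S v] rig_class_cell[OF S w]] xyz
  by (simp add: Rig_Cmp[OF S v w] comparison_pt)

text \<open>A necklace over \<open>S\<close> is the composite of its beads, so every simplex of a mapping space of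
  \<open>T_ob (Cbox_ob S)\<close> is a composite of images of simplices of \<open>S\<close>.\<close>

lemma comparison_surj:
  "nec_between S x y T f \<Longrightarrow> C \<in> nec_chains T k \<Longrightarrow>
    \<exists>w. rig_word S k (pt S x) w (pt S y)
      \<and> Hmap (comparison S) (pt S x) (pt S y) k (rig_class S (pt S x) (pt S y) k w) = nec_simplex S x y k T f C"
proof (induction T arbitrary: x f C)
  case Nil
  note t = nec_betweenD[OF Nil(1)]
  have x: "x \<in> cells S 0" using psh_hom_cell[OF t(2) vtx_cell[OF t(1), of 0]] t(3) by simp
  have f: "f = const_nec S x" using psh_hom_Nil[OF S t(2)] unfolding t(3) .
  have y: "y = x" using t(3,4) by simp
  have "rig_word S k (pt S x) [] (pt S x)" by simp
  then show ?case unfolding f y nec_chains_Nil[OF Nil(2)] using comparison_Nil[OF x] by blast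
next
  case (Cons n T)
  note t = nec_betweenD[OF Cons.prems(1)]
  have n: "[n] \<in> Ob Nec" "T \<in> Ob Nec" "1 \<le> n" using t(1) by (simp_all add: Nec_Ob)
  have nT: "[n] @ T \<in> Ob Nec" using n by (simp del: append_Cons)
  have f: "f \<in> psh_hom simplex_cat (necklace ([n] @ T)) S" using t(2) by simp
  have bn: "bead n = [n]" using n(3) by (simp add: bead_def)
  \<comment> \<open>the first bead, as a simplex of the necklace\<close>
  define c0 where "c0 = (\<lambda>i\<in>{..n}. i)"
  have c0: "c0 \<in> cells (necklace [n]) n" unfolding necklace_cell_iff[OF n(1)] by (auto simp: c0_def mono_on_def joints_bead)
  have sub: "cells (necklace [n]) m \<subseteq> cells (necklace ([n] @ T)) m" for m by (rule necklace_append_left[OF n(1,2)])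
  define s where "s = f n c0"
  have s: "s \<in> cells S n" unfolding s_def using psh_hom_cell[OF f] c0 sub by blast
  define g where "g = (\<lambda>m. \<lambda>d\<in>cells (necklace T) m. f m (\<lambda>i\<in>{..m}. n + d i))"
  have right: "(\<lambda>i\<in>{..m}. n + d i) \<in> cells (necklace ([n] @ T)) m" if "d \<in> cells (necklace T) m" for m d
    using necklace_append_right[OF n(1,2) that] by simp
  have f1: "simplex_nec S n s 0 [n] m c = f m c" if c: "c \<in> cells (necklace [n]) m" for m c
  proof -
    have "act (necklace ([n] @ T)) (m, n, \<lambda>t\<in>{..m}. 0 + c t) c0 = c"
      using necklace_cell_le[OF c] necklace_cell_restrict[OF c] by (simp add: act_necklace c0_def cong: restrict_cong)
    moreover have a: "(m, n, \<lambda>t\<in>{..m}. 0 + c t) \<in> Ar simplex_cat" using simplex_nec_arr[of 0 "[n]" n, OF _ c] by simp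
    have "f m (act (necklace ([n] @ T)) (m, n, \<lambda>t\<in>{..m}. 0 + c t) c0) = act S (m, n, \<lambda>t\<in>{..m}. 0 + c t) (f n c0)"
      using psh_hom_act[OF f a, of c0] subsetD[OF sub c0] by simp
    ultimately show ?thesis using c by (simp add: simplex_nec_def s_def)
  qed
  have g: "g \<in> psh_hom simplex_cat (necklace T) S"
  proof (rule psh_homI)
    fix m d assume "d \<in> cells (necklace T) m"
    then show "g m d \<in> cells S m" using psh_hom_cell[OF f right] by (simp add: g_def)
  next
    fix u d assume u: "u \<in> Ar simplex_cat" and d: "d \<in> cells (necklace T) (Cod simplex_cat u)"
    obtain p q h where uh: "u = (p, q, h)" by (cases u)
    have "act (necklace ([n] @ T)) u (\<lambda>i\<in>{..q}. n + d i) = (\<lambda>i\<in>{..p}. n + act (necklace T) u d i)"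
      using u by (auto simp: uh act_necklace fun_eq_iff)
    then show "g (Dom simplex_cat u) (act (necklace T) u d) = act S u (g (Cod simplex_cat u) d)"
      using psh_hom_act[OF f u[unfolded uh], of "\<lambda>i\<in>{..q}. n + d i"] right[of d q] psh_act_cells[OF necklace_presheaf u d] d
      by (simp add: g_def uh)
  qed (simp add: g_def)
  have vn: "vertex S n s i = f 0 (vtx i)" if "i \<le> n" for i
    using f1[OF vtx_cell[OF n(1)], of i] simplex_nec_vtx[OF S n(1), of i n s 0] that by simp
  have "(\<lambda>i\<in>{..0}. n + vtx v i) = vtx (n + v)" for v unfolding vtx_def by (rule restrict_ext) simp
  then have g0: "g 0 (vtx v) = f 0 (vtx (n + v))" if "v \<le> sum_list T" for v
    using vtx_cell[OF n(2) that] by (simp add: g_def del: atMost_0)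
  define y' where "y' = f 0 (vtx n)"
  have b1: "nec_between S x y' [n] (simplex_nec S n s 0 [n])"
    using simplex_nec_between[OF S s _ n(1), of 0] vn[of 0] vn[of n] t(3) by (simp add: y'_def)
  have b2: "nec_between S y' y T g" using g g0[of 0] g0[of "sum_list T"] n(2) t(4) by (simp add: nec_between_def y'_def)
  have fe: "f = glue [n] T (simplex_nec S n s 0 [n]) g"
  proof (rule glue_unique[OF n(1,2) nec_betweenD(2)[OF b1] g _ f])
    show "simplex_nec S n s 0 [n] 0 (vtx (sum_list [n])) = g 0 (vtx 0)" using nec_betweenD[OF b1] nec_betweenD[OF b2] by simp
    show "f m (\<lambda>i\<in>{..m}. sum_list [n] + d i) = g m d" if "d \<in> cells (necklace T) m" for m d
      using that by (simp add: g_def)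
  qed (simp add: f1)
  have CP: "C t \<in> P_ob ([n] @ T)" if "t \<le> k" for t using Cons.prems(2) that by (simp add: nerve_cell_iff)
  have Ct: "joints [n] \<union> (+) n ` joints T \<subseteq> C t" "C t \<subseteq> {..n + sum_list T}" if "t \<le> k" for t
    using CP[OF that] P_ob_iff[OF nT] joints_append[of "[n]" T] by simp_all
  have CC: "C s \<subseteq> C t" if "s \<le> t" "t \<le> k" for s t using Cons.prems(2) that by (simp add: nerve_cell_iff)
  have Cv: "v \<le> sum_list T" if "t \<le> k" "n + v \<in> C t" for t v using subsetD[OF Ct(2) that(2)] that(1) by simp
  \<comment> \<open>The joint \<open>n\<close> belongs to all sets of the chain, so \<open>C\<close> splits into its parts on the first bead and
    on the remaining ones.\<close>
  define C1 where "C1 = (\<lambda>t\<in>{..k}. C t \<inter> {..n})"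
  define C2 where "C2 = (\<lambda>t\<in>{..k}. {v. n + v \<in> C t})"
  have C1: "C1 \<in> path_chains 0 n k"
    using Ct CC by (intro path_chainI) (auto simp: C1_def joints_bead subset_iff)
  have C2: "C2 \<in> nec_chains T k"
    using Ct(1) CC Cv by (auto simp: C2_def nerve_cell_iff P_ob_iff[OF n(2)] subset_iff)
  have u1: "unshift 0 k C1 = C1" by (auto simp: unshift_def C1_def fun_eq_iff)
  have C1n: "C1 \<in> nec_chains [n] k" using unshift_chain[OF C1] by (simp add: u1 bn)
  have Ce: "C = (\<lambda>t\<in>{..k}. C1 t \<union> (+) (sum_list [n]) ` C2 t)"
  proof
    fix t show "C t = (\<lambda>t\<in>{..k}. C1 t \<union> (+) (sum_list [n]) ` C2 t) t"
    proof (cases "t \<le> k")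
      case True
      have "v \<in> (+) n ` {v. n + v \<in> C t}" if "v \<in> C t" "\<not> v \<le> n" for v
        using that by (intro image_eqI[of _ _ "v - n"]) auto
      then show ?thesis using True by (auto simp: C1_def C2_def)
    next
      case False
      then show ?thesis using Cons.prems(2) by (simp add: nerve_cell_iff extensional_def)
    qed
  qed
  have x: "x \<in> cells S 0" "y' \<in> cells S 0" "y \<in> cells S 0"
    using vertex_cell[OF S s, of 0] vertex_cell[OF S s, of n] vn[of 0] vn[of n] t(3)
      psh_hom_cell[OF g vtx_cell[OF n(2) order_refl]] nec_betweenD(4)[OF b2] by (simp_all add: y'_def)
  obtain w where w: "rig_word S k (pt S y') w (pt S y)"
    "Hmap (comparison S) (pt S y') (pt S y) k (rig_class S (pt S y') (pt S y) k w) = nec_simplex S y' y k T g C2"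
    using Cons.IH[OF b2 C2] by blast
  have v: "rig_vertex S n s 0 = pt S x" "rig_vertex S n s n = pt S y'"
    using pt_vertex[OF s, of 0] pt_vertex[OF s, of n] vn[of 0] vn[of n] t(3) by (simp_all add: y'_def)
  have l: "rig_word S k (pt S x) [((n, s), 0, n, C1)] (pt S y')" using s C1 v by (simp add: rig_word_Cons[OF S])
  have "Hmap (comparison S) (pt S x) (pt S y') k (rig_class S (pt S x) (pt S y') k [((n, s), 0, n, C1)])
      = nec_simplex S x y' k [n] (simplex_nec S n s 0 [n]) C1"
    using comparison_letter[OF S s _ _ C1] vn[of 0] vn[of n] t(3) by (simp add: v letter_simplex_def[OF S] bn u1 y'_def)
  then have "Hmap (comparison S) (pt S x) (pt S y) k (rig_class S (pt S x) (pt S y) k ([((n, s), 0, n, C1)] @ w))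
      = nec_simplex S x y k ([n] @ T) f C"
    unfolding comparison_append[OF x l w(1)] w(2) using nec_simplex_Cmp[OF S x b1 C1n b2 C2] fe Ce by simp
  moreover have "rig_word S k (pt S x) ([((n, s), 0, n, C1)] @ w) (pt S y)" using l w(1) rig_word_append[OF S] by blast
  ultimately show ?case by auto
qed

text \<open>Conversely, the word of the necklace obtained from a word is equivalent to that word.  As the
  class of the word of a necklace depends only on the simplex given by the necklace, the
  comparison functor is injective.\<close>

lemma comparison_word:
  "x \<in> cells S 0 \<Longrightarrow> y \<in> cells S 0 \<Longrightarrow> rig_word S k (pt S x) w (pt S y) \<Longrightarrow>
    \<exists>T f C. nec_between S x y T f \<and> C \<in> nec_chains T k
      \<and> Hmap (comparison S) (pt S x) (pt S y) k (rig_class S (pt S x) (pt S y) k w) = nec_simplex S x y k T f C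
      \<and> rig_class S (pt S x) (pt S y) k (nec_word f C k) = rig_class S (pt S x) (pt S y) k w"
proof (induction w arbitrary: x)
  case Nil
  then have "x = y" using pt_inj by simp
  moreover have "nec_word (const_nec S x) (\<lambda>t\<in>{..k}. {0}) k = []" by (simp add: nec_word_def)
  ultimately show ?case
    using nec_between_const[OF S Nil(1)] Nil_chain[of k] comparison_Nil[OF Nil(1), of k] by metis
next
  case (Cons l w)
  obtain n s i j c where l: "l = ((n, s), i, j, c)" by (cases l) auto
  have *: "s \<in> cells S n" "i \<le> n" "j \<le> n" "c \<in> path_chains i j k" "pt S x = rig_vertex S n s i" "rig_word S k (rig_vertex S n s j) w (pt S y)"
    using Cons.prems(3) unfolding l rig_word_Cons[OF S] by blast+
  let ?x = "vertex S n s i" and ?z = "vertex S n s j"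
  have z: "?z \<in> cells S 0" "rig_vertex S n s j = pt S ?z" using vertex_cell[OF S *(1,3)] pt_vertex[OF *(1,3)] by simp_all
  have x: "x = ?x" using pt_inj[OF Cons.prems(1) vertex_cell[OF S *(1,2)]] *(5) pt_vertex[OF *(1,2)] by simp
  have ij: "i \<le> j" by (rule path_chain_le[OF *(4)])
  note IHp = Cons.IH[OF z(1) Cons.prems(2) *(6)[unfolded z(2)]]
  obtain T f C where T: "nec_between S ?z y T f" "C \<in> nec_chains T k"
    and H: "Hmap (comparison S) (pt S ?z) (pt S y) k (rig_class S (pt S ?z) (pt S y) k w) = nec_simplex S ?z y k T f C"
    and K: "rig_class S (pt S ?z) (pt S y) k (nec_word f C k) = rig_class S (pt S ?z) (pt S y) k w"
    using IHp by blast
  let ?B = "bead (j - i)" and ?g = "simplex_nec S n s i (bead (j - i))" and ?D = "unshift i k c"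
  have B: "nec_between S x ?z ?B ?g" unfolding x by (rule bead_between[OF S *(1) ij *(3)])
  have D: "?D \<in> nec_chains ?B k" by (rule unshift_chain[OF *(4)])
  have lw: "rig_word S k (pt S x) [l] (pt S ?z)" unfolding l rig_word_Cons[OF S] using * z by simp
  have Hl: "Hmap (comparison S) (pt S x) (pt S ?z) k (rig_class S (pt S x) (pt S ?z) k [l]) = nec_simplex S x ?z k ?B ?g ?D"
    using comparison_letter[OF S *(1,2,3,4)] by (simp add: l *(5) z(2)[symmetric] letter_simplex_def[OF S] x[symmetric])
  have Kl: "rig_class S (pt S x) (pt S ?z) k (nec_word ?g ?D k) = rig_class S (pt S x) (pt S ?z) k [l]"
    using nec_word_letter[OF *(1,3,4)] by (simp add: l *(5) z(2)[symmetric])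
  let ?E = "\<lambda>t\<in>{..k}. ?D t \<union> (+) (sum_list ?B) ` C t"
  have "Hmap (comparison S) (pt S x) (pt S y) k (rig_class S (pt S x) (pt S y) k ([l] @ w)) = nec_simplex S x y k (?B @ T) (glue ?B T ?g f) ?E"
    unfolding comparison_append[OF Cons.prems(1) z(1) Cons.prems(2) lw *(6)[unfolded z(2)]] Hl H
    by (rule nec_simplex_Cmp[OF S Cons.prems(1) z(1) Cons.prems(2) B D T])
  moreover have "rig_class S (pt S x) (pt S y) k (nec_word (glue ?B T ?g f) ?E k) = rig_class S (pt S x) (pt S y) k ([l] @ w)"
    unfolding nec_word_glue[OF B D T]
    by (rule rig_class_append_cong[OF nec_word_rig_word[OF B D] lw nec_word_rig_word[OF T] *(6)[unfolded z(2)] Kl K])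
  moreover have "[l] @ w = l # w" by simp
  ultimately show ?case
    using nec_between_glue[OF B T(1)] nec_chain_append[OF nec_betweenD(1)[OF B] nec_betweenD(1)[OF T(1)] D T(2)] by metis
qed

lemma comparison_bij:
  assumes x: "x \<in> cells S 0" and y: "y \<in> cells S 0"
  shows "bij_betw (Hmap (comparison S) (pt S x) (pt S y) k) (cells (Hom (Rig_ob S) (pt S x) (pt S y)) k) (cells (tri (rig_hom S x y)) k)"
proof (rule bij_betwI')
  fix V W assume V: "V \<in> cells (Hom (Rig_ob S) (pt S x) (pt S y)) k" and W: "W \<in> cells (Hom (Rig_ob S) (pt S x) (pt S y)) k"
  obtain v where v: "rig_word S k (pt S x) v (pt S y)" "V = rig_class S (pt S x) (pt S y) k v" using V by (rule Rig_cellE[OF S])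
  obtain w where w: "rig_word S k (pt S x) w (pt S y)" "W = rig_class S (pt S x) (pt S y) k w" using W by (rule Rig_cellE[OF S])
  obtain T f C where T: "nec_between S x y T f" "C \<in> nec_chains T k"
    "Hmap (comparison S) (pt S x) (pt S y) k V = nec_simplex S x y k T f C" "rig_class S (pt S x) (pt S y) k (nec_word f C k) = V"
    using comparison_word[OF x y v(1)] v(2) by blast
  obtain U g D where U: "nec_between S x y U g" "D \<in> nec_chains U k"
    "Hmap (comparison S) (pt S x) (pt S y) k W = nec_simplex S x y k U g D" "rig_class S (pt S x) (pt S y) k (nec_word g D k) = W"
    using comparison_word[OF x y w(1)] w(2) by blast
  have "V = W" if "nec_simplex S x y k T f C = nec_simplex S x y k U g D"
    using nec_simplex_invariant[OF that T(1,2) U(1,2), of "\<lambda>T f C. rig_class S (pt S x) (pt S y) k (nec_word f C k)", OF nec_word_shift] T(4) U(4)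
    by simp
  then show "(Hmap (comparison S) (pt S x) (pt S y) k V = Hmap (comparison S) (pt S x) (pt S y) k W) = (V = W)"
    using T(3) U(3) by auto
next
  fix V assume "V \<in> cells (Hom (Rig_ob S) (pt S x) (pt S y)) k"
  then show "Hmap (comparison S) (pt S x) (pt S y) k V \<in> cells (tri (rig_hom S x y)) k"
    using sfun_cell[OF comparison(1)[OF S], unfolded comparison(2,3)[OF S], OF pt_in[OF x] pt_in[OF y]]
    by (simp add: comparison_pt x y)
next
  fix X assume "X \<in> cells (tri (rig_hom S x y)) k"
  then obtain T f C where "nec_between S x y T f" "C \<in> nec_chains T k" "X = nec_simplex S x y k T f C" by (rule nec_simplexE)
  then show "\<exists>V\<in>cells (Hom (Rig_ob S) (pt S x) (pt S y)) k. X = Hmap (comparison S) (pt S x) (pt S y) k V"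
    using comparison_surj[of x y T f C k] rig_class_cell[OF S] by metis
qed

end

text \<open>The inverse bijections form a functor: its laws may be checked after applying \<open>F\<close>, which is
  injective.\<close>

lemma scat_isoI:
  fixes F :: "('o, 'a, 'p, 'b) sfun"
  assumes F: "is_sfun F" and o: "bij_betw (Omap F) (Obj (Src F)) (Obj (Tgt F))"
    and h: "\<And>x y n. x \<in> Obj (Src F) \<Longrightarrow> y \<in> Obj (Src F) \<Longrightarrow>
      bij_betw (Hmap F x y n) (cells (Hom (Src F) x y) n) (cells (Hom (Tgt F) (Omap F x) (Omap F y)) n)"
  shows "is_scat_iso F"
proof -
  let ?A = "Src F" and ?B = "Tgt F"
  have A: "is_scat ?A" and B: "is_scat ?B" using F unfolding is_sfun_def by blast+
  define g where "g = inv_into (Obj ?A) (Omap F)"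
  have g: "g x \<in> Obj ?A" "Omap F (g x) = x" if "x \<in> Obj ?B" for x
    using o that unfolding g_def bij_betw_def by (auto intro: inv_into_into f_inv_into_f)
  have gF: "g (Omap F x) = x" if "x \<in> Obj ?A" for x
    using o that unfolding g_def bij_betw_def by simp
  define k where "k x y n = inv_into (cells (Hom ?A (g x) (g y)) n) (Hmap F (g x) (g y) n)" for x y n
  have k: "k x y n b \<in> cells (Hom ?A (g x) (g y)) n" "Hmap F (g x) (g y) n (k x y n b) = b"
    if "x \<in> Obj ?B" "y \<in> Obj ?B" "b \<in> cells (Hom ?B x y) n" for x y n b
    using h[OF g(1)[OF that(1)] g(1)[OF that(2)], of n] that(3) g(2)[OF that(1)] g(2)[OF that(2)]
    unfolding k_def bij_betw_def by (auto intro: inv_into_into f_inv_into_f)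
  have inj: "a = a'" if "x \<in> Obj ?A" "y \<in> Obj ?A" "a \<in> cells (Hom ?A x y) n" "a' \<in> cells (Hom ?A x y) n"
    "Hmap F x y n a = Hmap F x y n a'" for x y n a a'
    using h[OF that(1,2), of n] that(3-5) unfolding bij_betw_def by (auto dest: inj_onD)
  define G :: "('p, 'b, 'o, 'a) sfun" where "G = \<lparr>Src = ?B, Tgt = ?A, Omap = (\<lambda>x\<in>Obj ?B. g x),
     Hmap = (\<lambda>x\<in>Obj ?B. \<lambda>y\<in>Obj ?B. \<lambda>n. \<lambda>b\<in>cells (Hom ?B x y) n. k x y n b)\<rparr>"
  have st: "Src G = ?B" "Tgt G = ?A" by (simp_all add: G_def)
  have Go: "Omap G x = g x" if "x \<in> Obj ?B" for x using that by (simp add: G_def)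
  have Gh: "Hmap G x y n b = k x y n b" if "x \<in> Obj ?B" "y \<in> Obj ?B" "b \<in> cells (Hom ?B x y) n" for x y n b
    using that by (simp add: G_def)
  have G: "is_sfun G"
    unfolding is_sfun_def st
  proof (intro conjI ballI allI)
    show "Omap G \<in> Obj ?B \<rightarrow>\<^sub>E Obj ?A" using g by (auto simp: G_def)
    have "Hmap G x y \<in> psh_hom simplex_cat (Hom ?B x y) (Hom ?A (Omap G x) (Omap G y))"
      if xy: "x \<in> Obj ?B" "y \<in> Obj ?B" for x y
    proof (rule psh_homI)
      fix u b assume u: "u \<in> Ar simplex_cat" and b: "b \<in> cells (Hom ?B x y) (Cod simplex_cat u)"
      note b' = psh_act_cells[OF scat_psh[OF B xy] u b]
      note gg = g(1)[OF xy(1)] g(1)[OF xy(2)]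
      have "k x y (Dom simplex_cat u) (act (Hom ?B x y) u b) = act (Hom ?A (g x) (g y)) u (k x y (Cod simplex_cat u) b)"
        by (rule inj[OF gg k(1)[OF xy b'] psh_act_cells[OF scat_psh[OF A gg] u k(1)[OF xy b]]])
          (simp add: k(2)[OF xy b'] sfun_act[OF F gg u k(1)[OF xy b]] k(2)[OF xy b] g(2) xy)
      then show "Hmap G x y (Dom simplex_cat u) (act (Hom ?B x y) u b) = act (Hom ?A (Omap G x) (Omap G y)) u (Hmap G x y (Cod simplex_cat u) b)"
        using Gh[OF xy b] Gh[OF xy b'] Go xy by simp
    qed (use k(1)[OF xy] Gh[OF xy] Go xy in \<open>simp_all, simp add: G_def\<close>)
    then show "Hmap G \<in> (\<Pi>\<^sub>E x\<in>Obj ?B. \<Pi>\<^sub>E y\<in>Obj ?B. psh_hom simplex_cat (Hom ?B x y) (Hom ?A (Omap G x) (Omap G y)))"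
      by (intro PiE_I) (simp_all add: G_def)
  next
    fix x assume x: "x \<in> Obj ?B"
    have uB: "Unit ?B x \<in> cells (Hom ?B x x) 0" using B x by (simp add: is_scat_def)
    have uA: "Unit ?A (g x) \<in> cells (Hom ?A (g x) (g x)) 0" using A g(1)[OF x] by (simp add: is_scat_def)
    note u = uB uA
    have "\<forall>x\<in>Obj ?A. Hmap F x x 0 (Unit ?A x) = Unit ?B (Omap F x)" using F by (simp add: is_sfun_def)
    from bspec[OF this g(1)[OF x]] have Fu: "Hmap F (g x) (g x) 0 (Unit ?A (g x)) = Unit ?B x" unfolding g(2)[OF x] .
    then have "k x x 0 (Unit ?B x) = Unit ?A (g x)"
      by (intro inj[OF g(1)[OF x] g(1)[OF x] k(1)[OF x x u(1)] u(2)]) (simp only: k(2)[OF x x u(1)] Fu)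
    then show "Hmap G x x 0 (Unit ?B x) = Unit ?A (Omap G x)" using Gh[OF x x u(1)] Go[OF x] by simp
  next
    fix x y z n a b assume xyz: "x \<in> Obj ?B" "y \<in> Obj ?B" "z \<in> Obj ?B"
      and a: "a \<in> cells (Hom ?B x y) n" and b: "b \<in> cells (Hom ?B y z) n"
    note gg = g(1)[OF xyz(1)] g(1)[OF xyz(2)] g(1)[OF xyz(3)]
    note c = scat_cmp_cell[OF B xyz a b]
    have "k x z n (Cmp ?B x y z n (a, b)) = Cmp ?A (g x) (g y) (g z) n (k x y n a, k y z n b)"
      by (rule inj[OF gg(1,3) k(1)[OF xyz(1,3) c] scat_cmp_cell[OF A gg k(1)[OF xyz(1,2) a] k(1)[OF xyz(2,3) b]]])
        (simp add: k(2)[OF xyz(1,3) c] sfun_cmp[OF F gg k(1)[OF xyz(1,2) a] k(1)[OF xyz(2,3) b]]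
          k(2)[OF xyz(1,2) a] k(2)[OF xyz(2,3) b] g(2) xyz)
    then show "Hmap G x z n (Cmp ?B x y z n (a, b)) = Cmp ?A (Omap G x) (Omap G y) (Omap G z) n (Hmap G x y n a, Hmap G y z n b)"
      using Gh[OF xyz(1,3) c] Gh[OF xyz(1,2) a] Gh[OF xyz(2,3) b] Go xyz by simp
  qed (rule A B)+
  have GF: "efun_comp G F = efun_id ?A"
  proof (rule sfun_eqI)
    show "is_sfun (efun_comp G F)" by (rule sfun_comp[OF F G]) (simp add: st)
    show "is_sfun (efun_id ?A)" by (rule efun_id_sfun[OF A])
    fix x assume "x \<in> Obj (Src (efun_comp G F))"
    then have x: "x \<in> Obj ?A" by (simp add: efun_comp_def)
    then show "Omap (efun_comp G F) x = Omap (efun_id ?A) x"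
      using Go[OF sfun_ob[OF F x]] gF by (simp add: efun_comp_def efun_id_def)
    fix y n a assume "y \<in> Obj (Src (efun_comp G F))" "a \<in> cells (Hom (Src (efun_comp G F)) x y) n"
    then have y: "y \<in> Obj ?A" and a: "a \<in> cells (Hom ?A x y) n" by (simp_all add: efun_comp_def)
    note Fx = sfun_ob[OF F x] sfun_ob[OF F y] and Fa = sfun_cell[OF F x y a]
    have "k (Omap F x) (Omap F y) n (Hmap F x y n a) = a"
      using k[OF Fx Fa] unfolding gF[OF x] gF[OF y] by (intro inj[OF x y _ a]) simp_all
    then show "Hmap (efun_comp G F) x y n a = Hmap (efun_id ?A) x y n a"
      using x y a Gh[OF Fx Fa] by (simp add: efun_comp_def efun_id_def psh_comp_cell psh_id_cell)
  qed (simp_all add: efun_comp_def efun_id_def st)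
  have FG: "efun_comp F G = efun_id ?B"
  proof (rule sfun_eqI)
    show "is_sfun (efun_comp F G)" by (rule sfun_comp[OF G F]) (simp add: st)
    show "is_sfun (efun_id ?B)" by (rule efun_id_sfun[OF B])
    fix x assume "x \<in> Obj (Src (efun_comp F G))"
    then have x: "x \<in> Obj ?B" by (simp add: efun_comp_def st)
    then show "Omap (efun_comp F G) x = Omap (efun_id ?B) x"
      using Go g(2) by (simp add: efun_comp_def efun_id_def st)
    fix y n b assume "y \<in> Obj (Src (efun_comp F G))" "b \<in> cells (Hom (Src (efun_comp F G)) x y) n"
    then have y: "y \<in> Obj ?B" and b: "b \<in> cells (Hom ?B x y) n" by (simp_all add: efun_comp_def st)
    then show "Hmap (efun_comp F G) x y n b = Hmap (efun_id ?B) x y n b"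
      using x Gh[OF x y b] Go k(2)[OF x y b] by (simp add: efun_comp_def efun_id_def psh_comp_cell psh_id_cell st)
  qed (simp_all add: efun_comp_def efun_id_def st)
  show ?thesis unfolding is_scat_iso_def using F G GF FG st by blast
qed

lemma comparison_iso:
  assumes S: "is_presheaf simplex_cat S" shows "is_scat_iso (comparison S)"
proof (rule scat_isoI[OF comparison(1)[OF S]], unfold comparison(2,3)[OF S] T_ob_sel Cbox_ob_sel)
  show "bij_betw (Omap (comparison S)) (Obj (Rig_ob S)) (cells S 0)"
    unfolding Rig_Obj_pt[OF S] by (rule bij_betw_byWitness[of _ "pt S"]) (auto simp: comparison_pt[OF S])
  fix X Y n assume "X \<in> Obj (Rig_ob S)" "Y \<in> Obj (Rig_ob S)"
  then obtain x y where "x \<in> cells S 0" "y \<in> cells S 0" "X = pt S x" "Y = pt S y" unfolding Rig_Obj_pt[OF S] by blast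
  then show "bij_betw (Hmap (comparison S) X Y n) (cells (Hom (Rig_ob S) X Y) n)
      (cells (tri (rig_hom S (Omap (comparison S) X) (Omap (comparison S) Y))) n)"
    using comparison_bij[OF S, of x y n] by (simp add: comparison_pt[OF S])
qed

text \<open>Every simplex of a mapping space of \<open>Rig_ob S\<close> is a composite of letters, so a functor on \<open>Rig_ob S\<close>
  is determined by its values on them.\<close>

lemma Rig_sfun_eqI:
  assumes S: "is_presheaf simplex_cat S" and F: "is_sfun F" "Src F = Rig_ob S" and G: "is_sfun G" "Src G = Rig_ob S"
    and t: "Tgt F = Tgt G"
    and o: "\<And>x. x \<in> cells S 0 \<Longrightarrow> Omap F (pt S x) = Omap G (pt S x)"
    and l: "\<And>n s i j k c. s \<in> cells S n \<Longrightarrow> i \<le> n \<Longrightarrow> j \<le> n \<Longrightarrow> c \<in> path_chains i j k \<Longrightarrow>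
      Hmap F (rig_vertex S n s i) (rig_vertex S n s j) k (rig_class S (rig_vertex S n s i) (rig_vertex S n s j) k [((n, s), i, j, c)])
      = Hmap G (rig_vertex S n s i) (rig_vertex S n s j) k (rig_class S (rig_vertex S n s i) (rig_vertex S n s j) k [((n, s), i, j, c)])"
  shows "F = G"
proof (rule sfun_eqI[OF F(1) G(1)])
  have o': "Omap F X = Omap G X" if "X \<in> Obj (Rig_ob S)" for X using that o unfolding Rig_Obj_pt[OF S] by blast
  show "Omap F X = Omap G X" if "X \<in> Obj (Src F)" for X using o' that F by simp
  fix X Y k W assume "X \<in> Obj (Src F)" "Y \<in> Obj (Src F)" "W \<in> cells (Hom (Src F) X Y) k"
  then have X: "X \<in> Obj (Rig_ob S)" and Y: "Y \<in> Obj (Rig_ob S)" and "W \<in> cells (Hom (Rig_ob S) X Y) k" by (simp_all add: F)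
  then obtain w where w: "rig_word S k X w Y" "W = rig_class S X Y k w" by (elim Rig_cellE[OF S])
  have "Hmap F X Y k (rig_class S X Y k w) = Hmap G X Y k (rig_class S X Y k w)" using w(1) X
  proof (induction w arbitrary: X)
    case Nil
    then show ?case
      using sfun_unit[OF F(1), unfolded F(2), OF Y, of k] sfun_unit[OF G(1), unfolded G(2), OF Y, of k] o'[OF Y] t
      by (simp add: Rig_unit_simplex[OF S])
  next
    case (Cons a w)
    obtain n s i j c where a: "a = ((n, s), i, j, c)" by (cases a) auto
    have *: "s \<in> cells S n" "i \<le> n" "j \<le> n" "c \<in> path_chains i j k" "X = rig_vertex S n s i" "rig_word S k (rig_vertex S n s j) w Y"
      using Cons.prems(1) unfolding a rig_word_Cons[OF S] by blast+
    let ?Z = "rig_vertex S n s j"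
    have Z: "?Z \<in> Obj (Rig_ob S)" by (rule rig_vertex_in[OF S *(1,3)])
    have aw: "rig_word S k X [a] ?Z" unfolding a rig_word_Cons[OF S] using * by simp
    have e: "rig_class S X Y k (a # w) = Cmp (Rig_ob S) X ?Z Y k (rig_class S X ?Z k [a], rig_class S ?Z Y k w)"
      using Rig_Cmp[OF S aw *(6)] by simp
    note c = rig_class_cell[OF S aw] rig_class_cell[OF S *(6)]
    show ?case
      unfolding e sfun_cmp[OF F(1), unfolded F(2), OF Cons.prems(2) Z Y c] sfun_cmp[OF G(1), unfolded G(2), OF Cons.prems(2) Z Y c]
        o'[OF Cons.prems(2)] o'[OF Z] o'[OF Y] Cons.IH[OF *(6) Z] t
      using l[OF *(1-4)] by (simp add: a *(5))
  qed
  then show "Hmap F X Y k W = Hmap G X Y k W" by (simp add: w(2))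
qed (simp_all add: F G t)

text \<open>Both sides map a letter of the simplex \<open>s\<close> to the corresponding bead of the simplex \<open>p n s\<close>.\<close>

lemma comparison_natural:
  assumes S: "is_presheaf simplex_cat S" and S': "is_presheaf simplex_cat S'" and p: "p \<in> psh_hom simplex_cat S S'"
  shows "efun_comp (T_ar (Cbox_ar (S, p, S'))) (comparison S) = efun_comp (comparison S') (Rig_ar (S, p, S'))"
proof (rule Rig_sfun_eqI[OF S])
  let ?P = "T_ar (Cbox_ar (S, p, S'))" and ?R = "Rig_ar (S, p, S')"
  let ?F = "efun_comp ?P (comparison S)" and ?G = "efun_comp (comparison S') ?R"
  note cS = comparison[OF S] and cS' = comparison[OF S'] and R = Rig_ar_sel[OF S S' p]
  have P: "Src ?P = T_ob (Cbox_ob S)" "Tgt ?P = T_ob (Cbox_ob S')" "Omap ?P = p 0" by (simp_all add: T_ar_def)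
  show "is_sfun ?F" by (rule sfun_comp[OF cS(1) T_ar_sfun[OF Cbox_ar_cfun[OF S S' p]]]) (simp add: cS P)
  show "is_sfun ?G" by (rule sfun_comp[OF Rig_ar_sfun[OF S S' p] cS'(1)]) (simp add: cS' R)
  show "Src ?F = Rig_ob S" "Src ?G = Rig_ob S" "Tgt ?F = Tgt ?G" by (simp_all add: efun_comp_def cS cS' R P)
  have pv: "p 0 (vertex S n s i) = vertex S' n (p n s) i" if "s \<in> cells S n" "i \<le> n" for n s i
    using psh_hom_act[OF p vertex_incl_arr[OF that(2)]] that(1) by (simp add: vertex_def)
  have ps: "p n s \<in> cells S' n" if "s \<in> cells S n" for n s using psh_hom_cell[OF p that] .
  show "Omap ?F (pt S x) = Omap ?G (pt S x)" if x: "x \<in> cells S 0" for x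
    using pt_in[OF S x] comparison_pt[OF S x] comparison_pt[OF S' ps[OF x]] Rig_omap_vertex[OF S S' p x, of 0]
    by (simp add: efun_comp_def cS R P)
  fix n s i j k c assume s: "s \<in> cells S n" and ij: "i \<le> n" "j \<le> n" and c: "c \<in> path_chains i j k"
  have ij': "i \<le> j" by (rule path_chain_le[OF c])
  let ?X = "rig_vertex S n s i" and ?Y = "rig_vertex S n s j" and ?T = "bead (j - i)"
  have X: "?X \<in> Obj (Rig_ob S)" "?Y \<in> Obj (Rig_ob S)" using rig_vertex_in[OF S s] ij by simp_all
  have w: "rig_word S k ?X [((n, s), i, j, c)] ?Y" using s ij c by (simp add: rig_word_Cons[OF S])
  note W = rig_class_cell[OF S w]
  note B = bead_between[OF S s ij' ij(2)] and C = unshift_chain[OF c]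
  have sn: "psh_comp (necklace ?T) p (simplex_nec S n s i ?T) = simplex_nec S' n (p n s) i ?T"
  proof -
    have "p m (act S (m, n, \<lambda>t\<in>{..m}. i + d t) s) = act S' (m, n, \<lambda>t\<in>{..m}. i + d t) (p n s)" if "d \<in> cells (necklace ?T) m" for m d
      using psh_hom_act[OF p simplex_nec_arr[OF _ that, of i n]] s ij ij' by simp
    then show ?thesis by (auto simp: psh_comp_def simplex_nec_def fun_eq_iff)
  qed
  have "Hmap ?F ?X ?Y k (rig_class S ?X ?Y k [((n, s), i, j, c)]) = Hmap ?P (vertex S n s i) (vertex S n s j) k (letter_simplex S k n s i j c)"
    using X W comparison_vertex[OF S s] ij comparison_letter[OF S s ij c] by (simp add: efun_comp_def cS psh_comp_cell)
  also have "\<dots> = letter_simplex S' k n (p n s) i j c"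
    unfolding letter_simplex_def[OF S] letter_simplex_def[OF S']
      nec_simplex_map[OF S S' p vertex_cell[OF S s ij(1)] vertex_cell[OF S s ij(2)] B C] sn pv[OF s ij(1)] pv[OF s ij(2)] ..
  also have "\<dots> = Hmap ?G ?X ?Y k (rig_class S ?X ?Y k [((n, s), i, j, c)])"
    using X W Rig_ar_class[OF S S' p X w] Rig_omap_vertex[OF S S' p s] ij comparison_letter[OF S' ps[OF s] ij c]
    by (simp add: efun_comp_def R psh_comp_cell)
  finally show "Hmap ?F ?X ?Y k (rig_class S ?X ?Y k [((n, s), i, j, c)]) = Hmap ?G ?X ?Y k (rig_class S ?X ?Y k [((n, s), i, j, c)])" .
qed

theorem proposition5p3:
  "is_functor (SSet :: ('a sset, (simp_arr, 'a) psh_arr) cat) CCat Cbox \<and>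
   is_functor CCat SCat (T_functor :: (('a, 'a rig_cube) ccat, _, _, _) func) \<and>
   naturally_isomorphic (SSet :: ('a sset, (simp_arr, 'a) psh_arr) cat) Rig (T_functor \<circ>\<^sub>F Cbox)"
proof (intro conjI)
  show C: "is_functor (SSet :: ('a sset, (simp_arr, 'a) psh_arr) cat) CCat Cbox" by (rule Cbox_functor)
  show T: "is_functor CCat SCat (T_functor :: (('a, 'a rig_cube) ccat, _, _, _) func)" by (rule T_functor_functor)
  have "is_scat_iso (comparison S) \<and> Src (comparison S) = fob Rig S \<and> Tgt (comparison S) = fob (T_functor \<circ>\<^sub>F Cbox) S"
    if "S \<in> Ob SSet" for S :: "'a sset"
    using that comparison_iso[of S] comparison(2,3)[of S]
    by (simp add: SSet_sel Rig_def fcompose_def T_functor_def Cbox_def)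
  moreover have "efun_comp (far (T_functor \<circ>\<^sub>F Cbox) u) (comparison (Dom SSet u)) = efun_comp (comparison (Cod SSet u)) (far Rig u)"
    if "u \<in> Ar SSet" for u :: "(simp_arr, 'a) psh_arr"
  proof -
    obtain S p S' where u: "u = (S, p, S')" by (cases u)
    then show ?thesis using that comparison_natural[of S S' p]
      by (simp add: SSet_sel Rig_def fcompose_def T_functor_def Cbox_def)
  qed
  ultimately show "naturally_isomorphic (SSet :: ('a sset, (simp_arr, 'a) psh_arr) cat) Rig (T_functor \<circ>\<^sub>F Cbox)"
    unfolding naturally_isomorphic_def using Rig_functor fcompose_functor[OF C T] by blast
qed

end
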